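(* Let $n\ge1$, $1<\alpha<2$, $T>0$, and let $\mathcal B$ be the operator in the context (with its standing assumptions), and suppose condition (D) holds: all the functions $\frac{\partial a_{ij}}{\partial x_k}$, $\frac{\partial^2a_{ij}}{\partial x_k\partial x_l}$, $\frac{\partial b_i}{\partial x_k}$ ($i,j,k,l=1,\dots,n$) exist, are bounded and uniformly Hölder continuous. Let $u$ be a classical solution on $[0,T]\times\mathbb R^n$ of $(\mathbb D_t^{(\alpha)}u)(t,x)-\mathcal Bu(t,x)=0$ with $u(0,x)=0$, $\frac{\partial u}{\partial t}(0,x)=0$. If for some $\sigma>0$ $$\lim_{|x|\to\infty}u(t,x)\exp\left\{-\sigma|x|^{\frac{2}{2-\alpha}}\right\}=0$$ uniformly with respect to $t\in[0,T]$, then $u(t,x)\equiv0$.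
   Context: Caputo–Dzhrbashyan derivative: $(\mathbb D_t^{(\alpha)}u)(t,x)=\frac{1}{\Gamma(2-\alpha)}\frac{\partial}{\partial t}\int_0^t(t-\tau)^{1-\alpha}u'_\tau(\tau,x)d\tau-\frac{t^{1-\alpha}u'_t(0,x)}{\Gamma(2-\alpha)}$. $\mathcal Bu=\sum_{i,j}a_{ij}(x)\frac{\partial^2u}{\partial x_i\partial x_j}+\sum_jb_j(x)\frac{\partial u}{\partial x_j}+c(x)u$, where $a_{ij}=a_{ji},b_j,c$ are real, bounded, uniformly Hölder continuous with exponent $\gamma$, $2-\frac2\alpha<\gamma\le1$, and $\sum a_{ij}(x)\zeta_i\zeta_j\ge\delta_0|\zeta|^2$ for all $x,\zeta$, some $\delta_0>0$. Classical solution: $u$ is twice continuously differentiable in $x$ for each $t>0$; $u$ is continuously differentiable in $(t,x)$ on $[0,T]\times\mathbb R^n$, and $\frac{1}{\Gamma(2-\alpha)}\int_0^t(t-\tau)^{1-\alpha}u'_\tau(\tau,x)d\tau$ is continuously differentiable in $t$ for $t>0$; $u$ satisfies the equation and the initial conditions. *)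

theory Defs
  imports "HOL-Analysis.Analysis"
begin

definition unif_holder :: "real \<Rightarrow> (real^('n::finite) \<Rightarrow> real) \<Rightarrow> bool" where
  "unif_holder \<gamma> f \<longleftrightarrow> (\<exists>C. \<forall>x y. \<bar>f x - f y\<bar> \<le> C * dist x y powr \<gamma>)"

definition bdd_fun :: "(real^('n::finite) \<Rightarrow> real) \<Rightarrow> bool" where
  "bdd_fun f \<longleftrightarrow> (\<exists>M. \<forall>x. \<bar>f x\<bar> \<le> M)"

definition bdd_holder :: "(real^'n \<Rightarrow> real) \<Rightarrow> bool" where
  "bdd_holder f \<longleftrightarrow> bdd_fun f \<and> (\<exists>\<beta>. 0 < \<beta> \<and> \<beta> \<le> 1 \<and> unif_holder \<beta> f)"

definition has_partial :: "(real^'n \<Rightarrow> real) \<Rightarrow> 'n \<Rightarrow> (real^'n \<Rightarrow> real) \<Rightarrow> bool" where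
  "has_partial f k g \<longleftrightarrow>
     (\<forall>x. ((\<lambda>s. f (x + s *\<^sub>R axis k 1)) has_real_derivative g x) (at 0))"

definition standing_assms ::
  "real \<Rightarrow> real \<Rightarrow> ('n::finite \<Rightarrow> 'n \<Rightarrow> real^'n \<Rightarrow> real) \<Rightarrow> ('n \<Rightarrow> real^'n \<Rightarrow> real)
     \<Rightarrow> (real^'n \<Rightarrow> real) \<Rightarrow> bool" where
  "standing_assms \<alpha> \<gamma> a b c \<longleftrightarrow>
     2 - 2 / \<alpha> < \<gamma> \<and> \<gamma> \<le> 1 \<and>
     (\<forall>i j. a i j = a j i) \<and>
     (\<forall>i j. bdd_fun (a i j) \<and> unif_holder \<gamma> (a i j)) \<and>
     (\<forall>j. bdd_fun (b j) \<and> unif_holder \<gamma> (b j)) \<and>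
     bdd_fun c \<and> unif_holder \<gamma> c \<and>
     (\<exists>\<delta>0>0. \<forall>x \<zeta>. (\<Sum>i\<in>UNIV. \<Sum>j\<in>UNIV. a i j x * \<zeta>$i * \<zeta>$j) \<ge> \<delta>0 * (norm \<zeta>)\<^sup>2)"

definition condition_D ::
  "('n::finite \<Rightarrow> 'n \<Rightarrow> real^'n \<Rightarrow> real) \<Rightarrow> ('n \<Rightarrow> real^'n \<Rightarrow> real) \<Rightarrow> bool" where
  "condition_D a b \<longleftrightarrow>
     (\<exists>da dda db.
        (\<forall>i j k. has_partial (a i j) k (da i j k) \<and> bdd_holder (da i j k)) \<and>
        (\<forall>i j k l. has_partial (da i j k) l (dda i j k l) \<and> bdd_holder (dda i j k l)) \<and>
        (\<forall>i k. has_partial (b i) k (db i k) \<and> bdd_holder (db i k)))"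

definition opB ::
  "('n::finite \<Rightarrow> 'n \<Rightarrow> real^'n \<Rightarrow> real) \<Rightarrow> ('n \<Rightarrow> real^'n \<Rightarrow> real) \<Rightarrow> (real^'n \<Rightarrow> real)
    \<Rightarrow> real \<Rightarrow> ('n \<Rightarrow> real) \<Rightarrow> ('n \<Rightarrow> 'n \<Rightarrow> real) \<Rightarrow> real^'n \<Rightarrow> real" where
  "opB a b c v vx vxx x =
     (\<Sum>i\<in>UNIV. \<Sum>j\<in>UNIV. a i j x * vxx i j) + (\<Sum>j\<in>UNIV. b j x * vx j) + c x * v"

definition classical_solution ::
  "real \<Rightarrow> real \<Rightarrow> ('n::finite \<Rightarrow> 'n \<Rightarrow> real^'n \<Rightarrow> real) \<Rightarrow> ('n \<Rightarrow> real^'n \<Rightarrow> real)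
    \<Rightarrow> (real^'n \<Rightarrow> real) \<Rightarrow> (real \<Rightarrow> real^'n \<Rightarrow> real) \<Rightarrow> bool" where
  "classical_solution \<alpha> T a b c u \<longleftrightarrow>
    (\<exists>ut ux uxx It.
      \<comment> \<open>u is continuously differentiable in (t,x) on [0,T] x R^n\<close>
      (\<forall>t\<in>{0..T}. \<forall>x.
         ((\<lambda>p. u (fst p) (snd p)) has_derivative
            (\<lambda>h. fst h * ut t x + (\<Sum>k\<in>UNIV. snd h $ k * ux k t x)))
         (at (t, x) within {0..T} \<times> UNIV)) \<and>
      continuous_on ({0..T} \<times> UNIV) (\<lambda>p. ut (fst p) (snd p)) \<and>
      (\<forall>k. continuous_on ({0..T} \<times> UNIV) (\<lambda>p. ux k (fst p) (snd p))) \<and>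
      \<comment> \<open>u is twice continuously differentiable in x for each t > 0\<close>
      (\<forall>t\<in>{0<..T}. \<forall>k l. has_partial (ux k t) l (uxx k l t) \<and> continuous_on UNIV (uxx k l t)) \<and>
      \<comment> \<open>the fractional integral is continuously differentiable in t for t > 0\<close>
      (\<forall>x. \<forall>t\<in>{0<..T}.
         ((\<lambda>s. integral {0..s} (\<lambda>\<tau>. (s - \<tau>) powr (1 - \<alpha>) * ut \<tau> x) / Gamma (2 - \<alpha>))
            has_real_derivative It t x) (at t within {0..T})) \<and>
      (\<forall>x. continuous_on {0<..T} (\<lambda>t. It t x)) \<and>
      \<comment> \<open>the equation\<close>
      (\<forall>t\<in>{0<..T}. \<forall>x.
         (It t x - t powr (1 - \<alpha>) * ut 0 x / Gamma (2 - \<alpha>))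
           - opB a b c (u t x) (\<lambda>k. ux k t x) (\<lambda>k l. uxx k l t x) x = 0) \<and>
      \<comment> \<open>initial conditions\<close>
      (\<forall>x. u 0 x = 0) \<and> (\<forall>x. ut 0 x = 0))"

end

theory Submission
 imports Defs "HOL-Real_Asymp.Real_Asymp"
begin

text \<open>
 The time derivative of the fractional integral is only separately continuous in time and space, so
 testing the equation against functions of space needs an integrability proof first. Let Z be the set
 of points near which it is not locally square integrable. By Baire's theorem it is bounded on the part of
 Z in some ball. The Fourier coefficients in time of the cut-off solution solve elliptic equations with
 parameters \<open>\<mu>\<close> in a sector away from the negative axis. Their data are square summable uniformly in the number
 of coefficients, and a truncated near-minimiser of the energy extends the values on Z; this bounds the sum of the
 squared coefficients near that point, and Z is empty by Parseval's identity.

 Now the truncated Laplace transform in time satisfies a weak elliptic equation with zero-order coefficient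
 \<open>p\<^sup>\<alpha>\<close> and an error of size \<open>exp (- p T)\<close>. An energy estimate with the weight \<open>exp (- \<kappa> |x|)\<close>, where \<open>\<kappa>\<close> is a multiple of
 \<open>p powr (\<alpha> / 2)\<close>, on balls whose radius is a multiple of \<open>p powr (1 - \<alpha> / 2)\<close> beats the growth of \<open>u\<close> and gives decay like
 \<open>exp (- p t0)\<close>. This forces \<open>u\<close> to vanish on \<open>[0, t0]\<close>. Since the convolution then ignores \<open>[0, t0]\<close>, the
 argument restarts from \<open>t0\<close>.
\<close>

text \<open>Nothing is known about the boundary of the set on which the coefficients solve their
  equations, so no boundary value problem can be solved there. A near-minimiser avoids this: it
  exists for any set, a radial contraction bounds all its components jointly, and near-minimality
  enters through the square root of an energy, so the number of coefficients never shows. The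
  frequencies have real part 1: the weight \<open>exp (- t)\<close> makes Bessel's inequality
  available for convolutions, whose support is unbounded, and the argument of
  \<open>p powr \<alpha>\<close> stays below \<open>\<alpha> pi / 2 < pi\<close>. Turning by half of
  it makes the zero-order and the gradient part coercive at once. The exponent
  \<open>2 / (2 - \<alpha>)\<close> is where three rates meet: for
  \<open>\<rho> = (p / K) powr (1 - \<alpha> / 2)\<close> the growth is exponential in
  \<open>\<rho> powr (2 / (2 - \<alpha>)) = p / K\<close>, the weight gains
  \<open>\<kappa> \<rho>\<close>, a multiple of \<open>K powr (\<alpha> / 2) * (p / K)\<close>, and
  truncation in time gains \<open>p T\<close>. For large \<open>K\<close> both gains win, at the
  price of the short interval \<open>[0, 1 / K]\<close>.\<close>

hide_fact (open)
 Henstock_Kurzweil_Integration.integrable_add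
 Henstock_Kurzweil_Integration.integrable_bound
 Henstock_Kurzweil_Integration.integrable_diff
 Henstock_Kurzweil_Integration.integrable_sum
 Henstock_Kurzweil_Integration.integral_add
 Henstock_Kurzweil_Integration.integral_cong
 Henstock_Kurzweil_Integration.integral_diff
 Henstock_Kurzweil_Integration.integral_nonneg
 Henstock_Kurzweil_Integration.integral_norm_bound_integral
 Henstock_Kurzweil_Integration.integral_sum

lemmas real_derivative_iff = has_real_derivative_iff_has_vector_derivative

abbreviation cts :: "('a::topological_space => 'b::topological_space) => bool" where
 "cts f \<equiv> continuous_on UNIV f"

abbreviation cts2 :: "('a::topological_space => 'b::topological_space => 'c::topological_space) => bool" where
 "cts2 f \<equiv> cts (\<lambda>p. f (fst p) (snd p))"

abbreviation lintegrable :: "('a::euclidean_space => 'b::{banach, second_countable_topology}) => bool" where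
 "lintegrable f \<equiv> integrable lborel f"

abbreviation integral_lborel :: "('a::euclidean_space => 'b::{banach, second_countable_topology}) => 'b"
 (binder "\<integral>" 10) where "integral_lborel f \<equiv> integral\<^sup>L lborel f"

section \<open>Derivatives along null sequences and integrals with a parameter\<close>

lemma has_vector_derivative_sequentially:
 fixes f :: "real => 'v::real_normed_vector"
 assumes "\<And>s. (\<And>n. s n \<noteq> 0) ==> (\<And>n. \<bar>s n\<bar> < r) ==> s \<longlonglongrightarrow> 0 ==>
   (\<lambda>n. (f (x + s n) - f x) /\<^sub>R s n) \<longlonglongrightarrow> D" and "0 < r"
 shows "(f has_vector_derivative D) (at x)"
proof -
 have "((\<lambda>h. (f (x + h) - f x) /\<^sub>R h) \<longlongrightarrow> D) (at 0)"
 proof (subst tendsto_at_iff_sequentially, intro allI impI)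
  fix s :: "nat => real" assume s: "\<forall>i. s i \<in> UNIV - {0}" "s \<longlonglongrightarrow> 0"
  obtain N where N: "\<And>n. n \<ge> N ==> \<bar>s n\<bar> < r"
   using s(2) \<open>0 < r\<close> unfolding LIMSEQ_def dist_real_def by auto
  have "(\<lambda>n. (f (x + s (n + N)) - f x) /\<^sub>R s (n + N)) \<longlonglongrightarrow> D"
   by (rule assms(1)) (use s N in \<open>auto intro: LIMSEQ_ignore_initial_segment\<close>)
  then show "((\<lambda>h. (f (x + h) - f x) /\<^sub>R h) \<circ> s) \<longlonglongrightarrow> D"
   unfolding comp_def by (rule LIMSEQ_offset)
 qed
 then have "((\<lambda>h. norm (f (x + h) - f x - h *\<^sub>R D) / norm h) \<longlongrightarrow> 0) (at 0)"
 proof -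
  assume "((\<lambda>h. (f (x + h) - f x) /\<^sub>R h) \<longlongrightarrow> D) (at 0)"
  then have "((\<lambda>h. norm ((f (x + h) - f x) /\<^sub>R h - D)) \<longlongrightarrow> 0) (at 0)"
   by (simp add: LIM_zero_iff tendsto_norm_zero_iff)
  then show ?thesis
  proof (rule Lim_transform_eventually)
   show "\<forall>\<^sub>F h in at 0. norm ((f (x + h) - f x) /\<^sub>R h - D) = norm (f (x + h) - f x - h *\<^sub>R D) / norm h"
    unfolding eventually_at_filter
   proof (intro always_eventually allI impI)
    fix h :: real assume "h \<noteq> 0"
    then have "(f (x + h) - f x) /\<^sub>R h - D = (f (x + h) - f x - h *\<^sub>R D) /\<^sub>R h"
     by (simp add: scaleR_diff_right)
    then show "norm ((f (x + h) - f x) /\<^sub>R h - D) = norm (f (x + h) - f x - h *\<^sub>R D) / norm h"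
     by (simp add: divide_inverse mult.commute)
   qed
  qed
 qed
 then show ?thesis
  by (simp add: has_vector_derivative_def has_derivative_at bounded_linear_scaleR_left)
qed

lemma has_vector_derivative_seq:
 fixes f :: "real => 'v::real_normed_vector"
 assumes "(f has_vector_derivative D) (at x)" "\<And>n. s n \<noteq> 0" "s \<longlonglongrightarrow> 0"
 shows "(\<lambda>n. (f (x + s n) - f x) /\<^sub>R s n) \<longlonglongrightarrow> D"
proof -
 have "((\<lambda>h. norm (f (x + h) - f x - h *\<^sub>R D) / norm h) \<longlongrightarrow> 0) (at 0)"
  using assms(1) by (simp add: has_vector_derivative_def has_derivative_at)
 then have "(\<lambda>n. norm (f (x + s n) - f x - s n *\<^sub>R D) / norm (s n)) \<longlonglongrightarrow> 0"
  using assms(2,3) by (auto simp: tendsto_at_iff_sequentially comp_def)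
 moreover have "norm (f (x + s n) - f x - s n *\<^sub>R D) / norm (s n) = norm ((f (x + s n) - f x) /\<^sub>R s n - D)" for n
 proof -
  have "(f (x + s n) - f x) /\<^sub>R s n - D = (f (x + s n) - f x - s n *\<^sub>R D) /\<^sub>R s n"
   using assms(2)[of n] by (simp add: scaleR_diff_right)
  then show ?thesis by (simp add: divide_inverse mult.commute)
 qed
 ultimately show ?thesis by (simp add: LIM_zero_iff tendsto_norm_zero_iff)
qed

lemma vector_derivative_bound_difference:
 fixes f :: "real => 'v::real_normed_vector"
 assumes d: "\<And>t. t \<in> closed_segment x y ==> (f has_vector_derivative f' t) (at t)"
  and b: "\<And>t. t \<in> closed_segment x y ==> norm (f' t) \<le> B"
 shows "norm (f y - f x) \<le> B * \<bar>y - x\<bar>"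
proof -
 have "norm (f y - f x) \<le> B * norm (y - x)"
  using d b by (intro differentiable_bound[where S = "closed_segment x y" and f' = "\<lambda>t h. h *\<^sub>R f' t"])
   (auto simp: has_vector_derivative_def intro: has_derivative_at_withinI simp: onorm_scaleR_left_lemma
    onorm_scaleR_left bounded_linear_ident onorm_id)
 then show ?thesis by simp
qed

text \<open>The mean value bound turns the bound \<open>g\<close> on the derivative into a bound on
  all difference quotients, so dominated convergence applies along every null sequence.
  Measurability of \<open>f' x\<close> is a consequence, since it is a pointwise limit of difference
  quotients.\<close>

lemma has_vector_derivative_integral:
 fixes f :: "real => 'b => 'v::{banach, second_countable_topology}"
 assumes r: "0 < r"
  and int: "\<And>s. \<bar>s - x\<bar> < r ==> integrable M (f s)"
  and d: "\<And>s t. t \<in> space M ==> \<bar>s - x\<bar> < r ==> ((\<lambda>s. f s t) has_vector_derivative f' s t) (at s)"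
  and b: "\<And>s t. t \<in> space M ==> \<bar>s - x\<bar> < r ==> norm (f' s t) \<le> g t"
  and g: "integrable M g"
 shows "((\<lambda>s. \<integral>t. f s t \<partial>M) has_vector_derivative (\<integral>t. f' x t \<partial>M)) (at x)" "integrable M (f' x)"
proof -
 have lim: "(\<lambda>n. (f (x + s n) t - f x t) /\<^sub>R s n) \<longlonglongrightarrow> f' x t"
  if "\<And>n. s n \<noteq> 0" "s \<longlonglongrightarrow> 0" "t \<in> space M" for s t
  using has_vector_derivative_seq[OF d[of t x] that(1,2)] that(3) r by simp
 have bd: "norm ((f (x + h) t - f x t) /\<^sub>R h) \<le> g t" if "\<bar>h\<bar> < r" "h \<noteq> 0" "t \<in> space M" for h t
 proof -
  have "norm (f (x + h) t - f x t) \<le> g t * \<bar>x + h - x\<bar>"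
  proof (rule vector_derivative_bound_difference[where f = "\<lambda>s. f s t" and f' = "\<lambda>s. f' s t"])
   fix s assume "s \<in> closed_segment x (x + h)"
   then have "\<bar>s - x\<bar> < r" using that(1) by (auto simp: closed_segment_eq_real_ivl split: if_splits)
   then show "((\<lambda>s. f s t) has_vector_derivative f' s t) (at s)" "norm (f' s t) \<le> g t"
    using d b that(3) by auto
  qed
  then show ?thesis using that(2) by (simp add: divide_simps mult.commute)
 qed
 have meas: "(\<lambda>t. (f (x + h) t - f x t) /\<^sub>R h) \<in> borel_measurable M" if "\<bar>h\<bar> < r" for h
  using int[of "x + h"] int[of x] that r by auto
 define s0 where "s0 n = r / (real n + 2)" for n
 have s0: "s0 n \<noteq> 0" "\<bar>s0 n\<bar> < r" for n using r by (auto simp: s0_def divide_simps)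
 have s0l: "s0 \<longlonglongrightarrow> 0" unfolding s0_def by real_asymp
 have m: "f' x \<in> borel_measurable M"
  by (rule borel_measurable_LIMSEQ_metric[where f = "\<lambda>n t. (f (x + s0 n) t - f x t) /\<^sub>R s0 n"])
   (use meas[OF s0(2)] lim[OF s0(1) s0l] in auto)
 have "(\<lambda>n. (\<integral>t. (f (x + s n) t - f x t) /\<^sub>R s n \<partial>M)) \<longlonglongrightarrow> (\<integral>t. f' x t \<partial>M)"
  if "\<And>n. s n \<noteq> 0" "\<And>n. \<bar>s n\<bar> < r" "s \<longlonglongrightarrow> 0" for s
  by (rule integral_dominated_convergence[where w = g]) (use m meas that lim bd g in auto)
 then show "((\<lambda>s. \<integral>t. f s t \<partial>M) has_vector_derivative (\<integral>t. f' x t \<partial>M)) (at x)"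
  using int r by (intro has_vector_derivative_sequentially[of r]) auto
 show "integrable M (f' x)"
  by (rule integrable_bound[OF g m]) (use b[of _ x] r in \<open>auto intro!: AE_I2 intro: order_trans abs_ge_self\<close>)
qed

text \<open>The dominating function may depend on the convergent sequence. In the applications the
  sequence with its limit is a compact set, on which a jointly continuous integrand is
  bounded.\<close>

lemma continuous_on_integral_dominated:
 fixes f :: "'a::metric_space => 'b => 'v::{banach, second_countable_topology}"
 assumes m: "\<And>x. f x \<in> borel_measurable M"
  and c: "\<And>t. t \<in> space M ==> cts (\<lambda>x. f x t)"
  and b: "\<And>s x. s \<longlonglongrightarrow> x ==> \<exists>g. integrable M g \<and> (\<forall>n. \<forall>t\<in>space M. norm (f (s n) t) \<le> g t)"
 shows "cts (\<lambda>x. \<integral>t. f x t \<partial>M)"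
 unfolding continuous_on_sequentially
proof (intro allI ballI impI, elim conjE)
 fix s :: "nat => 'a" and x assume s: "s \<longlonglongrightarrow> x"
 obtain g where g: "integrable M g" "\<forall>n. \<forall>t\<in>space M. norm (f (s n) t) \<le> g t" using b[OF s] by blast
 show "((\<lambda>x. \<integral>t. f x t \<partial>M) \<circ> s) \<longlonglongrightarrow> (\<integral>t. f x t \<partial>M)"
  unfolding comp_def
 proof (rule integral_dominated_convergence[where w = g])
  show "AE t in M. (\<lambda>n. f (s n) t) \<longlonglongrightarrow> f x t"
  proof (rule AE_I2)
   fix t assume "t \<in> space M"
   then have "isCont (\<lambda>x. f x t) x" using c by (simp add: continuous_on_eq_continuous_at)
   then show "(\<lambda>n. f (s n) t) \<longlonglongrightarrow> f x t" using isCont_tendsto_compose s by blast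
  qed
 qed (use m g in auto)
qed

section \<open>Partial derivatives and test functions\<close>

text \<open>The vector-valued counterpart of \<open>has_partial\<close>; the Fourier coefficients of
  the solution are complex.\<close>

definition pderiv_on :: "(real^'n => 'v::real_normed_vector) => 'n::finite => (real^'n => 'v) => bool" where
 "pderiv_on f k g \<longleftrightarrow> (\<forall>x. ((\<lambda>s. f (x + s *\<^sub>R axis k 1)) has_vector_derivative g x) (at 0))"

definition C1_fun :: "(real^'n => 'v::real_normed_vector) => ('n::finite => real^'n => 'v) => bool" where
 "C1_fun f df \<longleftrightarrow> cts f \<and> (\<forall>k. pderiv_on f k (df k) \<and> cts (df k))"

text \<open>\<open>S\<close> is an arbitrary set and \<open>f\<close> is defined on the whole space,
  so that no regularity of \<open>S\<close> ever enters; the partial derivatives are carried along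
  as data.\<close>

definition C1_test :: "(real^'n) set => (real^'n => 'v::real_normed_vector) => ('n::finite => real^'n => 'v) => bool" where
 "C1_test S f df \<longleftrightarrow> C1_fun f df \<and> (\<exists>K. compact K \<and> K \<subseteq> S \<and> (\<forall>x. x \<notin> K \<longrightarrow> f x = 0))"

lemma has_partial_iff: "has_partial f k g \<longleftrightarrow> pderiv_on f k g"
 by (simp add: has_partial_def pderiv_on_def real_derivative_iff)

lemma pderiv_line:
 assumes "pderiv_on f k g"
 shows "((\<lambda>s. f (x + s *\<^sub>R axis k 1)) has_vector_derivative g (x + s *\<^sub>R axis k 1)) (at s)"
proof -
 have "((\<lambda>r. f ((x + s *\<^sub>R axis k 1) + r *\<^sub>R axis k 1)) has_vector_derivative g (x + s *\<^sub>R axis k 1)) (at 0)"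
  using assms by (simp add: pderiv_on_def)
 then have "((\<lambda>r. f (x + (s + r) *\<^sub>R axis k 1)) has_vector_derivative g (x + s *\<^sub>R axis k 1)) (at (s - s))"
  by (simp add: scaleR_add_left add.assoc)
 then have "((\<lambda>r. f (x + (s + r) *\<^sub>R axis k 1)) \<circ> (\<lambda>r. r - s) has_vector_derivative 1 *\<^sub>R g (x + s *\<^sub>R axis k 1)) (at s)"
  by (intro vector_diff_chain_at) (auto intro!: derivative_eq_intros)
 then show ?thesis by (simp add: comp_def)
qed

lemma pderiv_bounded_linear:
 assumes "bounded_linear h" "pderiv_on f k g"
 shows "pderiv_on (\<lambda>x. h (f x)) k (\<lambda>x. h (g x))"
 using assms unfolding pderiv_on_def by (auto intro: bounded_linear.has_vector_derivative)

lemma pderiv_add: "pderiv_on f k f' ==> pderiv_on g k g' ==> pderiv_on (\<lambda>x. f x + g x) k (\<lambda>x. f' x + g' x)"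
 unfolding pderiv_on_def by (auto intro: has_vector_derivative_add)

lemma pderiv_diff: "pderiv_on f k f' ==> pderiv_on g k g' ==> pderiv_on (\<lambda>x. f x - g x) k (\<lambda>x. f' x - g' x)"
 unfolding pderiv_on_def by (auto intro: has_vector_derivative_diff)

lemma pderiv_scaleR:
 assumes "pderiv_on f k f'" "pderiv_on g k g'"
 shows "pderiv_on (\<lambda>x. f x *\<^sub>R g x) k (\<lambda>x. f x *\<^sub>R g' x + f' x *\<^sub>R g x)"
 unfolding pderiv_on_def
proof
 fix x
 have "((\<lambda>s. f (x + s *\<^sub>R axis k 1)) has_real_derivative f' x) (at 0)"
  using assms by (auto simp: pderiv_on_def real_derivative_iff)
 moreover have "((\<lambda>s. g (x + s *\<^sub>R axis k 1)) has_vector_derivative g' x) (at 0)"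
  using assms by (auto simp: pderiv_on_def)
 ultimately show "((\<lambda>s. f (x + s *\<^sub>R axis k 1) *\<^sub>R g (x + s *\<^sub>R axis k 1)) has_vector_derivative f x *\<^sub>R g' x + f' x *\<^sub>R g x) (at 0)"
  using has_vector_derivative_scaleR by fastforce
qed

lemma pderiv_mult:
 fixes f g :: "real^'n::finite => real"
 assumes "pderiv_on f k f'" "pderiv_on g k g'"
 shows "pderiv_on (\<lambda>x. f x * g x) k (\<lambda>x. f x * g' x + f' x * g x)"
 using pderiv_scaleR[OF assms] by simp

lemma pderiv_chain:
 assumes "pderiv_on f k f'" "\<And>x. (h has_real_derivative h' (f x)) (at (f x))"
 shows "pderiv_on (\<lambda>x. h (f x)) k (\<lambda>x. h' (f x) * f' x)"
 unfolding pderiv_on_def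
proof
 fix x
 have "((\<lambda>s. f (x + s *\<^sub>R axis k 1)) has_real_derivative f' x) (at 0)"
  using assms by (auto simp: pderiv_on_def real_derivative_iff)
 moreover have "(h has_real_derivative h' (f x)) (at (f (x + 0 *\<^sub>R axis k 1)))" using assms by simp
 ultimately show "((\<lambda>s. h (f (x + s *\<^sub>R axis k 1))) has_vector_derivative h' (f x) * f' x) (at 0)"
  unfolding real_derivative_iff[symmetric]
  using DERIV_chain2[of h "h' (f x)" "\<lambda>s. f (x + s *\<^sub>R axis k 1)" 0 "f' x" UNIV] by simp
qed

lemma pderiv_sum:
 assumes "\<And>i. i \<in> I ==> pderiv_on (f i) k (f' i)"
 shows "pderiv_on (\<lambda>x. \<Sum>i\<in>I. f i x) k (\<lambda>x. \<Sum>i\<in>I. f' i x)"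
 using assms unfolding pderiv_on_def by (auto intro!: has_vector_derivative_sum)

lemma pderiv_inner:
 assumes "pderiv_on f k f'" "pderiv_on g k g'"
 shows "pderiv_on (\<lambda>x. f x \<bullet> g x) k (\<lambda>x. f x \<bullet> g' x + f' x \<bullet> g x)"
 unfolding pderiv_on_def
proof
 fix x
 have "((\<lambda>s. f (x + s *\<^sub>R axis k 1)) has_vector_derivative f' x) (at 0)"
    "((\<lambda>s. g (x + s *\<^sub>R axis k 1)) has_vector_derivative g' x) (at 0)"
  using assms by (auto simp: pderiv_on_def)
 from bounded_bilinear.has_vector_derivative[OF bounded_bilinear_inner this]
 show "((\<lambda>s. f (x + s *\<^sub>R axis k 1) \<bullet> g (x + s *\<^sub>R axis k 1)) has_vector_derivative f x \<bullet> g' x + f' x \<bullet> g x) (at 0)"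
  by simp
qed

lemma pderiv_unique: "pderiv_on f k f' ==> pderiv_on f k f'' ==> f' = f''"
 unfolding pderiv_on_def by (auto intro!: ext vector_derivative_unique_at)

text \<open>The complement of \<open>K\<close> is open, so the derivatives vanish off
  \<open>K\<close> together with the function.\<close>

lemma C1_testE:
 assumes "C1_test S f df"
 obtains K where "compact K" "K \<subseteq> S" "\<And>x. x \<notin> K ==> f x = 0" "\<And>x k. x \<notin> K ==> df k x = 0"
proof -
 obtain K where K: "compact K" "K \<subseteq> S" "\<And>x. x \<notin> K ==> f x = 0" using assms by (auto simp: C1_test_def)
 have "df k x = 0" if "x \<notin> K" for x k
 proof -
  have o: "open (- K)" using K(1) by (simp add: compact_imp_closed open_Compl)
  have "\<exists>e>0. ball x e \<subseteq> - K" using o that unfolding open_contains_ball by blast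
  then obtain e where e: "0 < e" "ball x e \<subseteq> - K" by blast
  have "((\<lambda>s. f (x + s *\<^sub>R axis k 1)) has_vector_derivative df k x) (at 0)"
   using assms by (auto simp: C1_test_def C1_fun_def pderiv_on_def)
  moreover have "((\<lambda>s. f (x + s *\<^sub>R axis k 1)) has_vector_derivative 0) (at 0)"
  proof (rule has_vector_derivative_transform_within[where f = "\<lambda>_. 0" and d = e])
   fix s :: real assume "dist s 0 < e"
   then have "x + s *\<^sub>R axis k 1 \<in> ball x e" by (simp add: dist_norm)
   then show "0 = f (x + s *\<^sub>R axis k 1)" using e(2) K(3) by auto
  qed (use e in auto)
  ultimately show ?thesis by (rule vector_derivative_unique_at)
 qed
 then show thesis using K that by blast
qed

lemma C1_fun_add: "C1_fun f df ==> C1_fun g dg ==> C1_fun (\<lambda>x. f x + g x) (\<lambda>k x. df k x + dg k x)"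
 unfolding C1_fun_def by (auto intro!: continuous_on_add pderiv_add)

lemma C1_fun_diff: "C1_fun f df ==> C1_fun g dg ==> C1_fun (\<lambda>x. f x - g x) (\<lambda>k x. df k x - dg k x)"
 unfolding C1_fun_def by (auto intro!: continuous_on_diff pderiv_diff)

lemma C1_fun_bounded_linear: "bounded_linear h ==> C1_fun f df ==> C1_fun (\<lambda>x. h (f x)) (\<lambda>k x. h (df k x))"
 unfolding C1_fun_def by (simp add: pderiv_bounded_linear bounded_linear.continuous_on)

lemma C1_fun_scaleR: "C1_fun f df ==> C1_fun g dg ==> C1_fun (\<lambda>x. f x *\<^sub>R g x) (\<lambda>k x. f x *\<^sub>R dg k x + df k x *\<^sub>R g x)"
 unfolding C1_fun_def by (auto intro!: continuous_on_add continuous_on_scaleR pderiv_scaleR)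

lemma C1_test_fun: "C1_test S f df ==> C1_fun f df"
 by (simp add: C1_test_def)

lemma C1_testI: "C1_fun f df ==> compact K ==> K \<subseteq> S ==> (\<And>x. x \<notin> K ==> f x = 0) ==> C1_test S f df"
 by (auto simp: C1_test_def)

lemma C1_test_bounded_linear:
 assumes "bounded_linear h" "C1_test S f df"
 shows "C1_test S (\<lambda>x. h (f x)) (\<lambda>k x. h (df k x))"
proof -
 obtain K where "compact K" "K \<subseteq> S" "\<And>x. x \<notin> K ==> f x = 0" by (rule C1_testE[OF assms(2)]) blast
 then show ?thesis
  using linear_0[OF bounded_linear.linear[OF assms(1)]]
  by (intro C1_testI[of _ _ K] C1_fun_bounded_linear[OF assms(1) C1_test_fun[OF assms(2)]]) simp_all
qed

lemma C1_test_scaleR: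
 assumes "C1_fun f df" "C1_test S g dg"
 shows "C1_test S (\<lambda>x. f x *\<^sub>R g x) (\<lambda>k x. f x *\<^sub>R dg k x + df k x *\<^sub>R g x)"
proof -
 obtain K where "compact K" "K \<subseteq> S" "\<And>x. x \<notin> K ==> g x = 0" by (rule C1_testE[OF assms(2)]) blast
 then show ?thesis
  by (intro C1_testI[of _ _ K] C1_fun_scaleR[OF assms(1) C1_test_fun[OF assms(2)]]) simp_all
qed

section \<open>Integrals of compactly supported functions\<close>

lemma integrable_compact_support:
 fixes f :: "'a::euclidean_space => 'b::{banach, second_countable_topology}"
 assumes "cts f" "compact K" "\<And>x. x \<notin> K ==> f x = 0"
 shows "lintegrable f"
proof -
 have "lintegrable (\<lambda>x. indicator K x *\<^sub>R f x)"
  using assms by (intro borel_integrable_compact) (auto intro: continuous_on_subset)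
 moreover have "(\<lambda>x. indicator K x *\<^sub>R f x) = f" using assms(3) by (auto simp: indicator_def)
 ultimately show ?thesis by simp
qed

lemma bounded_compact_support:
 fixes f :: "'a::euclidean_space => 'b::real_normed_vector"
 assumes "cts f" "compact K" "\<And>x. x \<notin> K ==> f x = 0"
 obtains B where "0 < B" "\<And>x. norm (f x) \<le> B"
proof -
 have "bounded (f ` K)" using assms by (intro compact_imp_bounded compact_continuous_image) (auto intro: continuous_on_subset)
 then obtain B where "0 < B" "\<And>x. x \<in> K ==> norm (f x) \<le> B" unfolding bounded_pos by auto
 then show thesis using that[of B] assms(3) by (metis less_imp_le norm_zero)
qed

text \<open>By translation invariance every difference quotient of \<open>f\<close> has integral
  zero. These quotients are bounded by the mean value theorem and, for steps shorter than 1, live on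
  one ball of radius \<open>R + 1\<close>, so dominated convergence passes the identity on to the
  derivative.\<close>

lemma integral_pderiv_eq_0:
 fixes f :: "real^'n::finite => real"
 assumes d: "pderiv_on f k g" and c: "cts f" "cts g"
  and K: "compact K" "\<And>x. x \<notin> K ==> f x = 0" "\<And>x. x \<notin> K ==> g x = 0"
 shows "(\<integral>x. g x) = 0"
proof -
 obtain B where B: "0 < B" "\<And>x. norm (g x) \<le> B" using bounded_compact_support[OF c(2) K(1,3)] by metis
 obtain R where R: "\<And>x. x \<in> K ==> norm x \<le> R" using compact_imp_bounded[OF K(1)] unfolding bounded_iff by auto
 define e where "e = (axis k 1 :: real^'n)"
 have e: "norm e = 1" by (simp add: e_def)
 define s where "s n = 1 / (real n + 2)" for n
 have s: "s n \<noteq> 0" "\<bar>s n\<bar> < 1" for n by (auto simp: s_def divide_simps)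
 have sl: "s \<longlonglongrightarrow> 0" unfolding s_def by real_asymp
 have fi: "lintegrable f" by (rule integrable_compact_support[OF c(1) K(1,2)])
 have tr: "lintegrable (\<lambda>x. f (x + v))" "(\<integral>x. f (x + v)) = (\<integral>x. f x)" for v
 proof -
  have "integrable (distr lborel borel ((+) v)) f" using fi by (simp add: lborel_distr_plus)
  then show "lintegrable (\<lambda>x. f (x + v))"
   by (subst (asm) integrable_distr_eq) (use fi in \<open>auto simp: add.commute\<close>)
  have "(\<integral>x. f x) = (\<integral>x. f x \<partial>distr lborel borel ((+) v))" by (simp add: lborel_distr_plus)
  also have "\<dots> = (\<integral>x. f (v + x))" by (rule integral_distr) (use fi in auto)
  finally show "(\<integral>x. f (x + v)) = (\<integral>x. f x)" by (simp add: add.commute)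
 qed
 have "(\<lambda>n. (\<integral>x. (f (x + s n *\<^sub>R e) - f x) /\<^sub>R s n)) \<longlonglongrightarrow> (\<integral>x. g x)"
 proof (rule integral_dominated_convergence[where w = "\<lambda>x. indicator (cball 0 (R + 1)) x * B"])
  show "lintegrable (\<lambda>x::real^'n. indicator (cball 0 (R + 1)) x * B)"
   using borel_integrable_compact[of "cball (0::real^'n) (R+1)" "\<lambda>_. B"] by simp
  show "AE x in lborel. (\<lambda>n. (f (x + s n *\<^sub>R e) - f x) /\<^sub>R s n) \<longlonglongrightarrow> g x"
  proof (rule AE_I2)
   fix x
   show "(\<lambda>n. (f (x + s n *\<^sub>R e) - f x) /\<^sub>R s n) \<longlonglongrightarrow> g x"
    using has_vector_derivative_seq[OF d[unfolded pderiv_on_def, rule_format, of x] s(1) sl] by (simp add: e_def)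
  qed
  show "AE x in lborel. norm ((f (x + s n *\<^sub>R e) - f x) /\<^sub>R s n) \<le> indicator (cball 0 (R + 1)) x * B" for n
  proof (rule AE_I2)
   fix x
   have "norm (f (x + s n *\<^sub>R e) - f (x + 0 *\<^sub>R e)) \<le> B * \<bar>s n - 0\<bar>"
    by (rule vector_derivative_bound_difference[where f = "\<lambda>r. f (x + r *\<^sub>R e)" and f' = "\<lambda>r. g (x + r *\<^sub>R e)"])
     (use pderiv_line[OF d] B in \<open>auto simp: e_def\<close>)
   then have 1: "norm ((f (x + s n *\<^sub>R e) - f x) /\<^sub>R s n) \<le> B"
    using s(1)[of n] by (simp add: divide_simps mult.commute)
   have "(f (x + s n *\<^sub>R e) - f x) /\<^sub>R s n = 0" if "x \<notin> cball 0 (R + 1)"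
   proof -
    have "norm x \<le> norm (x + s n *\<^sub>R e) + norm (s n *\<^sub>R e)" using norm_triangle_ineq4[of "x + s n *\<^sub>R e" "s n *\<^sub>R e"] by simp
    then have "x \<notin> K" "x + s n *\<^sub>R e \<notin> K" using that R[of x] R[of "x + s n *\<^sub>R e"] s(2)[of n] e by auto
    then show ?thesis using K by simp
   qed
   then show "norm ((f (x + s n *\<^sub>R e) - f x) /\<^sub>R s n) \<le> indicator (cball 0 (R + 1)) x * B"
    using 1 by (auto simp: indicator_def)
  qed
  show "g \<in> borel_measurable lborel" using integrable_compact_support[OF c(2) K(1,3)] by auto
  show "(\<lambda>x. (f (x + s n *\<^sub>R e) - f x) /\<^sub>R s n) \<in> borel_measurable lborel" for n
   using tr(1)[of "s n *\<^sub>R e"] fi by auto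
 qed
 moreover have "(\<integral>x. (f (x + s n *\<^sub>R e) - f x) /\<^sub>R s n) = 0" for n
  using tr[of "s n *\<^sub>R e"] fi by simp
 ultimately have "(\<lambda>n::nat. 0) \<longlonglongrightarrow> (\<integral>x. g x)" by (simp only:)
 then show ?thesis by (simp add: LIMSEQ_const_iff)
qed

section \<open>Near-minimisers of the energy\<close>

lemma DERIV_glue:
 assumes "(f has_real_derivative D) (at x within {..x})" "(f has_real_derivative D) (at x within {x..})"
 shows "(f has_real_derivative D) (at x)"
proof -
 have "{..x} \<union> {x..} = (UNIV :: real set)" by auto
 then have "at x = sup (at x within {..x}) (at x within {x..})" by (metis at_within_union)
 then show ?thesis using assms unfolding has_field_derivative_iff by (simp only:) (rule filterlim_sup)
qed

text \<open>The variable \<open>s\<close> stands for \<open>|z|^2\<close>. Multiplying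
  \<open>z\<close> by this factor fixes the ball of radius \<open>sqrt R\<close> and sends a larger
  radius \<open>r\<close> to \<open>2 * sqrt R - R / r\<close>: a continuously differentiable map
  whose radial slope \<open>R / r^2\<close> is at most 1 and whose values stay below
  \<open>2 * sqrt R\<close>.\<close>

definition radial_cut :: "real => real => real" where
 "radial_cut R s = (if s \<le> R then 1 else 2 * sqrt (R / s) - R / s)"

definition radial_cut' :: "real => real => real" where
 "radial_cut' R s = (if s \<le> R then 0 else (R - sqrt (R * s)) / s\<^sup>2)"

lemma DERIV_radial_cut:
 assumes "0 < R" shows "(radial_cut R has_real_derivative radial_cut' R s) (at s)"
proof -
 have outer: "((\<lambda>s. 2 * sqrt (R / s) - R / s) has_real_derivative (R - sqrt (R * s)) / s\<^sup>2) (at s)" if "s \<ge> R" for s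
 proof -
  have s: "0 < s" using that assms by simp
  then have "0 < R / s" using assms by simp
  then have "((\<lambda>s. 2 * sqrt (R / s) - R / s) has_real_derivative
    2 * (inverse (sqrt (R / s)) / 2 * (- R / s\<^sup>2)) + R / s\<^sup>2) (at s)"
   using s assms by (auto intro!: derivative_eq_intros simp: power2_eq_square divide_less_0_iff)
  moreover have "inverse (sqrt (R / s)) * R = sqrt (R * s)"
   using s assms by (simp add: real_sqrt_divide real_sqrt_mult field_simps)
  then have "2 * (inverse (sqrt (R / s)) / 2 * (- R / s\<^sup>2)) + R / s\<^sup>2 = (R - sqrt (R * s)) / s\<^sup>2"
   by (simp add: diff_divide_distrib mult.assoc[symmetric])
  ultimately show ?thesis by simp
 qed
 consider "s < R" | "s = R" | "s > R" by linarith
 then show ?thesis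
 proof cases
  case 1
  show ?thesis
   by (rule has_field_derivative_transform_within_open[where f = "\<lambda>_. 1" and S = "{..<R}"])
    (use 1 in \<open>auto simp: radial_cut_def radial_cut'_def\<close>)
 next
  case 2
  have a: "(radial_cut R has_real_derivative 0) (at R within {..R})"
   by (rule has_field_derivative_transform_within[where f = "\<lambda>_. 1" and d = 1])
    (auto simp: radial_cut_def)
  have "((\<lambda>s. 2 * sqrt (R / s) - R / s) has_real_derivative 0) (at R within {R..})"
   using has_field_derivative_at_within[OF outer[of R]] assms by simp
  then have "(radial_cut R has_real_derivative 0) (at R within {R..})"
   by (rule has_field_derivative_transform_within[where d = 1])
    (use assms in \<open>auto simp: radial_cut_def\<close>)
  from DERIV_glue[OF a this] 2 show ?thesis by (simp add: radial_cut'_def)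
 next
  case 3
  show ?thesis
   by (rule has_field_derivative_transform_within_open[where f = "\<lambda>s. 2 * sqrt (R / s) - R / s" and S = "{R<..}"])
    (use 3 outer[of s] in \<open>auto simp: radial_cut_def radial_cut'_def\<close>)
 qed
qed

lemma continuous_radial_cut: "0 < R ==> continuous_on S (radial_cut R)"
 by (rule DERIV_continuous_on[where D = "radial_cut' R"]) (rule has_field_derivative_at_within[OF DERIV_radial_cut])

lemma continuous_radial_cut':
 assumes "0 < R" shows "cts (radial_cut' R)"
proof -
 have "continuous_on ({..R} \<union> {R..}) (\<lambda>s. if s \<le> R then 0 else (R - sqrt (R * s)) / s\<^sup>2)"
  by (rule continuous_on_If) (use assms in \<open>auto intro!: continuous_intros\<close>)
 moreover have "{..R} \<union> {R..} = UNIV" by auto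
 ultimately show ?thesis by (simp add: radial_cut'_def[abs_def])
qed

text \<open>With \<open>q = sqrt (R / s)\<close> in \<open>(0, 1]\<close> the factor is
  \<open>2 q - q^2\<close> and \<open>s\<close> times its derivative is \<open>q^2 - q\<close>, so
  all claims become polynomial inequalities in \<open>q\<close>. The third and the fourth are what
  the energy comparison asks of the truncation.\<close>

lemma radial_cut_bounds:
 assumes "0 < R" "0 \<le> s"
 shows "0 \<le> radial_cut R s" "radial_cut R s \<le> 1" "radial_cut' R s \<le> 0"
  "0 \<le> radial_cut R s + s * radial_cut' R s" "s * (radial_cut R s)\<^sup>2 \<le> 4 * R"
proof -
 have "0 \<le> radial_cut R s \<and> radial_cut R s \<le> 1 \<and> radial_cut' R s \<le> 0 \<and>
  0 \<le> radial_cut R s + s * radial_cut' R s \<and> s * (radial_cut R s)\<^sup>2 \<le> 4 * R"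
 proof (cases "s \<le> R")
  case True then show ?thesis using assms by (simp add: radial_cut_def radial_cut'_def)
 next
  case False
  define q where "q = sqrt (R / s)"
  have s: "0 < s" "R < s" using False assms by auto
  have q: "0 < q" "q \<le> 1" using s assms by (auto simp: q_def)
  have q2: "R / s = q\<^sup>2" using s assms by (simp add: q_def)
  have c: "radial_cut R s = 2 * q - q\<^sup>2" using False q2 by (simp add: radial_cut_def q_def)
  have R: "R = s * q\<^sup>2" using q2 s by (simp add: field_simps)
  have "R * s = (s * q)\<^sup>2" using R by (simp add: power2_eq_square)
  then have "sqrt (R * s) = s * q" using s q by (simp add: real_sqrt_unique)
  then have c': "s * radial_cut' R s = q\<^sup>2 - q"
   using False R s by (simp add: radial_cut'_def power2_eq_square field_simps)
  have qq: "q\<^sup>2 \<le> q" using q by (simp add: power2_eq_square mult_left_le)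
  have "radial_cut' R s \<le> 0"
  proof (rule ccontr)
   assume "\<not> radial_cut' R s \<le> 0"
   then have "0 < s * radial_cut' R s" using s by simp
   then show False using c' qq by simp
  qed
  moreover have "s * (radial_cut R s)\<^sup>2 = R * (2 - q)\<^sup>2"
   using arg_cong[OF R, of "\<lambda>v. v * (2 - q)\<^sup>2"] unfolding c by (simp add: power2_eq_square algebra_simps)
  moreover have "(2 - q)\<^sup>2 \<le> 2\<^sup>2" using q by (intro power_mono) auto
  ultimately show ?thesis unfolding c c' using qq q assms sum_power2_ge_zero[of "1 - q" 0]
   by (auto simp: power2_diff intro: mult_left_mono)
 qed
 then show "0 \<le> radial_cut R s" "radial_cut R s \<le> 1" "radial_cut' R s \<le> 0"
  "0 \<le> radial_cut R s + s * radial_cut' R s" "s * (radial_cut R s)\<^sup>2 \<le> 4 * R" by auto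
qed

text \<open>The discriminant criterion. With \<open>d^2\<close> an energy gap instead of an energy,
  it also expresses that a near-minimiser is almost orthogonal to all admissible variations.\<close>

lemma quadratic_nonneg_imp:
 fixes A B d :: real
 assumes "\<And>r. 0 \<le> r\<^sup>2 * A + 2 * r * B + d\<^sup>2" "0 \<le> A" "0 \<le> d"
 shows "\<bar>B\<bar> \<le> d * sqrt A"
proof (cases "A = 0")
 case True
 have "B = 0"
 proof (rule ccontr)
  assume "B \<noteq> 0"
  then show False using assms(1)[of "- (d\<^sup>2 + 1) / (2 * B)"] True by (simp add: field_simps)
 qed
 then show ?thesis using True by simp
next
 case False
 then have A: "0 < A" using assms by simp
 have "0 \<le> (- B / A)\<^sup>2 * A + 2 * (- B / A) * B + d\<^sup>2" using assms(1) .
 then have "B\<^sup>2 \<le> d\<^sup>2 * A" using A by (simp add: power2_eq_square divide_simps mult.commute)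
 then have "sqrt (B\<^sup>2) \<le> sqrt (d\<^sup>2 * A)" by (rule real_sqrt_le_mono)
 then show ?thesis using assms by (simp add: real_sqrt_mult)
qed

section \<open>The energy form of the principal part\<close>

locale elliptic_form =
 fixes a :: "'n::finite => 'n => real^'n => real" and \<Lambda> \<delta>0 :: real
 assumes a_sym: "a i j x = a j i x"
  and a_cont: "cts (a i j)"
  and a_bound: "\<bar>a i j x\<bar> \<le> \<Lambda>"
  and ellip: "\<delta>0 * (norm \<zeta>)\<^sup>2 \<le> (\<Sum>i\<in>UNIV. \<Sum>j\<in>UNIV. a i j x * \<zeta>$i * \<zeta>$j)"
  and \<delta>0: "0 < \<delta>0"
begin

definition aform :: "real^'n => ('n => 'v::euclidean_space) => ('n => 'v) => real" where
 "aform x F G = (\<Sum>k\<in>UNIV. \<Sum>l\<in>UNIV. a k l x * (F k \<bullet> G l))"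

abbreviation af :: "('n => real^'n => 'v::euclidean_space) => ('n => real^'n => 'v) => real^'n => real" where
 "af F G x \<equiv> aform x (\<lambda>k. F k x) (\<lambda>k. G k x)"

lemma aform_commute: "aform x F G = aform x G F"
proof -
 have "aform x F G = (\<Sum>l\<in>UNIV. \<Sum>k\<in>UNIV. a k l x * (F k \<bullet> G l))"
  unfolding aform_def by (rule sum.swap)
 then show ?thesis unfolding aform_def by (simp add: a_sym inner_commute)
qed

lemma aform_add_left: "aform x (\<lambda>k. F k + G k) H = aform x F H + aform x G H"
 by (simp add: aform_def inner_add_left distrib_left sum.distrib)

lemma aform_diff_left: "aform x (\<lambda>k. F k - G k) H = aform x F H - aform x G H"
 by (simp add: aform_def inner_diff_left right_diff_distrib sum_subtractf)

lemma aform_scaleR_left: "aform x (\<lambda>k. r *\<^sub>R F k) H = r * aform x F H"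
 by (simp add: aform_def sum_distrib_left ac_simps)

lemma aform_add_right: "aform x H (\<lambda>k. F k + G k) = aform x H F + aform x H G"
 using aform_add_left aform_commute by metis

lemma aform_scaleR_right: "aform x H (\<lambda>k. r *\<^sub>R F k) = r * aform x H F"
 using aform_scaleR_left aform_commute by metis

lemma quad_ge: "\<delta>0 * (\<Sum>k\<in>UNIV. (c k)\<^sup>2) \<le> (\<Sum>k\<in>UNIV. \<Sum>l\<in>UNIV. a k l x * (c k * c l))"
proof -
 have "(norm ((\<chi> k. c k) :: real^'n))\<^sup>2 = (\<Sum>k\<in>UNIV. (c k)\<^sup>2)"
  by (simp add: norm_vec_def L2_set_def sum_nonneg)
 then show ?thesis using ellip[of "\<chi> k. c k" x] by (simp add: mult.assoc)
qed

lemma quad_nonneg: "0 \<le> (\<Sum>k\<in>UNIV. \<Sum>l\<in>UNIV. a k l x * (c k * c l))"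
 using quad_ge[of c x] \<delta>0 by (smt (verit) sum_nonneg zero_le_power2 mult_nonneg_nonneg)

text \<open>Expanding in the orthonormal basis of the value space reduces the vector-valued form to
  scalar ellipticity.\<close>

lemma aform_ge: "\<delta>0 * (\<Sum>k\<in>UNIV. (norm (F k))\<^sup>2) \<le> aform x F F"
proof -
 have 1: "aform x F F = (\<Sum>b\<in>Basis. \<Sum>k\<in>UNIV. \<Sum>l\<in>UNIV. a k l x * ((F k \<bullet> b) * (F l \<bullet> b)))"
 proof -
  have "aform x F F = (\<Sum>k\<in>UNIV. \<Sum>l\<in>UNIV. \<Sum>b\<in>Basis. a k l x * ((F k \<bullet> b) * (F l \<bullet> b)))"
   unfolding aform_def by (simp add: euclidean_inner[of "F _" "F _"] sum_distrib_left)
  also have "\<dots> = (\<Sum>k\<in>UNIV. \<Sum>b\<in>Basis. \<Sum>l\<in>UNIV. a k l x * ((F k \<bullet> b) * (F l \<bullet> b)))"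
   by (intro sum.cong refl sum.swap)
  also have "\<dots> = (\<Sum>b\<in>Basis. \<Sum>k\<in>UNIV. \<Sum>l\<in>UNIV. a k l x * ((F k \<bullet> b) * (F l \<bullet> b)))"
   by (rule sum.swap)
  finally show ?thesis .
 qed
 have 2: "(\<Sum>k\<in>UNIV. (norm (F k))\<^sup>2) = (\<Sum>b\<in>Basis. \<Sum>k\<in>UNIV. (F k \<bullet> b)\<^sup>2)"
 proof -
  have "(norm (F k))\<^sup>2 = (\<Sum>b\<in>Basis. (F k \<bullet> b)\<^sup>2)" for k
   unfolding power2_norm_eq_inner euclidean_inner[of "F k" "F k"] by (simp add: power2_eq_square)
  then show ?thesis by (simp add: sum.swap[of _ UNIV Basis])
 qed
 have "\<delta>0 * (\<Sum>b\<in>Basis. \<Sum>k\<in>UNIV. (F k \<bullet> b)\<^sup>2) = (\<Sum>b\<in>Basis. \<delta>0 * (\<Sum>k\<in>UNIV. (F k \<bullet> b)\<^sup>2))"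
  by (rule sum_distrib_left)
 then show ?thesis unfolding 1 2 by (simp only:) (intro sum_mono quad_ge)
qed

lemma aform_nonneg: "0 \<le> aform x F F"
 using aform_ge[of F x] \<delta>0 by (smt (verit) sum_nonneg zero_le_power2 mult_nonneg_nonneg)

lemma aform_Cauchy: "\<bar>aform x F G\<bar> \<le> sqrt (aform x F F) * sqrt (aform x G G)"
proof (rule quadratic_nonneg_imp)
 fix r
 have "0 \<le> aform x (\<lambda>k. F k + r *\<^sub>R G k) (\<lambda>k. F k + r *\<^sub>R G k)" by (rule aform_nonneg)
 then show "0 \<le> r\<^sup>2 * aform x G G + 2 * r * aform x F G + (sqrt (aform x F F))\<^sup>2"
  by (simp add: aform_add_left aform_add_right aform_scaleR_left aform_scaleR_right
    aform_commute[of x G F] aform_nonneg power2_eq_square algebra_simps)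
qed (auto simp: aform_nonneg)

lemma \<Lambda>: "0 \<le> \<Lambda>"
 using a_bound[of undefined undefined undefined] by linarith

lemma aform_le: "aform x F F \<le> \<Lambda> * (\<Sum>k\<in>UNIV. norm (F k))\<^sup>2"
proof -
 have "a k l x * (F k \<bullet> F l) \<le> \<Lambda> * (norm (F k) * norm (F l))" for k l
 proof -
  have "a k l x * (F k \<bullet> F l) \<le> \<bar>a k l x\<bar> * \<bar>F k \<bullet> F l\<bar>" by (simp flip: abs_mult)
  also have "\<dots> \<le> \<Lambda> * (norm (F k) * norm (F l))"
   by (intro mult_mono a_bound Cauchy_Schwarz_ineq2) (auto simp: \<Lambda>)
  finally show ?thesis .
 qed
 then have "aform x F F \<le> (\<Sum>k\<in>UNIV. \<Sum>l\<in>UNIV. \<Lambda> * (norm (F k) * norm (F l)))"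
  unfolding aform_def by (intro sum_mono)
 also have "\<dots> = \<Lambda> * (\<Sum>k\<in>UNIV. \<Sum>l\<in>UNIV. norm (F k) * norm (F l))"
  by (simp only: sum_distrib_left)
 also have "\<dots> = \<Lambda> * (\<Sum>k\<in>UNIV. norm (F k))\<^sup>2"
  by (simp only: power2_eq_square sum_product)
 finally show ?thesis .
qed

lemma continuous_aform:
 assumes "\<And>k. cts (F k)" "\<And>k. cts (G k)"
 shows "cts (\<lambda>x. af F G x)"
 unfolding aform_def by (intro continuous_intros a_cont assms)

lemma integrable_aform:
 assumes "C1_fun f df" "C1_test S g dg"
 shows "lintegrable (\<lambda>x. af df dg x)"
proof -
 obtain K where K: "compact K" "\<And>x k. x \<notin> K ==> dg k x = 0" using C1_testE[OF assms(2)] by metis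
 show ?thesis
  by (rule integrable_compact_support[OF continuous_aform K(1)])
   (use assms K(2) in \<open>auto simp: C1_fun_def C1_test_def aform_def\<close>)
qed

text \<open>If \<open>y\<close> is the gradient of \<open>z\<close>, then \<open>2 * D k\<close> is
  the derivative of \<open>s\<close>, and the left-hand side is the energy density of the truncated
  family. After expansion the cross term and the square of the radial term combine to
  \<open>4 * g' * (g + s * g')\<close> times the quadratic form of \<open>D\<close>, which is
  nonpositive under the sign conditions.\<close>

lemma aform_radial:
 fixes z :: "'i => 'v::euclidean_space" and y :: "'i => 'n => 'v"
 assumes "finite I" and s: "s = (\<Sum>i\<in>I. (norm (z i))\<^sup>2)" and D: "\<And>k. D k = (\<Sum>i\<in>I. z i \<bullet> y i k)"
  and g: "0 \<le> g" "g \<le> 1" "g' \<le> 0" "0 \<le> g + s * g'"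
 shows "(\<Sum>i\<in>I. aform x (\<lambda>k. g *\<^sub>R y i k + (g' * (2 * D k)) *\<^sub>R z i) (\<lambda>k. g *\<^sub>R y i k + (g' * (2 * D k)) *\<^sub>R z i))
  \<le> (\<Sum>i\<in>I. aform x (y i) (y i))"
proof -
 define q where "q = (\<Sum>k\<in>UNIV. \<Sum>l\<in>UNIV. a k l x * (D k * D l))"
 have e1: "(\<Sum>i\<in>I. aform x (y i) (\<lambda>k. D k *\<^sub>R z i)) = q"
 proof -
  have "(\<Sum>i\<in>I. aform x (y i) (\<lambda>k. D k *\<^sub>R z i)) = (\<Sum>i\<in>I. \<Sum>k\<in>UNIV. \<Sum>l\<in>UNIV. a k l x * (D l * (z i \<bullet> y i k)))"
   unfolding aform_def by (simp add: inner_commute)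
  also have "\<dots> = (\<Sum>k\<in>UNIV. \<Sum>l\<in>UNIV. \<Sum>i\<in>I. a k l x * (D l * (z i \<bullet> y i k)))"
   by (subst sum.swap, intro sum.cong refl sum.swap)
  also have "\<dots> = (\<Sum>k\<in>UNIV. \<Sum>l\<in>UNIV. a k l x * (D l * D k))"
   by (simp only: D[of "_ :: 'n", symmetric] sum_distrib_left[symmetric])
  also have "\<dots> = q" unfolding q_def by (simp only: mult.commute)
  finally show ?thesis .
 qed
 have e2: "(\<Sum>i\<in>I. aform x (\<lambda>k. D k *\<^sub>R z i) (\<lambda>k. D k *\<^sub>R z i)) = s * q"
 proof -
  have "aform x (\<lambda>k. D k *\<^sub>R z i) (\<lambda>k. D k *\<^sub>R z i) = (norm (z i))\<^sup>2 * q" for i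
   unfolding aform_def q_def by (simp add: sum_distrib_left power2_norm_eq_inner ac_simps)
  then show ?thesis by (simp add: s sum_distrib_right)
 qed
 have "aform x (\<lambda>k. g *\<^sub>R y i k + (g' * (2 * D k)) *\<^sub>R z i) (\<lambda>k. g *\<^sub>R y i k + (g' * (2 * D k)) *\<^sub>R z i)
  = g\<^sup>2 * aform x (y i) (y i) + (4 * g * g') * aform x (y i) (\<lambda>k. D k *\<^sub>R z i)
   + (4 * g'\<^sup>2) * aform x (\<lambda>k. D k *\<^sub>R z i) (\<lambda>k. D k *\<^sub>R z i)" for i
 proof -
  have "(\<lambda>k. g *\<^sub>R y i k + (g' * (2 * D k)) *\<^sub>R z i) = (\<lambda>k. g *\<^sub>R y i k + (2 * g') *\<^sub>R (D k *\<^sub>R z i))" by (simp add: ac_simps)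
  then show ?thesis
   by (simp only: aform_add_left aform_add_right aform_scaleR_left aform_scaleR_right
     aform_commute[of x "\<lambda>k. D k *\<^sub>R z i" "y i"]) (simp add: power2_eq_square algebra_simps)
 qed
 then have "(\<Sum>i\<in>I. aform x (\<lambda>k. g *\<^sub>R y i k + (g' * (2 * D k)) *\<^sub>R z i) (\<lambda>k. g *\<^sub>R y i k + (g' * (2 * D k)) *\<^sub>R z i))
  = g\<^sup>2 * (\<Sum>i\<in>I. aform x (y i) (y i)) + (4 * g * g') * q + (4 * g'\<^sup>2) * (s * q)"
  by (simp add: sum.distrib e1 e2 flip: sum_distrib_left)
 also have "\<dots> = g\<^sup>2 * (\<Sum>i\<in>I. aform x (y i) (y i)) + 4 * g' * (g + s * g') * q"
  by (simp add: power2_eq_square algebra_simps)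
 also have "\<dots> \<le> 1 * (\<Sum>i\<in>I. aform x (y i) (y i)) + 0"
 proof (intro add_mono mult_right_mono)
  show "4 * g' * (g + s * g') * q \<le> 0"
   using g quad_nonneg[of x D] by (simp add: q_def mult_nonpos_nonneg)
 qed (use g in \<open>auto intro!: power_le_one sum_nonneg aform_nonneg\<close>)
 finally show ?thesis by simp
qed

text \<open>A minimiser need not exist among continuously differentiable families on an arbitrary
  \<open>S\<close>, but a family with energy within \<open>d^2\<close> of the infimum does.
  Truncating it radially does not increase the energy and bounds the whole family pointwise, a
  substitute for the maximum principle that does not depend on the size of \<open>I\<close>.\<close>

lemma near_minimiser:
 fixes Q :: "'i => real^'n => 'v::euclidean_space" and dQ :: "'i => 'n => real^'n => 'v"
 assumes I: "finite I" and Q: "\<And>i. i \<in> I ==> C1_test UNIV (Q i) (dQ i)"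
  and R: "0 < R" "\<And>x. x \<notin> S ==> (\<Sum>i\<in>I. (norm (Q i x))\<^sup>2) < R" and d: "0 < d"
 obtains z dz where "\<And>i. i \<in> I ==> C1_test UNIV (z i) (dz i)"
  "\<And>i. i \<in> I ==> C1_test S (\<lambda>x. z i x - Q i x) (\<lambda>k x. dz i k x - dQ i k x)"
  "\<And>x. (\<Sum>i\<in>I. (norm (z i x))\<^sup>2) \<le> 4 * R"
  "\<And>\<phi> d\<phi>. (\<And>i. i \<in> I ==> C1_test S (\<phi> i) (d\<phi> i)) ==>
    \<bar>\<Sum>i\<in>I. \<integral>x. af (dz i) (d\<phi> i) x\<bar>
     \<le> d * sqrt (\<Sum>i\<in>I. \<integral>x. af (d\<phi> i) (d\<phi> i) x)"
proof -
 \<comment> \<open>Admissible families take the values of \<open>Q\<close> off a compact part of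
   \<open>S\<close>; this replaces a boundary condition.\<close>
 define adm where "adm z dz \<longleftrightarrow> (\<forall>i\<in>I. C1_test UNIV (z i) (dz i) \<and>
   C1_test S (\<lambda>x. z i x - Q i x) (\<lambda>k x. dz i k x - dQ i k x))" for z :: "'i => real^'n => 'v" and dz
 define E where "E dz = (\<Sum>i\<in>I. \<integral>x. af (dz i) (dz i) x)"
  for dz :: "'i => 'n => real^'n => 'v"
 define X where "X = {E dz |z dz. adm z dz}"
 have Epos: "0 \<le> E dz" for dz unfolding E_def by (intro sum_nonneg integral_nonneg) (auto simp: aform_nonneg)
 have "adm Q dQ" unfolding adm_def using Q by (auto simp: C1_test_def C1_fun_def pderiv_on_def)
 then have Xne: "X \<noteq> {}" by (auto simp: X_def)
 have Xb: "bdd_below X" using Epos by (auto simp: X_def bdd_below_def)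
 obtain z0 dz0 where z0: "adm z0 dz0" "E dz0 < Inf X + d\<^sup>2"
  using cInf_lessD[OF Xne, of "Inf X + d\<^sup>2"] d by (auto simp: X_def)
 define s where "s x = (\<Sum>i\<in>I. (norm (z0 i x))\<^sup>2)" for x
 define D where "D k x = (\<Sum>i\<in>I. z0 i x \<bullet> dz0 i k x)" for k x
 define z where "z i x = radial_cut R (s x) *\<^sub>R z0 i x" for i x
 define dz where "dz i k x = radial_cut R (s x) *\<^sub>R dz0 i k x + (radial_cut' R (s x) * (2 * D k x)) *\<^sub>R z0 i x" for i k x
 have z0C: "C1_fun (z0 i) (dz0 i)" if "i \<in> I" for i using z0(1) that by (auto simp: adm_def C1_test_def)
 have sC: "cts s" unfolding s_def using z0C by (intro continuous_intros) (auto simp: C1_fun_def)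
 have DC: "cts (D k)" for k
  unfolding D_def[abs_def] using z0C by (intro continuous_intros) (auto simp: C1_fun_def)
 have sp: "pderiv_on s k (\<lambda>x. 2 * D k x)" for k
 proof -
  have "pderiv_on (\<lambda>x. \<Sum>i\<in>I. z0 i x \<bullet> z0 i x) k (\<lambda>x. \<Sum>i\<in>I. z0 i x \<bullet> dz0 i k x + dz0 i k x \<bullet> z0 i x)"
   using z0C by (intro pderiv_sum pderiv_inner) (auto simp: C1_fun_def)
  moreover have "(\<lambda>x. \<Sum>i\<in>I. z0 i x \<bullet> z0 i x) = s" by (simp add: s_def power2_norm_eq_inner fun_eq_iff)
  moreover have "(\<lambda>x. \<Sum>i\<in>I. z0 i x \<bullet> dz0 i k x + dz0 i k x \<bullet> z0 i x) = (\<lambda>x. 2 * D k x)"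
   by (simp add: D_def fun_eq_iff sum_distrib_left inner_commute)
  ultimately show ?thesis by simp
 qed
 have cut: "cts (\<lambda>x. radial_cut R (s x))" "cts (\<lambda>x. radial_cut' R (s x))"
  using continuous_on_compose2[OF continuous_radial_cut[OF R(1), of UNIV] sC]
   continuous_on_compose2[OF continuous_radial_cut'[OF R(1)] sC] by auto
 have zC: "C1_fun (z i) (dz i)" if "i \<in> I" for i
  unfolding C1_fun_def
 proof (intro conjI allI)
  show "cts (z i)" unfolding z_def[abs_def]
   using z0C[OF that] by (intro continuous_intros cut) (auto simp: C1_fun_def)
  show "cts (dz i k)" for k unfolding dz_def[abs_def]
   using z0C[OF that] by (intro continuous_intros cut DC) (auto simp: C1_fun_def)
  show "pderiv_on (z i) k (dz i k)" for k unfolding z_def[abs_def] dz_def[abs_def]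
   by (intro pderiv_scaleR pderiv_chain[OF sp] DERIV_radial_cut R) (use z0C[OF that] in \<open>auto simp: C1_fun_def\<close>)
 qed
 have zT: "C1_test UNIV (z i) (dz i)" if "i \<in> I" for i
 proof -
  have "C1_test UNIV (z0 i) (dz0 i)" using z0(1) that by (simp add: adm_def)
  then obtain K where K: "compact K" "\<And>x. x \<notin> K ==> z0 i x = 0"
   by (rule C1_testE) blast
  have "\<forall>x. x \<notin> K \<longrightarrow> z i x = 0" using K by (simp add: z_def)
  then show ?thesis using K(1) zC[OF that] by (auto simp: C1_test_def)
 qed
 have "\<forall>i\<in>I. \<exists>K. compact K \<and> K \<subseteq> S \<and> (\<forall>x. x \<notin> K \<longrightarrow> z0 i x - Q i x = 0)"
  using z0(1) by (auto simp: adm_def C1_test_def)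
 then obtain K where K: "\<And>i. i \<in> I ==> compact (K i)" "\<And>i. i \<in> I ==> K i \<subseteq> S"
   "\<And>i x. i \<in> I ==> x \<notin> K i ==> z0 i x = Q i x" by (auto simp: bchoice_iff)
 have "\<forall>i\<in>I. \<exists>K. compact K \<and> (\<forall>x. x \<notin> K \<longrightarrow> Q i x = 0)" using Q by (auto simp: C1_test_def)
 then obtain KQ where KQ: "\<And>i. i \<in> I ==> compact (KQ i)" "\<And>i x. i \<in> I ==> x \<notin> KQ i ==> Q i x = 0"
  by (auto simp: bchoice_iff)
 \<comment> \<open>Off \<open>L\<close> the datum has size below \<open>R\<close>, so wherever
   \<open>z0\<close> still equals \<open>Q\<close> the factor is 1 and truncation changes nothing.
   \<open>L\<close> is compact and, by the hypothesis on \<open>R\<close>, lies inside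
   \<open>S\<close>.\<close>
 define L where "L = {x. R \<le> (\<Sum>i\<in>I. (norm (Q i x))\<^sup>2)}"
 have "closed L" unfolding L_def
  using Q by (intro closed_Collect_le continuous_intros) (auto simp: C1_test_def C1_fun_def)
 moreover have "L \<subseteq> (\<Union>i\<in>I. KQ i)"
 proof
  fix x assume "x \<in> L"
  show "x \<in> (\<Union>i\<in>I. KQ i)"
  proof (rule ccontr)
   assume "x \<notin> (\<Union>i\<in>I. KQ i)"
   then have "(\<Sum>i\<in>I. (norm (Q i x))\<^sup>2) = 0" using KQ(2) by (intro sum.neutral) auto
   then show False using \<open>x \<in> L\<close> R(1) by (simp add: L_def)
  qed
 qed
 moreover have "compact (\<Union>i\<in>I. KQ i)" using I KQ(1) by (intro compact_UN) auto
 ultimately have Lc: "compact L" by (metis compact_Int_closed inf.absorb_iff2)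
 define K' where "K' = (\<Union>i\<in>I. K i) \<union> L"
 have K': "compact K'" "K' \<subseteq> S"
 proof -
  have "L \<subseteq> S" unfolding L_def using R(2) by (force simp: not_less[symmetric])
  then show "K' \<subseteq> S" using K(2) by (auto simp: K'_def)
  show "compact K'" unfolding K'_def using I K(1) Lc by (intro compact_Un compact_UN) auto
 qed
 have zQ: "C1_test S (\<lambda>x. z i x - Q i x) (\<lambda>k x. dz i k x - dQ i k x)" if "i \<in> I" for i
  unfolding C1_test_def
 proof (intro conjI exI[of _ K'] allI impI)
  show "C1_fun (\<lambda>x. z i x - Q i x) (\<lambda>k x. dz i k x - dQ i k x)"
   by (rule C1_fun_diff[OF zC[OF that] C1_test_fun[OF Q[OF that]]])
  fix x assume x: "x \<notin> K'"
  then have e: "z0 j x = Q j x" if "j \<in> I" for j using K(3) that by (auto simp: K'_def)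
  then have "s x = (\<Sum>i\<in>I. (norm (Q i x))\<^sup>2)" by (simp add: s_def)
  then have "s x < R" using x by (auto simp: K'_def L_def)
  then show "z i x - Q i x = 0" using e that by (simp add: z_def radial_cut_def)
 qed (use K' in auto)
 have int: "lintegrable (\<lambda>x. af dw dw' x)"
  if "C1_test S1 w dw" "C1_test S2 w' dw'" for w w' :: "real^'n => 'v" and dw dw' S1 S2
  using integrable_aform[of w dw S2 w' dw'] that by (auto simp: C1_test_def)
 have iz: "lintegrable (\<lambda>x. af (dz i) (dz i) x)" if "i \<in> I" for i
  by (rule int[OF zT[OF that] zT[OF that]])
 have z0T: "C1_test UNIV (z0 i) (dz0 i)" if "i \<in> I" for i using z0(1) that by (auto simp: adm_def)
 have iz0: "lintegrable (\<lambda>x. af (dz0 i) (dz0 i) x)" if "i \<in> I" for i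
  by (rule int[OF z0T[OF that] z0T[OF that]])
 have "E dz \<le> E dz0"
 proof -
  have "E dz = (\<integral>x. (\<Sum>i\<in>I. af (dz i) (dz i) x))"
   unfolding E_def using iz by (intro integral_sum[symmetric]) auto
  also have "\<dots> \<le> (\<integral>x. (\<Sum>i\<in>I. af (dz0 i) (dz0 i) x))"
  proof (rule integral_mono)
   show "(\<Sum>i\<in>I. af (dz i) (dz i) x) \<le> (\<Sum>i\<in>I. af (dz0 i) (dz0 i) x)" for x
    unfolding dz_def
    by (rule aform_radial[OF I, of "s x" "\<lambda>i. z0 i x" "\<lambda>k. D k x"])
     (use radial_cut_bounds[OF R(1), of "s x"] in \<open>auto simp: s_def D_def sum_nonneg\<close>)
  qed (use iz iz0 in \<open>auto intro!: integrable_sum\<close>)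
  also have "\<dots> = E dz0" unfolding E_def using iz0 by (intro integral_sum) auto
  finally show ?thesis .
 qed
 then have Ez: "E dz \<le> Inf X + d\<^sup>2" using z0(2) by simp
 show thesis
 proof (rule that[of z dz])
  show "(\<Sum>i\<in>I. (norm (z i x))\<^sup>2) \<le> 4 * R" for x
  proof -
   have "(\<Sum>i\<in>I. (norm (z i x))\<^sup>2) = s x * (radial_cut R (s x))\<^sup>2"
    by (simp add: z_def s_def power_mult_distrib sum_distrib_right mult.commute)
   then show ?thesis using radial_cut_bounds(5)[OF R(1), of "s x"] by (simp add: s_def sum_nonneg)
  qed
  fix \<phi> :: "'i => real^'n => 'v" and d\<phi> assume \<phi>: "\<And>i. i \<in> I ==> C1_test S (\<phi> i) (d\<phi> i)"
  define B where "B = (\<Sum>i\<in>I. \<integral>x. af (dz i) (d\<phi> i) x)"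
  show "\<bar>\<Sum>i\<in>I. \<integral>x. af (dz i) (d\<phi> i) x\<bar>
     \<le> d * sqrt (\<Sum>i\<in>I. \<integral>x. af (d\<phi> i) (d\<phi> i) x)"
   unfolding B_def[symmetric] E_def[symmetric]
  \<comment> \<open>Each variation \<open>z + r \<phi>\<close> is admissible, so its energy is at
    least \<open>Inf X\<close>, whereas that of \<open>z\<close> is at most
    \<open>Inf X + d^2\<close>; the difference is a quadratic polynomial in \<open>r\<close> that
    never falls below \<open>- d^2\<close>.\<close>
  proof (rule quadratic_nonneg_imp)
   fix r :: real
   have "adm (\<lambda>i x. z i x + r *\<^sub>R \<phi> i x) (\<lambda>i k x. dz i k x + r *\<^sub>R d\<phi> i k x)"
    unfolding adm_def
   proof
    fix i assume i: "i \<in> I"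
    obtain K1 where K1: "compact K1" "\<And>x. x \<notin> K1 ==> z i x = 0" by (rule C1_testE[OF zT[OF i]]) blast
    obtain K2 where K2: "compact K2" "K2 \<subseteq> S" "\<And>x. x \<notin> K2 ==> z i x - Q i x = 0" by (rule C1_testE[OF zQ[OF i]]) blast
    obtain K3 where K3: "compact K3" "K3 \<subseteq> S" "\<And>x. x \<notin> K3 ==> \<phi> i x = 0" by (rule C1_testE[OF \<phi>[OF i]]) blast
    have C: "C1_fun (\<lambda>x. z i x + r *\<^sub>R \<phi> i x) (\<lambda>k x. dz i k x + r *\<^sub>R d\<phi> i k x)"
     by (rule C1_fun_add[OF zC[OF i] C1_fun_bounded_linear[OF bounded_linear_scaleR_right C1_test_fun[OF \<phi>[OF i]]]])
    have C2: "C1_fun (\<lambda>x. z i x + r *\<^sub>R \<phi> i x - Q i x) (\<lambda>k x. dz i k x + r *\<^sub>R d\<phi> i k x - dQ i k x)"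
     by (rule C1_fun_diff[OF C C1_test_fun[OF Q[OF i]]])
    have "C1_test UNIV (\<lambda>x. z i x + r *\<^sub>R \<phi> i x) (\<lambda>k x. dz i k x + r *\<^sub>R d\<phi> i k x)"
     unfolding C1_test_def using C K1 K3 by (intro conjI exI[of _ "K1 \<union> K3"]) auto
    moreover have "C1_test S (\<lambda>x. z i x + r *\<^sub>R \<phi> i x - Q i x) (\<lambda>k x. dz i k x + r *\<^sub>R d\<phi> i k x - dQ i k x)"
     unfolding C1_test_def using C2 K2 K3 by (intro conjI exI[of _ "K2 \<union> K3"]) auto
    ultimately show "C1_test UNIV (\<lambda>x. z i x + r *\<^sub>R \<phi> i x) (\<lambda>k x. dz i k x + r *\<^sub>R d\<phi> i k x) \<and>
     C1_test S (\<lambda>x. z i x + r *\<^sub>R \<phi> i x - Q i x) (\<lambda>k x. dz i k x + r *\<^sub>R d\<phi> i k x - dQ i k x)" by simp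
   qed
   then have "Inf X \<le> E (\<lambda>i k x. dz i k x + r *\<^sub>R d\<phi> i k x)"
    by (intro cInf_lower Xb) (auto simp: X_def)
   also have "\<dots> = (\<Sum>i\<in>I. \<integral>x. (af (dz i) (dz i) x + (2 * r) * af (dz i) (d\<phi> i) x
     + r\<^sup>2 * af (d\<phi> i) (d\<phi> i) x))"
    unfolding E_def
    by (intro sum.cong refl integral_cong)
     (simp add: aform_add_left aform_add_right aform_scaleR_left aform_scaleR_right
      aform_commute[of _ "\<lambda>k. d\<phi> _ k _" "\<lambda>k. dz _ k _"] power2_eq_square algebra_simps)
   also have "\<dots> = (\<Sum>i\<in>I. (\<integral>x. af (dz i) (dz i) x)
     + (2 * r) * (\<integral>x. af (dz i) (d\<phi> i) x)
     + r\<^sup>2 * (\<integral>x. af (d\<phi> i) (d\<phi> i) x))"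
   proof (intro sum.cong refl)
    fix i assume i: "i \<in> I"
    note ii = int[OF zT[OF i] zT[OF i]] int[OF zT[OF i] \<phi>[OF i]] int[OF \<phi>[OF i] \<phi>[OF i]]
    show "(\<integral>x. (af (dz i) (dz i) x + (2 * r) * af (dz i) (d\<phi> i) x
     + r\<^sup>2 * af (d\<phi> i) (d\<phi> i) x)) = (\<integral>x. af (dz i) (dz i) x)
     + (2 * r) * (\<integral>x. af (dz i) (d\<phi> i) x)
     + r\<^sup>2 * (\<integral>x. af (d\<phi> i) (d\<phi> i) x)"
     using ii by simp
   qed
   also have "\<dots> = E dz + 2 * r * B + r\<^sup>2 * E d\<phi>"
    by (simp add: E_def B_def sum.distrib sum_distrib_left)
   finally show "0 \<le> r\<^sup>2 * E d\<phi> + 2 * r * B + d\<^sup>2" using Ez by simp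
  qed (use Epos d in auto)
 qed (use zT zQ in auto)
qed

end

section \<open>A uniform estimate for elliptic equations with complex parameters\<close>

text \<open>The weight \<open>e / 8\<close> is chosen so that two such terms use up only a quarter
  of a coercive term with factor \<open>e\<close>.\<close>

lemma inner_le_weighted:
 fixes v w :: "'v::real_inner"
 assumes "0 < e"
 shows "\<bar>v \<bullet> w\<bar> \<le> e / 8 * (norm w)\<^sup>2 + 2 / e * (norm v)\<^sup>2"
proof -
 have "\<bar>v \<bullet> w\<bar> \<le> norm v * norm w" by (rule Cauchy_Schwarz_ineq2)
 also have "\<dots> \<le> e / 8 * (norm w)\<^sup>2 + 2 / e * (norm v)\<^sup>2"
 proof -
  have "0 \<le> (e * norm w - 4 * norm v)\<^sup>2" by simp
  then have "8 * e * (norm v * norm w) \<le> e\<^sup>2 * (norm w)\<^sup>2 + 16 * (norm v)\<^sup>2"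
   by (simp add: power2_eq_square algebra_simps)
  then have "norm v * norm w \<le> (e\<^sup>2 * (norm w)\<^sup>2 + 16 * (norm v)\<^sup>2) / (8 * e)"
   using assms by (simp add: pos_le_divide_eq mult.commute)
  also have "\<dots> = e / 8 * (norm w)\<^sup>2 + 2 / e * (norm v)\<^sup>2"
   using assms by (simp add: add_divide_distrib power2_eq_square)
  finally show ?thesis .
 qed
 finally show ?thesis .
qed

lemma power2_norm_add3: "(norm (x + y + z :: 'v::real_normed_vector))\<^sup>2 \<le> 3 * ((norm x)\<^sup>2 + (norm y)\<^sup>2 + (norm z)\<^sup>2)"
proof -
 have "(norm (x + y + z))\<^sup>2 \<le> (norm x + norm y + norm z)\<^sup>2"
  by (intro power_mono norm_ge_zero order_trans[OF norm_triangle_ineq add_mono[OF norm_triangle_ineq]]) simp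
 moreover have "0 \<le> (norm x - norm y)\<^sup>2 + (norm y - norm z)\<^sup>2 + (norm x - norm z)\<^sup>2" by simp
 ultimately show ?thesis by (simp add: power2_eq_square algebra_simps)
qed

lemma integrable_indicator_compact:
 fixes c :: real
 assumes "compact (D :: 'a::euclidean_space set)"
 shows "lintegrable (\<lambda>x. c * indicator D x)" "(\<integral>x. c * indicator D x) = c * measure lborel D"
 using borel_integrable_compact[OF assms, of "\<lambda>_. c"] assms
 by (simp_all add: mult.commute borel_compact)

context elliptic_form
begin

text \<open>The real inner product of the two multiples also produces the antisymmetric part
  \<open>Im (F k * cnj (F l))\<close>; it drops out against the symmetric coefficients.\<close>

lemma aform_complex_mult:
 fixes F :: "'n => complex"
 shows "aform x (\<lambda>k. w * F k) (\<lambda>k. v * F k) = Re (w * cnj v) * aform x F F"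
proof -
 have 1: "(w * F k) \<bullet> (v * F l) = Re (w * cnj v) * (F k \<bullet> F l) - Im (w * cnj v) * Im (F k * cnj (F l))" for k l
  by (simp add: inner_complex_def algebra_simps)
 define S where "S = (\<Sum>k\<in>UNIV. \<Sum>l\<in>UNIV. a k l x * Im (F k * cnj (F l)))"
 have "S = (\<Sum>l\<in>UNIV. \<Sum>k\<in>UNIV. a k l x * Im (F k * cnj (F l)))" unfolding S_def by (rule sum.swap)
 also have "\<dots> = - S" unfolding S_def
  by (simp add: sum_negf[symmetric] a_sym[of _ _ x] algebra_simps)
 finally have "S = 0" by simp
 have "aform x (\<lambda>k. w * F k) (\<lambda>k. v * F k) = Re (w * cnj v) * aform x F F - Im (w * cnj v) * S"
  unfolding aform_def S_def 1 by (simp only: sum_distrib_left right_diff_distrib sum_subtractf mult.left_commute)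
 with \<open>S = 0\<close> show ?thesis by simp
qed

lemma aform_move:
 fixes F G :: "'n => complex"
 shows "aform x (\<lambda>k. w * F k) (\<lambda>k. v * G k) = aform x F (\<lambda>k. cnj w * v * G k)"
 unfolding aform_def by (intro sum.cong refl) (simp add: inner_complex_def algebra_simps)

text \<open>The functions to be estimated are \<open>w i = \<mu> i * u i + err i\<close>, for which
  a pointwise bound \<open>bd\<close> is given only off \<open>S\<close>. The cut-off main part
  \<open>Q i = \<eta> * \<mu> i * u i\<close> is compared with a near-minimiser \<open>z\<close>
  that has the same values off \<open>S\<close>, and the equation is tested with the difference,
  turned by \<open>\<zeta> i\<close> and cut off once more by \<open>\<eta>\<close>. All bounds are
  assumed for sums over \<open>I\<close>, so neither the size of \<open>I\<close> nor the size of
  the \<open>\<mu> i\<close> enters the result.\<close>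

lemma uniform_L2_estimate:
 fixes u :: "'i => real^'n => complex" and \<mu> \<zeta> :: "'i => complex" and \<eta> :: "real^'n => real"
 assumes I: "finite I"
  and u: "\<And>i. i \<in> I ==> C1_fun (u i) (du i)"
  and cont: "\<And>i. i \<in> I ==> cts (err i)" "\<And>i. i \<in> I ==> cts (l i)"
  and \<eta>: "C1_test D \<eta> d\<eta>" "\<And>x. \<bar>\<eta> x\<bar> \<le> 1" "\<And>x k. \<bar>d\<eta> k x\<bar> \<le> M"
  and D: "compact D" "S \<subseteq> D"
  and weak: "\<And>i \<phi> d\<phi>. i \<in> I ==> C1_test S \<phi> d\<phi> ==>
   (\<integral>x. (\<mu> i * u i x + err i x) \<bullet> \<phi> x + af (du i) d\<phi> x - l i x \<bullet> \<phi> x) = 0"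
  and \<zeta>: "\<And>i. i \<in> I ==> norm (\<zeta> i) = 1" "\<And>i. i \<in> I ==> c \<le> Re (\<zeta> i)"
   "\<And>i. i \<in> I ==> c / norm (\<mu> i) \<le> Re (\<zeta> i / \<mu> i)" "\<And>i. i \<in> I ==> 1 \<le> norm (\<mu> i)" and c: "0 < c"
  and M: "0 \<le> M" "\<And>x. x \<in> D ==> (\<Sum>i\<in>I. (norm (err i x))\<^sup>2) \<le> M" "\<And>x. x \<in> D ==> (\<Sum>i\<in>I. (norm (l i x))\<^sup>2) \<le> M"
   "\<And>x k. x \<in> D ==> (\<Sum>i\<in>I. (norm (du i k x))\<^sup>2) \<le> M" "\<And>x. x \<in> D ==> (\<Sum>i\<in>I. norm (\<mu> i) * (norm (u i x))\<^sup>2) \<le> M"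
  and bd: "\<And>x. x \<in> D ==> x \<notin> S ==> \<eta> x \<noteq> 0 ==> (\<Sum>i\<in>I. (norm (\<mu> i * u i x + err i x))\<^sup>2) \<le> M"
  and n: "n = real CARD('n)"
  and Cg: "Cg = 3 * (2 * M + n^4 * \<Lambda>\<^sup>2 * M^3)"
  and CC: "CC = 2 / c * (4 * (4 * M + 1)) + 2 / c * Cg + \<Lambda> * n\<^sup>2 * M^3 / c"
 shows "(\<Sum>i\<in>I. \<integral>x. (norm (\<eta> x *\<^sub>R (\<mu> i * u i x + err i x)))\<^sup>2)
  \<le> 3 * ((4 / (3 * c)) * (CC * measure lborel D + 1 / c) + (4 * (4 * M + 1) + M) * measure lborel D)"
proof -
 let ?w = "\<lambda>i x. \<mu> i * u i x + err i x"
 define Q where "Q i x = \<eta> x *\<^sub>R (\<mu> i * u i x)" for i x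
 define dQ where "dQ i k x = \<eta> x *\<^sub>R (\<mu> i * du i k x) + d\<eta> k x *\<^sub>R (\<mu> i * u i x)" for i k x
 obtain K\<eta> where K\<eta>: "compact K\<eta>" "K\<eta> \<subseteq> D" "\<And>x. x \<notin> K\<eta> ==> \<eta> x = 0" "\<And>x k. x \<notin> K\<eta> ==> d\<eta> k x = 0"
  by (rule C1_testE[OF \<eta>(1)]) blast
 have QT: "C1_test D (Q i) (dQ i)" if "i \<in> I" for i
 proof (rule C1_testI[OF _ K\<eta>(1,2)])
  show "C1_fun (Q i) (dQ i)"
   unfolding Q_def[abs_def] dQ_def[abs_def]
   by (rule C1_fun_scaleR[OF C1_test_fun[OF \<eta>(1)] C1_fun_bounded_linear[OF bounded_linear_mult_right u[OF that]]])
  show "Q i x = 0" if "x \<notin> K\<eta>" for x using K\<eta>(3)[OF that] by (simp add: Q_def)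
 qed
 have C1_mono: "C1_test D f df ==> C1_test UNIV f df" for f :: "real^'n => complex" and df
  by (auto simp: C1_test_def)
 \<comment> \<open>Off \<open>S\<close> the hypothesis \<open>bd\<close> bounds \<open>w\<close>,
   and \<open>Q\<close> differs from \<open>\<eta> * w\<close> by the controlled error. The
   additional 1 keeps the inequality strict and the level positive even if
   \<open>M = 0\<close>.\<close>
 have Qb: "(\<Sum>i\<in>I. (norm (Q i x))\<^sup>2) < 4 * M + 1" if x: "x \<notin> S" for x
 proof (cases "\<eta> x = 0")
  case True then show ?thesis using M by (simp add: Q_def)
 next
  case False
  then have xD: "x \<in> D" using K\<eta> by blast
  have "(norm (Q i x))\<^sup>2 \<le> 2 * (norm (?w i x))\<^sup>2 + 2 * (norm (err i x))\<^sup>2" for i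
  proof -
   have "norm (Q i x) \<le> 1 * norm (\<mu> i * u i x)" unfolding Q_def norm_scaleR using \<eta>(2) by (intro mult_right_mono) auto
   also have "\<dots> \<le> norm (?w i x) + norm (err i x)"
    using norm_triangle_ineq4[of "\<mu> i * u i x + err i x" "err i x"] by simp
   finally have "(norm (Q i x))\<^sup>2 \<le> (norm (?w i x) + norm (err i x))\<^sup>2" by (intro power_mono) auto
   moreover have "0 \<le> (norm (?w i x) - norm (err i x))\<^sup>2" by simp
   ultimately show ?thesis by (simp add: power2_eq_square algebra_simps)
  qed
  then have "(\<Sum>i\<in>I. (norm (Q i x))\<^sup>2) \<le> (\<Sum>i\<in>I. 2 * (norm (?w i x))\<^sup>2 + 2 * (norm (err i x))\<^sup>2)"
   by (intro sum_mono)
  also have "\<dots> = 2 * (\<Sum>i\<in>I. (norm (?w i x))\<^sup>2) + 2 * (\<Sum>i\<in>I. (norm (err i x))\<^sup>2)"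
   by (simp add: sum.distrib sum_distrib_left)
  also have "\<dots> < 4 * M + 1" using bd[OF xD x False] M(2)[OF xD] by linarith
  finally show ?thesis .
 qed
 obtain z dz where z: "\<And>i. i \<in> I ==> C1_test UNIV (z i) (dz i)"
  "\<And>i. i \<in> I ==> C1_test S (\<lambda>x. z i x - Q i x) (\<lambda>k x. dz i k x - dQ i k x)"
  "\<And>x. (\<Sum>i\<in>I. (norm (z i x))\<^sup>2) \<le> 4 * (4 * M + 1)"
  "\<And>\<phi> d\<phi>. (\<And>i. i \<in> I ==> C1_test S (\<phi> i) (d\<phi> i)) ==>
    \<bar>\<Sum>i\<in>I. \<integral>x. af (dz i) (d\<phi> i) x\<bar>
     \<le> 1 * sqrt (\<Sum>i\<in>I. \<integral>x. af (d\<phi> i) (d\<phi> i) x)"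
 proof (rule near_minimiser[OF I C1_mono[OF QT] _ Qb zero_less_one])
  show "0 < 4 * M + 1" using M by simp
 qed (assumption, assumption, blast)
 define r where "r i x = Q i x - z i x" for i x
 define dr where "dr i k x = dQ i k x - dz i k x" for i k x
 have rT: "C1_test S (r i) (dr i)" if "i \<in> I" for i
  using C1_test_bounded_linear[OF bounded_linear_minus[OF bounded_linear_ident] z(2)[OF that]]
  by (simp add: r_def[abs_def] dr_def[abs_def])
 have rD: "r i x = 0" "\<And>k. dr i k x = 0" if "i \<in> I" "x \<notin> D" for i x
  by (rule C1_testE[OF rT[OF that(1)]], use that(2) D(2) in blast)+
 have QD: "Q i x = 0" if "x \<notin> D" for i x using K\<eta>(2,3) that by (auto simp: Q_def)
 have zD: "z i x = 0" if "i \<in> I" "x \<notin> D" for i x using rD(1)[OF that] QD[OF that(2)] by (simp add: r_def)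
 define \<rho> where "\<rho> i x = cnj (\<zeta> i) * r i x" for i x
 define d\<rho> where "d\<rho> i k x = cnj (\<zeta> i) * dr i k x" for i k x
 have \<rho>T: "C1_test S (\<rho> i) (d\<rho> i)" if "i \<in> I" for i
  using C1_test_bounded_linear[OF bounded_linear_mult_right rT[OF that]] by (simp add: \<rho>_def[abs_def] d\<rho>_def[abs_def])
 \<comment> \<open>\<open>g\<close> gathers the lower-order terms, \<open>N\<close> is the only term
   that keeps the gradient of \<open>z\<close>, and \<open>P\<close> is the tested integrand after
   \<open>\<eta> du\<close> has been expressed through \<open>dr\<close> and
   \<open>dz\<close>.\<close>
 define g where "g i x = \<eta> x *\<^sub>R err i x - \<eta> x *\<^sub>R l i x + (\<Sum>k\<in>UNIV. \<Sum>m\<in>UNIV. (a k m x * d\<eta> m x) *\<^sub>R du i k x)" for i x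
 define N where "N i x = aform x (\<lambda>k. dz i k x) (\<lambda>k. cnj (\<zeta> i / \<mu> i) * dr i k x)" for i x
 define A where "A i x = af (dr i) (dr i) x" for i x
 let ?L = "\<lambda>i x. (3 * c / 4) * (norm (r i x))\<^sup>2 + (3 * c / 4) * (A i x / norm (\<mu> i))"
 define P where "P i x = Re (\<zeta> i) * (norm (r i x))\<^sup>2 + Re (\<zeta> i / \<mu> i) * A i x + z i x \<bullet> \<rho> i x + N i x + g i x \<bullet> \<rho> i x
   - aform x (\<lambda>k. d\<eta> k x *\<^sub>R u i x) (\<lambda>k. d\<rho> i k x)" for i x
 have \<mu>0: "\<mu> i \<noteq> 0" if "i \<in> I" for i using \<zeta>(4)[OF that] by auto
 have ident: "(?w i x) \<bullet> (\<eta> x *\<^sub>R \<rho> i x)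
   + aform x (\<lambda>k. du i k x) (\<lambda>k. \<eta> x *\<^sub>R d\<rho> i k x + d\<eta> k x *\<^sub>R \<rho> i x) - l i x \<bullet> (\<eta> x *\<^sub>R \<rho> i x) = P i x"
  if i: "i \<in> I" for i x
 proof -
  \<comment> \<open>The definition of \<open>dQ\<close> is solved for \<open>\<eta> du\<close>;
    dividing by \<open>\<mu>\<close> is what gives the gradient part its factor
    \<open>1 / \<mu>\<close>.\<close>
  have e1: "\<eta> x *\<^sub>R du i k x = inverse (\<mu> i) * dr i k x + inverse (\<mu> i) * dz i k x - d\<eta> k x *\<^sub>R u i x" for k
  proof -
   have im: "inverse (\<mu> i) * (\<mu> i * w) = w" for w using \<mu>0[OF i] by (simp add: mult.assoc[symmetric])
   have "inverse (\<mu> i) * dQ i k x = \<eta> x *\<^sub>R du i k x + d\<eta> k x *\<^sub>R u i x"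
    unfolding dQ_def distrib_left mult_scaleR_right im ..
   then show ?thesis by (simp add: dr_def right_diff_distrib)
  qed
  have "aform x (\<lambda>k. du i k x) (\<lambda>k. \<eta> x *\<^sub>R d\<rho> i k x + d\<eta> k x *\<^sub>R \<rho> i x)
   = aform x (\<lambda>k. \<eta> x *\<^sub>R du i k x) (\<lambda>k. d\<rho> i k x) + aform x (\<lambda>k. du i k x) (\<lambda>k. d\<eta> k x *\<^sub>R \<rho> i x)"
   by (simp add: aform_add_right aform_scaleR_right aform_scaleR_left)
  also have "aform x (\<lambda>k. \<eta> x *\<^sub>R du i k x) (\<lambda>k. d\<rho> i k x) =
    aform x (\<lambda>k. inverse (\<mu> i) * dr i k x) (\<lambda>k. cnj (\<zeta> i) * dr i k x) + aform x (\<lambda>k. inverse (\<mu> i) * dz i k x) (\<lambda>k. cnj (\<zeta> i) * dr i k x)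
    - aform x (\<lambda>k. d\<eta> k x *\<^sub>R u i x) (\<lambda>k. d\<rho> i k x)"
   unfolding e1 by (simp add: aform_add_left aform_diff_left d\<rho>_def)
  also have "aform x (\<lambda>k. inverse (\<mu> i) * dr i k x) (\<lambda>k. cnj (\<zeta> i) * dr i k x) = Re (\<zeta> i / \<mu> i) * A i x"
   unfolding aform_complex_mult A_def by (simp add: divide_inverse mult.commute)
  also have "aform x (\<lambda>k. inverse (\<mu> i) * dz i k x) (\<lambda>k. cnj (\<zeta> i) * dr i k x) = N i x"
   unfolding aform_move N_def by (simp add: divide_inverse mult.commute)
  also have "aform x (\<lambda>k. du i k x) (\<lambda>k. d\<eta> k x *\<^sub>R \<rho> i x) = (\<Sum>k\<in>UNIV. \<Sum>m\<in>UNIV. (a k m x * d\<eta> m x) *\<^sub>R du i k x) \<bullet> \<rho> i x"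
   by (simp add: aform_def inner_sum_left mult.assoc)
  finally have 1: "aform x (\<lambda>k. du i k x) (\<lambda>k. \<eta> x *\<^sub>R d\<rho> i k x + d\<eta> k x *\<^sub>R \<rho> i x) =
   Re (\<zeta> i / \<mu> i) * A i x + N i x - aform x (\<lambda>k. d\<eta> k x *\<^sub>R u i x) (\<lambda>k. d\<rho> i k x)
   + (\<Sum>k\<in>UNIV. \<Sum>m\<in>UNIV. (a k m x * d\<eta> m x) *\<^sub>R du i k x) \<bullet> \<rho> i x" by simp
  have 2: "r i x \<bullet> \<rho> i x = Re (\<zeta> i) * (norm (r i x))\<^sup>2"
   unfolding \<rho>_def cmod_power2 by (simp add: inner_complex_def power2_eq_square algebra_simps)
  have 3: "\<eta> x *\<^sub>R (\<mu> i * u i x) = r i x + z i x" by (simp add: r_def Q_def)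
  have "(?w i x) \<bullet> (\<eta> x *\<^sub>R \<rho> i x) = (\<eta> x *\<^sub>R (\<mu> i * u i x)) \<bullet> \<rho> i x + (\<eta> x *\<^sub>R err i x) \<bullet> \<rho> i x"
   by (simp add: inner_add_left algebra_simps)
  also have "\<dots> = Re (\<zeta> i) * (norm (r i x))\<^sup>2 + z i x \<bullet> \<rho> i x + (\<eta> x *\<^sub>R err i x) \<bullet> \<rho> i x"
   unfolding 3 inner_add_left 2 ..
  finally show ?thesis unfolding 1 P_def g_def by (simp add: inner_add_left inner_diff_left)
 qed
 have intP: "(\<integral>x. P i x) = 0" if i: "i \<in> I" for i
  using weak[OF i C1_test_scaleR[OF C1_test_fun[OF \<eta>(1)] \<rho>T[OF i]]] by (simp only: ident[OF i])
 have cK: "lintegrable h" if "cts h" "\<And>x. x \<notin> D ==> h x = 0" for h :: "real^'n => real"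
  by (rule integrable_compact_support[OF that(1) D(1) that(2)])
 have contr: "cts (r i)" "cts (dr i k)" "cts (\<rho> i)" "cts (d\<rho> i k)"
  "cts (z i)" "cts (dz i k)" "cts (u i)" "cts (du i k)" if "i \<in> I" for i k
  using rT[OF that] \<rho>T[OF that] z(1)[OF that] u[OF that] by (auto simp: C1_test_def C1_fun_def)
 have cont\<eta>: "cts \<eta>" "cts (d\<eta> k)" for k using \<eta>(1) by (auto simp: C1_test_def C1_fun_def)
 have iA: "lintegrable (A i)" and iN: "lintegrable (N i)" if "i \<in> I" for i
  unfolding A_def[abs_def] N_def[abs_def] using rD[OF that] contr[OF that]
  by (intro cK continuous_aform continuous_intros; simp add: aform_def)+
 have ir: "lintegrable (\<lambda>x. (norm (r i x))\<^sup>2)" if "i \<in> I" for i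
  using rD[OF that] contr[OF that] by (intro cK continuous_intros) auto
 have iz: "lintegrable (\<lambda>x. (norm (z i x))\<^sup>2)" if "i \<in> I" for i
  using zD[OF that] contr[OF that] by (intro cK continuous_intros) auto
 have cg: "cts (g i)" if "i \<in> I" for i unfolding g_def[abs_def]
  using contr[OF that] cont[OF that] by (intro continuous_intros cont\<eta> a_cont)
 have iP: "lintegrable (P i)" if "i \<in> I" for i
 proof -
  have "lintegrable (\<lambda>x. z i x \<bullet> \<rho> i x)" "lintegrable (\<lambda>x. g i x \<bullet> \<rho> i x)"
   using contr[OF that] cg[OF that] rD[OF that] by (intro cK continuous_intros; simp add: \<rho>_def)+
  moreover have "lintegrable (\<lambda>x. aform x (\<lambda>k. d\<eta> k x *\<^sub>R u i x) (\<lambda>k. d\<rho> i k x))"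
   using contr[OF that] rD[OF that] by (intro cK continuous_aform continuous_intros cont\<eta>; simp add: d\<rho>_def aform_def)
  ultimately show ?thesis
   unfolding P_def[abs_def] using ir[OF that] iA[OF that] iN[OF that]
   by (intro integrable_add integrable_diff integrable_mult_right)
 qed
 define H where "H x = CC * indicator D x" for x :: "real^'n"
 have point: "(\<Sum>i\<in>I. P i x) \<ge> (\<Sum>i\<in>I. ?L i x + N i x) - H x" for x
 proof (cases "x \<in> D")
  case False
  have e: "P i x = 0 \<and> r i x = 0 \<and> A i x = 0 \<and> N i x = 0" if "i \<in> I" for i
   using rD[OF that False] by (simp add: P_def \<rho>_def d\<rho>_def A_def N_def aform_def)
  then have "(\<Sum>i\<in>I. P i x) = 0" "(\<Sum>i\<in>I. ?L i x + N i x) = 0"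
   by (auto intro!: sum.neutral)
  then show ?thesis using False by (simp add: H_def)
 next
  case True
  have Pi: "P i x \<ge> ?L i x + N i x
    - (2 / c * (norm (z i x))\<^sup>2 + 2 / c * (norm (g i x))\<^sup>2 + (\<Lambda> * n\<^sup>2 * M\<^sup>2 / c) * (norm (\<mu> i) * (norm (u i x))\<^sup>2))" if i: "i \<in> I" for i
  proof -
   have n\<rho>: "norm (\<rho> i x) = norm (r i x)" using \<zeta>(1)[OF i] by (simp add: \<rho>_def norm_mult)
   have A0: "0 \<le> A i x" by (simp add: A_def aform_nonneg)
   have m0: "0 < norm (\<mu> i)" using \<mu>0[OF i] by simp
   have t1: "c * (norm (r i x))\<^sup>2 \<le> Re (\<zeta> i) * (norm (r i x))\<^sup>2" using \<zeta>(2)[OF i] by (intro mult_right_mono) auto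
   have t2: "c / norm (\<mu> i) * A i x \<le> Re (\<zeta> i / \<mu> i) * A i x" by (rule mult_right_mono[OF \<zeta>(3)[OF i] A0])
   have t3: "\<bar>z i x \<bullet> \<rho> i x\<bar> \<le> c / 8 * (norm (r i x))\<^sup>2 + 2 / c * (norm (z i x))\<^sup>2"
    using inner_le_weighted[OF c, of "z i x" "\<rho> i x"] n\<rho> by simp
   have t4: "\<bar>g i x \<bullet> \<rho> i x\<bar> \<le> c / 8 * (norm (r i x))\<^sup>2 + 2 / c * (norm (g i x))\<^sup>2"
    using inner_le_weighted[OF c, of "g i x" "\<rho> i x"] n\<rho> by simp
   \<comment> \<open>The gradient term at hand is only \<open>A / |\<mu>|\<close>, so Young's
     inequality must be weighted with \<open>|\<mu>|\<close>; this is why a bound on the sum of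
     \<open>|\<mu>| |u|^2\<close>, not of \<open>|u|^2\<close>, is assumed.\<close>
   have t5: "\<bar>aform x (\<lambda>k. d\<eta> k x *\<^sub>R u i x) (\<lambda>k. d\<rho> i k x)\<bar>
     \<le> c / 4 * (A i x / norm (\<mu> i)) + (\<Lambda> * n\<^sup>2 * M\<^sup>2 / c) * (norm (\<mu> i) * (norm (u i x))\<^sup>2)"
   proof -
    define U where "U = aform x (\<lambda>k. d\<eta> k x *\<^sub>R u i x) (\<lambda>k. d\<eta> k x *\<^sub>R u i x)"
    have "af (d\<rho> i) (d\<rho> i) x = A i x"
     unfolding d\<rho>_def aform_complex_mult A_def using \<zeta>(1)[OF i]
     by (simp add: complex_norm_square[symmetric] mult.commute[of "cnj _"] flip: of_real_power)
    then have "\<bar>aform x (\<lambda>k. d\<eta> k x *\<^sub>R u i x) (\<lambda>k. d\<rho> i k x)\<bar> \<le> sqrt U * sqrt (A i x)"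
     using aform_Cauchy[of x "\<lambda>k. d\<eta> k x *\<^sub>R u i x" "\<lambda>k. d\<rho> i k x"] by (simp add: U_def)
    also have "\<dots> \<le> c / 4 * (A i x / norm (\<mu> i)) + norm (\<mu> i) / c * U"
    proof -
     define m where "m = norm (\<mu> i)"
     have U0: "0 \<le> U" by (simp add: U_def aform_nonneg)
     have "0 \<le> (c * sqrt (A i x) - 2 * m * sqrt U)\<^sup>2" by simp
     then have "4 * c * m * (sqrt U * sqrt (A i x)) \<le> c\<^sup>2 * A i x + 4 * m\<^sup>2 * U"
      using U0 A0 by (simp add: power2_diff power_mult_distrib algebra_simps)
     then have "sqrt U * sqrt (A i x) \<le> (c\<^sup>2 * A i x + 4 * m\<^sup>2 * U) / (4 * c * m)"
      using c m0 by (simp add: pos_le_divide_eq mult.commute m_def)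
     also have "\<dots> = c / 4 * (A i x / m) + m / c * U"
      using c m0 by (simp add: add_divide_distrib power2_eq_square m_def)
     finally show ?thesis by (simp add: m_def)
    qed
    also have "\<dots> \<le> c / 4 * (A i x / norm (\<mu> i)) + norm (\<mu> i) / c * (\<Lambda> * (n * M * norm (u i x))\<^sup>2)"
    proof -
     have "(\<Sum>k\<in>UNIV. norm (d\<eta> k x *\<^sub>R u i x)) \<le> (\<Sum>k\<in>(UNIV::'n set). M * norm (u i x))"
      by (intro sum_mono) (use \<eta>(3) in \<open>auto intro: mult_right_mono\<close>)
     then have "(\<Sum>k\<in>UNIV. norm (d\<eta> k x *\<^sub>R u i x))\<^sup>2 \<le> (n * M * norm (u i x))\<^sup>2"
      by (intro power_mono) (auto simp: n intro: sum_nonneg)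
     then have "U \<le> \<Lambda> * (n * M * norm (u i x))\<^sup>2"
      unfolding U_def by (intro order_trans[OF aform_le] mult_left_mono \<Lambda>)
     then show ?thesis using c by (intro add_left_mono mult_left_mono) auto
    qed
    finally show ?thesis by (simp add: power_mult_distrib ac_simps)
   qed
   have "c / norm (\<mu> i) * A i x = c * (A i x / norm (\<mu> i))" by simp
   with t1 t2 t3 t4 t5 show ?thesis unfolding P_def
    by (simp add: abs_le_iff algebra_simps)
  qed
  have gs: "(\<Sum>i\<in>I. (norm (g i x))\<^sup>2) \<le> Cg"
  proof -
   have gi: "(norm (g i x))\<^sup>2 \<le> 3 * ((norm (err i x))\<^sup>2 + (norm (l i x))\<^sup>2 + n^3 * \<Lambda>\<^sup>2 * M\<^sup>2 * (\<Sum>k\<in>UNIV. (norm (du i k x))\<^sup>2))" for i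
   proof -
    define s where "s = (\<Sum>k\<in>UNIV. \<Sum>m\<in>UNIV. (a k m x * d\<eta> m x) *\<^sub>R du i k x)"
    have "norm s \<le> (\<Sum>k\<in>UNIV. \<Sum>m\<in>(UNIV::'n set). \<Lambda> * M * norm (du i k x))" unfolding s_def
    proof (intro order_trans[OF norm_sum] sum_mono)
     fix k m
     have "\<bar>a k m x * d\<eta> m x\<bar> \<le> \<Lambda> * M" unfolding abs_mult by (intro mult_mono a_bound \<eta>(3) \<Lambda>) auto
     then show "norm ((a k m x * d\<eta> m x) *\<^sub>R du i k x) \<le> \<Lambda> * M * norm (du i k x)" by (simp add: mult_right_mono)
    qed
    also have "\<dots> = n * \<Lambda> * M * (\<Sum>k\<in>UNIV. norm (du i k x))" by (simp add: n sum_distrib_left mult.assoc)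
    finally have "(norm s)\<^sup>2 \<le> (n * \<Lambda> * M * (\<Sum>k\<in>UNIV. norm (du i k x)))\<^sup>2" by (intro power_mono) auto
    also have "\<dots> = n\<^sup>2 * \<Lambda>\<^sup>2 * M\<^sup>2 * (\<Sum>k\<in>UNIV. norm (du i k x))\<^sup>2" by (simp add: power_mult_distrib)
    also have "\<dots> \<le> n\<^sup>2 * \<Lambda>\<^sup>2 * M\<^sup>2 * (n * (\<Sum>k\<in>UNIV. (norm (du i k x))\<^sup>2))"
     using sum_squared_le_sum_of_squares[where I = "UNIV::'n set" and f = "\<lambda>k. norm (du i k x)"] by (intro mult_left_mono) (auto simp: n mult.commute)
    finally have s2: "(norm s)\<^sup>2 \<le> n^3 * \<Lambda>\<^sup>2 * M\<^sup>2 * (\<Sum>k\<in>UNIV. (norm (du i k x))\<^sup>2)"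
     by (simp add: power2_eq_square power3_eq_cube ac_simps)
    have sc: "(norm (\<eta> x *\<^sub>R v))\<^sup>2 \<le> (norm v)\<^sup>2" for v :: complex
     using \<eta>(2)[of x] by (intro power_mono) (auto intro: mult_left_le_one_le)
    have "(norm (g i x))\<^sup>2 \<le> 3 * ((norm (\<eta> x *\<^sub>R err i x))\<^sup>2 + (norm (- (\<eta> x *\<^sub>R l i x)))\<^sup>2 + (norm s)\<^sup>2)"
     using power2_norm_add3[of "\<eta> x *\<^sub>R err i x" "- (\<eta> x *\<^sub>R l i x)" s] by (simp add: g_def s_def)
    then show ?thesis using s2 sc[of "err i x"] sc[of "l i x"] unfolding norm_minus_cancel by argo
   qed
   have "(\<Sum>i\<in>I. (norm (g i x))\<^sup>2) \<le> (\<Sum>i\<in>I. 3 * ((norm (err i x))\<^sup>2 + (norm (l i x))\<^sup>2 + n^3 * \<Lambda>\<^sup>2 * M\<^sup>2 * (\<Sum>k\<in>UNIV. (norm (du i k x))\<^sup>2)))"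
    by (intro sum_mono gi)
   also have "\<dots> = 3 * ((\<Sum>i\<in>I. (norm (err i x))\<^sup>2) + (\<Sum>i\<in>I. (norm (l i x))\<^sup>2) + n^3 * \<Lambda>\<^sup>2 * M\<^sup>2 * (\<Sum>k\<in>UNIV. \<Sum>i\<in>I. (norm (du i k x))\<^sup>2))"
   proof -
    have sw: "(\<Sum>k\<in>UNIV. \<Sum>i\<in>I. (norm (du i k x))\<^sup>2) = (\<Sum>i\<in>I. \<Sum>k\<in>UNIV. (norm (du i k x))\<^sup>2)"
     by (rule sum.swap)
    show ?thesis unfolding sw by (simp only: sum.distrib sum_distrib_left distrib_left)
   qed
   also have "\<dots> \<le> 3 * (M + M + n^3 * \<Lambda>\<^sup>2 * M\<^sup>2 * (\<Sum>k\<in>(UNIV::'n set). M))"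
    using M(2,3,4)[OF True] by (intro mult_left_mono add_mono sum_mono) (auto simp: n)
   also have "\<dots> = Cg" by (simp add: Cg n power2_eq_square power3_eq_cube power4_eq_xxxx algebra_simps)
   finally show ?thesis .
  qed
  have "(\<Sum>i\<in>I. 2 / c * (norm (z i x))\<^sup>2 + 2 / c * (norm (g i x))\<^sup>2 + (\<Lambda> * n\<^sup>2 * M\<^sup>2 / c) * (norm (\<mu> i) * (norm (u i x))\<^sup>2))
   = 2 / c * (\<Sum>i\<in>I. (norm (z i x))\<^sup>2) + 2 / c * (\<Sum>i\<in>I. (norm (g i x))\<^sup>2) + (\<Lambda> * n\<^sup>2 * M\<^sup>2 / c) * (\<Sum>i\<in>I. norm (\<mu> i) * (norm (u i x))\<^sup>2)"
   by (simp only: sum.distrib sum_distrib_left)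
  also have "\<dots> \<le> 2 / c * (4 * (4 * M + 1)) + 2 / c * Cg + (\<Lambda> * n\<^sup>2 * M\<^sup>2 / c) * M"
   using c \<Lambda> z(3)[of x] gs M(5)[OF True] by (intro add_mono mult_left_mono) auto
  also have "\<dots> = H x" using True by (simp add: H_def CC power2_eq_square power3_eq_cube)
  finally have "(\<Sum>i\<in>I. ?L i x + N i x) - H x
   \<le> (\<Sum>i\<in>I. ?L i x + N i x) - (\<Sum>i\<in>I. 2 / c * (norm (z i x))\<^sup>2 + 2 / c * (norm (g i x))\<^sup>2 + (\<Lambda> * n\<^sup>2 * M\<^sup>2 / c) * (norm (\<mu> i) * (norm (u i x))\<^sup>2))"
   by simp
  also have "\<dots> \<le> (\<Sum>i\<in>I. P i x)" unfolding sum_subtractf[symmetric] by (intro sum_mono Pi)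
  finally show ?thesis .
 qed
 define X where "X = (\<Sum>i\<in>I. \<integral>x. (norm (r i x))\<^sup>2)"
 define Y where "Y = (\<Sum>i\<in>I. (\<integral>x. A i x) / norm (\<mu> i))"
 define V where "V = measure lborel D"
 have iH: "lintegrable H" "(\<integral>x. H x) = CC * V"
  unfolding H_def[abs_def] V_def using integrable_indicator_compact[OF D(1), of CC] by auto
 have Epos: "0 \<le> (\<integral>x. A i x)" for i by (intro integral_nonneg) (simp add: A_def aform_nonneg)
 have Y0: "0 \<le> Y" unfolding Y_def by (intro sum_nonneg divide_nonneg_nonneg Epos) auto
 have "(\<integral>x. (\<Sum>i\<in>I. ?L i x + N i x) - H x) \<le> (\<integral>x. (\<Sum>i\<in>I. P i x))"
  by (rule integral_mono)
   (use point iH iP ir iA iN in \<open>auto intro!: integrable_sum integrable_diff integrable_add\<close>)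
 also have "(\<integral>x. (\<Sum>i\<in>I. P i x)) = 0" using iP intP by (simp add: integral_sum)
 also have "(\<integral>x. (\<Sum>i\<in>I. ?L i x + N i x) - H x)
   = (3 * c / 4) * X + (3 * c / 4) * Y + (\<Sum>i\<in>I. \<integral>x. N i x) - CC * V"
 proof -
  have "(\<integral>x. (\<Sum>i\<in>I. ?L i x + N i x) - H x)
   = (\<Sum>i\<in>I. \<integral>x. ?L i x + N i x) - (\<integral>x. H x)"
   using iH ir iA iN by (subst integral_diff) (auto intro!: integral_sum)
  also have "(\<Sum>i\<in>I. \<integral>x. ?L i x + N i x)
   = (\<Sum>i\<in>I. (3 * c / 4) * (\<integral>x. (norm (r i x))\<^sup>2) + (3 * c / 4) * ((\<integral>x. A i x) / norm (\<mu> i)) + (\<integral>x. N i x))"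
   using ir iA iN by (intro sum.cong refl) simp
  finally show ?thesis by (simp add: iH(2) X_def Y_def sum.distrib sum_distrib_left)
 qed
 finally have main: "(3 * c / 4) * X + (3 * c / 4) * Y + (\<Sum>i\<in>I. \<integral>x. N i x) - CC * V \<le> 0" .
 \<comment> \<open>The family \<open>cnj (\<zeta> / \<mu>) * r\<close> has energy
   \<open>A / |\<mu>|^2\<close>, at most \<open>A / |\<mu>|\<close> since
   \<open>|\<mu>| \<ge> 1\<close>. Near-minimality therefore bounds all gradient terms of
   \<open>z\<close> together by \<open>sqrt Y\<close>, which \<open>Y\<close> absorbs.\<close>
 have Nb: "\<bar>\<Sum>i\<in>I. \<integral>x. N i x\<bar> \<le> sqrt Y"
 proof -
  have T: "C1_test S (\<lambda>x. cnj (\<zeta> i / \<mu> i) * r i x) (\<lambda>k x. cnj (\<zeta> i / \<mu> i) * dr i k x)" if "i \<in> I" for i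
   using C1_test_bounded_linear[OF bounded_linear_mult_right rT[OF that]] by blast
  have e: "aform x (\<lambda>k. cnj (\<zeta> i / \<mu> i) * dr i k x) (\<lambda>k. cnj (\<zeta> i / \<mu> i) * dr i k x) = A i x / (norm (\<mu> i))\<^sup>2" if "i \<in> I" for i x
  proof -
   have "Re (cnj (\<zeta> i / \<mu> i) * cnj (cnj (\<zeta> i / \<mu> i))) = (norm (\<zeta> i / \<mu> i))\<^sup>2"
    by (simp only: complex_cnj_cnj mult.commute[of "cnj _"] complex_norm_square[symmetric] Re_complex_of_real)
   then show ?thesis unfolding aform_complex_mult A_def using \<zeta>(1)[OF that] by (simp add: norm_divide power_divide)
  qed
  have "\<bar>\<Sum>i\<in>I. \<integral>x. N i x\<bar> \<le> 1 * sqrt (\<Sum>i\<in>I. \<integral>x. aform x (\<lambda>k. cnj (\<zeta> i / \<mu> i) * dr i k x) (\<lambda>k. cnj (\<zeta> i / \<mu> i) * dr i k x))"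
   unfolding N_def by (rule z(4)[OF T])
  also have "\<dots> \<le> sqrt Y" unfolding Y_def mult_1
  proof (intro real_sqrt_le_mono sum_mono)
   fix i assume i: "i \<in> I"
   have "norm (\<mu> i) \<le> (norm (\<mu> i))\<^sup>2" using \<zeta>(4)[OF i] by (rule self_le_power) simp
   then show "(\<integral>x. aform x (\<lambda>k. cnj (\<zeta> i / \<mu> i) * dr i k x) (\<lambda>k. cnj (\<zeta> i / \<mu> i) * dr i k x)) \<le> (\<integral>x. A i x) / norm (\<mu> i)"
    unfolding e[OF i] using Epos[of i] \<mu>0[OF i] by (simp add: divide_left_mono)
  qed
  finally show ?thesis .
 qed
 have "sqrt Y \<le> c / 4 * Y + 1 / c"
 proof -
  have "0 \<le> (c * sqrt Y - 2)\<^sup>2" by simp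
  then have "4 * c * sqrt Y \<le> c\<^sup>2 * Y + 4" using Y0 by (simp add: power2_diff power_mult_distrib)
  then have "sqrt Y \<le> (c\<^sup>2 * Y + 4) / (4 * c)" using c by (simp add: pos_le_divide_eq mult.commute)
  also have "\<dots> = c / 4 * Y + 1 / c" using c by (simp add: add_divide_distrib power2_eq_square)
  finally show ?thesis .
 qed
 moreover have "c / 4 * Y \<le> (3 * c / 4) * Y" using c Y0 by (intro mult_right_mono) auto
 ultimately have "(3 * c / 4) * X \<le> CC * V + 1 / c" using main Nb by linarith
 then have X: "X \<le> (4 / (3 * c)) * (CC * V + 1 / c)" using c by (simp add: field_simps)
 have fin: "(\<integral>x. (norm (\<eta> x *\<^sub>R (?w i x)))\<^sup>2)
  \<le> (\<integral>x. 3 * ((norm (r i x))\<^sup>2 + (norm (z i x))\<^sup>2 + (norm (\<eta> x *\<^sub>R err i x))\<^sup>2))"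
  and ierr: "lintegrable (\<lambda>x. (norm (\<eta> x *\<^sub>R err i x))\<^sup>2)" if i: "i \<in> I" for i
 proof -
  have \<eta>D: "\<eta> x = 0" if "x \<notin> D" for x using K\<eta>(2,3) that by blast
  show ierr: "lintegrable (\<lambda>x. (norm (\<eta> x *\<^sub>R err i x))\<^sup>2)"
   using cont[OF i] \<eta>D by (intro cK continuous_intros cont\<eta>) auto
  show "(\<integral>x. (norm (\<eta> x *\<^sub>R (?w i x)))\<^sup>2)
   \<le> (\<integral>x. 3 * ((norm (r i x))\<^sup>2 + (norm (z i x))\<^sup>2 + (norm (\<eta> x *\<^sub>R err i x))\<^sup>2))"
  proof (rule integral_mono)
   show "lintegrable (\<lambda>x. (norm (\<eta> x *\<^sub>R (?w i x)))\<^sup>2)"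
    using cont[OF i] contr[OF i] \<eta>D by (intro cK continuous_intros cont\<eta>) auto
   show "lintegrable (\<lambda>x. 3 * ((norm (r i x))\<^sup>2 + (norm (z i x))\<^sup>2 + (norm (\<eta> x *\<^sub>R err i x))\<^sup>2))"
    using ir[OF i] iz[OF i] ierr by auto
   fix x
   have "\<eta> x *\<^sub>R (?w i x) = r i x + z i x + \<eta> x *\<^sub>R err i x" by (simp add: r_def Q_def scaleR_add_right)
   then show "(norm (\<eta> x *\<^sub>R (?w i x)))\<^sup>2 \<le> 3 * ((norm (r i x))\<^sup>2 + (norm (z i x))\<^sup>2 + (norm (\<eta> x *\<^sub>R err i x))\<^sup>2)"
    using power2_norm_add3[of "r i x" "z i x" "\<eta> x *\<^sub>R err i x"] by simp
  qed
 qed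
 have zs: "(\<Sum>i\<in>I. \<integral>x. (norm (z i x))\<^sup>2) \<le> 4 * (4 * M + 1) * V"
 proof -
  have "(\<Sum>i\<in>I. \<integral>x. (norm (z i x))\<^sup>2) = (\<integral>x. (\<Sum>i\<in>I. (norm (z i x))\<^sup>2))"
   using iz by (intro integral_sum[symmetric]) auto
  also have "\<dots> \<le> (\<integral>x. 4 * (4 * M + 1) * indicator D x)"
  proof (rule integral_mono)
   show "(\<Sum>i\<in>I. (norm (z i x))\<^sup>2) \<le> 4 * (4 * M + 1) * indicator D x" for x
    using z(3)[of x] zD by (cases "x \<in> D") auto
  qed (use iz integrable_indicator_compact[OF D(1), of "4 * (4 * M + 1)"] in \<open>auto intro!: integrable_sum\<close>)
  finally show ?thesis using integrable_indicator_compact[OF D(1), of "4 * (4 * M + 1)"] by (simp add: V_def)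
 qed
 have es: "(\<Sum>i\<in>I. \<integral>x. (norm (\<eta> x *\<^sub>R err i x))\<^sup>2) \<le> M * V"
 proof -
  have "(\<Sum>i\<in>I. \<integral>x. (norm (\<eta> x *\<^sub>R err i x))\<^sup>2) = (\<integral>x. (\<Sum>i\<in>I. (norm (\<eta> x *\<^sub>R err i x))\<^sup>2))"
   using ierr by (intro integral_sum[symmetric]) auto
  also have "\<dots> \<le> (\<integral>x. M * indicator D x)"
  proof (rule integral_mono)
   fix x
   have sc: "(norm (\<eta> x *\<^sub>R v))\<^sup>2 \<le> (norm v)\<^sup>2" for v :: complex
    using \<eta>(2)[of x] by (intro power_mono) (auto intro: mult_left_le_one_le)
   show "(\<Sum>i\<in>I. (norm (\<eta> x *\<^sub>R err i x))\<^sup>2) \<le> M * indicator D x"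
   proof (cases "x \<in> D")
    case True
    have "(\<Sum>i\<in>I. (norm (\<eta> x *\<^sub>R err i x))\<^sup>2) \<le> (\<Sum>i\<in>I. (norm (err i x))\<^sup>2)" by (intro sum_mono sc)
    then show ?thesis using M(2)[OF True] True by simp
   next
    case False
    then have "x \<notin> K\<eta>" using K\<eta>(2) by blast
    then show ?thesis using K\<eta>(3) False by simp
   qed
  qed (use ierr integrable_indicator_compact[OF D(1), of M] in \<open>auto intro!: integrable_sum\<close>)
  finally show ?thesis using integrable_indicator_compact[OF D(1), of M] by (simp add: V_def)
 qed
 have "(\<Sum>i\<in>I. \<integral>x. (norm (\<eta> x *\<^sub>R (?w i x)))\<^sup>2)
  \<le> (\<Sum>i\<in>I. \<integral>x. 3 * ((norm (r i x))\<^sup>2 + (norm (z i x))\<^sup>2 + (norm (\<eta> x *\<^sub>R err i x))\<^sup>2))"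
  by (intro sum_mono fin)
 also have "\<dots> = 3 * (X + (\<Sum>i\<in>I. \<integral>x. (norm (z i x))\<^sup>2) + (\<Sum>i\<in>I. \<integral>x. (norm (\<eta> x *\<^sub>R err i x))\<^sup>2))"
  using ir iz ierr by (simp add: X_def sum.distrib sum_distrib_left)
 also have "\<dots> \<le> 3 * ((4 / (3 * c)) * (CC * V + 1 / c) + (4 * (4 * M + 1) + M) * V)"
  using X zs es by (intro mult_left_mono) (auto simp: distrib_right)
 finally show ?thesis by (simp add: V_def)
qed

end

lemma has_vector_derivative_exp_affine:
 fixes c d :: complex
 shows "((\<lambda>w. exp (c + of_real w * d)) has_vector_derivative (d * exp (c + of_real w * d))) (at w)"
 by (rule has_vector_derivative_real_field) (auto intro!: derivative_eq_intros)

section \<open>The kernel of fractional integration\<close>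

text \<open>The kernel of order \<open>2 - \<alpha>\<close>. Its value 0 for
  \<open>s \<le> 0\<close> turns the integral over \<open>[0, t]\<close> into a convolution on the
  whole line.\<close>

definition frac_ker :: "real => real => real" where
 "frac_ker \<alpha> s = (if 0 < s then s powr (1 - \<alpha>) / Gamma (2 - \<alpha>) else 0)"

lemma frac_ker_measurable [measurable]: "frac_ker \<alpha> \<in> borel_measurable borel"
 unfolding frac_ker_def by measurable

context
 fixes \<alpha> :: real
 assumes \<alpha>: "1 < \<alpha>" "\<alpha> < 2"
begin

lemma Gamma_pos: "0 < Gamma (2 - \<alpha>)"
 using \<alpha> by (intro Gamma_real_pos) auto

lemma frac_ker_nonneg: "0 \<le> frac_ker \<alpha> s"
 using Gamma_pos by (simp add: frac_ker_def)

lemma frac_ker_antimono: "0 < s ==> s \<le> t ==> frac_ker \<alpha> t \<le> frac_ker \<alpha> s"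
 using Gamma_pos \<alpha> by (auto simp: frac_ker_def intro!: divide_right_mono powr_mono2')

text \<open>The case \<open>p = 1\<close> is the Gamma integral; replacing \<open>s\<close> by
  \<open>p * s\<close> gives the power.\<close>

lemma frac_ker_laplace_real:
 assumes "0 < p"
 shows "has_bochner_integral lborel (\<lambda>s. frac_ker \<alpha> s * exp (- p * s)) (p powr (\<alpha> - 2))"
proof -
 define g where "g t = frac_ker \<alpha> t * exp (- t)" for t
 have gm: "g \<in> borel_measurable lborel" unfolding g_def by measurable
 have g0: "0 \<le> g t" for t by (simp add: g_def frac_ker_nonneg)
 have "(\<integral>\<^sup>+t. ennreal (Gamma (2 - \<alpha>)) * ennreal (g t) \<partial>lborel) = (\<integral>\<^sup>+t. ennreal (indicator {0..} t * t powr (2 - \<alpha> - 1) / exp t) \<partial>lborel)"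
 proof (rule nn_integral_cong_AE)
  show "AE t in lborel. ennreal (Gamma (2 - \<alpha>)) * ennreal (g t) = ennreal (indicator {0..} t * t powr (2 - \<alpha> - 1) / exp t)"
   using AE_lborel_singleton[of 0]
  proof eventually_elim
   case (elim t)
   then show ?case using Gamma_pos
    by (auto simp: g_def frac_ker_def indicator_def exp_minus field_simps simp flip: ennreal_mult')
  qed
 qed
 also have "\<dots> = ennreal (Gamma (2 - \<alpha>))"
  by (rule Gamma_conv_nn_integral_real[symmetric]) (use \<alpha> in auto)
 finally have "ennreal (Gamma (2 - \<alpha>)) * (\<integral>\<^sup>+t. ennreal (g t) \<partial>lborel) = ennreal (Gamma (2 - \<alpha>)) * 1"
  using gm by (simp add: nn_integral_cmult)
 then have "(\<integral>\<^sup>+t. ennreal (g t) \<partial>lborel) = ennreal 1"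
  using Gamma_pos by (subst (asm) ennreal_mult_cancel_left) auto
 then have "has_bochner_integral lborel g 1"
  using gm g0 by (intro has_bochner_integral_nn_integral) auto
 then have "has_bochner_integral lborel (\<lambda>s. g (0 + p * s)) (1 /\<^sub>R \<bar>p\<bar>)"
  using lborel_has_bochner_integral_real_affine_iff[of p g 1 0] assms by simp
 then have "has_bochner_integral lborel (\<lambda>s. p powr (\<alpha> - 1) * g (p * s)) (p powr (\<alpha> - 1) * (1 / p))"
  using assms by (intro has_bochner_integral_mult_right) (auto simp: field_simps)
 moreover have "p powr (\<alpha> - 1) * g (p * s) = frac_ker \<alpha> s * exp (- p * s)" for s
 proof (cases "0 < s")
  case True
  then have "p powr (\<alpha> - 1) * (p * s) powr (1 - \<alpha>) = s powr (1 - \<alpha>)"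
   using assms by (simp add: powr_mult powr_add[symmetric] mult.assoc[symmetric])
  then show ?thesis using True assms by (simp add: g_def frac_ker_def mult.assoc[symmetric])
 next
  case False
  then have "\<not> 0 < p * s" using assms by (simp add: zero_less_mult_iff)
  then show ?thesis using False by (simp add: g_def frac_ker_def)
 qed
 moreover have "p powr (\<alpha> - 1) * (1 / p) = p powr (\<alpha> - 2)"
  using assms powr_diff[of p "\<alpha> - 1" 1] by simp
 ultimately show ?thesis by simp
qed

lemma frac_ker_integrable_Icc: "lintegrable (\<lambda>s. frac_ker \<alpha> s * indicator {..M} s)"
proof (rule integrable_bound)
 show "lintegrable (\<lambda>s. exp \<bar>M\<bar> * (frac_ker \<alpha> s * exp (- 1 * s)))"
  using frac_ker_laplace_real[of 1] by (auto simp: has_bochner_integral_iff)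
 show "AE s in lborel. norm (frac_ker \<alpha> s * indicator {..M} s) \<le> norm (exp \<bar>M\<bar> * (frac_ker \<alpha> s * exp (- 1 * s)))"
 proof (rule AE_I2)
  fix s :: real
  have "1 \<le> exp \<bar>M\<bar> * exp (- 1 * s)" if "s \<le> M" using that by (simp flip: exp_add)
  then have "s \<le> M ==> frac_ker \<alpha> s * 1 \<le> frac_ker \<alpha> s * (exp \<bar>M\<bar> * exp (- 1 * s))"
   by (intro mult_left_mono frac_ker_nonneg)
  then show "norm (frac_ker \<alpha> s * indicator {..M} s) \<le> norm (exp \<bar>M\<bar> * (frac_ker \<alpha> s * exp (- 1 * s)))"
   using frac_ker_nonneg[of s] by (auto simp: indicator_def abs_mult ac_simps)
 qed
qed measurable

text \<open>On the vertical line of real part \<open>l\<close> the transform \<open>h w\<close>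
  satisfies, by integration by parts, a first-order linear differential equation in
  \<open>w\<close>. Hence \<open>h w * Complex l w powr (2 - \<alpha>)\<close> is constant, and the
  real case fixes the constant at \<open>w = 0\<close>.\<close>

lemma frac_ker_laplace:
 assumes l: "0 < l"
 shows "lintegrable (\<lambda>s. frac_ker \<alpha> s *\<^sub>R exp (- (Complex l w * of_real s)))"
  "(\<integral>s. frac_ker \<alpha> s *\<^sub>R exp (- (Complex l w * of_real s))) = Complex l w powr (of_real (\<alpha> - 2))"
proof -
 define e where "e w s = exp (- (Complex l w * of_real s))" for w s
 have ne: "norm (e w s) = exp (- l * s)" for w s by (simp add: e_def)
 have "e w \<in> borel_measurable borel" for w
  unfolding e_def by (intro borel_measurable_continuous_onI continuous_intros)
 then have em [measurable]: "e w \<in> borel_measurable lborel" for w by simp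
 have rint: "lintegrable (\<lambda>s. frac_ker \<alpha> s * exp (- r * s))" if "0 < r" for r
  using frac_ker_laplace_real[OF that] by (simp add: has_bochner_integral_iff)
 have int: "lintegrable (\<lambda>s. frac_ker \<alpha> s *\<^sub>R e w s)" for w
  by (rule integrable_bound[OF rint[OF l]])
   (auto simp: ne frac_ker_nonneg abs_mult)
 then show "lintegrable (\<lambda>s. frac_ker \<alpha> s *\<^sub>R exp (- (Complex l w * of_real s)))" by (simp add: e_def)
 \<comment> \<open>One factor \<open>s\<close> costs half of the exponential decay:
   \<open>s \<le> (2 / l) * exp (l / 2 * s)\<close>.\<close>
 have sint: "lintegrable (\<lambda>s. s * frac_ker \<alpha> s * exp (- l * s))"
 proof (rule integrable_bound)
  show "lintegrable (\<lambda>s. (2 / l) * (frac_ker \<alpha> s * exp (- (l / 2) * s)))" using rint[of "l / 2"] l by simp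
  show "AE s in lborel. norm (s * frac_ker \<alpha> s * exp (- l * s)) \<le> norm ((2 / l) * (frac_ker \<alpha> s * exp (- (l / 2) * s)))"
  proof (rule AE_I2)
   fix s :: real
   show "norm (s * frac_ker \<alpha> s * exp (- l * s)) \<le> norm ((2 / l) * (frac_ker \<alpha> s * exp (- (l / 2) * s)))"
   proof (cases "0 < s")
    case True
    have "l * s / 2 \<le> exp (l / 2 * s)" using exp_ge_add_one_self[of "l / 2 * s"] by linarith
    then have "s * exp (- l * s) \<le> (2 / l) * (exp (l / 2 * s) * exp (- l * s))"
     using l by (simp add: field_simps)
    also have "exp (l / 2 * s) * exp (- l * s) = exp (- (l / 2) * s)" by (simp flip: exp_add)
    finally have "frac_ker \<alpha> s * (s * exp (- l * s)) \<le> frac_ker \<alpha> s * ((2 / l) * exp (- (l / 2) * s))"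
     by (rule mult_left_mono[OF _ frac_ker_nonneg])
    then show ?thesis using True l frac_ker_nonneg[of s] by (simp add: abs_mult ac_simps)
   qed (simp add: frac_ker_def)
  qed
 qed measurable
 define h where "h w = (\<integral>s. frac_ker \<alpha> s *\<^sub>R e w s)" for w
 have dh: "(h has_vector_derivative (\<integral>s. (frac_ker \<alpha> s * s) *\<^sub>R (- \<i> * e w s))) (at w)"
  and ids: "lintegrable (\<lambda>s. (frac_ker \<alpha> s * s) *\<^sub>R (- \<i> * e w s))" for w
 proof -
  have d1: "((\<lambda>w. frac_ker \<alpha> s *\<^sub>R e w s) has_vector_derivative (frac_ker \<alpha> s * s) *\<^sub>R (- \<i> * e r s)) (at r)" for r s
  proof -
   have "((\<lambda>w. e w s) has_vector_derivative (s *\<^sub>R (- \<i> * e r s))) (at r)"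
    using has_vector_derivative_exp_affine[of "- (of_real l * of_real s)" "- \<i> * of_real s" r]
    by (simp add: e_def Complex_eq algebra_simps scaleR_conv_of_real)
   then show ?thesis
    using bounded_linear.has_vector_derivative[OF bounded_linear_scaleR_right, of "\<lambda>w. e w s" "s *\<^sub>R (- \<i> * e r s)" "at r" "frac_ker \<alpha> s"] by simp
  qed
  have b1: "norm ((frac_ker \<alpha> s * s) *\<^sub>R (- \<i> * e r s)) \<le> s * frac_ker \<alpha> s * exp (- l * s)" for r s
  proof (cases "0 < s")
   case True then show ?thesis by (simp add: norm_mult ne abs_mult frac_ker_nonneg)
  qed (simp add: frac_ker_def)
  note hvd = has_vector_derivative_integral[where r = 1 and g = "\<lambda>s. s * frac_ker \<alpha> s * exp (- l * s)" and x = w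
   and f = "\<lambda>w s. frac_ker \<alpha> s *\<^sub>R e w s" and f' = "\<lambda>w s. (frac_ker \<alpha> s * s) *\<^sub>R (- \<i> * e w s)" and M = lborel,
   OF zero_less_one int d1 b1 sint]
  have "((\<lambda>w. \<integral>s. frac_ker \<alpha> s *\<^sub>R e w s) has_vector_derivative (\<integral>s. (frac_ker \<alpha> s * s) *\<^sub>R (- \<i> * e w s))) (at w)
   \<and> lintegrable (\<lambda>s. (frac_ker \<alpha> s * s) *\<^sub>R (- \<i> * e w s))"
   using hvd by blast
  then show "(h has_vector_derivative (\<integral>s. (frac_ker \<alpha> s * s) *\<^sub>R (- \<i> * e w s))) (at w)"
   "lintegrable (\<lambda>s. (frac_ker \<alpha> s * s) *\<^sub>R (- \<i> * e w s))" by (auto simp: h_def[abs_def])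
 qed
 have isk: "lintegrable (\<lambda>s. (frac_ker \<alpha> s * s) *\<^sub>R e w s)" for w
  using integrable_mult_right[OF ids[of w], of \<i>] by (simp add: mult.assoc[symmetric])
 \<comment> \<open>The primitive is \<open>s powr (2 - \<alpha>) / Gamma (2 - \<alpha>)\<close>
   times the exponential; it vanishes at 0 because \<open>\<alpha> < 2\<close> and at infinity
   because \<open>l > 0\<close>.\<close>
 have ibp: "Complex l w * (\<integral>s. (frac_ker \<alpha> s * s) *\<^sub>R e w s) = of_real (2 - \<alpha>) * h w" for w
 proof -
  have lim0: "((\<lambda>s. s powr c / G * exp (- m * s)) \<longlongrightarrow> 0) (at_right 0)" if "0 < c" "0 < G" "0 < m" for c G m :: real
   using that by real_asymp
  have lim1: "((\<lambda>s. s powr c / G * exp (- m * s)) \<longlongrightarrow> 0) at_top" if "0 < c" "0 < G" "0 < m" for c G m :: real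
   using that by real_asymp
  define F where "F s = (s powr (2 - \<alpha>) / Gamma (2 - \<alpha>)) *\<^sub>R e w s" for s
  define f where "f s = of_real (2 - \<alpha>) * (frac_ker \<alpha> s *\<^sub>R e w s) - Complex l w * ((frac_ker \<alpha> s * s) *\<^sub>R e w s)" for s
  have fint: "lintegrable f"
   unfolding f_def using int isk by (intro integrable_diff integrable_mult_right)
  have de: "(e w has_vector_derivative (- Complex l w * e w s)) (at s)" for s
   using has_vector_derivative_exp_affine[of 0 "- Complex l w" s] by (simp add: e_def[abs_def] mult.commute)
  have "(LBINT s=0..\<infinity>. f s) = 0 - 0"
  proof (rule interval_integral_FTC_integrable[where F = F])
   fix s assume "0 < ereal s" "ereal s < \<infinity>"
   then have s: "0 < s" by simp
   have "((\<lambda>s. s powr (2 - \<alpha>) / Gamma (2 - \<alpha>)) has_real_derivative (2 - \<alpha>) * frac_ker \<alpha> s) (at s)"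
    using DERIV_cdivide[OF has_real_derivative_powr[OF s, of "2 - \<alpha>"], of "Gamma (2 - \<alpha>)"] s by (simp add: frac_ker_def)
   from has_vector_derivative_scaleR[OF this de[of s]]
   have "(F has_vector_derivative (s powr (2 - \<alpha>) / Gamma (2 - \<alpha>)) *\<^sub>R (- Complex l w * e w s) + ((2 - \<alpha>) * frac_ker \<alpha> s) *\<^sub>R e w s) (at s)"
    by (simp add: F_def[abs_def])
   moreover have "s powr (2 - \<alpha>) / Gamma (2 - \<alpha>) = frac_ker \<alpha> s * s"
    using s powr_add[of s "1 - \<alpha>" 1] by (simp add: frac_ker_def)
   ultimately show "(F has_vector_derivative f s) (at s)"
    unfolding f_def by (simp add: scaleR_conv_of_real algebra_simps)
   have "isCont (\<lambda>s. of_real (2 - \<alpha>) * ((s powr (1 - \<alpha>) / Gamma (2 - \<alpha>)) *\<^sub>R e w s) - Complex l w * ((s powr (1 - \<alpha>) / Gamma (2 - \<alpha>) * s) *\<^sub>R e w s)) s"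
    unfolding e_def using s Gamma_pos by (intro continuous_intros) auto
   moreover have "\<forall>\<^sub>F s in nhds s. f s = of_real (2 - \<alpha>) * ((s powr (1 - \<alpha>) / Gamma (2 - \<alpha>)) *\<^sub>R e w s) - Complex l w * ((s powr (1 - \<alpha>) / Gamma (2 - \<alpha>) * s) *\<^sub>R e w s)"
    unfolding eventually_nhds by (intro exI[of _ "{0<..}"]) (use s in \<open>auto simp: f_def frac_ker_def\<close>)
   ultimately show "isCont f s" by (simp only: isCont_cong)
  next
   show "set_integrable lborel (einterval 0 \<infinity>) f"
    unfolding set_integrable_def using fint by (intro integrable_mult_indicator) auto
   have nF: "norm (F s) \<le> (s powr (2 - \<alpha>) / Gamma (2 - \<alpha>)) * exp (- l * s)" for s
    using Gamma_pos by (simp add: F_def ne)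
   have "((\<lambda>s. (s powr (2 - \<alpha>) / Gamma (2 - \<alpha>)) * exp (- l * s)) \<longlongrightarrow> 0) (at_right 0)"
    using lim0[of "2 - \<alpha>" "Gamma (2 - \<alpha>)" l] \<alpha> l Gamma_pos by simp
   then have "(F \<longlongrightarrow> 0) (at_right 0)" by (rule Lim_null_comparison[rotated]) (use nF in auto)
   then show "((F \<circ> real_of_ereal) \<longlongrightarrow> 0) (at_right 0)"
    by (simp add: ereal_tendsto_simps zero_ereal_def)
   have "((\<lambda>s. (s powr (2 - \<alpha>) / Gamma (2 - \<alpha>)) * exp (- l * s)) \<longlongrightarrow> 0) at_top"
    using lim1[of "2 - \<alpha>" "Gamma (2 - \<alpha>)" l] \<alpha> l Gamma_pos by simp
   then have "(F \<longlongrightarrow> 0) at_top" by (rule Lim_null_comparison[rotated]) (use nF in auto)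
   then show "((F \<circ> real_of_ereal) \<longlongrightarrow> 0) (at_left \<infinity>)" by (simp add: ereal_tendsto_simps)
  qed simp
  moreover have "(LBINT s=0..\<infinity>. f s) = (\<integral>s. f s)"
  proof -
   have "(LBINT s=0..\<infinity>. f s) = (LBINT s:{0<..}. f s)"
    using interval_integral_to_infinity_eq[of lborel 0 f] by (simp add: zero_ereal_def)
   also have "\<dots> = (\<integral>s. f s)" unfolding set_lebesgue_integral_def
    by (intro integral_cong) (auto simp: indicator_def f_def frac_ker_def)
   finally show ?thesis .
  qed
  ultimately have "(\<integral>s. f s) = 0" by simp
  moreover have "(\<integral>s. f s) = of_real (2 - \<alpha>) * h w - Complex l w * (\<integral>s. (frac_ker \<alpha> s * s) *\<^sub>R e w s)"
   unfolding f_def h_def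
   by (subst integral_diff[OF integrable_mult_right[OF int] integrable_mult_right[OF isk]])
    (simp only: integral_mult_right_zero)
  ultimately show ?thesis by simp
 qed
 define G where "G w = h w * (Complex l w powr of_real (2 - \<alpha>))" for w
 have "(G has_vector_derivative 0) (at w)" for w
 proof -
  have p0: "Complex l w \<noteq> 0" "Complex l w \<notin> \<real>\<^sub>\<le>\<^sub>0" using l by (auto simp: complex_nonpos_Reals_iff complex_eq_iff)
  have h': "(\<integral>s. (frac_ker \<alpha> s * s) *\<^sub>R (- \<i> * e w s)) = - \<i> * (of_real (2 - \<alpha>) * h w / Complex l w)"
  proof -
   have "(\<integral>s. (frac_ker \<alpha> s * s) *\<^sub>R (- \<i> * e w s)) = (\<integral>s. - \<i> * ((frac_ker \<alpha> s * s) *\<^sub>R e w s))"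
    by (intro integral_cong) auto
   also have "\<dots> = - \<i> * (\<integral>s. (frac_ker \<alpha> s * s) *\<^sub>R e w s)" by (rule integral_mult_right_zero)
   also have "(\<integral>s. (frac_ker \<alpha> s * s) *\<^sub>R e w s) = of_real (2 - \<alpha>) * h w / Complex l w"
    using ibp[of w] p0(1) by (simp add: field_simps)
   finally show ?thesis .
  qed
  have "((\<lambda>z. z powr of_real (2 - \<alpha>)) has_field_derivative of_real (2 - \<alpha>) * Complex l w powr (of_real (2 - \<alpha>) - 1)) (at (Complex l w))"
   by (rule has_field_derivative_powr[OF p0(2)])
  moreover have "((\<lambda>w. Complex l w) has_vector_derivative \<i>) (at w)"
   unfolding Complex_eq by (auto intro!: derivative_eq_intros simp: has_vector_derivative_def has_derivative_of_real scaleR_conv_of_real fun_eq_iff)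
  ultimately have "((\<lambda>z. z powr of_real (2 - \<alpha>)) \<circ> (\<lambda>w. Complex l w) has_vector_derivative \<i> * (of_real (2 - \<alpha>) * Complex l w powr (of_real (2 - \<alpha>) - 1))) (at w)"
   by (intro field_vector_diff_chain_at)
  from has_vector_derivative_mult[OF dh[of w] this]
  have "(G has_vector_derivative h w * (\<i> * (of_real (2 - \<alpha>) * Complex l w powr (of_real (2 - \<alpha>) - 1)))
    + (- \<i> * (of_real (2 - \<alpha>) * h w / Complex l w)) * Complex l w powr of_real (2 - \<alpha>)) (at w)"
   unfolding h' by (simp add: G_def[abs_def] comp_def)
  moreover have "Complex l w powr (of_real (2 - \<alpha>) - 1) = Complex l w powr of_real (2 - \<alpha>) / Complex l w"
   by (subst powr_diff) (use p0(1) in \<open>simp del: of_real_diff\<close>)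
  ultimately show ?thesis by simp
 qed
 then have "G w = G 0" using has_vector_derivative_zero_constant[of UNIV G] by (metis UNIV_I convex_UNIV has_vector_derivative_at_within)
 also have "G 0 = 1"
 proof -
  have e0: "- (Complex l 0 * of_real s) = of_real (- l * s)" for s by (simp add: complex_eq_iff)
  have "h 0 = (\<integral>s. of_real (frac_ker \<alpha> s * exp (- l * s)))"
   unfolding h_def e_def by (simp only: e0 exp_of_real scaleR_conv_of_real) (simp only: of_real_mult)
  also have "\<dots> = of_real (l powr (\<alpha> - 2))"
   using frac_ker_laplace_real[OF l] by (simp only: integral_complex_of_real has_bochner_integral_iff)
  finally have "h 0 = of_real (l powr (\<alpha> - 2))" .
  moreover have "Complex l 0 powr of_real (2 - \<alpha>) = of_real (l powr (2 - \<alpha>))"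
   unfolding complex_of_real_def[symmetric] by (rule powr_of_real) (use l in simp)
  moreover have "l powr (\<alpha> - 2) * l powr (2 - \<alpha>) = 1" using l by (simp add: powr_add[symmetric])
  ultimately show ?thesis unfolding G_def by (metis of_real_1 of_real_mult)
 qed
 finally have "h w * Complex l w powr of_real (2 - \<alpha>) = 1" by (simp add: G_def)
 moreover have "Complex l w powr of_real (2 - \<alpha>) * Complex l w powr of_real (\<alpha> - 2) = 1"
  using l by (simp add: powr_add[symmetric] complex_eq_iff)
 ultimately have "h w = Complex l w powr of_real (\<alpha> - 2)"
  by (metis mult.assoc mult.commute mult_1)
 then show "(\<integral>s. frac_ker \<alpha> s *\<^sub>R exp (- (Complex l w * of_real s))) = Complex l w powr (of_real (\<alpha> - 2))"
  by (simp add: h_def e_def)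
qed

end

section \<open>Fourier coefficients\<close>

text \<open>The imaginary parts \<open>pi j / T\<close> are those of the cosine system on
  \<open>[0, T]\<close>, which has period \<open>2 T\<close>; the real part 1 supplies the damping
  \<open>exp (- t)\<close> of the half-line Bessel inequality.\<close>

definition freq :: "real => nat => complex" where "freq T j = Complex 1 (pi * j / T)"

text \<open>Cosine polynomials, generated so that closure under sums is built in; the product
  formula makes them an algebra, as the theorem of Stone and Weierstrass requires.\<close>

inductive cos_poly :: "real => (real => real) => bool" for T where
 base: "cos_poly T (\<lambda>t. r * cos (pi * real j * t / T))"
| add: "cos_poly T f ==> cos_poly T g ==> cos_poly T (\<lambda>t. f t + g t)"

text \<open>The product-to-sum formula; \<open>max j k - min j k\<close> is \<open>|j - k|\<close>
  as a natural number.\<close>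

lemma cos_poly_mult_base:
 assumes "cos_poly T f" shows "cos_poly T (\<lambda>t. r * cos (pi * real j * t / T) * f t)"
 using assms
proof induction
 case (base r' k)
 have "r * cos (pi * real j * t / T) * (r' * cos (pi * real k * t / T)) =
  (r * r' / 2) * cos (pi * real (max j k - min j k) * t / T) + (r * r' / 2) * cos (pi * real (j + k) * t / T)" for t
 proof -
  have c1: "cos (pi * real (max j k - min j k) * t / T) = cos (pi * real j * t / T - pi * real k * t / T)"
  proof (cases "j \<le> k")
   case True
   then have "pi * real (max j k - min j k) * t / T = - (pi * real j * t / T - pi * real k * t / T)"
    by (simp add: of_nat_diff algebra_simps diff_divide_distrib)
   then show ?thesis by (metis cos_minus)
  qed (simp add: of_nat_diff algebra_simps diff_divide_distrib)
  have c2: "cos (pi * real (j + k) * t / T) = cos (pi * real j * t / T + pi * real k * t / T)"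
   by (simp add: algebra_simps add_divide_distrib)
  show ?thesis unfolding c1 c2 cos_diff cos_add by (simp only: distrib_left right_diff_distrib) simp
 qed
 then show ?case by (simp only:) (intro cos_poly.intros)
next
 case (add f g)
 then show ?case using cos_poly.add by (simp add: distrib_left)
qed

lemma cos_poly_mult: "cos_poly T g ==> cos_poly T f ==> cos_poly T (\<lambda>t. g t * f t)"
proof (induction rule: cos_poly.induct)
 case (base r j) then show ?case by (rule cos_poly_mult_base)
next
 case (add g h) then show ?case using cos_poly.add by (simp add: distrib_right)
qed

lemma cos_poly_sum:
 assumes "cos_poly T f" obtains N a where "\<And>t. f t = (\<Sum>j\<le>(N::nat). a j * cos (pi * real j * t / T))"
proof -
 have "\<exists>N a. \<forall>t. f t = (\<Sum>j\<le>(N::nat). a j * cos (pi * real j * t / T))" using assms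
 proof induction
  case (base r k)
  have "r * cos (pi * real k * t / T) = (\<Sum>j\<le>k. (if j = k then r else 0) * cos (pi * real j * t / T))" for t
   by (simp add: if_distrib[of "\<lambda>x. x * _"] cong: if_cong)
  then show ?case by (intro exI[of _ k] exI[of _ "\<lambda>j. if j = k then r else 0"]) simp
 next
  case (add f g)
  then obtain N a M b where NM: "\<forall>t. f t = (\<Sum>j\<le>(N::nat). a j * cos (pi * real j * t / T))"
    "\<forall>t. g t = (\<Sum>j\<le>(M::nat). b j * cos (pi * real j * t / T))" by blast
  then have N: "\<And>t. f t = (\<Sum>j\<le>(N::nat). a j * cos (pi * real j * t / T))"
   and M: "\<And>t. g t = (\<Sum>j\<le>(M::nat). b j * cos (pi * real j * t / T))" by auto
  have ext: "(\<Sum>j\<le>n. d j * cos (pi * real j * t / T)) = (\<Sum>j\<le>max N M. (if j \<le> n then d j else 0) * cos (pi * real j * t / T))"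
   if "n \<le> max N M" for n d t
   using that by (intro sum.mono_neutral_cong_left) auto
  have "f t + g t = (\<Sum>j\<le>max N M. ((if j \<le> N then a j else 0) + (if j \<le> M then b j else 0)) * cos (pi * real j * t / T))" for t
   unfolding N M by (simp only: ext[of N a] ext[of M b] max.cobounded1 max.cobounded2 distrib_right sum.distrib)
  then show ?case
   by (intro exI[of _ "max N M"] exI[of _ "\<lambda>j. (if j \<le> N then a j else 0) + (if j \<le> M then b j else 0)"]) simp
 qed
 then show thesis using that by blast
qed

text \<open>Cosines alone suffice: \<open>cos (pi t / T)\<close> already separates the points of
  \<open>[0, T]\<close>.\<close>

lemma cos_poly_dense:
 assumes "0 < T" "continuous_on {0..T} f" "0 < e"
 obtains N a where "\<And>t. t \<in> {0..T} ==> \<bar>f t - (\<Sum>j\<le>(N::nat). a j * cos (pi * real j * t / T))\<bar> < e"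
proof -
 have "\<exists>g. cos_poly T g \<and> (\<forall>t\<in>{0..T}. \<bar>f t - g t\<bar> < e)"
 proof (rule Stone_Weierstrass_HOL)
  show "cos_poly T (\<lambda>x. c)" for c using cos_poly.base[of T c 0] by simp
  show "continuous_on {0..T} f" if "cos_poly T f" for f
   using that by induction (use assms(1) in \<open>auto intro!: continuous_intros\<close>)
  show "\<exists>f. cos_poly T f \<and> f x \<noteq> f y" if "x \<in> {0..T} \<and> y \<in> {0..T} \<and> x \<noteq> y" for x y
  proof (intro exI conjI)
   show "cos_poly T (\<lambda>t. 1 * cos (pi * real 1 * t / T))" by (rule cos_poly.base)
   have "pi * x / T \<in> {0..pi}" "pi * y / T \<in> {0..pi}" "pi * x / T \<noteq> pi * y / T"
    using that assms(1) by (auto simp: field_simps)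
   then show "1 * cos (pi * real 1 * x / T) \<noteq> 1 * cos (pi * real 1 * y / T)"
    using cos_inj_pi[of "pi * x / T" "pi * y / T"] by auto
  qed
 qed (use assms cos_poly_mult cos_poly.add in auto)
 then obtain g where g: "cos_poly T g" "\<forall>t\<in>{0..T}. \<bar>f t - g t\<bar> < e" by blast
 obtain N a where "\<And>t. g t = (\<Sum>j\<le>(N::nat). a j * cos (pi * real j * t / T))" using cos_poly_sum[OF g(1)] by metis
 then show thesis using g(2) that[where N = N and a = a] by simp
qed

lemma integral_cos_cos:
 assumes "0 < T"
 shows "(LBINT t:{0..T}. cos (pi * real j * t / T) * cos (pi * real k * t / T)) = (if j = k then (if j = 0 then T else T / 2) else 0)"
proof -
 have i1: "(LBINT t:{0..T}. cos (pi * real_of_int m * t / T)) = (if m = 0 then T else 0)" for m :: int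
 proof (cases "m = 0")
  case True then show ?thesis using assms by (simp add: set_lebesgue_integral_def)
 next
  case False
  have "(\<integral>t. indicator {0..T} t *\<^sub>R cos (pi * real_of_int m * t / T)) = T / (pi * m) * sin (pi * real_of_int m * T / T) - T / (pi * m) * sin (pi * real_of_int m * 0 / T)"
   by (rule integral_FTC_Icc)
    (use assms False in \<open>auto intro!: continuous_intros derivative_eq_intros simp: real_derivative_iff[symmetric]\<close>)
  also have "\<dots> = 0" using assms sin_integer_2pi[of "m"] sin_zero_iff_int2[of "pi * real_of_int m"] by (auto simp: mult.commute)
  finally show ?thesis using False by (simp add: set_lebesgue_integral_def)
 qed
 have "(LBINT t:{0..T}. cos (pi * real j * t / T) * cos (pi * real k * t / T)) =
  (LBINT t:{0..T}. 1/2 * cos (pi * real_of_int (int j - int k) * t / T) + 1/2 * cos (pi * real_of_int (int j + int k) * t / T))"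
 proof -
  have "cos (pi * real j * t / T) * cos (pi * real k * t / T) = 1/2 * cos (pi * real_of_int (int j - int k) * t / T) + 1/2 * cos (pi * real_of_int (int j + int k) * t / T)" for t
  proof -
   have "pi * real_of_int (int j - int k) * t / T = pi * real j * t / T - pi * real k * t / T"
    "pi * real_of_int (int j + int k) * t / T = pi * real j * t / T + pi * real k * t / T"
    by (simp_all add: algebra_simps diff_divide_distrib add_divide_distrib)
   then show ?thesis by (simp only: cos_diff cos_add) (simp add: algebra_simps)
  qed
  then show ?thesis by simp
 qed
 also have "\<dots> = 1/2 * (LBINT t:{0..T}. cos (pi * real_of_int (int j - int k) * t / T)) + 1/2 * (LBINT t:{0..T}. cos (pi * real_of_int (int j + int k) * t / T))"
  by (subst set_integral_add) (use assms in \<open>auto intro!: borel_integrable_atLeastAtMost' continuous_intros\<close>)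
 also have "\<dots> = (if j = k then (if j = 0 then T else T / 2) else 0)" unfolding i1 by auto
 finally show ?thesis .
qed

text \<open>The half of Parseval's identity that bounds a function by its coefficients. A cosine
  polynomial \<open>P\<close> near \<open>f\<close> makes the integral of \<open>(f - P)^2\<close>
  small; completing the square in each coefficient replaces those of \<open>P\<close> by those of
  \<open>f\<close>.\<close>

lemma Parseval_le:
 assumes T: "0 < T" and f: "continuous_on {0..T} f" and e: "0 < e"
 obtains N where "(LBINT t:{0..T}. (f t)\<^sup>2) \<le> e + 2 / T * (\<Sum>j\<le>(N::nat). (LBINT t:{0..T}. f t * cos (pi * real j * t / T))\<^sup>2)"
proof -
 have s0: "0 < sqrt (e / T)" using T e by simp
 obtain N a where Na: "\<And>t. t \<in> {0..T} ==> \<bar>f t - (\<Sum>j\<le>(N::nat). a j * cos (pi * real j * t / T))\<bar> < sqrt (e / T)"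
  using cos_poly_dense[OF T f s0] by blast
 define c where "c j t = cos (pi * real j * t / T)" for j t
 define P where "P t = (\<Sum>j\<le>N. a j * c j t)" for t
 define d where "d j = (LBINT t:{0..T}. f t * c j t)" for j
 define n where "n j = (if j = 0 then T else T / 2)" for j :: nat
 have cc: "continuous_on {0..T} (c j)" for j unfolding c_def by (intro continuous_intros) (use T in auto)
 have cP: "continuous_on {0..T} P" unfolding P_def by (intro continuous_intros cc)
 have si: "set_integrable lborel {0..T} g" if "continuous_on {0..T} g" for g :: "real => real"
  by (rule borel_integrable_atLeastAtMost'[OF that])
 have ub: "(LBINT t:{0..T}. (f t - P t)\<^sup>2) \<le> e"
 proof -
  have "(LBINT t:{0..T}. (f t - P t)\<^sup>2) \<le> (LBINT t:{0..T}. e / T)"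
  proof (rule set_integral_mono)
   fix t assume "t \<in> {0..T}"
   then have "\<bar>f t - P t\<bar> \<le> sqrt (e / T)" using Na[of t] by (simp add: P_def c_def)
   then have "\<bar>f t - P t\<bar>\<^sup>2 \<le> (sqrt (e / T))\<^sup>2" by (intro power_mono) auto
   then show "(f t - P t)\<^sup>2 \<le> e / T" using T e by simp
  qed (intro si continuous_intros f cP)+
  then show ?thesis using T by (simp add: set_lebesgue_integral_def)
 qed
 have exp: "(LBINT t:{0..T}. (f t - P t)\<^sup>2) = (LBINT t:{0..T}. (f t)\<^sup>2) - 2 * (\<Sum>j\<le>N. a j * d j) + (\<Sum>j\<le>N. (a j)\<^sup>2 * n j)"
 proof -
  have "(LBINT t:{0..T}. (f t - P t)\<^sup>2) = (LBINT t:{0..T}. (f t)\<^sup>2 - 2 * (f t * P t) + P t * P t)"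
   by (intro set_lebesgue_integral_cong) (auto simp: power2_eq_square algebra_simps)
  also have "\<dots> = (LBINT t:{0..T}. (f t)\<^sup>2) - 2 * (LBINT t:{0..T}. f t * P t) + (LBINT t:{0..T}. P t * P t)"
   by (subst set_integral_add, (intro si continuous_intros f cP)+, subst set_integral_diff, (intro si continuous_intros f cP)+) simp
  also have "(LBINT t:{0..T}. f t * P t) = (\<Sum>j\<le>N. a j * d j)"
  proof -
   have "(LBINT t:{0..T}. f t * P t) = (\<integral>t. (\<Sum>j\<le>N. a j * (indicator {0..T} t * (f t * c j t))))"
    unfolding set_lebesgue_integral_def P_def by (intro integral_cong) (auto simp: sum_distrib_left ac_simps)
   also have "\<dots> = (\<Sum>j\<le>N. \<integral>t. a j * (indicator {0..T} t * (f t * c j t)))"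
    using si[OF continuous_on_mult[OF f cc]] by (intro integral_sum) (auto simp: set_integrable_def)
   finally show ?thesis by (simp add: d_def set_lebesgue_integral_def)
  qed
  also have "(LBINT t:{0..T}. P t * P t) = (\<Sum>j\<le>N. (a j)\<^sup>2 * n j)"
  proof -
   have "(LBINT t:{0..T}. P t * P t) = (\<integral>t. (\<Sum>j\<le>N. \<Sum>k\<le>N. (a j * a k) * (indicator {0..T} t * (c j t * c k t))))"
    unfolding set_lebesgue_integral_def P_def
    by (intro integral_cong) (auto simp: sum_product sum_distrib_left ac_simps)
   also have "\<dots> = (\<Sum>j\<le>N. \<Sum>k\<le>N. (a j * a k) * (\<integral>t. indicator {0..T} t * (c j t * c k t)))"
    using si[OF continuous_on_mult[OF cc cc]]
    by (subst integral_sum, force simp: set_integrable_def, subst integral_sum)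
     (auto simp: set_integrable_def)
   also have "\<dots> = (\<Sum>j\<le>N. \<Sum>k\<le>N. (a j * a k) * (if j = k then n j else 0))"
    using integral_cos_cos[OF T] by (simp add: set_lebesgue_integral_def c_def n_def cong: if_cong)
   also have "\<dots> = (\<Sum>j\<le>N. (a j)\<^sup>2 * n j)" by (simp add: if_distrib[of "\<lambda>x. _ * x"] power2_eq_square cong: if_cong)
   finally show ?thesis .
  qed
  finally show ?thesis .
 qed
 have "2 * (a j * d j) - (a j)\<^sup>2 * n j \<le> 2 / T * (d j)\<^sup>2" for j
 proof -
  have n: "T / 2 \<le> n j" "0 < n j" using T by (auto simp: n_def)
  have "0 \<le> (a j * n j - d j)\<^sup>2" by simp
  then have "(2 * (a j * d j) - (a j)\<^sup>2 * n j) * n j \<le> (d j)\<^sup>2" by (simp add: power2_eq_square algebra_simps)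
  then have "2 * (a j * d j) - (a j)\<^sup>2 * n j \<le> (d j)\<^sup>2 / n j" using n by (simp add: pos_le_divide_eq)
  also have "\<dots> \<le> (d j)\<^sup>2 / (T / 2)" using n T by (intro divide_left_mono) auto
  finally show ?thesis by (simp add: mult.commute)
 qed
 then have "(\<Sum>j\<le>N. 2 * (a j * d j) - (a j)\<^sup>2 * n j) \<le> (\<Sum>j\<le>N. 2 / T * (d j)\<^sup>2)" by (intro sum_mono)
 then have "2 * (\<Sum>j\<le>N. a j * d j) - (\<Sum>j\<le>N. (a j)\<^sup>2 * n j) \<le> 2 / T * (\<Sum>j\<le>N. (d j)\<^sup>2)"
  by (simp only: sum_subtractf sum_distrib_left)
 then show thesis using that[of N] ub exp by (simp add: d_def c_def)
qed

lemma norm_exp_freq: "norm (exp (- (freq T j * of_real t))) = exp (- t)"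
 by (simp add: freq_def)

lemma integral_cis_period:
 assumes T: "0 < T"
 shows "(\<integral>t. indicator {0..2 * T} t *\<^sub>R cis (pi * (real j - real k) / T * t)) = (if j = k then of_real (2 * T) else 0)"
proof (cases "j = k")
 case True then show ?thesis using T by (simp add: scaleR_conv_of_real)
next
 case False
 define m where "m = pi * (real j - real k) / T"
 have m: "m \<noteq> 0" using False T by (simp add: m_def)
 have "(\<integral>t. indicator {0..2 * T} t *\<^sub>R cis (m * t)) = cis (m * (2 * T)) / (\<i> * of_real m) - cis (m * 0) / (\<i> * of_real m)"
 proof (rule integral_FTC_Icc)
  fix t
  have "((\<lambda>w. exp (0 + of_real w * (\<i> * of_real m)) / (\<i> * of_real m)) has_vector_derivative exp (0 + of_real t * (\<i> * of_real m))) (at t within {0..2*T})"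
   by (rule has_vector_derivative_at_within)
    (use has_vector_derivative_divide[OF has_vector_derivative_exp_affine[of 0 "\<i> * of_real m" t], of "\<i> * of_real m"] m in simp)
  then show "((\<lambda>t. cis (m * t) / (\<i> * of_real m)) has_vector_derivative cis (m * t)) (at t within {0..2*T})"
   by (simp add: cis_conv_exp ac_simps)
 qed (use T in \<open>auto intro!: continuous_intros\<close>)
 also have "m * (2 * T) = 2 * pi * real_of_int (int j - int k)" using T by (simp add: m_def)
 finally show ?thesis using False cis_multiple_2pi[of "real_of_int (int j - int k)"] by (simp add: m_def)
qed

text \<open>\<open>B\<close> is merely bounded, and the real part of the frequencies supplies the
  weight \<open>exp (- t)\<close>. By duality it suffices to bound the weighted norm of the
  trigonometric sum \<open>S\<close> formed with the coefficients; \<open>S\<close> has period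
  \<open>2 T\<close>, and the constant is the geometric series of the weights of its
  periods.\<close>

lemma Bessel_half_line:
 fixes B :: "real => complex"
 assumes T: "0 < T" and F: "finite F" and Bm [measurable]: "B \<in> borel_measurable borel"
  and BD: "\<And>t. norm (B t) \<le> D" and B0: "\<And>t. t \<le> 0 ==> B t = 0"
 shows "(\<Sum>j\<in>F. (norm (\<integral>t. B t * exp (- (freq T j * of_real t))))\<^sup>2) \<le> D\<^sup>2 * (2 * T / (1 - exp (- 2 * T)))"
proof -
 define c where "c j = (\<integral>t. B t * exp (- (freq T j * of_real t)))" for j
 define C where "C = 2 * T / (1 - exp (- 2 * T))"
 define w where "w t = indicator {0<..} t * exp (- t)" for t :: real
 define \<omega> where "\<omega> j = pi * real j / T" for j
 define S where "S t = (\<Sum>j\<in>F. c j * cis (\<omega> j * t))" for t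
 define X where "X = (\<Sum>j\<in>F. (norm (c j))\<^sup>2)"
 define N where "N = (\<Sum>j\<in>F. norm (c j))"
 have X0: "0 \<le> X" by (simp add: X_def sum_nonneg)
 have C0: "0 < C" using T by (simp add: C_def)
 have wm [measurable]: "w \<in> borel_measurable borel" unfolding w_def by measurable
 have wi: "lintegrable w" and wI: "(\<integral>t. w t) = 1"
 proof -
  have "((\<lambda>x. exp (- 1 * x)) has_integral exp (- 1 * 0) / 1) {0::real..}"
   by (rule has_integral_exp_minus_to_infinity) simp
  then have "has_bochner_integral lborel (\<lambda>x::real. indicator {0..} x *\<^sub>R exp (- x)) 1"
   using has_integral_iff_emeasure_lborel nn_integral_has_integral_lebesgue[of "{0..}" "\<lambda>x. exp (- x)" 1]
   by (intro has_bochner_integral_nn_integral) (auto simp: ac_simps indicator_def cong: nn_integral_cong)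
  then have "has_bochner_integral lborel w 1"
  proof (rule has_bochner_integral_cong_AE[THEN iffD1, rotated -1])
   show "AE x in lborel. indicator {0..} x *\<^sub>R exp (- x) = w x"
    using AE_lborel_singleton[of 0] by eventually_elim (auto simp: w_def indicator_def)
  qed auto
  then show "lintegrable w" "(\<integral>t. w t) = 1" by (auto simp: has_bochner_integral_iff)
 qed
 have w0: "0 \<le> w t" for t by (simp add: w_def)
 have Sm [measurable]: "S \<in> borel_measurable borel"
  unfolding S_def by (intro borel_measurable_continuous_onI continuous_intros)
 have SN: "norm (S t) \<le> N" for t
  unfolding S_def N_def by (rule order_trans[OF norm_sum]) (simp add: norm_mult)
 have SNi: "(norm (S t))\<^sup>2 \<le> N\<^sup>2" for t by (intro power_mono SN) auto
 have wSi: "lintegrable (\<lambda>t. w t * (norm (S t))\<^sup>2)"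
  by (rule integrable_bound[where f = "\<lambda>t. w t * N\<^sup>2"])
   (use wi w0 SNi in \<open>auto intro!: mult_left_mono simp: abs_mult\<close>)
 define A where "A = (\<integral>t. w t * (norm (S t))\<^sup>2)"
 have expE: "exp (- (freq T j * of_real t)) = of_real (exp (- t)) * cis (- (\<omega> j * t))" for j t
  by (simp add: freq_def \<omega>_def cis_conv_exp exp_of_real[symmetric] exp_add[symmetric] Complex_eq algebra_simps)
 have BE: "B t * exp (- (freq T j * of_real t)) = B t * (of_real (w t) * cis (- (\<omega> j * t)))" for j t
  using B0[of t] by (cases "0 < t") (simp_all add: expE w_def)
 have cisN: "norm (B t * (of_real (w t) * cis r)) \<le> D * w t" for t r
  using BD[of t] w0[of t] by (simp add: norm_mult mult_right_mono)
 have Bi: "lintegrable (\<lambda>t. B t * (of_real (w t) * cis (- (\<omega> j * t))))" for j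
 proof (rule integrable_bound)
  show "lintegrable (\<lambda>t. D * w t)" using wi by simp
  have "(\<lambda>t. cis (- (\<omega> j * t))) \<in> borel_measurable borel"
   by (intro borel_measurable_continuous_onI continuous_intros)
  then show "(\<lambda>t. B t * (of_real (w t) * cis (- (\<omega> j * t)))) \<in> borel_measurable lborel" by measurable
 qed (use cisN in \<open>auto intro: order_trans[OF _ abs_ge_self]\<close>)
 have Xeq: "of_real X = (\<integral>t. B t * (of_real (w t) * cnj (S t)))"
 proof -
  have "of_real X = (\<Sum>j\<in>F. cnj (c j) * c j)"
   by (simp add: X_def complex_norm_square mult.commute del: of_real_power)
  also have "\<dots> = (\<Sum>j\<in>F. \<integral>t. cnj (c j) * (B t * (of_real (w t) * cis (- (\<omega> j * t)))))"
   by (simp only: c_def[of "_::nat"] BE integral_mult_right_zero)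
  also have "\<dots> = (\<integral>t. (\<Sum>j\<in>F. cnj (c j) * (B t * (of_real (w t) * cis (- (\<omega> j * t))))))"
   using Bi by (intro integral_sum[symmetric]) auto
  also have "\<dots> = (\<integral>t. B t * (of_real (w t) * cnj (S t)))"
   by (intro integral_cong refl)
    (simp add: S_def sum_distrib_left cis_cnj ac_simps)
  finally show ?thesis .
 qed
 have XA: "X \<le> A / (2 * C) + C * D\<^sup>2 / 2"
 proof -
  have "X = norm (of_real X :: complex)" using X0 by simp
  also have "\<dots> \<le> (\<integral>t. norm (B t * (of_real (w t) * cnj (S t))))" unfolding Xeq by (rule integral_norm_bound)
  also have "\<dots> \<le> (\<integral>t. (1 / (2 * C)) * (w t * (norm (S t))\<^sup>2) + (C * D\<^sup>2 / 2) * w t)"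
  proof (rule integral_mono')
   show "lintegrable (\<lambda>t. (1 / (2 * C)) * (w t * (norm (S t))\<^sup>2) + (C * D\<^sup>2 / 2) * w t)" using wSi wi by simp
   fix t
   have "0 \<le> (norm (S t) - C * D)\<^sup>2" by simp
   then have "2 * C * (D * norm (S t)) \<le> (norm (S t))\<^sup>2 + C\<^sup>2 * D\<^sup>2" by (simp add: power2_eq_square algebra_simps)
   then have "D * norm (S t) \<le> ((norm (S t))\<^sup>2 + C\<^sup>2 * D\<^sup>2) / (2 * C)" using C0 by (simp add: pos_le_divide_eq mult.commute)
   also have "\<dots> = (1 / (2 * C)) * (norm (S t))\<^sup>2 + C * D\<^sup>2 / 2" using C0 by (simp add: add_divide_distrib power2_eq_square)
   finally have 1: "D * norm (S t) \<le> (1 / (2 * C)) * (norm (S t))\<^sup>2 + C * D\<^sup>2 / 2" .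
   have "norm (B t * (of_real (w t) * cnj (S t))) = w t * (norm (B t) * norm (S t))" using w0[of t] by (simp add: norm_mult)
   also have "\<dots> \<le> w t * (D * norm (S t))" by (intro mult_left_mono mult_right_mono BD w0) auto
   also have "\<dots> \<le> w t * ((1 / (2 * C)) * (norm (S t))\<^sup>2 + C * D\<^sup>2 / 2)" by (rule mult_left_mono[OF 1 w0])
   finally show "norm (B t * (of_real (w t) * cnj (S t))) \<le> (1 / (2 * C)) * (w t * (norm (S t))\<^sup>2) + (C * D\<^sup>2 / 2) * w t"
    by (simp add: algebra_simps)
   show "0 \<le> (1 / (2 * C)) * (w t * (norm (S t))\<^sup>2) + (C * D\<^sup>2 / 2) * w t" using C0 w0[of t] by simp
  qed
  also have "\<dots> = A / (2 * C) + C * D\<^sup>2 / 2" using wSi wi by (simp add: A_def wI)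
  finally show ?thesis .
 qed
 \<comment> \<open>Shifting by one period multiplies the weight by \<open>exp (- 2 T)\<close>, so
   the part beyond \<open>2 T\<close> is a smaller copy of \<open>A\<close> itself; on the first
   period the weight is at most 1 and orthogonality gives \<open>2 T X\<close>.\<close>
 have "A \<le> 2 * T * X + exp (- 2 * T) * A"
 proof -
  define g where "g t = indicator {2*T<..} t * (exp (- t) * (norm (S t))\<^sup>2)" for t
  define f where "f t = indicator {0..2*T} t * (norm (S t))\<^sup>2" for t
  have fi: "lintegrable f"
  proof -
   have "set_integrable lborel {0..2*T} (\<lambda>t. (norm (S t))\<^sup>2)"
    unfolding S_def by (intro borel_integrable_atLeastAtMost' continuous_intros)
   then show ?thesis by (simp add: set_integrable_def f_def[abs_def])
  qed
  have [measurable]: "g \<in> borel_measurable borel" unfolding g_def by measurable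
  have gi: "lintegrable g"
   by (rule integrable_bound[OF wSi])
    (use T in \<open>auto simp: g_def w_def indicator_def abs_mult\<close>)
  have "A \<le> (\<integral>t. f t + g t)" unfolding A_def
  proof (rule integral_mono)
   fix t
   have "exp (- t) * (norm (S t))\<^sup>2 \<le> 1 * (norm (S t))\<^sup>2" if "0 < t" using that by (intro mult_right_mono) auto
   then show "w t * (norm (S t))\<^sup>2 \<le> f t + g t" by (auto simp: w_def f_def g_def indicator_def)
  qed (use wSi fi gi in auto)
  also have "\<dots> = (\<integral>t. f t) + (\<integral>t. g t)" using fi gi by simp
  also have "(\<integral>t. g t) = exp (- 2 * T) * A"
  proof -
   have per: "S (2 * T + t) = S t" for t
   proof -
    have "cis (\<omega> j * (2 * T + t)) = cis (\<omega> j * t)" for j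
    proof -
     have "\<omega> j * (2 * T + t) = 2 * pi * real j + \<omega> j * t" using T by (simp add: \<omega>_def field_simps)
     then have "cis (\<omega> j * (2 * T + t)) = cis (2 * pi * real j) * cis (\<omega> j * t)" by (simp only: cis_mult)
     then show ?thesis by (simp add: cis_multiple_2pi)
    qed
    then show ?thesis by (simp add: S_def)
   qed
   have "(\<integral>t. g t) = (\<integral>t. g (2 * T + 1 * t))"
    using lborel_integral_real_affine[of 1 g "2 * T"] by simp
   also have "\<dots> = (\<integral>t. exp (- 2 * T) * (w t * (norm (S t))\<^sup>2))"
    using per by (intro integral_cong refl) (auto simp: g_def w_def ac_simps indicator_def exp_diff exp_minus field_simps)
   finally show ?thesis by (simp add: A_def)
  qed
  also have "(\<integral>t. f t) = 2 * T * X"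
  proof -
   have sci: "complex_integrable lborel (\<lambda>t. indicator {0..2 * T} t *\<^sub>R cis (pi * (real j - real k) / T * t))" for j k
    by (rule borel_integrable_atLeastAtMost'[unfolded set_integrable_def]) (intro continuous_intros)
   have "of_real (\<integral>t. f t) = (\<integral>t. of_real (f t) :: complex)" by simp
   also have "\<dots> = (\<integral>t. (\<Sum>j\<in>F. \<Sum>k\<in>F. (c j * cnj (c k)) * (indicator {0..2 * T} t *\<^sub>R cis (pi * (real j - real k) / T * t))))"
   proof (intro integral_cong refl)
    fix t
    have "of_real ((norm (S t))\<^sup>2) = S t * cnj (S t)" by (simp add: complex_norm_square del: of_real_power)
    also have "\<dots> = (\<Sum>j\<in>F. \<Sum>k\<in>F. (c j * cnj (c k)) * (cis (\<omega> j * t) * cis (- (\<omega> k * t))))"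
     by (simp add: S_def sum_product cis_cnj ac_simps)
    also have "\<dots> = (\<Sum>j\<in>F. \<Sum>k\<in>F. (c j * cnj (c k)) * cis (pi * (real j - real k) / T * t))"
     by (simp add: cis_mult \<omega>_def algebra_simps diff_divide_distrib)
    finally show "of_real (f t) = (\<Sum>j\<in>F. \<Sum>k\<in>F. (c j * cnj (c k)) * (indicator {0..2 * T} t *\<^sub>R cis (pi * (real j - real k) / T * t)))"
     by (auto simp: f_def indicator_def simp del: of_real_power)
   qed
   also have "\<dots> = (\<Sum>j\<in>F. \<Sum>k\<in>F. (c j * cnj (c k)) * (\<integral>t. indicator {0..2 * T} t *\<^sub>R cis (pi * (real j - real k) / T * t)))"
    by (subst integral_sum, intro integrable_sum integrable_mult_right sci,
      subst integral_sum, intro integrable_mult_right sci) (simp only: integral_mult_right_zero)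
   also have "\<dots> = (\<Sum>j\<in>F. (c j * cnj (c j)) * of_real (2 * T))"
    unfolding integral_cis_period[OF T] using F by (simp add: if_distrib[of "\<lambda>x. _ * x"] cong: if_cong)
   also have "\<dots> = of_real (2 * T * X)"
    by (simp add: X_def complex_norm_square sum_distrib_left mult.commute del: of_real_power)
   finally show ?thesis by (simp only: of_real_eq_iff)
  qed
  finally show ?thesis .
 qed
 then have "A * (1 - exp (- 2 * T)) \<le> 2 * T * X" by (simp add: algebra_simps)
 then have "A \<le> C * X" using T by (simp add: C_def pos_le_divide_eq)
 then have "A / (2 * C) \<le> X / 2" using C0 by (simp add: field_simps)
 then have "X \<le> C * D\<^sup>2" using XA by linarith
 then show ?thesis by (simp add: X_def c_def C_def mult.commute)
qed

section \<open>Fractional integration in time\<close>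

definition fconv :: "real => (real => 'v::{banach, second_countable_topology}) => real => 'v" where
 "fconv \<alpha> f t = (\<integral>s. frac_ker \<alpha> s *\<^sub>R f (t - s))"

definition frac_mass :: "real => real => real" where
 "frac_mass \<alpha> M = (\<integral>s. frac_ker \<alpha> s * indicator {..M} s)"

lemma compact_image_bound:
 fixes f :: "'a::topological_space => 'b::real_normed_vector"
 assumes "compact K" "continuous_on K f"
 obtains B where "0 < B" "\<And>x. x \<in> K ==> norm (f x) \<le> B"
proof -
 have "bounded (f ` K)" by (rule compact_imp_bounded[OF compact_continuous_image[OF assms(2,1)]])
 then show thesis using that unfolding bounded_pos by auto
qed

lemma DERIV_affine_arg:
 fixes f :: "real => real"
 assumes "(f has_real_derivative D) (at (c + m * x))"
 shows "((\<lambda>x. f (c + m * x)) has_real_derivative m * D) (at x)"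
proof -
 have "((\<lambda>x. c + m * x) has_real_derivative m) (at x)" by (auto intro!: derivative_eq_intros)
 from DERIV_chain2[where f = f and g = "\<lambda>x. c + m * x", OF assms this] show ?thesis by (simp add: mult.commute)
qed

lemma measurable_reflect:
 fixes f :: "real => 'v::{banach, second_countable_topology}"
 assumes "cts f"
 shows "(\<lambda>s. f (t - s)) \<in> borel_measurable borel"
 by (intro borel_measurable_continuous_onI continuous_on_compose2[OF assms] continuous_intros) auto

lemma DERIV_pos_part_powr:
 assumes "1 < c"
 shows "((\<lambda>s. max 0 s powr c) has_real_derivative c * max 0 s powr (c - 1)) (at s)"
proof -
 consider "s < 0" | "s = 0" | "0 < s" by linarith
 then show ?thesis
 proof cases
  case 1
  show ?thesis
   by (rule has_field_derivative_transform_within_open[where f = "\<lambda>_. 0" and S = "{..<0}"]) (use 1 in auto)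
 next
  case 2
  have a: "((\<lambda>s. max 0 s powr c) has_real_derivative 0) (at 0 within {..0})"
   by (rule has_field_derivative_transform_within[where f = "\<lambda>_. 0" and d = 1]) auto
  have "((\<lambda>s. s powr c / s) \<longlongrightarrow> 0) (at_right 0)" using assms by real_asymp
  then have "((\<lambda>s. max 0 s powr c) has_real_derivative 0) (at 0 within {0..})"
   unfolding has_field_derivative_iff at_within_Ici_at_right
   by (rule Lim_transform_eventually) (auto simp: eventually_at_right[of 0 1] intro!: exI[of _ 1])
  from DERIV_glue[OF a this] show ?thesis using 2 by simp
 next
  case 3
  show ?thesis
   by (rule has_field_derivative_transform_within_open[where f = "\<lambda>s. s powr c" and S = "{0<..}"])
    (use 3 has_real_derivative_powr[OF 3, of c] in auto)
 qed
qed

text \<open>After division by \<open>(x + y) powr c\<close> this is \<open>r \<le> r powr c\<close>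
  for the two fractions \<open>x / (x + y)\<close> and \<open>y / (x + y)\<close>, whose sum is
  1.\<close>

lemma powr_subadditive:
 assumes "0 < x" "0 < y" "0 < c" "c \<le> (1::real)"
 shows "(x + y) powr c \<le> x powr c + y powr c"
proof -
 have r: "r \<le> r powr c" if "0 < r" "r \<le> 1" for r :: real
  using powr_mono'[of c 1 r] that assms by simp
 have "1 = x / (x + y) + y / (x + y)" using assms by (simp add: add_divide_distrib[symmetric])
 also have "\<dots> \<le> (x / (x + y)) powr c + (y / (x + y)) powr c"
  using assms by (intro add_mono r) auto
 also have "\<dots> = (x powr c + y powr c) / (x + y) powr c"
  using assms by (simp add: powr_divide add_divide_distrib)
 finally show ?thesis using assms by (simp add: pos_le_divide_eq)
qed

section \<open>Convolution with the kernel: regularity, Laplace transform and commutators\<close>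

context
 fixes \<alpha> :: real
 assumes \<alpha>: "1 < \<alpha>" "\<alpha> < 2"
begin

lemma frac_mass_nonneg: "0 \<le> frac_mass \<alpha> M"
 unfolding frac_mass_def by (intro integral_nonneg) (simp add: frac_ker_nonneg[OF \<alpha>])

lemma fconv_integrable:
 fixes f :: "real => 'v::{banach, second_countable_topology}"
 assumes f: "cts f" "\<And>t. t \<le> 0 ==> f t = 0"
 shows "lintegrable (\<lambda>s. frac_ker \<alpha> s *\<^sub>R f (t - s))"
proof -
 obtain B where B: "0 < B" "\<And>r. r \<in> {0..\<bar>t\<bar>} ==> norm (f r) \<le> B"
  using compact_image_bound[OF compact_Icc continuous_on_subset[OF f(1) subset_UNIV]] by blast
 show ?thesis
 proof (rule integrable_bound)
  show "lintegrable (\<lambda>s. B * (frac_ker \<alpha> s * indicator {..\<bar>t\<bar>} s))"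
   using frac_ker_integrable_Icc[OF \<alpha>, of "\<bar>t\<bar>"] by simp
  have "(\<lambda>s. frac_ker \<alpha> s *\<^sub>R f (t - s)) \<in> borel_measurable borel"
   using measurable_reflect[OF f(1)] by measurable
  then show "(\<lambda>s. frac_ker \<alpha> s *\<^sub>R f (t - s)) \<in> borel_measurable lborel" by simp
  show "AE s in lborel. norm (frac_ker \<alpha> s *\<^sub>R f (t - s)) \<le> norm (B * (frac_ker \<alpha> s * indicator {..\<bar>t\<bar>} s))"
  proof (rule AE_I2)
   fix s
   show "norm (frac_ker \<alpha> s *\<^sub>R f (t - s)) \<le> norm (B * (frac_ker \<alpha> s * indicator {..\<bar>t\<bar>} s))"
   proof (cases "0 < s \<and> s < t")
    case True
    then have "norm (f (t - s)) \<le> B" by (intro B) auto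
    then show ?thesis using True B(1) frac_ker_nonneg[OF \<alpha>, of s] by (simp add: abs_mult mult.commute[of B] mult_left_mono)
   next
    case False
    then show ?thesis using f(2)[of "t - s"] by (cases "0 < s") (auto simp: frac_ker_def)
   qed
  qed
 qed
qed

lemma fconv_norm_le:
 fixes f :: "real => 'v::{banach, second_countable_topology}"
 assumes f: "\<And>t. t \<le> 0 ==> f t = 0" "\<And>r. r \<le> t ==> norm (f r) \<le> B"
 shows "norm (fconv \<alpha> f t) \<le> B * frac_mass \<alpha> t"
proof -
 have B: "0 \<le> B" using f(2)[of t] norm_ge_zero[of "f t"] by linarith
 have "norm (fconv \<alpha> f t) \<le> (\<integral>s. norm (frac_ker \<alpha> s *\<^sub>R f (t - s)))"
  unfolding fconv_def by (rule integral_norm_bound)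
 also have "\<dots> \<le> (\<integral>s. B * (frac_ker \<alpha> s * indicator {..t} s))"
 proof (rule integral_mono')
  show "lintegrable (\<lambda>s. B * (frac_ker \<alpha> s * indicator {..t} s))"
   using frac_ker_integrable_Icc[OF \<alpha>, of t] by simp
  fix s
  show "0 \<le> B * (frac_ker \<alpha> s * indicator {..t} s)" using B frac_ker_nonneg[OF \<alpha>, of s] by simp
  show "norm (frac_ker \<alpha> s *\<^sub>R f (t - s)) \<le> B * (frac_ker \<alpha> s * indicator {..t} s)"
  proof (cases "0 < s \<and> s \<le> t")
   case True
   then have "norm (f (t - s)) \<le> B" by (intro f) auto
   then show ?thesis using True frac_ker_nonneg[OF \<alpha>, of s] by (simp add: mult.commute[of B] mult_left_mono)
  next
   case False
   then show ?thesis using f(1)[of "t - s"] by (cases "0 < s") (auto simp: frac_ker_def)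
  qed
 qed
 finally show ?thesis by (simp add: frac_mass_def)
qed

lemma fconv_eq_0:
 fixes f :: "real => 'v::{banach, second_countable_topology}"
 assumes "\<And>r. r \<le> t ==> f r = 0" shows "fconv \<alpha> f t = 0"
proof -
 have "frac_ker \<alpha> s *\<^sub>R f (t - s) = 0" for s using assms[of "t - s"] by (cases "0 < s") (auto simp: frac_ker_def)
 then show ?thesis unfolding fconv_def by (simp only: integral_zero)
qed

lemma continuous_fconv:
 fixes f :: "real => 'x::heine_borel => 'v::{banach, second_countable_topology}"
 assumes f: "cts2 f" "\<And>t x. t \<le> 0 ==> f t x = 0"
 shows "cts (\<lambda>p. fconv \<alpha> (\<lambda>t. f t (snd p)) (fst p))"
 unfolding fconv_def
proof (rule continuous_on_integral_dominated)
 have c: "cts (\<lambda>t. f t x)" for x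
 proof -
  have "cts (\<lambda>t. (t, x))" by (intro continuous_intros)
  from continuous_on_compose2[OF f(1) this] show ?thesis by simp
 qed
 show "(\<lambda>s. frac_ker \<alpha> s *\<^sub>R f (fst p - s) (snd p)) \<in> borel_measurable lborel" for p :: "real \<times> 'x"
  using measurable_reflect[OF c] by measurable
 show "cts (\<lambda>p. frac_ker \<alpha> s *\<^sub>R f (fst p - s) (snd p))" for s
 proof -
  have "cts (\<lambda>p :: real \<times> 'x. (fst p - s, snd p))" by (intro continuous_intros)
  from continuous_on_compose2[OF f(1) this] show ?thesis by (intro continuous_intros) simp
 qed
 fix q :: "nat => real \<times> 'x" and p assume q: "q \<longlonglongrightarrow> p"
 define K where "K = insert p (range q)"
 have K: "compact K" unfolding K_def by (rule compact_sequence_with_limit[OF q])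
 obtain M where M: "0 < M" "\<And>y. y \<in> K ==> norm (fst y) \<le> M"
  using compact_image_bound[OF K continuous_on_fst[OF continuous_on_id]] by blast
 have "continuous_on ({0..\<bar>M\<bar>} \<times> K) (\<lambda>z. (fst (snd z) - fst z, snd (snd z)))" by (intro continuous_intros)
 from continuous_on_compose2[OF f(1) this]
 have "continuous_on ({0..\<bar>M\<bar>} \<times> K) (\<lambda>z. f (fst (snd z) - fst z) (snd (snd z)))" by simp
 then obtain B where B0: "0 < B" "\<And>z. z \<in> {0..\<bar>M\<bar>} \<times> K ==> norm (f (fst (snd z) - fst z) (snd (snd z))) \<le> B"
  using compact_image_bound[OF compact_Times[OF compact_Icc K]] by blast
 have B: "0 < B" "\<And>s y. s \<in> {0..\<bar>M\<bar>} ==> y \<in> K ==> norm (f (fst y - s) (snd y)) \<le> B"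
  using B0(1) B0(2)[of "(_, _)"] by auto
 show "\<exists>g. lintegrable g \<and> (\<forall>n. \<forall>s\<in>space lborel. norm (frac_ker \<alpha> s *\<^sub>R f (fst (q n) - s) (snd (q n))) \<le> g s)"
 proof (intro exI conjI allI ballI)
  show "lintegrable (\<lambda>s. B * (frac_ker \<alpha> s * indicator {..\<bar>M\<bar>} s))"
   using frac_ker_integrable_Icc[OF \<alpha>, of "\<bar>M\<bar>"] by simp
  fix n s
  have qn: "q n \<in> K" by (simp add: K_def)
  show "norm (frac_ker \<alpha> s *\<^sub>R f (fst (q n) - s) (snd (q n))) \<le> B * (frac_ker \<alpha> s * indicator {..\<bar>M\<bar>} s)"
  proof (cases "0 < s \<and> s < fst (q n)")
   case True
   then have s: "s \<in> {0..\<bar>M\<bar>}" using M(2)[OF qn] by auto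
   then show ?thesis using B(2)[OF s qn] frac_ker_nonneg[OF \<alpha>, of s] by (simp add: mult.commute[of B] mult_left_mono)
  next
   case False
   then have e: "frac_ker \<alpha> s *\<^sub>R f (fst (q n) - s) (snd (q n)) = 0"
    using f(2)[of "fst (q n) - s"] by (cases "0 < s") (auto simp: frac_ker_def)
   show ?thesis unfolding e using B(1) frac_ker_nonneg[OF \<alpha>, of s] by simp
  qed
 qed
qed

text \<open>All differentiation falls on \<open>f\<close>, which vanishes for nonpositive times, so
  no boundary term arises although the kernel is singular at 0.\<close>

lemma has_vector_derivative_fconv:
 fixes f :: "real => 'v::{banach, second_countable_topology}"
 assumes f: "cts f" "\<And>t. t \<le> 0 ==> f t = 0"
  and f': "cts f'" "\<And>t. t \<le> 0 ==> f' t = 0"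
  and d: "\<And>t. t < T ==> (f has_vector_derivative f' t) (at t)" and t: "t < T"
 shows "(fconv \<alpha> f has_vector_derivative fconv \<alpha> f' t) (at t)"
proof -
 obtain B where B: "0 < B" "\<And>r. r \<in> {0..\<bar>T\<bar>} ==> norm (f' r) \<le> B"
  using compact_image_bound[OF compact_Icc continuous_on_subset[OF f'(1) subset_UNIV]] by blast
 have "((\<lambda>r. \<integral>s. frac_ker \<alpha> s *\<^sub>R f (r - s)) has_vector_derivative (\<integral>s. frac_ker \<alpha> s *\<^sub>R f' (t - s))) (at t)"
 proof (rule has_vector_derivative_integral[where r = "T - t" and g = "\<lambda>s. B * (frac_ker \<alpha> s * indicator {..\<bar>T\<bar>} s)"])
  show "lintegrable (\<lambda>s. frac_ker \<alpha> s *\<^sub>R f (r - s))" for r by (rule fconv_integrable[OF f])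
  show "lintegrable (\<lambda>s. B * (frac_ker \<alpha> s * indicator {..\<bar>T\<bar>} s))"
   using frac_ker_integrable_Icc[OF \<alpha>, of "\<bar>T\<bar>"] by simp
  fix r s assume r: "\<bar>r - t\<bar> < T - t"
  show "((\<lambda>r. frac_ker \<alpha> s *\<^sub>R f (r - s)) has_vector_derivative frac_ker \<alpha> s *\<^sub>R f' (r - s)) (at r)"
  proof (cases "0 < s")
   case True
   have "(f has_vector_derivative f' (r - s)) (at (r - s))" using True r by (intro d) auto
   moreover have "((\<lambda>r. r - s) has_vector_derivative 1) (at r)" by (auto intro!: derivative_eq_intros)
   ultimately have "((\<lambda>r. f (r - s)) has_vector_derivative 1 *\<^sub>R f' (r - s)) (at r)"
    using vector_diff_chain_at[of "\<lambda>r. r - s" 1 r f "f' (r - s)"] by (simp add: comp_def)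
   then show ?thesis
    using bounded_linear.has_vector_derivative[OF bounded_linear_scaleR_right, of "\<lambda>r. f (r - s)" "f' (r - s)" "at r" "frac_ker \<alpha> s"] by simp
  qed (simp add: frac_ker_def)
  show "norm (frac_ker \<alpha> s *\<^sub>R f' (r - s)) \<le> B * (frac_ker \<alpha> s * indicator {..\<bar>T\<bar>} s)"
  proof (cases "0 < s \<and> s < r")
   case True
   then have "norm (f' (r - s)) \<le> B" "s \<le> \<bar>T\<bar>" using r by (auto intro!: B)
   then show ?thesis using frac_ker_nonneg[OF \<alpha>, of s] by (simp add: mult.commute[of B] mult_left_mono)
  next
   case False
   then have e: "frac_ker \<alpha> s *\<^sub>R f' (r - s) = 0" using f'(2)[of "r - s"] by (cases "0 < s") (auto simp: frac_ker_def)
   show ?thesis unfolding e using B(1) frac_ker_nonneg[OF \<alpha>, of s] by simp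
  qed
 qed (use t in simp)
 then show ?thesis by (simp add: fconv_def[abs_def])
qed

text \<open>The convolution theorem. The convolution itself has unbounded support;
  \<open>Re p > 0\<close> is what makes its transform converge.\<close>

lemma fconv_laplace:
 fixes f :: "real => complex"
 assumes f: "cts f" "\<And>t. t \<notin> {0..b} ==> f t = 0" "f 0 = 0" and p: "0 < Re p"
 shows "lintegrable (\<lambda>t. fconv \<alpha> f t * exp (- (p * of_real t)))"
  "(\<integral>t. fconv \<alpha> f t * exp (- (p * of_real t))) =
   p powr of_real (\<alpha> - 2) * (\<integral>t. f t * exp (- (p * of_real t)))"
proof -
 define E where "E t = exp (- (p * of_real t))" for t :: real
 have Ec: "continuous_on S E" for S unfolding E_def by (intro continuous_intros)
 have Em [measurable]: "E \<in> borel_measurable borel" using Ec by (rule borel_measurable_continuous_onI)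
 have fm [measurable]: "f \<in> borel_measurable borel" using f(1) by (rule borel_measurable_continuous_onI)
 have EE: "E (s + t) = E s * E t" for s t by (simp add: E_def exp_add[symmetric] algebra_simps)
 have ik: "lintegrable (\<lambda>s. frac_ker \<alpha> s *\<^sub>R E s)" "(\<integral>s. frac_ker \<alpha> s *\<^sub>R E s) = p powr of_real (\<alpha> - 2)"
  using frac_ker_laplace[OF \<alpha> p, of "Im p"] by (simp_all add: E_def)
 have fE: "lintegrable (\<lambda>t. f t * E t)"
  by (rule integrable_compact_support[of _ "{0..b}"]) (use f Ec in \<open>auto intro!: continuous_intros\<close>)
 define \<Phi> where "\<Phi> s t = frac_ker \<alpha> s *\<^sub>R f (t - s) * E t" for s t
 have \<Phi>: "\<Phi> s t = (frac_ker \<alpha> s *\<^sub>R E s) * (f (t - s) * E (t - s))" for s t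
  using EE[of s "t - s"] by (simp add: \<Phi>_def ac_simps)
 have tr: "lintegrable (\<lambda>t. g (t - s))" "(\<integral>t. g (t - s)) = (\<integral>t. g t)"
  if "lintegrable g" for g :: "real => 'b::{banach, second_countable_topology}" and s
  using lborel_integrable_real_affine[OF that, of 1 "-s"] lborel_integral_real_affine[of 1 g "-s"]
  by (simp_all add: algebra_simps)
 have i2: "lintegrable (\<lambda>t. \<Phi> s t)" for s
  unfolding \<Phi> using tr(1)[OF fE, of s] by (intro integrable_mult_right)
 have "integrable (lborel \<Otimes>\<^sub>M lborel) (\<lambda>(s, t). \<Phi> s t)"
 proof (rule lborel_pair.Fubini_integrable)
  show "(\<lambda>(s, t). \<Phi> s t) \<in> borel_measurable (lborel \<Otimes>\<^sub>M lborel)" unfolding \<Phi>_def by measurable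
  have "(\<integral>t. norm (\<Phi> s t)) = norm (frac_ker \<alpha> s *\<^sub>R E s) * (\<integral>t. norm (f t * E t))" for s
  proof -
   have "(\<integral>t. norm (\<Phi> s t)) = (\<integral>t. norm (frac_ker \<alpha> s *\<^sub>R E s) * norm (f (t - s) * E (t - s)))"
    unfolding \<Phi> by (simp only: norm_mult)
   also have "\<dots> = norm (frac_ker \<alpha> s *\<^sub>R E s) * (\<integral>t. norm (f (t - s) * E (t - s)))" by simp
   also have "(\<integral>t. norm (f (t - s) * E (t - s))) = (\<integral>t. norm (f t * E t))"
    by (rule tr(2)[of "\<lambda>t. norm (f t * E t)"]) (use fE in auto)
   finally show ?thesis .
  qed
  then show "lintegrable (\<lambda>s. \<integral>t. norm (case (s, t) of (s, t) => \<Phi> s t))"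
   unfolding prod.case by (simp only:) (intro integrable_mult_left integrable_norm ik(1))
  show "AE s in lborel. lintegrable (\<lambda>t. case (s, t) of (s, t) => \<Phi> s t)" using i2 by simp
 qed
 note int = this
 have eq: "(\<integral>s. \<Phi> s t) = fconv \<alpha> f t * E t" for t
  unfolding \<Phi>_def fconv_def by (rule integral_mult_left_zero)
 show "lintegrable (\<lambda>t. fconv \<alpha> f t * exp (- (p * of_real t)))"
  using lborel_pair.integrable_snd[OF int] by (simp add: eq E_def)
 have "(\<integral>t. fconv \<alpha> f t * E t) = (\<integral>s. (\<integral>t. \<Phi> s t))"
  using lborel_pair.Fubini_integral[OF int] by (simp add: eq)
 also have "\<dots> = (\<integral>s. (frac_ker \<alpha> s *\<^sub>R E s) * (\<integral>t. f t * E t))"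
  unfolding \<Phi> using tr[OF fE] by simp
 also have "\<dots> = p powr of_real (\<alpha> - 2) * (\<integral>t. f t * E t)"
  by (simp only: integral_mult_left_zero ik(2))
 finally show "(\<integral>t. fconv \<alpha> f t * exp (- (p * of_real t))) = p powr of_real (\<alpha> - 2) * (\<integral>t. f t * exp (- (p * of_real t)))"
  by (simp add: E_def)
qed

lemma fconv_reflect: "fconv \<alpha> f t = (\<integral>r. frac_ker \<alpha> (t - r) *\<^sub>R f r)"
 unfolding fconv_def using lborel_integral_real_affine[of "-1" "\<lambda>s. frac_ker \<alpha> s *\<^sub>R f (t - s)" t] by simp

text \<open>Up to time \<open>2 b\<close> the mass of the kernel gives the bound; later the support
  of \<open>f\<close> is at distance at least \<open>b\<close>, where the decreasing kernel is at
  most \<open>frac_ker \<alpha> b\<close>.\<close>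

lemma fconv_bounded:
 fixes f :: "real => 'v::{banach, second_countable_topology}"
 assumes f: "cts f" "\<And>t. t \<notin> {0..b} ==> f t = 0" "f 0 = 0" "\<And>t. norm (f t) \<le> B" and b: "0 < b"
 shows "norm (fconv \<alpha> f t) \<le> B * (frac_mass \<alpha> (2 * b) + frac_ker \<alpha> b * b)"
proof -
 have B: "0 \<le> B" using f(4)[of 0] norm_ge_zero[of "f 0"] by linarith
 have f0: "f t = 0" if "t \<le> 0" for t using f(2)[of t] f(3) that by (cases "t = 0") auto
 show ?thesis
 proof (cases "t \<le> 2 * b")
  case True
  have "norm (fconv \<alpha> f t) \<le> B * frac_mass \<alpha> t" by (rule fconv_norm_le) (use f0 f(4) in auto)
  also have "frac_mass \<alpha> t \<le> frac_mass \<alpha> (2 * b)" unfolding frac_mass_def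
   by (rule integral_mono)
    (use frac_ker_integrable_Icc[OF \<alpha>] True frac_ker_nonneg[OF \<alpha>] in \<open>auto simp: indicator_def\<close>)
  finally have "norm (fconv \<alpha> f t) \<le> B * frac_mass \<alpha> (2 * b)" using B by (simp add: mult_left_mono)
  moreover have "0 \<le> B * (frac_ker \<alpha> b * b)" using B b frac_ker_nonneg[OF \<alpha>, of b] by simp
  ultimately show ?thesis by (simp add: distrib_left)
 next
  case False
  have "norm (fconv \<alpha> f t) \<le> (\<integral>r. norm (frac_ker \<alpha> (t - r) *\<^sub>R f r))"
   unfolding fconv_reflect by (rule integral_norm_bound)
  also have "\<dots> \<le> (\<integral>r. (frac_ker \<alpha> b * B) * indicator {0..b} r)"
  proof (rule integral_mono')
   show "lintegrable (\<lambda>r. (frac_ker \<alpha> b * B) * indicator {0..b} r)"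
    by (rule integrable_indicator_compact[OF compact_Icc])
   fix r :: real
   show "0 \<le> (frac_ker \<alpha> b * B) * indicator {0..b} r" using B frac_ker_nonneg[OF \<alpha>] by simp
   show "norm (frac_ker \<alpha> (t - r) *\<^sub>R f r) \<le> (frac_ker \<alpha> b * B) * indicator {0..b} r"
   proof (cases "r \<in> {0..b}")
    case True
    then have "frac_ker \<alpha> (t - r) \<le> frac_ker \<alpha> b" using False b by (intro frac_ker_antimono[OF \<alpha>]) auto
    then have "frac_ker \<alpha> (t - r) * norm (f r) \<le> frac_ker \<alpha> b * B"
     by (intro mult_mono f(4) frac_ker_nonneg[OF \<alpha>]) auto
    then show ?thesis using True frac_ker_nonneg[OF \<alpha>, of "t - r"] by simp
   qed (use f(2) in simp)
  qed
  also have "\<dots> = frac_ker \<alpha> b * B * b" using b by simp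
  also have "\<dots> \<le> B * (frac_mass \<alpha> (2 * b) + frac_ker \<alpha> b * b)"
   using mult_nonneg_nonneg[OF B frac_mass_nonneg[of "2 * b"]] by (simp add: algebra_simps)
  finally show ?thesis .
 qed
qed

text \<open>The Lipschitz factor \<open>\<theta> t - \<theta> r\<close> cancels one power of the
  singularity of the kernel. The time derivative of the product is then at most
  \<open>\<alpha> C / Gamma (2 - \<alpha>)\<close> times \<open>(t - r) powr (1 - \<alpha>)\<close>,
  where \<open>\<alpha>\<close> is \<open>(\<alpha> - 1) + 1\<close> from the product rule, and the
  right-hand side is the integral of this bound.\<close>

lemma kernel_increment:
 fixes \<theta> :: "real => real"
 assumes d: "\<And>t. (\<theta> has_real_derivative \<theta>' t) (at t)" and C: "\<And>t. \<bar>\<theta>' t\<bar> \<le> C" and tt: "t \<le> t'"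
 shows "\<bar>frac_ker \<alpha> (t' - r) * (\<theta> t' - \<theta> r) - frac_ker \<alpha> (t - r) * (\<theta> t - \<theta> r)\<bar>
  \<le> \<alpha> * C / (Gamma (2 - \<alpha>) * (2 - \<alpha>)) * (max 0 (t' - r) powr (2 - \<alpha>) - max 0 (t - r) powr (2 - \<alpha>))"
proof -
 define A where "A = \<alpha> * C / (Gamma (2 - \<alpha>) * (2 - \<alpha>))"
 define G where "G = Gamma (2 - \<alpha>)"
 have G: "0 < G" using Gamma_pos[OF \<alpha>] by (simp add: G_def)
 have C0: "0 \<le> C" using C[of 0] by simp
 have lip: "\<bar>\<theta> x - \<theta> y\<bar> \<le> C * \<bar>x - y\<bar>" for x y
  using vector_derivative_bound_difference[of y x \<theta> \<theta>' C] d C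
  by (simp add: real_derivative_iff)
 consider "t' \<le> r" | "t \<le> r" "r < t'" | "r < t" by linarith
 then have "\<bar>frac_ker \<alpha> (t' - r) * (\<theta> t' - \<theta> r) - frac_ker \<alpha> (t - r) * (\<theta> t - \<theta> r)\<bar>
  \<le> A * (max 0 (t' - r) powr (2 - \<alpha>) - max 0 (t - r) powr (2 - \<alpha>))"
 proof cases
  case 1 then show ?thesis using tt by (simp add: frac_ker_def)
 next
  case 2
  have "frac_ker \<alpha> (t' - r) * \<bar>\<theta> t' - \<theta> r\<bar> \<le> (t' - r) powr (1 - \<alpha>) / G * (C * (t' - r))"
   using 2 lip[of t' r] G by (simp add: frac_ker_def G_def divide_right_mono mult_left_mono)
  also have "\<dots> = C / G * ((t' - r) powr (1 - \<alpha>) * (t' - r) powr 1)" using 2 by simp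
  also have "\<dots> = C / G * (t' - r) powr (2 - \<alpha>)" by (simp only: powr_add[symmetric]) simp
  also have "\<dots> \<le> A * (t' - r) powr (2 - \<alpha>)"
  proof (intro mult_right_mono)
   have "C * (2 - \<alpha>) \<le> \<alpha> * C" using mult_right_mono[of "2 - \<alpha>" \<alpha> C] \<alpha> C0 by (simp add: mult.commute)
   then have "C \<le> \<alpha> * C / (2 - \<alpha>)" using \<alpha> by (simp add: pos_le_divide_eq)
   then have "C / G \<le> \<alpha> * C / (2 - \<alpha>) / G" using G by (intro divide_right_mono) simp_all
   then show "C / G \<le> A" by (simp add: A_def G_def[symmetric] mult.commute)
  qed auto
  finally show ?thesis using 2 frac_ker_nonneg[OF \<alpha>, of "t' - r"] by (simp add: frac_ker_def[of _ "t - r"] abs_mult)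
 next
  case 3
  define k where "k x = (x - r) powr (1 - \<alpha>) / G * (\<theta> x - \<theta> r)" for x
  define k' where "k' x = (1 - \<alpha>) * (x - r) powr (- \<alpha>) / G * (\<theta> x - \<theta> r) + (x - r) powr (1 - \<alpha>) / G * \<theta>' x" for x
  define g where "g x = A * (x - r) powr (2 - \<alpha>)" for x
  have dk: "(k has_real_derivative k' x) (at x)" if "r < x" for x
  proof -
   have "((\<lambda>x. (x - r) powr (1 - \<alpha>) / G) has_real_derivative (1 - \<alpha>) * (x - r) powr (- \<alpha>) / G) (at x)"
    using DERIV_affine_arg[of "\<lambda>s. s powr (1 - \<alpha>)" "(1 - \<alpha>) * (x - r) powr (- \<alpha>)" "- r" 1 x] has_real_derivative_powr[of "x - r" "1 - \<alpha>"] that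
    by (intro DERIV_cdivide) simp
   from DERIV_mult[OF this DERIV_diff[OF d[of x] DERIV_const[of "\<theta> r"]]]
   show ?thesis by (simp add: k_def[abs_def] k'_def algebra_simps)
  qed
  have dg: "(g has_real_derivative \<alpha> * C / G * (x - r) powr (1 - \<alpha>)) (at x)" if "r < x" for x
  proof -
   have "(g has_real_derivative A * ((2 - \<alpha>) * (x - r) powr (1 - \<alpha>))) (at x)"
    unfolding g_def using DERIV_affine_arg[of "\<lambda>s. s powr (2 - \<alpha>)" "(2 - \<alpha>) * (x - r) powr (1 - \<alpha>)" "- r" 1 x] has_real_derivative_powr[of "x - r" "2 - \<alpha>"] that
    by (intro DERIV_cmult) simp
   moreover have "A * (2 - \<alpha>) = \<alpha> * C / G" using \<alpha> by (simp add: A_def G_def)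
   ultimately show ?thesis by (simp add: mult.assoc[symmetric])
  qed
  have kb: "\<bar>k' x\<bar> \<le> \<alpha> * C / G * (x - r) powr (1 - \<alpha>)" if "r < x" for x
  proof -
   have "\<bar>(1 - \<alpha>) * (x - r) powr (- \<alpha>) / G * (\<theta> x - \<theta> r)\<bar> = (\<alpha> - 1) * (x - r) powr (- \<alpha>) / G * \<bar>\<theta> x - \<theta> r\<bar>"
    using \<alpha> G by (simp add: abs_mult)
   also have "\<dots> \<le> (\<alpha> - 1) * (x - r) powr (- \<alpha>) / G * (C * (x - r))"
    using lip[of x r] \<alpha> G that by (intro mult_left_mono) auto
   also have "\<dots> = (\<alpha> - 1) * C / G * ((x - r) powr (- \<alpha>) * (x - r) powr 1)" using that by simp
   also have "\<dots> = (\<alpha> - 1) * C / G * (x - r) powr (1 - \<alpha>)" by (simp only: powr_add[symmetric]) simp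
   finally have 1: "\<bar>(1 - \<alpha>) * (x - r) powr (- \<alpha>) / G * (\<theta> x - \<theta> r)\<bar> \<le> (\<alpha> - 1) * C / G * (x - r) powr (1 - \<alpha>)" .
   have "\<bar>(x - r) powr (1 - \<alpha>) / G * \<theta>' x\<bar> = (x - r) powr (1 - \<alpha>) / G * \<bar>\<theta>' x\<bar>" using G by (simp add: abs_mult)
   also have "\<dots> \<le> (x - r) powr (1 - \<alpha>) / G * C" using C[of x] G by (intro mult_left_mono) auto
   finally have 2: "\<bar>(x - r) powr (1 - \<alpha>) / G * \<theta>' x\<bar> \<le> (x - r) powr (1 - \<alpha>) / G * C" .
   have "(\<alpha> - 1) * C / G * (x - r) powr (1 - \<alpha>) + (x - r) powr (1 - \<alpha>) / G * C = \<alpha> * C / G * (x - r) powr (1 - \<alpha>)"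
    using G by (simp add: field_simps)
   then show ?thesis unfolding k'_def using order_trans[OF abs_triangle_ineq add_mono[OF 1 2]] by simp
  qed
  \<comment> \<open>Both \<open>g - k\<close> and \<open>g + k\<close> are nondecreasing, since
    \<open>|k'|\<close> is at most the derivative of \<open>g\<close>; together this bounds the
    increment of \<open>k\<close> by that of \<open>g\<close>.\<close>
  have "g t - k t \<le> g t' - k t'"
  proof (rule DERIV_nonneg_imp_nondecreasing[OF tt])
   fix x assume "t \<le> x" "x \<le> t'"
   then have x: "r < x" using 3 by simp
   show "\<exists>y. ((\<lambda>x. g x - k x) has_real_derivative y) (at x) \<and> 0 \<le> y"
    using DERIV_diff[OF dg[OF x] dk[OF x]] kb[OF x] by (intro exI conjI) (assumption, simp add: abs_le_iff)
  qed
  moreover have "g t + k t \<le> g t' + k t'"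
  proof (rule DERIV_nonneg_imp_nondecreasing[OF tt])
   fix x assume "t \<le> x" "x \<le> t'"
   then have x: "r < x" using 3 by simp
   show "\<exists>y. ((\<lambda>x. g x + k x) has_real_derivative y) (at x) \<and> 0 \<le> y"
    using DERIV_add[OF dg[OF x] dk[OF x]] kb[OF x] by (intro exI conjI) (assumption, simp add: abs_le_iff)
  qed
  moreover have "frac_ker \<alpha> (x - r) * (\<theta> x - \<theta> r) = k x" "A * max 0 (x - r) powr (2 - \<alpha>) = g x" if "r < x" for x
   using that by (simp_all add: frac_ker_def k_def g_def G_def)
  ultimately show ?thesis using 3 tt by (simp add: right_diff_distrib abs_le_iff)
 qed
 then show ?thesis by (simp only: A_def)
qed

text \<open>Integrating in \<open>r\<close> gives differences of the primitive \<open>H\<close>.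
  With \<open>c = 2 - \<alpha>\<close> their derivative in time is
  \<open>max 0 t powr c - max 0 (t - T) powr c\<close>, which is at most \<open>T powr c\<close> by
  subadditivity of the power.\<close>

lemma pos_part_powr_increment:
 assumes T: "0 < T" and tt: "t \<le> t'"
 shows "(\<integral>r. indicator {0..T} r *\<^sub>R (max 0 (t' - r) powr (2 - \<alpha>) - max 0 (t - r) powr (2 - \<alpha>))) \<le> T powr (2 - \<alpha>) * (t' - t)"
proof -
 define c where "c = 2 - \<alpha>"
 have c: "0 < c" "c < 1" using \<alpha> by (auto simp: c_def)
 define H where "H x = max 0 x powr (c + 1) / (c + 1)" for x :: real
 have dH: "(H has_real_derivative max 0 x powr c) (at x)" for x
  using DERIV_cdivide[OF DERIV_pos_part_powr[of "c + 1" x], of "c + 1"] c by (simp add: H_def[abs_def])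
 have cg: "continuous_on S (\<lambda>r. max 0 (x - r) powr c)" for x and S :: "real set"
  using c by (intro continuous_on_powr' continuous_intros) auto
 have I: "(\<integral>r. indicator {0..T} r *\<^sub>R max 0 (x - r) powr c) = H x - H (x - T)" for x
 proof -
  have "(\<integral>r. indicator {0..T} r *\<^sub>R max 0 (x - r) powr c) = - H (x - T) - - H (x - 0)"
  proof (rule integral_FTC_Icc)
   fix r
   have "((\<lambda>r. - H (x - r)) has_real_derivative max 0 (x - r) powr c) (at r)"
    using DERIV_minus[OF DERIV_affine_arg[of H "max 0 (x - r) powr c" x "-1" r]] dH[of "x - r"] by simp
   then show "((\<lambda>r. - H (x - r)) has_vector_derivative max 0 (x - r) powr c) (at r within {0..T})"
    by (simp add: real_derivative_iff has_vector_derivative_at_within)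
  qed (use T cg in auto)
  then show ?thesis by simp
 qed
 have ii: "lintegrable (\<lambda>r. indicator {0..T} r *\<^sub>R max 0 (x - r) powr c)" for x
  using borel_integrable_atLeastAtMost'[OF cg[of _ x]] by (simp add: set_integrable_def)
 have "(\<integral>r. indicator {0..T} r *\<^sub>R (max 0 (t' - r) powr c - max 0 (t - r) powr c))
  = (H t' - H (t' - T)) - (H t - H (t - T))"
  unfolding scaleR_diff_right by (subst integral_diff[OF ii ii]) (simp only: I)
 also have "\<dots> \<le> T powr c * (t' - t)"
 proof -
  have "T powr c * t - (H t - H (t - T)) \<le> T powr c * t' - (H t' - H (t' - T))"
  proof (rule DERIV_nonneg_imp_nondecreasing[OF tt])
   fix x
   have "((\<lambda>x. H (x - T)) has_real_derivative max 0 (x - T) powr c) (at x)"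
    using DERIV_affine_arg[of H "max 0 (x - T) powr c" "- T" 1 x] dH[of "x - T"] by simp
   then have "((\<lambda>x. T powr c * x - (H x - H (x - T))) has_real_derivative T powr c - (max 0 x powr c - max 0 (x - T) powr c)) (at x)"
    using dH[of x] by (auto intro!: derivative_eq_intros)
   moreover have "max 0 x powr c \<le> max 0 (x - T) powr c + T powr c"
   proof (cases "x \<le> T")
    case True
    then have "max 0 x powr c \<le> T powr c" using T c by (intro powr_mono2) auto
    then show ?thesis using True by simp
   next
    case False
    then show ?thesis using powr_subadditive[of "x - T" T c] c T by simp
   qed
   ultimately show "\<exists>y. ((\<lambda>x. T powr c * x - (H x - H (x - T))) has_real_derivative y) (at x) \<and> 0 \<le> y"
    by (intro exI conjI) (assumption, simp)
  qed
  then show ?thesis by (simp add: algebra_simps)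
 qed
 finally show ?thesis by (simp add: c_def)
qed

text \<open>The commutator of multiplication by \<open>\<theta>\<close> and fractional integration
  gains regularity: it is Lipschitz in time even though neither of its two terms need be. This keeps
  the error of the cut-off square summable after multiplication by the frequency.\<close>

lemma commutator_lipschitz:
 fixes \<theta> :: "real => real"
 assumes d: "\<And>t. (\<theta> has_real_derivative \<theta>' t) (at t)" and C: "\<And>t. \<bar>\<theta>' t\<bar> \<le> C"
  and \<theta>0: "\<And>t. t > T ==> \<theta> t = 0" and T: "0 < T"
  and V: "cts V" "\<And>t. t \<le> 0 ==> V t = 0" "\<And>t. t \<le> T ==> \<bar>V t\<bar> \<le> (B::real)"
 shows "\<bar>(\<theta> t' * fconv \<alpha> V t' - fconv \<alpha> (\<lambda>t. \<theta> t * V t) t') - (\<theta> t * fconv \<alpha> V t - fconv \<alpha> (\<lambda>t. \<theta> t * V t) t)\<bar>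
  \<le> \<alpha> * C / (Gamma (2 - \<alpha>) * (2 - \<alpha>)) * B * T powr (2 - \<alpha>) * \<bar>t' - t\<bar>"
proof -
 define A where "A = \<alpha> * C / (Gamma (2 - \<alpha>) * (2 - \<alpha>))"
 have C0: "0 \<le> C" using C[of 0] by simp
 have B0: "0 \<le> B" using V(3)[of 0] T by simp
 have A0: "0 \<le> A" using Gamma_pos[OF \<alpha>] \<alpha> C0 by (simp add: A_def)
 have \<theta>c: "cts \<theta>" using d by (rule DERIV_continuous_on[OF has_field_derivative_at_within])
 define \<kappa> where "\<kappa> t r = frac_ker \<alpha> (t - r) * (\<theta> t - \<theta> r)" for t r
 define P where "P t = \<theta> t * fconv \<alpha> V t - fconv \<alpha> (\<lambda>t. \<theta> t * V t) t" for t
 have refl_int: "lintegrable (\<lambda>r. frac_ker \<alpha> (t - r) *\<^sub>R f r)"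
  if "cts f" "\<And>t. t \<le> 0 ==> f t = 0" for f :: "real => real" and t
  using lborel_integrable_real_affine[OF fconv_integrable[OF that, of t], of "-1" t] by simp
 have i1: "lintegrable (\<lambda>r. frac_ker \<alpha> (t - r) *\<^sub>R V r)" for t by (rule refl_int) (use V in auto)
 have i2: "lintegrable (\<lambda>r. frac_ker \<alpha> (t - r) *\<^sub>R (\<theta> r * V r))" for t
  by (rule refl_int) (use V \<theta>c in \<open>auto intro!: continuous_intros\<close>)
 \<comment> \<open>Outside \<open>[0, T]\<close> both sides vanish: for \<open>r < 0\<close> because
   of \<open>V\<close>, for \<open>r > T\<close> because the kernel only sees \<open>t > r\<close>,
   where \<open>\<theta>\<close> is zero.\<close>
 have eq: "\<theta> t * (frac_ker \<alpha> (t - r) *\<^sub>R V r) - frac_ker \<alpha> (t - r) *\<^sub>R (\<theta> r * V r) = indicator {0..T} r *\<^sub>R (\<kappa> t r * V r)" for t r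
 proof (cases "r \<in> {0..T}")
  case True then show ?thesis by (simp add: \<kappa>_def algebra_simps)
 next
  case False
  then consider "r < 0" | "T < r" by force
  then show ?thesis
  proof cases
   case 1 then show ?thesis using V(2)[of r] by simp
  next
   case 2
   then have "frac_ker \<alpha> (t - r) * \<theta> t = 0" using \<theta>0[of t] by (cases "r < t") (auto simp: frac_ker_def)
   then show ?thesis using 2 \<theta>0[of r] by (auto simp: indicator_def)
  qed
 qed
 have Pi: "lintegrable (\<lambda>r. indicator {0..T} r *\<^sub>R (\<kappa> t r * V r))" for t
  unfolding eq[symmetric] using i1[of t] i2[of t] by auto
 have P: "P t = (\<integral>r. indicator {0..T} r *\<^sub>R (\<kappa> t r * V r))" for t
  unfolding eq[symmetric] P_def fconv_reflect using i1[of t] i2[of t] by simp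
 have main: "\<bar>P t' - P t\<bar> \<le> A * B * T powr (2 - \<alpha>) * (t' - t)" if tt: "t \<le> t'" for t t'
 proof -
  define h where "h r = max 0 (t' - r) powr (2 - \<alpha>) - max 0 (t - r) powr (2 - \<alpha>)" for r
  have ch: "continuous_on S h" for S
   unfolding h_def using \<alpha> by (intro continuous_on_diff continuous_on_powr' continuous_intros) auto
  have hi: "lintegrable (\<lambda>r. indicator {0..T} r *\<^sub>R h r)"
   using borel_integrable_atLeastAtMost'[OF ch] by (simp add: set_integrable_def)
  have "P t' - P t = (\<integral>r. indicator {0..T} r *\<^sub>R (\<kappa> t' r * V r) - indicator {0..T} r *\<^sub>R (\<kappa> t r * V r))"
   unfolding P using Pi by (intro integral_diff[symmetric])
  then have "\<bar>P t' - P t\<bar> \<le> (\<integral>r. norm (indicator {0..T} r *\<^sub>R (\<kappa> t' r * V r) - indicator {0..T} r *\<^sub>R (\<kappa> t r * V r)))"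
   using integral_norm_bound[of lborel "\<lambda>r. indicator {0..T} r *\<^sub>R (\<kappa> t' r * V r) - indicator {0..T} r *\<^sub>R (\<kappa> t r * V r)"] by simp
  also have "\<dots> \<le> (\<integral>r. (A * B) * (indicator {0..T} r *\<^sub>R h r))"
  proof (rule integral_mono)
   fix r
   show "norm (indicator {0..T} r *\<^sub>R (\<kappa> t' r * V r) - indicator {0..T} r *\<^sub>R (\<kappa> t r * V r)) \<le> (A * B) * (indicator {0..T} r *\<^sub>R h r)"
   proof (cases "r \<in> {0..T}")
    case True
    have "\<bar>\<kappa> t' r - \<kappa> t r\<bar> * \<bar>V r\<bar> \<le> (A * h r) * B"
     using kernel_increment[OF d C tt, of r] V(3)[of r] True
     by (intro mult_mono) (auto simp: \<kappa>_def A_def h_def intro: order_trans[OF abs_ge_zero])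
    moreover have "\<kappa> t' r * V r - \<kappa> t r * V r = (\<kappa> t' r - \<kappa> t r) * V r" by (simp add: algebra_simps)
    ultimately show ?thesis using True by (simp add: abs_mult ac_simps)
   qed simp
  qed (use Pi hi in auto)
  also have "\<dots> = (A * B) * (\<integral>r. indicator {0..T} r *\<^sub>R h r)" by simp
  also have "\<dots> \<le> (A * B) * (T powr (2 - \<alpha>) * (t' - t))"
   using pos_part_powr_increment[OF T tt] A0 B0 by (intro mult_left_mono) (auto simp: h_def)
  finally show ?thesis by (simp add: mult.assoc)
 qed
 show ?thesis unfolding A_def[symmetric] P_def[symmetric]
  using main[of t t'] main[of t' t] by (cases "t \<le> t'") (auto simp: abs_minus_commute)
qed

end

section \<open>Integrals depending on a parameter\<close>

lemma continuous_param_integral_compact: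
 fixes F :: "'x::heine_borel => 'y::euclidean_space => 'v::{banach, second_countable_topology}"
 assumes F: "cts2 F" and K: "compact K" "\<And>t x. x \<notin> K ==> F t x = 0"
 shows "cts (\<lambda>t. \<integral>x. F t x)"
proof (rule continuous_on_integral_dominated)
 have cx: "cts (\<lambda>x. F t x)" for t
 proof -
  have "cts (\<lambda>x. (t, x))" by (intro continuous_intros)
  from continuous_on_compose2[OF F(1) this] show ?thesis by simp
 qed
 show "(\<lambda>x. F t x) \<in> borel_measurable lborel" for t
  using borel_measurable_continuous_onI[OF cx] by simp
 show "cts (\<lambda>t. F t x)" for x
 proof -
  have "cts (\<lambda>t. (t, x))" by (intro continuous_intros)
  from continuous_on_compose2[OF F(1) this] show ?thesis by simp
 qed
 fix s :: "nat => 'x" and t assume s: "s \<longlonglongrightarrow> t"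
 have C: "compact (insert t (range s))" by (rule compact_sequence_with_limit[OF s])
 obtain B where B: "0 < B" "\<And>p. p \<in> insert t (range s) \<times> K ==> norm (F (fst p) (snd p)) \<le> B"
  using compact_image_bound[OF compact_Times[OF C K(1)] continuous_on_subset[OF F(1) subset_UNIV]] by blast
 show "\<exists>g. lintegrable g \<and> (\<forall>n. \<forall>x\<in>space lborel. norm (F (s n) x) \<le> g x)"
 proof (intro exI conjI allI ballI)
  show "lintegrable (\<lambda>x. B * indicator K x)" by (rule integrable_indicator_compact[OF K(1)])
  fix n x show "norm (F (s n) x) \<le> B * indicator K x"
   using B(2)[of "(s n, x)"] K(2)[of x "s n"] by (cases "x \<in> K") auto
 qed
qed

lemma continuous_param_integral:
 fixes F :: "real => 'x::heine_borel => 'v::{banach, second_countable_topology}"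
 assumes F: "cts2 F" "\<And>t x. t \<notin> {lo..hi} ==> F t x = 0"
 shows "cts (\<lambda>x. \<integral>t. F t x)"
proof (rule continuous_param_integral_compact[OF _ compact_Icc F(2)])
 have "cts (\<lambda>p :: 'x \<times> real. (snd p, fst p))" by (intro continuous_intros)
 from continuous_on_compose2[OF F(1) this] show "cts (\<lambda>p. F (snd p) (fst p))" by simp
qed

lemma pderiv_param_integral:
 fixes F :: "real => real^'n::finite => 'v::{banach, second_countable_topology}"
 assumes F: "cts2 F" "\<And>t x. t \<notin> {lo..hi} ==> F t x = 0"
  and dF: "cts2 dF" "\<And>t x. t \<notin> {lo..hi} ==> dF t x = 0"
  and p: "\<And>t. pderiv_on (F t) k (dF t)"
 shows "pderiv_on (\<lambda>x. \<integral>t. F t x) k (\<lambda>x. \<integral>t. dF t x)"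
 unfolding pderiv_on_def
proof
 fix x :: "real^'n"
 obtain B where B: "0 < B" "\<And>p. p \<in> {lo..hi} \<times> cball x 1 ==> norm (dF (fst p) (snd p)) \<le> B"
  using compact_image_bound[OF compact_Times[OF compact_Icc compact_cball] continuous_on_subset[OF dF(1) subset_UNIV]] by blast
 have "((\<lambda>s. \<integral>t. F t (x + s *\<^sub>R axis k 1)) has_vector_derivative (\<integral>t. dF t (x + 0 *\<^sub>R axis k 1))) (at 0)"
 proof (rule has_vector_derivative_integral[where r = 1 and g = "\<lambda>t. B * indicator {lo..hi} t"])
  show "lintegrable (\<lambda>t. B * indicator {lo..hi} t)" by (rule integrable_indicator_compact[OF compact_Icc])
  fix s :: real
  show "lintegrable (\<lambda>t. F t (x + s *\<^sub>R axis k 1))"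
  proof (rule integrable_compact_support[OF _ compact_Icc])
   have "cts (\<lambda>t. (t, x + s *\<^sub>R axis k 1))" by (intro continuous_intros)
   from continuous_on_compose2[OF F(1) this] show "cts (\<lambda>t. F t (x + s *\<^sub>R axis k 1))" by simp
  qed (rule F(2))
  fix t
  show "((\<lambda>s. F t (x + s *\<^sub>R axis k 1)) has_vector_derivative dF t (x + s *\<^sub>R axis k 1)) (at s)"
   by (rule pderiv_line[OF p])
  assume "\<bar>s - 0\<bar> < 1"
  then have "x + s *\<^sub>R axis k 1 \<in> cball x 1" by (simp add: dist_norm)
  then show "norm (dF t (x + s *\<^sub>R axis k 1)) \<le> B * indicator {lo..hi} t"
   using B(2)[of "(t, x + s *\<^sub>R axis k 1)"] dF(2)[of t] by (cases "t \<in> {lo..hi}") auto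
 qed simp
 then show "((\<lambda>s. \<integral>t. F t (x + s *\<^sub>R axis k 1)) has_vector_derivative (\<integral>t. dF t x)) (at 0)" by simp
qed

text \<open>The fractional derivative is known only on the open interval \<open>(0, T)\<close>; a
  cut-off supported inside makes its multiples continuous on the whole line.\<close>

lemma continuous_extend_zero:
 fixes f :: "real => 'v::real_normed_vector"
 assumes "continuous_on {0<..<T} f" "\<And>t. t \<notin> {lo..hi} ==> f t = 0" "0 < lo" "hi < T"
 shows "cts f"
proof -
 have "continuous_on (- {lo..hi}) f"
  using continuous_on_cong[of "- {lo..hi}" "- {lo..hi}" f "\<lambda>_. 0"] assms(2) by (simp add: continuous_on_const)
 then have "continuous_on ({0<..<T} \<union> - {lo..hi}) f"
  by (intro continuous_on_open_Un assms(1)) (auto intro: open_Compl)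
 moreover have "{0<..<T} \<union> - {lo..hi} = UNIV" using assms(3,4) by auto
 ultimately show ?thesis by simp
qed

lemma has_vector_derivative_extend_zero:
 fixes f :: "real => 'v::real_normed_vector"
 assumes "\<And>t. 0 < t ==> t < T ==> (f has_vector_derivative f' t) (at t)"
  "\<And>t. t \<notin> {lo..hi} ==> f t = 0" "\<And>t. t \<notin> {lo..hi} ==> f' t = 0" "0 < lo" "hi < T"
 shows "(f has_vector_derivative f' t) (at t)"
proof (cases "t \<in> {lo..hi}")
 case True then show ?thesis using assms(1,4,5) by simp
next
 case False
 have "(f has_vector_derivative 0) (at t)"
  by (rule has_vector_derivative_transform_within_open[where f = "\<lambda>_. 0" and S = "- {lo..hi}"])
   (use False assms(2) in \<open>auto intro: open_Compl\<close>)
 then show ?thesis using assms(3)[OF False] by simp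
qed

lemma integral_derivative_eq_0:
 fixes f :: "real => complex"
 assumes d: "\<And>t. (f has_vector_derivative f' t) (at t)" and c: "cts f'"
  and z: "\<And>t. t \<notin> {lo..hi} ==> f t = 0" "\<And>t. t \<notin> {lo..hi} ==> f' t = 0"
 shows "(\<integral>t. f' t) = 0"
proof -
 have "(\<integral>t. f' t) = (\<integral>t. indicator {lo - 1..max lo hi + 1} t *\<^sub>R f' t)"
  by (intro integral_cong refl) (use z(2) in \<open>force simp: indicator_def\<close>)
 also have "\<dots> = f (max lo hi + 1) - f (lo - 1)"
  by (rule integral_FTC_Icc) (use d c in \<open>auto intro: has_vector_derivative_at_within continuous_on_subset\<close>)
 also have "f (max lo hi + 1) = 0" by (rule z(1)) auto
 also have "f (lo - 1) = 0" by (rule z(1)) auto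
 finally show ?thesis by simp
qed

text \<open>Formally these are the coefficients of the derivative of \<open>L\<close>, which is
  bounded by \<open>C\<close>. Instead of differentiating almost everywhere, Bessel's inequality is
  applied to the difference quotients of step \<open>h\<close>; their coefficients carry the factor
  \<open>(1 - exp (- p h)) / h\<close>, which tends to the frequency \<open>p\<close>.\<close>

lemma Bessel_lipschitz:
 fixes L :: "real => complex"
 assumes T: "0 < T" and F: "finite F" and lip: "\<And>s t. norm (L t - L s) \<le> C * \<bar>t - s\<bar>" and L0: "\<And>t. t \<le> 0 ==> L t = 0"
  and int: "\<And>j. lintegrable (\<lambda>t. L t * exp (- (freq T j * of_real t)))"
 shows "(\<Sum>j\<in>F. (norm (freq T j * (\<integral>t. L t * exp (- (freq T j * of_real t)))))\<^sup>2) \<le> C\<^sup>2 * (2 * T / (1 - exp (- 2 * T)))"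
proof -
 define E where "E j t = exp (- (freq T j * of_real t))" for j and t :: real
 define I where "I j = (\<integral>t. L t * E j t)" for j
 have Lc: "cts L"
 proof (rule continuous_at_imp_continuous_on, rule ballI)
  fix t
  have "((\<lambda>s. norm (L s - L t)) \<longlongrightarrow> 0) (at t)"
  proof (rule Lim_null_comparison)
   show "\<forall>\<^sub>F s in at t. norm (norm (L s - L t)) \<le> C * \<bar>s - t\<bar>" using lip by simp
   have "((\<lambda>s. C * \<bar>s - t\<bar>) \<longlongrightarrow> C * \<bar>t - t\<bar>) (at t)" by (intro tendsto_intros)
   then show "((\<lambda>s. C * \<bar>s - t\<bar>) \<longlongrightarrow> 0) (at t)" by simp
  qed
  then show "isCont L t" by (simp add: isCont_def LIM_zero_iff tendsto_norm_zero_iff)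
 qed
 have step: "(\<Sum>j\<in>F. (norm ((1 - exp (- (freq T j * of_real h))) / of_real h * I j))\<^sup>2) \<le> C\<^sup>2 * (2 * T / (1 - exp (- 2 * T)))"
  if h: "0 < h" for h :: real
 proof -
  define B where "B t = (L t - L (t - h)) / of_real h" for t
  have BI: "(\<integral>t. B t * E j t) = (1 - exp (- (freq T j * of_real h))) / of_real h * I j" for j
  proof -
   have sh: "L (t - h) * E j t = exp (- (freq T j * of_real h)) * (L (t - h) * E j (t - h))" for t
   proof -
    have "- (freq T j * of_real t) = - (freq T j * of_real h) + - (freq T j * of_real (t - h))" by (simp add: algebra_simps)
    then have "E j t = exp (- (freq T j * of_real h)) * E j (t - h)" unfolding E_def by (simp only: exp_add)
    then show ?thesis by simp
   qed
   have i1: "lintegrable (\<lambda>t. L (t - h) * E j (t - h))" "(\<integral>t. L (t - h) * E j (t - h)) = I j"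
    using lborel_integrable_real_affine[OF int[of j], of 1 "-h"] lborel_integral_real_affine[of 1 "\<lambda>t. L t * E j t" "-h"]
    by (simp_all add: E_def I_def)
   have "(\<integral>t. B t * E j t) = (\<integral>t. (1 / of_real h) * (L t * E j t) - (1 / of_real h) * (exp (- (freq T j * of_real h)) * (L (t - h) * E j (t - h))))"
    by (intro integral_cong refl) (simp add: B_def sh[symmetric] diff_divide_distrib left_diff_distrib)
   also have "\<dots> = (1 / of_real h) * I j - (1 / of_real h) * (exp (- (freq T j * of_real h)) * I j)"
    using int[of j] i1 by (subst integral_diff) (simp_all add: E_def I_def)
   also have "\<dots> = (1 - exp (- (freq T j * of_real h))) / of_real h * I j" by (simp add: diff_divide_distrib left_diff_distrib)
   finally show ?thesis .
  qed
  have "(\<Sum>j\<in>F. (norm (\<integral>t. B t * E j t))\<^sup>2) \<le> C\<^sup>2 * (2 * T / (1 - exp (- 2 * T)))"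
   unfolding E_def
  proof (rule Bessel_half_line[OF T F])
   show "B \<in> borel_measurable borel" unfolding B_def
    by (intro borel_measurable_continuous_onI continuous_intros continuous_on_compose2[OF Lc]) (use h in auto)
   show "norm (B t) \<le> C" for t
   proof -
    have "norm (L t - L (t - h)) \<le> C * h" using lip[of t "t - h"] h by simp
    then show ?thesis using h by (simp add: B_def norm_divide divide_le_eq)
   qed
   show "B t = 0" if "t \<le> 0" for t using L0[OF that] L0[of "t - h"] that h by (simp add: B_def)
  qed
  then show ?thesis unfolding BI .
 qed
 define hn where "hn n = 1 / (real n + 1)" for n
 have hn: "0 < hn n" for n by (simp add: hn_def)
 have hl: "hn \<longlonglongrightarrow> 0" unfolding hn_def by real_asymp
 have lim: "(\<lambda>n. (1 - exp (- (p * of_real (hn n)))) / of_real (hn n)) \<longlonglongrightarrow> p" for p :: complex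
 proof -
  have "((\<lambda>w. exp (0 + of_real w * (- p))) has_vector_derivative (- p) * exp (0 + of_real 0 * (- p))) (at 0)"
   by (rule has_vector_derivative_exp_affine)
  from has_vector_derivative_seq[OF this, of hn] hl hn
  have "(\<lambda>n. (exp (- (p * of_real (hn n))) - 1) /\<^sub>R hn n) \<longlonglongrightarrow> - p"
   by (simp add: mult.commute less_imp_neq[symmetric])
  from tendsto_minus[OF this] show ?thesis
   by (simp add: scaleR_conv_of_real divide_inverse mult.commute right_diff_distrib)
 qed
 have "(\<lambda>n. \<Sum>j\<in>F. (norm ((1 - exp (- (freq T j * of_real (hn n)))) / of_real (hn n) * I j))\<^sup>2) \<longlonglongrightarrow> (\<Sum>j\<in>F. (norm (freq T j * I j))\<^sup>2)"
  by (intro tendsto_intros lim)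
 then have "(\<Sum>j\<in>F. (norm (freq T j * I j))\<^sup>2) \<le> C\<^sup>2 * (2 * T / (1 - exp (- 2 * T)))"
  by (rule LIMSEQ_le_const2) (use step hn in auto)
 then show ?thesis by (simp add: I_def E_def)
qed

section \<open>Solutions and their Fourier coefficients\<close>

text \<open>\<open>V\<close> is the time derivative of \<open>U\<close>, \<open>W\<close> its fractional derivative, \<open>UX k\<close> are the partial derivatives;
 \<open>U\<close> and \<open>V\<close> are extended by zero to negative times. \<open>bb\<close> is the drift left over when the operator is written in divergence form.\<close>

locale frac_data = elliptic_form a \<Lambda> \<delta>0 for a :: "'n::finite => 'n => real^'n => real" and \<Lambda> \<delta>0 :: real +
 fixes T \<alpha> :: real and U V W :: "real => real^'n => real" and UX :: "'n => real => real^'n => real"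
  and bb :: "'n => real^'n => real" and cc :: "real^'n => real"
 assumes T: "0 < T" and \<alpha>: "1 < \<alpha>" "\<alpha> < 2"
  and contU: "cts2 U"
  and contV: "cts2 V"
  and contUX: "\<And>k. cts2 (UX k)"
  and U0: "\<And>t x. t \<le> 0 ==> U t x = 0" and V0: "\<And>t x. t \<le> 0 ==> V t x = 0"
  and dU: "\<And>t x. t < T ==> ((\<lambda>t. U t x) has_real_derivative V t x) (at t)"
  and pU: "\<And>t k. pderiv_on (U t) k (UX k t)"
  and dJ: "\<And>t x. 0 < t ==> t < T ==> (fconv \<alpha> (\<lambda>t. V t x) has_real_derivative W t x) (at t)"
  and W_t: "\<And>x. continuous_on {0<..<T} (\<lambda>t. W t x)"
  and W_x: "\<And>t. 0 < t ==> t < T ==> cts (W t)"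
  and cont_bb: "\<And>k. cts (bb k)" and cont_cc: "cts cc"
  and slice: "\<And>t \<phi> d\<phi>. 0 < t ==> t < T ==> C1_test UNIV \<phi> d\<phi> ==>
    (\<integral>x. W t x * \<phi> x + aform x (\<lambda>k. UX k t x) (\<lambda>k. d\<phi> k x)
     - ((\<Sum>k\<in>UNIV. bb k x * UX k t x) + cc x * U t x) * \<phi> x) = 0"
begin

definition LL :: "real => real^'n => real" where
 "LL t x = (\<Sum>k\<in>UNIV. bb k x * UX k t x) + cc x * U t x"

definition JJ :: "real => real^'n => real" where "JJ t x = fconv \<alpha> (\<lambda>t. V t x) t"

lemma cont_snd: "cts g ==> cts (\<lambda>p. g (snd p))"
 by (rule continuous_on_compose2[of UNIV g]) (auto intro: continuous_intros)

lemma cont_fst: "cts g ==> cts (\<lambda>p. g (fst p))"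
 by (rule continuous_on_compose2[of UNIV g]) (auto intro: continuous_intros)

lemma cont_slice_t:
 fixes f :: "real => real^'n => 'v::topological_space"
 assumes "cts2 f" shows "cts (\<lambda>t. f t x)"
proof -
 have "cts (\<lambda>t. (t, x))" by (intro continuous_intros)
 from continuous_on_compose2[OF assms this] show ?thesis by simp
qed

lemma cont_slice_x:
 fixes f :: "real => real^'n => 'v::topological_space"
 assumes "cts2 f" shows "cts (\<lambda>x. f t x)"
proof -
 have "cts (\<lambda>x. (t, x))" by (intro continuous_intros)
 from continuous_on_compose2[OF assms this] show ?thesis by simp
qed

lemma contLL: "cts2 LL"
 unfolding LL_def by (intro continuous_intros contU contUX cont_snd cont_bb cont_cc)

lemma contJJ: "cts2 JJ"
 unfolding JJ_def by (rule continuous_fconv[OF \<alpha> contV V0])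

end

text \<open>A cut-off in time supported inside \<open>(0, T)\<close>, where alone the fractional
  derivative is controlled. Two derivatives are needed because \<open>\<theta>' * U\<close> is
  differentiated once more under the convolution; positivity inside allows division by
  \<open>\<theta>\<close> when integrability of \<open>W\<close> itself is recovered.\<close>

locale frac_cut = frac_data a \<Lambda> \<delta>0 T \<alpha> U V W UX bb cc
 for a :: "'n::finite => 'n => real^'n => real" and \<Lambda> \<delta>0 T \<alpha> U V W UX bb cc +
 fixes lo hi :: real and \<theta> \<theta>' \<theta>'' :: "real => real"
 assumes lohi: "0 < lo" "lo < hi" "hi < T"
  and d\<theta>: "\<And>t. (\<theta> has_real_derivative \<theta>' t) (at t)" and d\<theta>': "\<And>t. (\<theta>' has_real_derivative \<theta>'' t) (at t)"
  and cont\<theta>'': "cts \<theta>''"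
  and \<theta>_out: "\<And>t. t \<notin> {lo..hi} ==> \<theta> t = 0" "\<And>t. t \<notin> {lo..hi} ==> \<theta>' t = 0" "\<And>t. t \<notin> {lo..hi} ==> \<theta>'' t = 0"
  and \<theta>_pos: "\<And>t. lo < t ==> t < hi ==> 0 < \<theta> t"
begin

definition EE :: "nat => real => complex" where "EE j t = exp (- (freq T j * of_real t))"

text \<open>The Laplace transform of \<open>\<theta> f\<close> at \<open>freq T j\<close>; up to
  normalisation, the Fourier coefficient of \<open>exp (- t) \<theta> f\<close> for the period
  \<open>2 T\<close>.\<close>

definition hat :: "(real => real^'n => real) => nat => real^'n => complex" where
 "hat f j x = (\<integral>t. of_real (\<theta> t * f t x) * EE j t)"

lemma cont\<theta>: "continuous_on S \<theta>" "continuous_on S \<theta>'"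
 by (rule DERIV_continuous_on[OF has_field_derivative_at_within[OF d\<theta>]])
  (rule DERIV_continuous_on[OF has_field_derivative_at_within[OF d\<theta>']])

lemma contEE: "continuous_on S (EE j)"
 unfolding EE_def by (intro continuous_intros)

lemma vd_EE: "(EE j has_vector_derivative (- freq T j * EE j t)) (at t)"
 using has_vector_derivative_exp_affine[of 0 "- freq T j" t] by (simp add: EE_def[abs_def] mult.commute)

lemma vd_mult_EE:
 assumes "(f has_real_derivative f') (at t)"
 shows "((\<lambda>t. of_real (f t) * EE j t) has_vector_derivative (of_real f' * EE j t - freq T j * (of_real (f t) * EE j t))) (at t)"
proof -
 have "((\<lambda>t. of_real (f t) :: complex) has_vector_derivative of_real f') (at t)"
  using assms by (auto intro: has_vector_derivative_of_real simp: real_derivative_iff)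
 from has_vector_derivative_mult[OF this vd_EE] show ?thesis by (simp add: algebra_simps)
qed

lemma integrable_EE:
 assumes "cts g" "\<And>t. t \<notin> {lo..hi} ==> g t = 0"
 shows "lintegrable (\<lambda>t. of_real (g t) * EE j t)"
 by (rule integrable_compact_support[OF _ compact_Icc[of lo hi]])
  (use assms in \<open>auto intro!: continuous_intros contEE\<close>)

lemma hat_C1:
 assumes "\<And>t. pderiv_on (f t) k (g t)"
  and "cts2 f" "cts2 g"
 shows "pderiv_on (hat f j) k (hat g j)"
 unfolding hat_def
proof (rule pderiv_param_integral[where lo = lo and hi = hi])
 show "pderiv_on (\<lambda>x. of_real (\<theta> t * f t x) * EE j t) k (\<lambda>x. of_real (\<theta> t * g t x) * EE j t)" for t
 proof (rule pderiv_bounded_linear[of "\<lambda>r. of_real (\<theta> t * r) * EE j t", OF _ assms(1)])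
  show "bounded_linear (\<lambda>r. of_real (\<theta> t * r) * EE j t)"
   by (intro bounded_linear_mult_left[THEN bounded_linear_compose] bounded_linear_of_real[THEN bounded_linear_compose] bounded_linear_mult_right)
 qed
qed (use assms \<theta>_out in \<open>auto intro!: continuous_intros cont_fst[OF cont\<theta>(1)] cont_fst[OF contEE]\<close>)

lemma continuous_hat:
 assumes "cts2 f"
 shows "cts (hat f j)"
 unfolding hat_def
 by (rule continuous_param_integral[where lo = lo and hi = hi])
  (use assms \<theta>_out in \<open>auto intro!: continuous_intros cont_fst[OF cont\<theta>(1)] cont_fst[OF contEE]\<close>)

definition Bess :: real where "Bess = 2 * T / (1 - exp (- 2 * T))"

lemma Bess: "0 < Bess" using T by (simp add: Bess_def)

lemma Bessel_hat:
 assumes "finite F" "\<And>t. \<bar>\<theta> t * f t x\<bar> \<le> D" "cts (\<lambda>t. \<theta> t * f t x)"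
 shows "(\<Sum>j\<in>F. (norm (hat f j x))\<^sup>2) \<le> D\<^sup>2 * Bess"
 unfolding hat_def EE_def Bess_def
proof (rule Bessel_half_line[OF T assms(1)])
 show "(\<lambda>t. complex_of_real (\<theta> t * f t x)) \<in> borel_measurable borel"
  by (intro borel_measurable_continuous_onI continuous_intros assms(3))
 show "norm (complex_of_real (\<theta> t * f t x)) \<le> D" for t using assms(2)[of t] by (simp only: norm_of_real)
 show "complex_of_real (\<theta> t * f t x) = 0" if "t \<le> 0" for t using \<theta>_out(1)[of t] lohi that by simp
qed

lemma bounded_\<theta>: obtains C where "0 < C" "\<And>t. \<bar>\<theta> t\<bar> \<le> C" "\<And>t. \<bar>\<theta>' t\<bar> \<le> C" "\<And>t. \<bar>\<theta>'' t\<bar> \<le> C"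
proof -
 obtain A where A: "0 < A" "\<And>t. norm (\<theta> t) \<le> A" using bounded_compact_support[OF cont\<theta>(1) compact_Icc \<theta>_out(1)] by metis
 obtain B where B: "0 < B" "\<And>t. norm (\<theta>' t) \<le> B" using bounded_compact_support[OF cont\<theta>(2) compact_Icc \<theta>_out(2)] by metis
 obtain D where D: "0 < D" "\<And>t. norm (\<theta>'' t) \<le> D" using bounded_compact_support[OF cont\<theta>'' compact_Icc \<theta>_out(3)] by metis
 have "\<bar>\<theta> t\<bar> \<le> A + B + D" "\<bar>\<theta>' t\<bar> \<le> A + B + D" "\<bar>\<theta>'' t\<bar> \<le> A + B + D" for t
  using A(1) A(2)[of t] B(1) B(2)[of t] D(1) D(2)[of t] by auto
 then show thesis using that[of "A + B + D"] A B D by auto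
qed

lemma contW\<theta>: "cts (\<lambda>t. \<theta> t * W t x)"
 by (rule continuous_extend_zero[OF _ _ lohi(1,3)])
  (use \<theta>_out in \<open>auto intro!: continuous_intros cont\<theta> W_t\<close>)

definition uh :: "nat => real^'n => complex" where "uh = hat U"
definition qh :: "nat => real^'n => complex" where "qh = hat W"
text \<open>The symbol of the fractional derivative of order \<open>\<alpha>\<close> under the
  Laplace transform.\<close>

definition mu :: "nat => complex" where "mu j = freq T j powr of_real \<alpha>"
text \<open>The time derivative of \<open>\<theta> U\<close>.\<close>

definition ww :: "real => real^'n => real" where "ww t x = \<theta>' t * U t x + \<theta> t * V t x"

lemma freq_neq0: "freq T j \<noteq> 0" by (simp add: freq_def complex_eq_iff)

lemma contU_t: "continuous_on S (\<lambda>t. U t x)" and contV_t: "continuous_on S (\<lambda>t. V t x)" and contJJ_t: "continuous_on S (\<lambda>t. JJ t x)"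
 using cont_slice_t[OF contU] cont_slice_t[OF contV] cont_slice_t[OF contJJ] by (auto intro: continuous_on_subset)

lemma cont_ww: "cts (\<lambda>t. ww t x)"
 unfolding ww_def by (intro continuous_intros cont\<theta> contU_t contV_t)

lemma d_\<theta>U: "((\<lambda>t. \<theta> t * U t x) has_real_derivative ww t x) (at t)"
 unfolding real_derivative_iff
proof (rule has_vector_derivative_extend_zero[OF _ _ _ lohi(1,3)])
 fix t assume "0 < t" "t < T"
 then show "((\<lambda>t. \<theta> t * U t x) has_vector_derivative ww t x) (at t)"
  unfolding real_derivative_iff[symmetric] ww_def
  using DERIV_mult[OF d\<theta>[of t] dU[of t x]] by (simp add: algebra_simps)
qed (use \<theta>_out in \<open>auto simp: ww_def\<close>)

lemma freq_uh: "freq T j * uh j x = (\<integral>t. of_real (ww t x) * EE j t)"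
proof -
 have z: "\<theta> t * U t x = 0" "ww t x = 0" if "t \<notin> {lo..hi}" for t using \<theta>_out that by (auto simp: ww_def)
 have i: "lintegrable (\<lambda>t. of_real (ww t x) * EE j t)" "lintegrable (\<lambda>t. of_real (\<theta> t * U t x) * EE j t)"
  by (rule integrable_EE; use z in \<open>auto intro!: continuous_intros cont_ww cont\<theta> contU_t\<close>)+
 have "(\<integral>t. of_real (ww t x) * EE j t - freq T j * (of_real (\<theta> t * U t x) * EE j t)) = 0"
 proof (rule integral_derivative_eq_0[OF vd_mult_EE[OF d_\<theta>U]])
  show "cts (\<lambda>t. of_real (ww t x) * EE j t - freq T j * (of_real (\<theta> t * U t x) * EE j t))"
   by (intro continuous_intros cont_ww contEE cont\<theta> contU_t)
  show "complex_of_real (\<theta> t * U t x) * EE j t = 0" if "t \<notin> {lo..hi}" for t unfolding z(1)[OF that] by simp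
  show "complex_of_real (ww t x) * EE j t - freq T j * (complex_of_real (\<theta> t * U t x) * EE j t) = 0" if "t \<notin> {lo..hi}" for t
   unfolding z[OF that] by simp
 qed
 then show ?thesis using i by (simp add: uh_def hat_def)
qed

text \<open>Up to lower order both coefficients are \<open>p\<close> times a transform:
  \<open>qh\<close> by one integration by parts in time, \<open>mu * uh\<close> because
  \<open>p powr \<alpha> = p * p powr (\<alpha> - 2) * p\<close>, where the last factor stands for
  the derivative of \<open>\<theta> U\<close> and the middle one for the convolution. The difference
  contains only a commutator and a term with \<open>\<theta>'\<close>. The third claim expresses
  \<open>qh\<close> through the jointly continuous \<open>JJ\<close>.\<close>

lemma err_identity:
 "qh j x - mu j * uh j x = freq T j * (\<integral>t. of_real (\<theta> t * JJ t x - fconv \<alpha> (\<lambda>t. ww t x) t) * EE j t)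
  - (\<integral>t. of_real (\<theta>' t * JJ t x) * EE j t)"
 "lintegrable (\<lambda>t. of_real (\<theta> t * JJ t x - fconv \<alpha> (\<lambda>t. ww t x) t) * EE j t)"
 "qh j x = freq T j * (\<integral>t. of_real (\<theta> t * JJ t x) * EE j t) - (\<integral>t. of_real (\<theta>' t * JJ t x) * EE j t)"
proof -
 define p where "p = freq T j"
 have z: "\<theta> t * JJ t x = 0" "\<theta>' t * JJ t x = 0" "\<theta> t * W t x = 0" "ww t x = 0" if "t \<notin> {lo..hi}" for t
  using \<theta>_out that by (auto simp: ww_def)
 have i: "lintegrable (\<lambda>t. of_real (\<theta> t * JJ t x) * EE j t)" "lintegrable (\<lambda>t. of_real (\<theta>' t * JJ t x) * EE j t)"
  "lintegrable (\<lambda>t. of_real (\<theta> t * W t x) * EE j t)"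
  by (rule integrable_EE; use z in \<open>auto intro!: continuous_intros cont\<theta> contJJ_t contW\<theta>\<close>)+
 have dJ\<theta>: "((\<lambda>t. \<theta> t * JJ t x) has_real_derivative (\<theta>' t * JJ t x + \<theta> t * W t x)) (at t)" for t
  unfolding real_derivative_iff
 proof (rule has_vector_derivative_extend_zero[OF _ _ _ lohi(1,3)])
  fix t assume t: "0 < t" "t < T"
  show "((\<lambda>t. \<theta> t * JJ t x) has_vector_derivative \<theta>' t * JJ t x + \<theta> t * W t x) (at t)"
   unfolding real_derivative_iff[symmetric]
   using DERIV_mult[OF d\<theta>[of t] dJ[OF t, of x]] by (simp add: JJ_def algebra_simps)
 qed (use \<theta>_out in auto)
 have "(\<integral>t. of_real (\<theta>' t * JJ t x + \<theta> t * W t x) * EE j t - p * (of_real (\<theta> t * JJ t x) * EE j t)) = 0"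
  unfolding p_def
 proof (rule integral_derivative_eq_0[OF vd_mult_EE[OF dJ\<theta>]])
  show "cts (\<lambda>t. of_real (\<theta>' t * JJ t x + \<theta> t * W t x) * EE j t - freq T j * (of_real (\<theta> t * JJ t x) * EE j t))"
   by (intro continuous_intros cont\<theta> contJJ_t contEE contW\<theta>)
  show "complex_of_real (\<theta> t * JJ t x) * EE j t = 0" if "t \<notin> {lo..hi}" for t unfolding z(1)[OF that] by simp
  show "complex_of_real (\<theta>' t * JJ t x + \<theta> t * W t x) * EE j t - freq T j * (complex_of_real (\<theta> t * JJ t x) * EE j t) = 0"
   if "t \<notin> {lo..hi}" for t unfolding z[OF that] by simp
 qed
 moreover have "(\<integral>t. of_real (\<theta>' t * JJ t x + \<theta> t * W t x) * EE j t - p * (of_real (\<theta> t * JJ t x) * EE j t))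
  = (\<integral>t. of_real (\<theta>' t * JJ t x) * EE j t) + qh j x - p * (\<integral>t. of_real (\<theta> t * JJ t x) * EE j t)"
 proof -
  have "of_real (\<theta>' t * JJ t x + \<theta> t * W t x) * EE j t - p * (of_real (\<theta> t * JJ t x) * EE j t)
   = of_real (\<theta>' t * JJ t x) * EE j t + of_real (\<theta> t * W t x) * EE j t - p * (of_real (\<theta> t * JJ t x) * EE j t)" for t
   by (simp add: distrib_right)
  then show ?thesis using i by (simp add: qh_def hat_def)
 qed
 ultimately show q: "qh j x = freq T j * (\<integral>t. of_real (\<theta> t * JJ t x) * EE j t) - (\<integral>t. of_real (\<theta>' t * JJ t x) * EE j t)"
  by (simp add: p_def algebra_simps)
 have wz: "complex_of_real (ww t x) = 0" if "t \<notin> {0..hi}" for t using z(4)[of t] lohi that by auto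
 have w0: "complex_of_real (ww 0 x) = 0" using z(4)[of 0] lohi by simp
 have cw: "cts (\<lambda>t. complex_of_real (ww t x))" by (intro continuous_intros cont_ww)
 have Rep: "0 < Re p" by (simp add: p_def freq_def)
 have fc: "fconv \<alpha> (\<lambda>t. complex_of_real (ww t x)) t = of_real (fconv \<alpha> (\<lambda>t. ww t x) t)" for t
 proof -
  have "frac_ker \<alpha> s *\<^sub>R complex_of_real y = of_real (frac_ker \<alpha> s * y)" for s y by (simp add: scaleR_conv_of_real)
  then show ?thesis unfolding fconv_def by (simp only: real_scaleR_def integral_complex_of_real)
 qed
 note lap = fconv_laplace[OF \<alpha> cw wz w0 Rep, unfolded fc]
 have fi: "lintegrable (\<lambda>t. of_real (fconv \<alpha> (\<lambda>t. ww t x) t) * EE j t)" using lap(1) by (simp add: p_def EE_def)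
 have m: "mu j * uh j x = freq T j * (\<integral>t. of_real (fconv \<alpha> (\<lambda>t. ww t x) t) * EE j t)"
 proof -
  have "(\<integral>t. of_real (fconv \<alpha> (\<lambda>t. ww t x) t) * EE j t) = p powr of_real (\<alpha> - 2) * (p * uh j x)"
   using lap(2) freq_uh[of j x] by (simp add: p_def EE_def)
  moreover have "p * p powr of_real (\<alpha> - 2) * p = mu j"
  proof -
   have "p powr of_real \<alpha> = p powr (of_real (\<alpha> - 2) + 2)" by simp
   also have "\<dots> = p powr of_real (\<alpha> - 2) * p powr 2" by (rule powr_add)
   also have "p powr 2 = p ^ 2" using freq_neq0[of j] powr_nat[of p 2] by (simp add: p_def)
   finally show ?thesis by (simp add: mu_def p_def power2_eq_square)
  qed
  ultimately show ?thesis by (simp add: p_def mult.assoc[symmetric])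
 qed
 show "lintegrable (\<lambda>t. of_real (\<theta> t * JJ t x - fconv \<alpha> (\<lambda>t. ww t x) t) * EE j t)"
  using i(1) fi by (simp only: of_real_diff left_diff_distrib) (rule integrable_diff)
 have dI: "(\<integral>t. of_real (\<theta> t * JJ t x - fconv \<alpha> (\<lambda>t. ww t x) t) * EE j t)
   = (\<integral>t. of_real (\<theta> t * JJ t x) * EE j t) - (\<integral>t. of_real (fconv \<alpha> (\<lambda>t. ww t x) t) * EE j t)"
  using i(1) fi by (simp only: of_real_diff left_diff_distrib) (rule integral_diff)
 show "qh j x - mu j * uh j x = freq T j * (\<integral>t. of_real (\<theta> t * JJ t x - fconv \<alpha> (\<lambda>t. ww t x) t) * EE j t)
  - (\<integral>t. of_real (\<theta>' t * JJ t x) * EE j t)"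
  unfolding q m dI by (simp only: right_diff_distrib) simp
qed

text \<open>The convolution of \<open>ww\<close> splits according to its two summands. The part with
  \<open>V\<close> forms the commutator, the part with \<open>U\<close> has a bounded derivative, so
  the function multiplied by the frequency is Lipschitz; the remaining term is bounded. The result
  depends on \<open>x\<close> only through \<open>B\<close>.\<close>

lemma err_bound:
 assumes B: "0 \<le> B"
 obtains CE where "\<And>x F. (\<And>t. t \<le> T ==> \<bar>U t x\<bar> \<le> B \<and> \<bar>V t x\<bar> \<le> B) ==> finite F ==>
  (\<Sum>j\<in>F. (norm (qh j x - mu j * uh j x))\<^sup>2) \<le> CE"
proof -
 obtain C where C: "0 < C" "\<And>t. \<bar>\<theta> t\<bar> \<le> C" "\<And>t. \<bar>\<theta>' t\<bar> \<le> C" "\<And>t. \<bar>\<theta>'' t\<bar> \<le> C" using bounded_\<theta> by blast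
 define L1 where "L1 = \<alpha> * C / (Gamma (2 - \<alpha>) * (2 - \<alpha>)) * B * T powr (2 - \<alpha>)"
 define L2 where "L2 = (2 * C * B) * (frac_mass \<alpha> (2 * hi) + frac_ker \<alpha> hi * hi)"
 define J1 where "J1 = C * (B * frac_mass \<alpha> T)"
 show thesis
 proof (rule that[of "2 * ((L1 + L2)\<^sup>2 * Bess) + 2 * (J1\<^sup>2 * Bess)"])
  fix x and F :: "nat set" assume b: "\<And>t. t \<le> T ==> \<bar>U t x\<bar> \<le> B \<and> \<bar>V t x\<bar> \<le> B" and F: "finite F"
  define L where "L t = \<theta> t * JJ t x - fconv \<alpha> (\<lambda>t. ww t x) t" for t
  have Uz: "\<theta> t * V t x = 0" "\<theta>' t * U t x = 0" "\<theta>'' t * U t x + \<theta>' t * V t x = 0" if "t \<notin> {lo..hi}" for t using \<theta>_out that by auto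
  have c\<theta>V: "cts (\<lambda>t. \<theta> t * V t x)" "cts (\<lambda>t. \<theta>' t * U t x)"
   "cts (\<lambda>t. \<theta>'' t * U t x + \<theta>' t * V t x)"
   by (intro continuous_intros cont\<theta> cont\<theta>'' contU_t contV_t)+
  have z0: "\<theta> t * V t x = 0" "\<theta>' t * U t x = 0" "\<theta>'' t * U t x + \<theta>' t * V t x = 0" if "t \<le> 0" for t using Uz[of t] that lohi by auto
  have d2: "((\<lambda>t. \<theta>' t * U t x) has_real_derivative \<theta>'' t * U t x + \<theta>' t * V t x) (at t)" for t
   unfolding real_derivative_iff
  proof (rule has_vector_derivative_extend_zero[OF _ _ _ lohi(1,3)])
   fix t assume "0 < t" "t < T"
   then show "((\<lambda>t. \<theta>' t * U t x) has_vector_derivative \<theta>'' t * U t x + \<theta>' t * V t x) (at t)"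
    unfolding real_derivative_iff[symmetric]
    using DERIV_mult[OF d\<theta>'[of t] dU[of t x]] by (simp add: algebra_simps)
  qed (use Uz in auto)
  have split: "fconv \<alpha> (\<lambda>t. ww t x) t = fconv \<alpha> (\<lambda>t. \<theta>' t * U t x) t + fconv \<alpha> (\<lambda>t. \<theta> t * V t x) t" for t
   unfolding fconv_def ww_def
   using fconv_integrable[OF \<alpha> c\<theta>V(1) z0(1), of t] fconv_integrable[OF \<alpha> c\<theta>V(2) z0(2), of t]
   by (simp add: distrib_left)
  have lip1: "\<bar>(\<theta> t * JJ t x - fconv \<alpha> (\<lambda>t. \<theta> t * V t x) t) - (\<theta> s * JJ s x - fconv \<alpha> (\<lambda>t. \<theta> t * V t x) s)\<bar> \<le> L1 * \<bar>t - s\<bar>" for s t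
   unfolding JJ_def L1_def
   by (rule commutator_lipschitz[OF \<alpha> d\<theta> C(3) _ T contV_t V0]) (use \<theta>_out(1) lohi b in auto)
  have lip2: "\<bar>fconv \<alpha> (\<lambda>t. \<theta>' t * U t x) t - fconv \<alpha> (\<lambda>t. \<theta>' t * U t x) s\<bar> \<le> L2 * \<bar>t - s\<bar>" for s t
  proof -
   have "norm (fconv \<alpha> (\<lambda>t. \<theta>' t * U t x) t - fconv \<alpha> (\<lambda>t. \<theta>' t * U t x) s) \<le> L2 * \<bar>t - s\<bar>"
   proof (rule vector_derivative_bound_difference)
    fix r
    show "(fconv \<alpha> (\<lambda>t. \<theta>' t * U t x) has_vector_derivative fconv \<alpha> (\<lambda>t. \<theta>'' t * U t x + \<theta>' t * V t x) r) (at r)"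
     by (rule has_vector_derivative_fconv[OF \<alpha> c\<theta>V(2) z0(2) c\<theta>V(3) z0(3), where T = "r + 1"])
      (use d2 in \<open>auto simp: real_derivative_iff\<close>)
    have nb: "norm (\<theta>'' t * U t x + \<theta>' t * V t x) \<le> 2 * C * B" for t
    proof (cases "t \<le> T")
     case True
     have "\<bar>\<theta>'' t * U t x\<bar> \<le> C * B" "\<bar>\<theta>' t * V t x\<bar> \<le> C * B"
      unfolding abs_mult using b[OF True] C by (auto intro!: mult_mono intro: less_imp_le)
     then show ?thesis by simp
    next
     case False then show ?thesis using Uz(3)[of t] lohi C B by simp
    qed
    have zz: "\<theta>'' t * U t x + \<theta>' t * V t x = 0" if "t \<notin> {0..hi}" for t using Uz(3)[of t] lohi that by auto
    show "norm (fconv \<alpha> (\<lambda>t. \<theta>'' t * U t x + \<theta>' t * V t x) r) \<le> L2" unfolding L2_def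
     by (rule fconv_bounded[OF \<alpha> c\<theta>V(3) zz z0(3) nb]) (use lohi in auto)
   qed
   then show ?thesis by simp
  qed
  have lip: "norm (complex_of_real (L t) - of_real (L s)) \<le> (L1 + L2) * \<bar>t - s\<bar>" for s t
  proof -
   have "\<bar>L t - L s\<bar> \<le> L1 * \<bar>t - s\<bar> + L2 * \<bar>t - s\<bar>" using lip1[of t s] lip2[of t s] unfolding L_def split by linarith
   then show ?thesis by (simp flip: of_real_diff add: distrib_right)
  qed
  have L0: "complex_of_real (L t) = 0" if "t \<le> 0" for t
  proof -
   have "fconv \<alpha> (\<lambda>t. ww t x) t = 0" by (rule fconv_eq_0[OF \<alpha>]) (use \<theta>_out lohi that in \<open>auto simp: ww_def\<close>)
   moreover have "\<theta> t = 0" using \<theta>_out(1)[of t] lohi that by simp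
   ultimately show ?thesis by (simp add: L_def)
  qed
  define A1 where "A1 j = freq T j * (\<integral>t. of_real (L t) * EE j t)" for j
  define A2 where "A2 j = (\<integral>t. of_real (\<theta>' t * JJ t x) * EE j t)" for j
  have s1: "(\<Sum>j\<in>F. (norm (A1 j))\<^sup>2) \<le> (L1 + L2)\<^sup>2 * Bess"
   unfolding A1_def EE_def Bess_def
   by (rule Bessel_lipschitz[OF T F lip L0]) (use err_identity(2) in \<open>auto simp: L_def EE_def\<close>)
  have s2: "(\<Sum>j\<in>F. (norm (A2 j))\<^sup>2) \<le> J1\<^sup>2 * Bess"
   unfolding A2_def EE_def Bess_def
  proof (rule Bessel_half_line[OF T F])
   show "(\<lambda>t. complex_of_real (\<theta>' t * JJ t x)) \<in> borel_measurable borel"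
    by (intro borel_measurable_continuous_onI continuous_intros cont\<theta> contJJ_t)
   show "complex_of_real (\<theta>' t * JJ t x) = 0" if "t \<le> 0" for t using \<theta>_out(2)[of t] lohi that by simp
   show "norm (complex_of_real (\<theta>' t * JJ t x)) \<le> J1" for t
   proof (cases "t \<in> {lo..hi}")
    case True
    then have t: "t \<le> T" using lohi by simp
    have "norm (JJ t x) \<le> B * frac_mass \<alpha> t" unfolding JJ_def
     by (rule fconv_norm_le[OF \<alpha>]) (use V0 b t in auto)
    also have "frac_mass \<alpha> t \<le> frac_mass \<alpha> T" unfolding frac_mass_def
     by (rule integral_mono)
      (use frac_ker_integrable_Icc[OF \<alpha>] t frac_ker_nonneg[OF \<alpha>] in \<open>auto simp: indicator_def\<close>)
    finally have "\<bar>JJ t x\<bar> \<le> B * frac_mass \<alpha> T" using B by (simp add: mult_left_mono)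
    then have "\<bar>\<theta>' t\<bar> * \<bar>JJ t x\<bar> \<le> J1" unfolding J1_def using C by (intro mult_mono) auto
    then show ?thesis by (simp add: norm_mult)
   next
    case False
    then show ?thesis using \<theta>_out(2)[of t] C B frac_mass_nonneg[OF \<alpha>, of T] by (simp add: J1_def)
   qed
  qed
  have "(norm (qh j x - mu j * uh j x))\<^sup>2 \<le> 2 * (norm (A1 j))\<^sup>2 + 2 * (norm (A2 j))\<^sup>2" for j
  proof -
   have "norm (qh j x - mu j * uh j x) \<le> norm (A1 j) + norm (A2 j)"
    unfolding err_identity(1) A1_def A2_def L_def by (rule norm_triangle_ineq4)
   then have "(norm (qh j x - mu j * uh j x))\<^sup>2 \<le> (norm (A1 j) + norm (A2 j))\<^sup>2" by (intro power_mono) auto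
   moreover have "0 \<le> (norm (A1 j) - norm (A2 j))\<^sup>2" by simp
   ultimately show ?thesis by (simp add: power2_eq_square algebra_simps)
  qed
  then have "(\<Sum>j\<in>F. (norm (qh j x - mu j * uh j x))\<^sup>2) \<le> (\<Sum>j\<in>F. 2 * (norm (A1 j))\<^sup>2 + 2 * (norm (A2 j))\<^sup>2)"
   by (intro sum_mono)
  also have "\<dots> = 2 * (\<Sum>j\<in>F. (norm (A1 j))\<^sup>2) + 2 * (\<Sum>j\<in>F. (norm (A2 j))\<^sup>2)"
   by (simp add: sum.distrib sum_distrib_left)
  finally show "(\<Sum>j\<in>F. (norm (qh j x - mu j * uh j x))\<^sup>2) \<le> 2 * ((L1 + L2)\<^sup>2 * Bess) + 2 * (J1\<^sup>2 * Bess)"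
   using s1 s2 by linarith
 qed
qed

end

section \<open>Local square integrability of the fractional derivative\<close>

lemma C1_bump:
 fixes x0 :: "real^'n::finite"
 assumes r: "0 < r"
 obtains \<eta> d\<eta> where "C1_test (cball x0 r) \<eta> d\<eta>" "\<And>x. 0 \<le> \<eta> x" "\<And>x. \<eta> x \<le> (1::real)" "\<And>x. x \<in> ball x0 (r / 2) ==> 1 / 4 \<le> \<eta> x"
proof -
 define s where "s x = 1 - ((x - x0) \<bullet> (x - x0)) / r\<^sup>2" for x :: "real^'n"
 define \<eta> where "\<eta> x = max 0 (s x) powr 2" for x
 define d\<eta> where "d\<eta> k x = 2 * max 0 (s x) powr (2 - 1) * (- (2 * (x - x0) $ k) / r\<^sup>2)" for k x
 have sc: "cts s" unfolding s_def using r by (intro continuous_intros) auto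
 have ps: "pderiv_on s k (\<lambda>x. - (2 * (x - x0) $ k) / r\<^sup>2)" for k
 proof -
  have d: "pderiv_on (\<lambda>x. x - x0) k (\<lambda>_. axis k 1)"
   unfolding pderiv_on_def by (auto intro!: derivative_eq_intros simp: has_vector_derivative_def)
  have "pderiv_on (\<lambda>x. (x - x0) \<bullet> (x - x0)) k (\<lambda>x. (x - x0) \<bullet> axis k 1 + axis k 1 \<bullet> (x - x0))"
   by (rule pderiv_inner[OF d d])
  then have 1: "pderiv_on (\<lambda>x. (x - x0) \<bullet> (x - x0)) k (\<lambda>x. 2 * (x - x0) $ k)"
   by (simp add: inner_axis inner_axis')
  have 2: "((\<lambda>y. 1 - y * q) has_real_derivative - q) (at y)" for y q :: real by (auto intro!: derivative_eq_intros)
  have "pderiv_on (\<lambda>x. 1 - ((x - x0) \<bullet> (x - x0)) * (1 / r\<^sup>2)) k (\<lambda>x. - (1 / r\<^sup>2) * (2 * (x - x0) $ k))"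
   by (rule pderiv_chain[OF 1 2])
  moreover have "(\<lambda>x. - (1 / r\<^sup>2) * (2 * (x - x0) $ k)) = (\<lambda>x. - (2 * (x - x0) $ k) / r\<^sup>2)"
  proof -
   have "- (1 / q) * A = - A / q" for q A :: real by simp
   then show ?thesis by (simp only:)
  qed
  ultimately show ?thesis by (simp add: s_def[abs_def])
 qed
 have s1: "s x \<le> 1" for x by (simp add: s_def)
 show thesis
 proof (rule that)
  show "C1_test (cball x0 r) \<eta> d\<eta>"
  proof (rule C1_testI[OF _ compact_cball order_refl])
   have p: "pderiv_on \<eta> k (d\<eta> k)" for k
    unfolding \<eta>_def[abs_def] d\<eta>_def[abs_def] using pderiv_chain[OF ps DERIV_pos_part_powr[of 2]] by simp
   show "C1_fun \<eta> d\<eta>"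
    unfolding C1_fun_def using p
   proof (intro conjI allI)
    show "cts \<eta>" unfolding \<eta>_def[abs_def]
     by (intro continuous_on_powr' continuous_on_max sc continuous_intros) auto
    show "cts (d\<eta> k)" for k unfolding d\<eta>_def[abs_def]
     by (intro continuous_on_powr' continuous_on_max sc continuous_intros) (use r in auto)
   qed auto
   fix x assume "x \<notin> cball x0 r"
   then have "r < norm (x - x0)" by (simp add: dist_norm norm_minus_commute)
   then have "r\<^sup>2 < (norm (x - x0))\<^sup>2" using r by (intro power_strict_mono) auto
   then have "s x \<le> 0" using r by (simp add: s_def power2_norm_eq_inner)
   then show "\<eta> x = 0" by (simp add: \<eta>_def)
  qed
  show "0 \<le> \<eta> x" for x by (simp add: \<eta>_def)
  show "\<eta> x \<le> 1" for x unfolding \<eta>_def using powr_mono2[of 2 "max 0 (s x)" 1] s1[of x] by simp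
  fix x assume "x \<in> ball x0 (r / 2)"
  then have "norm (x - x0) \<le> r / 2" by (simp add: dist_norm norm_minus_commute)
  then have "(norm (x - x0))\<^sup>2 \<le> (r / 2)\<^sup>2" by (intro power_mono) auto
  then have "(x - x0) \<bullet> (x - x0) / r\<^sup>2 \<le> 1 / 4" using r by (simp add: power2_norm_eq_inner power_divide divide_le_eq)
  then have "1 / 2 \<le> s x" unfolding s_def by linarith
  then have "(1 / 2) powr 2 \<le> max 0 (s x) powr 2" by (intro powr_mono2) auto
  moreover have "(1 / 2) powr 2 = (1 / 4 :: real)" by (simp add: powr_numeral power2_eq_square)
  ultimately show "1 / 4 \<le> \<eta> x" by (simp add: \<eta>_def)
 qed
qed

text \<open>Baire's theorem is applied in the subspace \<open>Z\<close>, which is completely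
  metrizable because it is closed; a relatively open part of some \<open>E m\<close> yields the
  ball.\<close>

lemma Baire_closed_cover:
 fixes Z :: "'a::euclidean_space set" and E :: "nat => 'a set"
 assumes "closed Z" "Z \<noteq> {}" "\<And>m. closed (E m)" "Z \<subseteq> (\<Union>m. E m)"
 obtains m x r where "0 < r" "x \<in> Z" "Z \<inter> ball x r \<subseteq> E m"
proof -
 define X where "X = top_of_set Z"
 have cm: "completely_metrizable_space X"
  unfolding X_def using assms(1) completely_metrizable_space_closedin[OF completely_metrizable_space_euclidean] by auto
 have "\<exists>m. X interior_of (Z \<inter> E m) \<noteq> {}"
 proof (rule ccontr)
  assume n: "\<not> ?thesis"
  have "X interior_of \<Union>(range (\<lambda>m. Z \<inter> E m)) = {}"
  proof (rule Baire_category_alt)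
   fix S assume "S \<in> range (\<lambda>m. Z \<inter> E m)"
   then obtain m where m: "S = Z \<inter> E m" by blast
   show "closedin X S \<and> X interior_of S = {}"
    using n m assms(3)[of m] by (auto simp: X_def closedin_closed)
  qed (use cm in auto)
  moreover have "\<Union>(range (\<lambda>m. Z \<inter> E m)) = topspace X" using assms(4) by (auto simp: X_def)
  ultimately have "X interior_of (topspace X) = {}" by simp
  then show False using assms(2) unfolding interior_of_topspace by (simp add: X_def)
 qed
 then obtain m x where "x \<in> X interior_of (Z \<inter> E m)" by blast
 then obtain S where S: "openin X S" "x \<in> S" "S \<subseteq> Z \<inter> E m" unfolding interior_of_def by blast
 then obtain U where U: "open U" "S = Z \<inter> U" by (auto simp: X_def openin_open)
 then obtain r where "0 < r" "ball x r \<subseteq> U" using S(2) open_contains_ball by blast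
 then show thesis using that[of r x m] S U by blast
qed

section \<open>Points near which the fractional derivative is square integrable\<close>

context frac_cut
begin

definition sqW :: "real \<times> (real^'n) => real" where "sqW p = (\<theta> (fst p) * W (fst p) (snd p))\<^sup>2"

text \<open>The complement of this set is the exceptional set. Square integrability is asked jointly
  in time and space, since its purpose is to justify Fubini's theorem.\<close>

definition good :: "(real^'n) set" where
 "good = {x. \<exists>e>0. lintegrable (\<lambda>p. indicator (ball x e) (snd p) * sqW p)}"

text \<open>\<open>W\<close> is separately continuous only; joint measurability comes from the
  jointly continuous \<open>JJ\<close> by difference quotients in time.\<close>

lemma W_measurable [measurable]: "(\<lambda>p. \<theta> (fst p) * W (fst p) (snd p)) \<in> borel_measurable borel"
proof -
 define h where "h n = 1 / (real n + 1)" for n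
 have h: "h n \<noteq> 0" for n by (simp add: h_def)
 have hl: "h \<longlonglongrightarrow> 0" unfolding h_def by real_asymp
 show ?thesis
 proof (rule borel_measurable_LIMSEQ_metric[where f = "\<lambda>n p. \<theta> (fst p) * ((JJ (fst p + h n) (snd p) - JJ (fst p) (snd p)) /\<^sub>R h n)"])
  fix n
  have "cts (\<lambda>p :: real \<times> (real^'n). (fst p + h n, snd p))" by (intro continuous_intros)
  from continuous_on_compose2[OF contJJ this] have "cts (\<lambda>p. JJ (fst p + h n) (snd p))" by simp
  then show "(\<lambda>p. \<theta> (fst p) * ((JJ (fst p + h n) (snd p) - JJ (fst p) (snd p)) /\<^sub>R h n)) \<in> borel_measurable borel"
   by (intro borel_measurable_continuous_onI continuous_intros cont_fst[OF cont\<theta>(1)] contJJ)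
  fix p :: "real \<times> (real^'n)"
  show "(\<lambda>n. \<theta> (fst p) * ((JJ (fst p + h n) (snd p) - JJ (fst p) (snd p)) /\<^sub>R h n)) \<longlonglongrightarrow> \<theta> (fst p) * W (fst p) (snd p)"
  proof (cases "fst p \<in> {lo..hi}")
   case True
   then have "((\<lambda>t. JJ t (snd p)) has_vector_derivative W (fst p) (snd p)) (at (fst p))"
    unfolding JJ_def real_derivative_iff[symmetric] using lohi by (intro dJ) auto
   from has_vector_derivative_seq[OF this h hl] show ?thesis by (intro tendsto_mult_left)
  qed (simp add: \<theta>_out)
 qed
qed

lemma sqW_measurable [measurable]: "sqW \<in> borel_measurable borel"
 unfolding sqW_def[abs_def] by measurable

lemma sqW_nonneg: "0 \<le> sqW p" by (simp add: sqW_def)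

lemma indicator_snd_measurable:
 assumes "A \<in> sets borel" shows "(\<lambda>p :: real \<times> (real^'n). indicator A (snd p) :: real) \<in> borel_measurable borel"
proof -
 have "snd -` A \<in> sets (borel :: (real \<times> (real^'n)) measure)"
  using measurable_sets[OF borel_measurable_continuous_onI[OF continuous_on_snd[OF continuous_on_id]] assms] by simp
 moreover have "(\<lambda>p :: real \<times> (real^'n). indicator A (snd p) :: real) = indicator (snd -` A)" by (auto simp: indicator_def)
 ultimately show ?thesis by simp
qed

lemma open_good: "open good"
 unfolding open_contains_ball
proof (rule ballI)
 fix x assume "x \<in> good"
 then obtain e where e: "0 < e" "lintegrable (\<lambda>p. indicator (ball x e) (snd p) * sqW p)" by (auto simp: good_def)
 have "y \<in> good" if y: "y \<in> ball x e" for y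
 proof -
  have sub: "z \<in> ball x e" if "z \<in> ball y (e - dist x y)" for z
   using that dist_triangle[of x z y] by simp
  have "lintegrable (\<lambda>p. indicator (ball y (e - dist x y)) (snd p) * sqW p)"
  proof (rule integrable_bound[OF e(2)])
   show "(\<lambda>p. indicator (ball y (e - dist x y)) (snd p) * sqW p) \<in> borel_measurable lborel"
    using indicator_snd_measurable[of "ball y (e - dist x y)"] by simp
   show "AE p in lborel. norm (indicator (ball y (e - dist x y)) (snd p) * sqW p) \<le> norm (indicator (ball x e) (snd p) * sqW p)"
    using sub by (intro AE_I2) (auto simp: indicator_def sqW_nonneg simp del: mem_ball)
  qed
  then show ?thesis using y by (auto simp: good_def intro!: exI[of _ "e - dist x y"])
 qed
 then show "\<exists>e>0. ball x e \<subseteq> good" using e(1) by (intro exI[of _ e]) auto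
qed

lemma integrable_sqW_compact:
 assumes K: "compact K" "K \<subseteq> good"
 shows "lintegrable (\<lambda>p. indicator K (snd p) * sqW p)"
proof -
 have "\<forall>x\<in>K. \<exists>e>0. lintegrable (\<lambda>p. indicator (ball x e) (snd p) * sqW p)" using K(2) by (auto simp: good_def)
 then obtain e where e: "\<And>x. x \<in> K ==> 0 < e x" "\<And>x. x \<in> K ==> lintegrable (\<lambda>p. indicator (ball x (e x)) (snd p) * sqW p)"
  by metis
 obtain F where F: "F \<subseteq> K" "finite F" "K \<subseteq> (\<Union>x\<in>F. ball x (e x))"
   proof (rule compactE_image[OF K(1), of K "\<lambda>x. ball x (e x)"])
  show "K \<subseteq> (\<Union>x\<in>K. ball x (e x))" using e(1) by force
 qed auto
 show ?thesis
 proof (rule integrable_bound)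
  show "lintegrable (\<lambda>p. \<Sum>x\<in>F. indicator (ball x (e x)) (snd p) * sqW p)"
   using e(2) F(1) by (intro integrable_sum) auto
  show "(\<lambda>p. indicator K (snd p) * sqW p) \<in> borel_measurable lborel"
   using indicator_snd_measurable[OF borel_compact[OF K(1)]] by simp
  show "AE p in lborel. norm (indicator K (snd p) * sqW p) \<le> norm (\<Sum>x\<in>F. indicator (ball x (e x)) (snd p) * sqW p)"
  proof (rule AE_I2)
   fix p :: "real \<times> (real^'n)"
   have "indicator K (snd p) \<le> (\<Sum>x\<in>F. indicator (ball x (e x)) (snd p) :: real)"
   proof (cases "snd p \<in> K")
    case True
    then obtain y where y: "y \<in> F" "snd p \<in> ball y (e y)" using F(3) by blast
    have "(indicator (ball y (e y)) (snd p) :: real) \<le> (\<Sum>x\<in>F. indicator (ball x (e x)) (snd p))"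
     by (rule member_le_sum[OF y(1)]) (use F in auto)
    then show ?thesis using True y(2) by simp
   qed (auto intro: sum_nonneg)
   then have "indicator K (snd p) * sqW p \<le> (\<Sum>x\<in>F. indicator (ball x (e x)) (snd p)) * sqW p"
    by (rule mult_right_mono[OF _ sqW_nonneg])
   then show "norm (indicator K (snd p) * sqW p) \<le> norm (\<Sum>x\<in>F. indicator (ball x (e x)) (snd p) * sqW p)"
    using sqW_nonneg[of p] by (simp add: sum_distrib_right abs_mult)
  qed
 qed
qed

text \<open>The equation for a Fourier coefficient is the time integral of the sliced equations.
  Exchanging the integrals requires joint integrability of \<open>\<theta> W\<close> on the support
  of the test function, hence the restriction to \<open>good\<close>.\<close>

lemma weak_hat:
 fixes \<phi> :: "real^'n => complex"
 assumes \<phi>: "C1_test good \<phi> d\<phi>"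
 shows "(\<integral>x. qh j x \<bullet> \<phi> x + aform x (\<lambda>k. hat (UX k) j x) (\<lambda>k. d\<phi> k x) - hat LL j x \<bullet> \<phi> x) = 0"
proof -
 obtain K where K: "compact K" "K \<subseteq> good" "\<And>x. x \<notin> K ==> \<phi> x = 0" "\<And>x k. x \<notin> K ==> d\<phi> k x = 0"
  by (rule C1_testE[OF \<phi>]) blast
 have \<phi>c: "cts \<phi>" "cts (d\<phi> k)" for k using C1_test_fun[OF \<phi>] by (auto simp: C1_fun_def)
 obtain C where C: "0 < C" "\<And>x. norm (\<phi> x) \<le> C" using bounded_compact_support[OF \<phi>c(1) K(1,3)] by metis
 define H1 where "H1 p = (of_real (\<theta> (fst p) * W (fst p) (snd p)) * EE j (fst p)) \<bullet> \<phi> (snd p)" for p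
 define H2 where "H2 p = aform (snd p) (\<lambda>k. of_real (\<theta> (fst p) * UX k (fst p) (snd p)) * EE j (fst p)) (\<lambda>k. d\<phi> k (snd p))
   - (of_real (\<theta> (fst p) * LL (fst p) (snd p)) * EE j (fst p)) \<bullet> \<phi> (snd p)" for p
 have i2: "lintegrable H2"
 proof (rule integrable_compact_support[OF _ compact_Times[OF compact_Icc[of lo hi] K(1)]])
  show "cts H2" unfolding H2_def[abs_def] aform_def
   by (intro continuous_intros cont_fst[OF cont\<theta>(1)] cont_fst[OF contEE] contUX contLL cont_snd \<phi>c a_cont)
  show "H2 p = 0" if "p \<notin> {lo..hi} \<times> K" for p
   using that \<theta>_out(1)[of "fst p"] K(3,4)[of "snd p"] by (cases p) (auto simp: H2_def aform_def)
 qed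
 have m1: "H1 \<in> borel_measurable lborel"
 proof -
  have "(\<lambda>p :: real \<times> (real^'n). EE j (fst p)) \<in> borel_measurable borel" "(\<lambda>p :: real \<times> (real^'n). \<phi> (snd p)) \<in> borel_measurable borel"
   by (intro borel_measurable_continuous_onI cont_fst[OF contEE] cont_snd \<phi>c)+
  then show ?thesis unfolding H1_def[abs_def] using W_measurable by measurable
 qed
 \<comment> \<open>By \<open>w \<le> w^2 + 1\<close> the square of \<open>\<theta> W\<close>,
   together with a constant on a compact set, dominates its product with the bounded test
   function.\<close>
 have i1: "lintegrable H1"
 proof (rule integrable_bound[OF _ m1])
  have "lintegrable (\<lambda>p :: real \<times> (real^'n). C * indicator ({lo..hi} \<times> K) p)"
   by (rule integrable_indicator_compact[OF compact_Times[OF compact_Icc K(1)]])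
  then show "lintegrable (\<lambda>p. C * (indicator K (snd p) * sqW p) + C * indicator ({lo..hi} \<times> K) p)"
   using integrable_sqW_compact[OF K(1,2)] by (intro integrable_add) auto
  show "AE p in lborel. norm (H1 p) \<le> norm (C * (indicator K (snd p) * sqW p) + C * indicator ({lo..hi} \<times> K) p)"
  proof (rule AE_I2)
   fix p :: "real \<times> (real^'n)"
   show "norm (H1 p) \<le> norm (C * (indicator K (snd p) * sqW p) + C * indicator ({lo..hi} \<times> K) p)"
   proof (cases "p \<in> {lo..hi} \<times> K")
    case True
    define w where "w = \<bar>\<theta> (fst p) * W (fst p) (snd p)\<bar>"
    have E1: "norm (EE j (fst p)) \<le> 1" using True lohi unfolding EE_def norm_exp_freq by auto
    have "norm (H1 p) \<le> norm (of_real (\<theta> (fst p) * W (fst p) (snd p)) * EE j (fst p)) * norm (\<phi> (snd p))"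
     unfolding H1_def real_norm_def by (rule Cauchy_Schwarz_ineq2)
    also have "\<dots> = w * norm (EE j (fst p)) * norm (\<phi> (snd p))" by (simp only: norm_mult[of "of_real _"] norm_of_real w_def)
    also have "\<dots> \<le> w * 1 * C" using E1 C by (intro mult_mono) (auto simp: w_def)
    also have "\<dots> \<le> (w\<^sup>2 + 1) * C"
    proof -
     have "0 \<le> (w - 1)\<^sup>2" by simp
     then have "2 * w \<le> w\<^sup>2 + 1" by (simp add: power2_diff)
     then have "w \<le> w\<^sup>2 + 1" using zero_le_power2[of w] by linarith
     then show ?thesis using C(1) by (simp add: mult_right_mono)
    qed
    also have "\<dots> = C * (indicator K (snd p) * sqW p) + C * indicator ({lo..hi} \<times> K) p"
     using True by (cases p) (simp add: sqW_def w_def algebra_simps)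
    finally show ?thesis by simp
   next
    case False
    then have "H1 p = 0" using \<theta>_out(1)[of "fst p"] K(3)[of "snd p"] by (cases p) (auto simp: H1_def)
    then show ?thesis by simp
   qed
  qed
 qed
 have iH: "integrable (lborel \<Otimes>\<^sub>M lborel) (\<lambda>(t, x). H1 (t, x) + H2 (t, x))"
  using integrable_add[OF i1 i2] by (simp add: lborel_prod[symmetric] split_def)
 have sl: "(\<integral>x. H1 (t, x) + H2 (t, x)) = 0" for t
 proof (cases "t \<in> {lo..hi}")
  case True
  define e where "e = of_real (\<theta> t) * EE j t"
  have bl: "bounded_linear (\<lambda>z. e \<bullet> z)" by (rule bounded_linear_inner_right)
  have "C1_test UNIV \<phi> d\<phi>" using \<phi> by (auto simp: C1_test_def)
  note te = C1_test_bounded_linear[OF bl this]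
  have "H1 (t, x) + H2 (t, x) = W t x * (e \<bullet> \<phi> x) + aform x (\<lambda>k. UX k t x) (\<lambda>k. e \<bullet> d\<phi> k x) - LL t x * (e \<bullet> \<phi> x)" for x
  proof -
   have m: "(of_real (\<theta> t * r) * EE j t) \<bullet> z = r * (e \<bullet> z)" for r z
    by (simp add: e_def inner_complex_def algebra_simps)
   show ?thesis unfolding H1_def H2_def fst_conv snd_conv m aform_def by simp
  qed
  then show ?thesis using slice[OF _ _ te, of t] True lohi by (simp add: LL_def)
 next
  case False
  then have "H1 (t, x) + H2 (t, x) = 0" for x using \<theta>_out(1)[of t] by (simp add: H1_def H2_def aform_def)
  then show ?thesis by simp
 qed
 have inner: "(\<integral>t. H1 (t, x) + H2 (t, x)) = qh j x \<bullet> \<phi> x + aform x (\<lambda>k. hat (UX k) j x) (\<lambda>k. d\<phi> k x) - hat LL j x \<bullet> \<phi> x" for x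
 proof -
  have iW: "lintegrable (\<lambda>t. of_real (\<theta> t * W t x) * EE j t)"
   by (rule integrable_EE[OF contW\<theta>]) (simp add: \<theta>_out)
  have iU: "lintegrable (\<lambda>t. of_real (\<theta> t * UX k t x) * EE j t)" for k
   by (rule integrable_EE) (auto intro!: continuous_intros cont\<theta> cont_slice_t[OF contUX] simp: \<theta>_out)
  have iL: "lintegrable (\<lambda>t. of_real (\<theta> t * LL t x) * EE j t)"
   by (rule integrable_EE) (auto intro!: continuous_intros cont\<theta> cont_slice_t[OF contLL] simp: \<theta>_out)
  have iA: "lintegrable (\<lambda>t. a k l x * ((of_real (\<theta> t * UX k t x) * EE j t) \<bullet> d\<phi> l x))" for k l
   by (intro integrable_mult_right integrable_inner_left iU)
  have "(\<integral>t. H1 (t, x) + H2 (t, x)) = (\<integral>t. (of_real (\<theta> t * W t x) * EE j t) \<bullet> \<phi> x + ((\<Sum>k\<in>UNIV. \<Sum>l\<in>UNIV. a k l x * ((of_real (\<theta> t * UX k t x) * EE j t) \<bullet> d\<phi> l x))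
    - (of_real (\<theta> t * LL t x) * EE j t) \<bullet> \<phi> x))"
   by (simp only: H1_def H2_def aform_def fst_conv snd_conv)
  also have "\<dots> = (\<integral>t. (of_real (\<theta> t * W t x) * EE j t) \<bullet> \<phi> x) + ((\<integral>t. (\<Sum>k\<in>UNIV. \<Sum>l\<in>UNIV. a k l x * ((of_real (\<theta> t * UX k t x) * EE j t) \<bullet> d\<phi> l x)))
    - (\<integral>t. (of_real (\<theta> t * LL t x) * EE j t) \<bullet> \<phi> x))"
   by (subst integral_add, rule integrable_inner_left[OF iW],
     intro integrable_diff integrable_sum iA integrable_inner_left iL,
     subst integral_diff, intro integrable_sum iA,
     rule integrable_inner_left[OF iL]) simp
  also have "(\<integral>t. (\<Sum>k\<in>UNIV. \<Sum>l\<in>UNIV. a k l x * ((of_real (\<theta> t * UX k t x) * EE j t) \<bullet> d\<phi> l x)))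
   = (\<Sum>k\<in>UNIV. \<Sum>l\<in>UNIV. a k l x * ((\<integral>t. of_real (\<theta> t * UX k t x) * EE j t) \<bullet> d\<phi> l x))"
   by (subst integral_sum, intro integrable_sum iA,
     subst integral_sum, intro iA) (simp only: integral_mult_right_zero integral_inner_left[OF iU])
  finally show ?thesis
   by (simp only: integral_inner_left[OF iW] integral_inner_left[OF iL] qh_def hat_def aform_def add_diff_eq)
 qed
 have "(\<integral>x. qh j x \<bullet> \<phi> x + aform x (\<lambda>k. hat (UX k) j x) (\<lambda>k. d\<phi> k x) - hat LL j x \<bullet> \<phi> x)
  = (\<integral>x. (\<integral>t. H1 (t, x) + H2 (t, x)))" by (simp only: inner)
 also have "\<dots> = (\<integral>t. (\<integral>x. H1 (t, x) + H2 (t, x)))"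
  using lborel_pair.Fubini_integral[of "\<lambda>t x. H1 (t, x) + H2 (t, x)"] iH by simp
 finally show ?thesis by (simp add: sl)
qed

text \<open>The frequency has positive real part, so its argument is at most \<open>pi / 2\<close>
  in absolute value. Half of the argument of \<open>mu j\<close> is then at most
  \<open>\<alpha> pi / 4 < pi / 2\<close>, and turning by it puts \<open>\<zeta>\<close> and
  \<open>\<zeta> / mu\<close> at opposite angles to the positive axis, both with real part bounded
  below.\<close>

lemma mu_phase:
 defines "\<zeta> j \<equiv> cis (\<alpha> * Arg (freq T j) / 2)"
 shows "norm (\<zeta> j) = 1" "cos (\<alpha> * pi / 4) \<le> Re (\<zeta> j)" "cos (\<alpha> * pi / 4) / norm (mu j) \<le> Re (\<zeta> j / mu j)"
  "1 \<le> norm (mu j)" "norm (mu j) \<le> (norm (freq T j))\<^sup>2" "0 < cos (\<alpha> * pi / 4)"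
proof -
 define p where "p = freq T j"
 have p0: "p \<noteq> 0" using freq_neq0 by (simp add: p_def)
 have p1: "1 \<le> norm p" using complex_Re_le_cmod[of p] by (simp add: p_def freq_def)
 have nm: "norm (mu j) = norm p powr \<alpha>" unfolding mu_def p_def[symmetric] using p0 by (simp add: norm_powr_real_powr')
 have mu: "mu j = of_real (norm p powr \<alpha>) * cis (\<alpha> * Arg p)"
 proof -
  have "mu j = exp (of_real \<alpha> * Ln p)" using p0 by (simp add: mu_def p_def[symmetric] powr_def)
  also have "Ln p = of_real (ln (norm p)) + \<i> * of_real (Arg p)" using p0 Arg_eq_Im_Ln[OF p0] by (simp add: complex_eq_iff)
  also have "exp (of_real \<alpha> * (of_real (ln (norm p)) + \<i> * of_real (Arg p))) = exp (of_real (\<alpha> * ln (norm p))) * cis (\<alpha> * Arg p)"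
   by (simp add: cis_conv_exp exp_add[symmetric] distrib_left ac_simps)
  also have "exp (of_real (\<alpha> * ln (norm p)) :: complex) = of_real (norm p powr \<alpha>)" using p0 by (simp only: exp_of_real) (simp add: powr_def)
  finally show ?thesis .
 qed
 have arg: "\<bar>Arg p\<bar> \<le> pi / 2" using Arg_Re_nonneg[of p] by (simp add: p_def freq_def)
 have cosb: "cos (\<alpha> * pi / 4) \<le> cos (\<alpha> * Arg p / 2)"
 proof -
  have "cos (\<alpha> * pi / 4) \<le> cos \<bar>\<alpha> * Arg p / 2\<bar>"
  proof (rule cos_monotone_0_pi_le)
   show "\<bar>\<alpha> * Arg p / 2\<bar> \<le> \<alpha> * pi / 4" using mult_left_mono[OF arg, of \<alpha>] \<alpha> by (simp add: abs_mult)
   show "\<alpha> * pi / 4 \<le> pi" using \<alpha> mult_right_mono[of \<alpha> 2 pi] by simp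
  qed simp
  also have "cos \<bar>\<alpha> * Arg p / 2\<bar> = cos (\<alpha> * Arg p / 2)" by (rule cos_abs_real)
  finally show ?thesis .
 qed
 show "norm (\<zeta> j) = 1" by (simp add: \<zeta>_def)
 show "cos (\<alpha> * pi / 4) \<le> Re (\<zeta> j)" using cosb by (simp add: \<zeta>_def p_def)
 have n0: "norm p powr \<alpha> > 0" using p0 by simp
 have "\<zeta> j / mu j = cis (- (\<alpha> * Arg p / 2)) / of_real (norm p powr \<alpha>)"
 proof -
  have "cis (\<alpha> * Arg p / 2) = cis (- (\<alpha> * Arg p / 2)) * cis (\<alpha> * Arg p)" by (simp add: cis_mult field_simps)
  then show ?thesis unfolding mu \<zeta>_def p_def[symmetric] by simp
 qed
 then have "Re (\<zeta> j / mu j) = cos (\<alpha> * Arg p / 2) / norm (mu j)" unfolding nm by (simp only: Re_divide_of_real cis.simps cos_minus)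
 then show "cos (\<alpha> * pi / 4) / norm (mu j) \<le> Re (\<zeta> j / mu j)" using cosb n0 by (simp add: nm divide_right_mono)
 show "1 \<le> norm (mu j)" unfolding nm using p1 \<alpha> by (simp add: ge_one_powr_ge_zero)
 show "norm (mu j) \<le> (norm (freq T j))\<^sup>2"
  unfolding nm p_def[symmetric] using powr_mono[of \<alpha> 2 "norm p"] p1 \<alpha> by (simp add: powr_numeral)
 show "0 < cos (\<alpha> * pi / 4)" using \<alpha> by (intro cos_gt_zero) auto
qed

text \<open>The real part of \<open>qh j x\<close> is the cosine coefficient of
  \<open>exp (- t) \<theta> W\<close>; the factor \<open>exp (2 T)\<close> removes the damping. The
  series may diverge for a given \<open>x\<close>, so the estimate is stated for extended
  nonnegative values.\<close>

lemma Parseval_W: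
 "(\<integral>\<^sup>+t. ennreal (sqW (t, x)) \<partial>lborel) \<le> ennreal (exp (2 * T) * (2 / T)) * (\<Sum>j. ennreal ((norm (qh j x))\<^sup>2))"
proof -
 define f where "f t = exp (- t) * (\<theta> t * W t x)" for t
 have fc: "continuous_on S f" for S
  unfolding f_def by (intro continuous_intros continuous_on_subset[OF contW\<theta>]) auto
 have d: "(LBINT t:{0..T}. f t * cos (pi * real j * t / T)) = Re (qh j x)" for j
 proof -
  have iW: "lintegrable (\<lambda>t. of_real (\<theta> t * W t x) * EE j t)"
   by (rule integrable_EE[OF contW\<theta>]) (simp add: \<theta>_out)
  have "Re (qh j x) = (\<integral>t. Re (of_real (\<theta> t * W t x) * EE j t))"
   unfolding qh_def hat_def by (rule integral_Re[OF iW, symmetric])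
  also have "\<dots> = (\<integral>t. indicator {0..T} t *\<^sub>R (f t * cos (pi * real j * t / T)))"
  proof (intro integral_cong refl)
   fix t
   have "Re (EE j t) = exp (- t) * cos (pi * real j * t / T)"
    by (simp add: EE_def freq_def Re_exp)
   then show "Re (of_real (\<theta> t * W t x) * EE j t) = indicator {0..T} t *\<^sub>R (f t * cos (pi * real j * t / T))"
    using \<theta>_out(1)[of t] lohi by (cases "t \<in> {lo..hi}") (auto simp: f_def indicator_def)
  qed
  finally show ?thesis by (simp add: set_lebesgue_integral_def)
 qed
 define F where "F = (LBINT t:{0..T}. (f t)\<^sup>2)"
 have Fi: "lintegrable (\<lambda>t. indicator {0..T} t *\<^sub>R (f t)\<^sup>2)"
  using borel_integrable_atLeastAtMost'[of 0 T "\<lambda>t. (f t)\<^sup>2"] fc by (auto simp: set_integrable_def intro!: continuous_intros)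
 have "ennreal F \<le> ennreal (2 / T) * (\<Sum>j. ennreal ((norm (qh j x))\<^sup>2))"
 proof (rule ennreal_le_epsilon)
  fix e :: real assume e: "0 < e"
  obtain N where N: "F \<le> e + 2 / T * (\<Sum>j\<le>(N::nat). (LBINT t:{0..T}. f t * cos (pi * real j * t / T))\<^sup>2)"
   unfolding F_def by (rule Parseval_le[OF T fc e])
  also have "\<dots> \<le> e + 2 / T * (\<Sum>j\<le>N. (norm (qh j x))\<^sup>2)"
   unfolding d using T by (intro add_left_mono mult_left_mono sum_mono) (auto intro!: abs_le_square_iff[THEN iffD1] abs_Re_le_cmod)
  finally have "ennreal F \<le> ennreal (e + 2 / T * (\<Sum>j\<le>N. (norm (qh j x))\<^sup>2))" by (rule ennreal_leI)
  also have "\<dots> = ennreal (2 / T) * (\<Sum>j\<le>N. ennreal ((norm (qh j x))\<^sup>2)) + ennreal e"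
  proof -
   have "ennreal (2 / T * (\<Sum>j\<le>N. (norm (qh j x))\<^sup>2)) = ennreal (2 / T) * (\<Sum>j\<le>N. ennreal ((norm (qh j x))\<^sup>2))"
    using T by (subst ennreal_mult) (auto simp: sum_nonneg sum_ennreal)
   moreover have "ennreal (e + 2 / T * (\<Sum>j\<le>N. (norm (qh j x))\<^sup>2)) = ennreal (2 / T * (\<Sum>j\<le>N. (norm (qh j x))\<^sup>2)) + ennreal e"
    unfolding add.commute[of e] using e T sum_nonneg[of "{..N}" "\<lambda>j. (norm (qh j x))\<^sup>2"] by (intro ennreal_plus mult_nonneg_nonneg) auto
   ultimately show ?thesis by (simp only:)
  qed
  also have "\<dots> \<le> ennreal (2 / T) * (\<Sum>j. ennreal ((norm (qh j x))\<^sup>2)) + ennreal e"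
   by (intro add_mono mult_left_mono sum_le_suminf) auto
  finally show "ennreal F \<le> ennreal (2 / T) * (\<Sum>j. ennreal ((norm (qh j x))\<^sup>2)) + ennreal e" .
 qed
 moreover have "(\<integral>\<^sup>+t. ennreal (sqW (t, x)) \<partial>lborel) \<le> ennreal (exp (2 * T)) * ennreal F"
 proof -
  have "(\<integral>\<^sup>+t. ennreal (sqW (t, x)) \<partial>lborel) \<le> (\<integral>\<^sup>+t. ennreal (exp (2 * T)) * ennreal (indicator {0..T} t *\<^sub>R (f t)\<^sup>2) \<partial>lborel)"
  proof (intro nn_integral_mono)
   fix t
   have "sqW (t, x) \<le> exp (2 * T) * (indicator {0..T} t *\<^sub>R (f t)\<^sup>2)"
   proof (cases "t \<in> {lo..hi}")
    case True
    have "(f t)\<^sup>2 = exp (- 2 * t) * sqW (t, x)" by (simp add: f_def sqW_def power_mult_distrib exp_double[symmetric])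
    moreover have "1 * sqW (t, x) \<le> (exp (2 * T) * exp (- 2 * t)) * sqW (t, x)"
     using True lohi by (intro mult_right_mono sqW_nonneg) (simp flip: exp_add)
    ultimately show ?thesis using True lohi by simp
   qed (simp add: sqW_def \<theta>_out)
   then show "ennreal (sqW (t, x)) \<le> ennreal (exp (2 * T)) * ennreal (indicator {0..T} t *\<^sub>R (f t)\<^sup>2)"
    by (subst ennreal_mult[symmetric]) (auto intro: ennreal_leI)
  qed
  also have "\<dots> = ennreal (exp (2 * T)) * (\<integral>\<^sup>+t. ennreal (indicator {0..T} t *\<^sub>R (f t)\<^sup>2) \<partial>lborel)"
   using Fi by (intro nn_integral_cmult) auto
  also have "(\<integral>\<^sup>+t. ennreal (indicator {0..T} t *\<^sub>R (f t)\<^sup>2) \<partial>lborel) = ennreal F"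
   unfolding F_def set_lebesgue_integral_def by (rule nn_integral_eq_integral[OF Fi]) auto
  finally show ?thesis .
 qed
 ultimately have "(\<integral>\<^sup>+t. ennreal (sqW (t, x)) \<partial>lborel) \<le> ennreal (exp (2 * T)) * (ennreal (2 / T) * (\<Sum>j. ennreal ((norm (qh j x))\<^sup>2)))"
  by (meson mult_left_mono order_trans zero_le)
 moreover have "ennreal (exp (2 * T) * (2 / T)) = ennreal (exp (2 * T)) * ennreal (2 / T)" using T by (intro ennreal_mult) auto
 ultimately show ?thesis by (simp only: mult.assoc)
qed

end

section \<open>Square summability of the coefficients and emptiness of the exceptional set\<close>

context frac_cut
begin

text \<open>Continuity of \<open>qh\<close> cannot be read off from \<open>W\<close>, which is not
  jointly continuous; \<open>err_identity\<close> expresses it by \<open>JJ\<close>.\<close>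

lemma cqh: "cts (qh i)"
proof -
 have "qh i = (\<lambda>x. freq T i * hat JJ i x - (\<integral>t. of_real (\<theta>' t * JJ t x) * EE i t))"
  unfolding hat_def by (rule ext) (rule err_identity(3))
 moreover have "cts (\<lambda>x. \<integral>t. of_real (\<theta>' t * JJ t x) * EE i t)"
  by (rule continuous_param_integral[where lo = lo and hi = hi])
   (use \<theta>_out contJJ in \<open>auto intro!: continuous_intros cont_fst[OF cont\<theta>(2)] cont_fst[OF contEE]\<close>)
 ultimately show ?thesis by (simp only:) (intro continuous_intros continuous_hat contJJ)
qed

text \<open>The uniform estimate with \<open>S\<close> the good part of a ball. Its data come from
  functions of time that are bounded or Lipschitz, so Bessel's inequality bounds their coefficients
  by constants free of \<open>N\<close>; off \<open>good\<close> the same applies to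
  \<open>W\<close> itself by the bound \<open>m\<close>.\<close>

lemma qh_L2_bound:
 assumes r: "0 < r" and m: "\<And>x t. x \<in> cball x0 r ==> x \<notin> good ==> t \<in> {lo..hi} ==> \<bar>W t x\<bar> \<le> m"
  and \<eta>: "C1_test (cball x0 r) \<eta> d\<eta>" "\<And>x. 0 \<le> \<eta> x" "\<And>x. \<eta> x \<le> (1::real)"
 obtains R where "\<And>N. (\<Sum>i<(N::nat). \<integral>x. (norm (\<eta> x *\<^sub>R qh i x))\<^sup>2) \<le> R"
proof -
 define D where "D = cball x0 r"
 have cD: "compact D" by (simp add: D_def)
 define S where "S = good \<inter> D"
 obtain C\<theta> where C\<theta>: "0 < C\<theta>" "\<And>t. \<bar>\<theta> t\<bar> \<le> C\<theta>" "\<And>t. \<bar>\<theta>' t\<bar> \<le> C\<theta>" by (rule bounded_\<theta>) blast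
 define FF where "FF p = \<bar>U (fst p) (snd p)\<bar> + \<bar>V (fst p) (snd p)\<bar> + (\<Sum>k\<in>UNIV. \<bar>UX k (fst p) (snd p)\<bar>) + \<bar>LL (fst p) (snd p)\<bar>" for p
 have "cts FF" unfolding FF_def[abs_def] by (intro continuous_intros contU contV contUX contLL)
 from compact_image_bound[OF compact_Times[OF compact_Icc cD] continuous_on_subset[OF this subset_UNIV]]
 obtain B where B: "0 < B" "\<And>p. p \<in> {0..T} \<times> D ==> norm (FF p) \<le> B" by blast
 have Bt: "\<bar>U t x\<bar> \<le> B" "\<bar>V t x\<bar> \<le> B" "\<bar>UX k t x\<bar> \<le> B" "\<bar>LL t x\<bar> \<le> B" if "t \<in> {0..T}" "x \<in> D" for t x k
 proof -
  have "FF (t, x) \<le> B" using B(2)[of "(t, x)"] that by simp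
  moreover have "\<bar>UX k t x\<bar> \<le> (\<Sum>k\<in>UNIV. \<bar>UX k t x\<bar>)" by (rule member_le_sum) auto
  ultimately show "\<bar>U t x\<bar> \<le> B" "\<bar>V t x\<bar> \<le> B" "\<bar>UX k t x\<bar> \<le> B" "\<bar>LL t x\<bar> \<le> B" by (auto simp: FF_def)
 qed
 obtain CE where CE: "\<And>x F. (\<And>t. t \<le> T ==> \<bar>U t x\<bar> \<le> B \<and> \<bar>V t x\<bar> \<le> B) ==> finite F ==>
  (\<Sum>j\<in>F. (norm (qh j x - mu j * uh j x))\<^sup>2) \<le> CE"
  by (rule err_bound[OF less_imp_le[OF B(1)]]) blast
 have \<eta>c: "cts \<eta>" "cts (d\<eta> k)" for k
  using C1_test_fun[OF \<eta>(1)] by (auto simp: C1_fun_def)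
 have \<eta>s: "\<eta> x = 0" "d\<eta> k x = 0" if "x \<notin> D" for x k
 proof -
  obtain K where K: "compact K" "K \<subseteq> D" "\<And>x. x \<notin> K ==> \<eta> x = 0" "\<And>x k. x \<notin> K ==> d\<eta> k x = 0"
   unfolding D_def by (rule C1_testE[OF \<eta>(1)]) blast
  then show "\<eta> x = 0" "d\<eta> k x = 0" using that by auto
 qed
 obtain M\<eta> where M\<eta>: "0 < M\<eta>" "\<And>x. norm (\<Sum>k\<in>UNIV. \<bar>d\<eta> k x\<bar>) \<le> M\<eta>"
  by (rule bounded_compact_support[of "\<lambda>x. \<Sum>k\<in>UNIV. \<bar>d\<eta> k x\<bar>" D])
   (use \<eta>c \<eta>s cD in \<open>auto intro!: continuous_intros\<close>)
 have M\<eta>k: "\<bar>d\<eta> k x\<bar> \<le> M\<eta>" for k x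
  using M\<eta>(2)[of x] member_le_sum[of k UNIV "\<lambda>k. \<bar>d\<eta> k x\<bar>"] by simp
 define M1 where "M1 = (C\<theta> * B)\<^sup>2 * Bess"
 define M2 where "M2 = (2 * C\<theta> * B)\<^sup>2 * Bess"
 define M3 where "M3 = (C\<theta> * \<bar>m\<bar>)\<^sup>2 * Bess"
 define M where "M = M\<eta> + \<bar>CE\<bar> + M1 + M2 + M3"
 have pos: "0 \<le> M1" "0 \<le> M2" "0 \<le> M3" using Bess by (auto simp: M1_def M2_def M3_def)
 have M: "0 \<le> M" "M\<eta> \<le> M" "CE \<le> M" "M1 \<le> M" "M2 \<le> M" "M3 \<le> M" using pos M\<eta>(1) by (auto simp: M_def)
 define \<zeta> where "\<zeta> j = cis (\<alpha> * Arg (freq T j) / 2)" for j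
 note ph = mu_phase[folded \<zeta>_def]
 have cuh: "cts (uh i)" for i unfolding uh_def by (rule continuous_hat[OF contU])
 define n where "n = real CARD('n)"
 define Cg where "Cg = 3 * (2 * M + n^4 * \<Lambda>\<^sup>2 * M^3)"
 define c where "c = cos (\<alpha> * pi / 4)"
 define CC where "CC = 2 / c * (4 * (4 * M + 1)) + 2 / c * Cg + \<Lambda> * n\<^sup>2 * M^3 / c"
 have smallhat: "(\<Sum>i\<in>I. (norm (hat f i x))\<^sup>2) \<le> (C\<theta> * b)\<^sup>2 * Bess"
  if "finite I" "cts (\<lambda>t. \<theta> t * f t x)" "\<And>t. t \<in> {lo..hi} ==> \<bar>f t x\<bar> \<le> b" "0 \<le> b" for f I x b
 proof (rule Bessel_hat[of I f x "C\<theta> * b", OF that(1) _ that(2)])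
  fix t
  show "\<bar>\<theta> t * f t x\<bar> \<le> C\<theta> * b"
  proof (cases "t \<in> {lo..hi}")
   case True then show ?thesis unfolding abs_mult using that(3)[of t] C\<theta> by (intro mult_mono) auto
  next
   case False then show ?thesis using \<theta>_out(1)[OF False] C\<theta>(1) that(4) by simp
  qed
 qed
 have in0T: "t \<in> {0..T}" if "t \<in> {lo..hi}" for t using that lohi by simp
 have "(\<Sum>i<N. \<integral>x. (norm (\<eta> x *\<^sub>R qh i x))\<^sup>2)
  \<le> 3 * ((4 / (3 * c)) * (CC * measure lborel D + 1 / c) + (4 * (4 * M + 1) + M) * measure lborel D)" for N :: nat
 proof -
  have "(\<Sum>i<N. \<integral>x. (norm (\<eta> x *\<^sub>R (mu i * uh i x + (qh i x - mu i * uh i x))))\<^sup>2)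
   \<le> 3 * ((4 / (3 * c)) * (CC * measure lborel D + 1 / c) + (4 * (4 * M + 1) + M) * measure lborel D)"
  proof (rule uniform_L2_estimate[where u = uh and du = "\<lambda>i k. hat (UX k) i" and err = "\<lambda>i x. qh i x - mu i * uh i x"
     and l = "\<lambda>i. hat LL i" and \<mu> = mu and \<zeta> = \<zeta> and M = M and c = c and D = D and S = S and d\<eta> = d\<eta>, OF finite_lessThan])
   show "C1_fun (uh i) (\<lambda>k. hat (UX k) i)" for i
    unfolding C1_fun_def uh_def using hat_C1[OF pU contU contUX] continuous_hat[OF contU] continuous_hat[OF contUX] by auto
   show "cts (\<lambda>x. qh i x - mu i * uh i x)" for i by (intro continuous_intros cqh cuh)
   show "cts (hat LL i)" for i by (rule continuous_hat[OF contLL])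
   show "C1_test D \<eta> d\<eta>" using \<eta>(1) by (simp add: D_def)
   show "\<bar>\<eta> x\<bar> \<le> 1" for x using \<eta>(2,3)[of x] by simp
   show "\<bar>d\<eta> k x\<bar> \<le> M" for k x using M\<eta>k[of k x] M by simp
   show "compact D" by (rule cD)
   show "S \<subseteq> D" by (simp add: S_def)
   show "(\<integral>x. (mu i * uh i x + (qh i x - mu i * uh i x)) \<bullet> \<phi> x + aform x (\<lambda>k. hat (UX k) i x) (\<lambda>k. d\<phi> k x) - hat LL i x \<bullet> \<phi> x) = 0"
    if "C1_test S \<phi> d\<phi>" for i \<phi> d\<phi>
   proof -
    have "C1_test good \<phi> d\<phi>" using that by (auto simp: C1_test_def S_def)
    from weak_hat[OF this, of i] show ?thesis by simp
   qed
   show "norm (\<zeta> i) = 1" for i by (rule ph(1))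
   show "c \<le> Re (\<zeta> i)" for i unfolding c_def by (rule ph(2))
   show "c / norm (mu i) \<le> Re (\<zeta> i / mu i)" for i unfolding c_def by (rule ph(3))
   show "1 \<le> norm (mu i)" for i by (rule ph(4))
   show "0 < c" unfolding c_def by (rule ph(6))
   show "0 \<le> M" by (rule M)
   show "n = real CARD('n)" by (rule n_def)
   show "Cg = 3 * (2 * M + n^4 * \<Lambda>\<^sup>2 * M^3)" by (rule Cg_def)
   show "CC = 2 / c * (4 * (4 * M + 1)) + 2 / c * Cg + \<Lambda> * n\<^sup>2 * M^3 / c" by (rule CC_def)
   fix x assume x: "x \<in> D"
   show "(\<Sum>i<N. (norm (qh i x - mu i * uh i x))\<^sup>2) \<le> M"
   proof -
    have "\<bar>U t x\<bar> \<le> B \<and> \<bar>V t x\<bar> \<le> B" if "t \<le> T" for t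
     using Bt(1,2)[of t x] x that U0[of t x] V0[of t x] B(1) by (cases "0 \<le> t") auto
    from CE[OF this finite_lessThan] show ?thesis using M(3) by (meson order_trans)
   qed
   show "(\<Sum>i<N. (norm (hat LL i x))\<^sup>2) \<le> M"
   proof -
    have "(\<Sum>i<N. (norm (hat LL i x))\<^sup>2) \<le> M1" unfolding M1_def
     by (rule smallhat) (use Bt(4) x in0T B(1) in \<open>auto intro!: continuous_intros cont\<theta> cont_slice_t[OF contLL]\<close>)
    then show ?thesis using M(4) by simp
   qed
   show "(\<Sum>i<N. (norm (hat (UX k) i x))\<^sup>2) \<le> M" for k
   proof -
    have "(\<Sum>i<N. (norm (hat (UX k) i x))\<^sup>2) \<le> M1" unfolding M1_def
     by (rule smallhat) (use Bt(3) x in0T B(1) in \<open>auto intro!: continuous_intros cont\<theta> cont_slice_t[OF contUX]\<close>)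
    then show ?thesis using M(4) by simp
   qed
   \<comment> \<open>Since \<open>|mu| \<le> |freq|^2\<close>, the weighted sum is dominated by the
     coefficients of the bounded function \<open>ww\<close>.\<close>
   show "(\<Sum>i<N. norm (mu i) * (norm (uh i x))\<^sup>2) \<le> M"
   proof -
    have "(\<Sum>i<N. norm (mu i) * (norm (uh i x))\<^sup>2) \<le> (\<Sum>i<N. (norm (freq T i * uh i x))\<^sup>2)"
     by (intro sum_mono) (simp add: norm_mult power_mult_distrib mult_right_mono ph(5))
    also have "\<dots> \<le> M2"
     unfolding freq_uh M2_def EE_def Bess_def
    proof (rule Bessel_half_line[OF T finite_lessThan])
     show "(\<lambda>t. complex_of_real (ww t x)) \<in> borel_measurable borel"
      by (intro borel_measurable_continuous_onI continuous_intros cont_ww)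
     show "complex_of_real (ww t x) = 0" if "t \<le> 0" for t using \<theta>_out(1,2)[of t] lohi that by (simp add: ww_def)
     show "norm (complex_of_real (ww t x)) \<le> 2 * C\<theta> * B" for t
     proof (cases "t \<in> {lo..hi}")
      case True
      have "\<bar>\<theta>' t * U t x\<bar> \<le> C\<theta> * B" "\<bar>\<theta> t * V t x\<bar> \<le> C\<theta> * B"
       unfolding abs_mult using Bt(1,2)[OF in0T[OF True] x] C\<theta> by (auto intro!: mult_mono)
      then show ?thesis unfolding norm_of_real ww_def by linarith
     next
      case False then show ?thesis using \<theta>_out(1,2)[OF False] C\<theta>(1) B(1) by (simp add: ww_def)
     qed
    qed
    finally show ?thesis using M(5) by simp
   qed
   assume xS: "x \<notin> S"
   show "(\<Sum>i<N. (norm (mu i * uh i x + (qh i x - mu i * uh i x)))\<^sup>2) \<le> M"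
   proof -
    have "(\<Sum>i<N. (norm (hat W i x))\<^sup>2) \<le> M3" unfolding M3_def
    proof (rule smallhat[of "{..<N}" W x "\<bar>m\<bar>", OF finite_lessThan contW\<theta>])
     fix t assume "t \<in> {lo..hi}"
     then show "\<bar>W t x\<bar> \<le> \<bar>m\<bar>" using m[of x t] xS x by (auto simp: S_def D_def)
    qed auto
    then show ?thesis using M(6) by (simp add: qh_def)
   qed
  qed
  then show ?thesis by simp
 qed
 then show thesis by (rule that)
qed

text \<open>Parseval's inequality turns the uniform bound on the partial sums into a bound on the
  space-time integral of \<open>(\<theta> W)^2\<close> weighted with \<open>\<eta>^2\<close>. On the
  half ball \<open>\<eta> \<ge> 1 / 4\<close>, which costs the factor 16.\<close>

lemma good_point:
 assumes r: "0 < r" and m: "\<And>x t. x \<in> cball x0 r ==> x \<notin> good ==> t \<in> {lo..hi} ==> \<bar>W t x\<bar> \<le> m"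
 shows "x0 \<in> good"
proof -
 let ?I = "\<lambda>x. \<integral>\<^sup>+t. ennreal (sqW (t, x)) \<partial>lborel"
 obtain \<eta> d\<eta> where \<eta>: "C1_test (cball x0 r) \<eta> d\<eta>" "\<And>x. 0 \<le> \<eta> x" "\<And>x. \<eta> x \<le> (1::real)"
  "\<And>x. x \<in> ball x0 (r / 2) ==> 1 / 4 \<le> \<eta> x" by (rule C1_bump[OF r, of x0]) blast
 obtain R where R: "\<And>N. (\<Sum>i<(N::nat). \<integral>x. (norm (\<eta> x *\<^sub>R qh i x))\<^sup>2) \<le> R"
  by (rule qh_L2_bound[OF r m \<eta>(1-3)]) blast+
 have \<eta>c: "cts \<eta>" using C1_test_fun[OF \<eta>(1)] by (auto simp: C1_fun_def)
 have \<eta>s: "\<eta> x = 0" if "x \<notin> cball x0 r" for x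
 proof -
  obtain K where K: "compact K" "K \<subseteq> cball x0 r" "\<And>x. x \<notin> K ==> \<eta> x = 0" "\<And>x k. x \<notin> K ==> d\<eta> k x = 0"
   by (rule C1_testE[OF \<eta>(1)]) blast
  from K(3)[of x] show "\<eta> x = 0" using that K(2) by blast
 qed
 define K where "K = exp (2 * T) * (2 / T)"
 define q where "q i x = (norm (\<eta> x *\<^sub>R qh i x))\<^sup>2" for i x
 have q0: "0 \<le> q i x" for i x by (simp add: q_def)
 have qi: "lintegrable (q i)" for i
  by (rule integrable_compact_support[OF _ compact_cball[of x0 r]])
   (auto simp: q_def[abs_def] \<eta>s intro!: continuous_intros \<eta>c cqh)
 define b where "b x = ennreal ((\<eta> x)\<^sup>2)" for x
 have bm: "b \<in> borel_measurable borel"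
  unfolding b_def using borel_measurable_continuous_onI[OF \<eta>c] by measurable
 have "(\<integral>\<^sup>+x. b x * ?I x \<partial>lborel) \<le> (\<integral>\<^sup>+x. ennreal K * (\<Sum>i. ennreal (q i x)) \<partial>lborel)"
 proof (intro nn_integral_mono)
  fix x
  have "b x * ?I x \<le> b x * (ennreal K * (\<Sum>i. ennreal ((norm (qh i x))\<^sup>2)))"
   unfolding K_def by (intro mult_left_mono Parseval_W) auto
  also have "\<dots> = ennreal K * (b x * (\<Sum>i. ennreal ((norm (qh i x))\<^sup>2)))" by (rule mult.left_commute)
  also have "b x * (\<Sum>i. ennreal ((norm (qh i x))\<^sup>2)) = (\<Sum>i. b x * ennreal ((norm (qh i x))\<^sup>2))"
   by (rule ennreal_suminf_cmult[symmetric])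
  also have "(\<lambda>i. b x * ennreal ((norm (qh i x))\<^sup>2)) = (\<lambda>i. ennreal (q i x))"
   by (rule ext) (simp add: b_def q_def power_mult_distrib ennreal_mult)
  finally show "b x * ?I x \<le> ennreal K * (\<Sum>i. ennreal (q i x))" .
 qed
 also have "\<dots> = ennreal K * (\<Sum>i. \<integral>\<^sup>+x. ennreal (q i x) \<partial>lborel)"
 proof -
  have m: "(\<lambda>x. ennreal (q i x)) \<in> borel_measurable lborel" for i using qi by simp
  then have "(\<lambda>x. \<Sum>i. ennreal (q i x)) \<in> borel_measurable lborel" by measurable
  then show ?thesis using nn_integral_suminf[OF m] by (simp add: nn_integral_cmult)
 qed
 also have "(\<lambda>i. \<integral>\<^sup>+x. ennreal (q i x) \<partial>lborel) = (\<lambda>i. ennreal (\<integral>x. q i x))"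
  using nn_integral_eq_integral[OF qi] q0 by auto
 also have "(\<Sum>i. ennreal (\<integral>x. q i x)) \<le> ennreal R"
 proof (rule suminf_le_const)
  fix N
  have "(\<Sum>i<N. ennreal (\<integral>x. q i x)) = ennreal (\<Sum>i<N. \<integral>x. q i x)"
   by (rule sum_ennreal) (auto intro: integral_nonneg q0)
  also have "\<dots> \<le> ennreal R" using R[of N] by (intro ennreal_leI) (simp add: q_def)
  finally show "(\<Sum>i<N. ennreal (\<integral>x. q i x)) \<le> ennreal R" .
 qed simp
 finally have fin: "(\<integral>\<^sup>+x. b x * ?I x \<partial>lborel) \<le> ennreal K * ennreal R"
  by (meson mult_left_mono order_trans zero_le)
 define F where "F p = indicator (ball x0 (r / 2)) (snd p) * sqW p" for p
 have Fm: "F \<in> borel_measurable borel"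
  unfolding F_def[abs_def] using indicator_snd_measurable[of "ball x0 (r / 2)"] by simp
 have sm: "(\<lambda>t. ennreal (sqW (t, x))) \<in> borel_measurable lborel" for x
 proof -
  have "(\<lambda>t. (t, x)) \<in> borel \<rightarrow>\<^sub>M borel" by (intro borel_measurable_continuous_onI continuous_intros)
  from measurable_compose[OF this sqW_measurable] show ?thesis by simp
 qed
 have "(\<integral>\<^sup>+p. ennreal (F p) \<partial>lborel) = (\<integral>\<^sup>+p. ennreal (F p) \<partial>(lborel \<Otimes>\<^sub>M lborel))" by (simp only: lborel_prod)
 also have "\<dots> = (\<integral>\<^sup>+x. \<integral>\<^sup>+t. ennreal (F (t, x)) \<partial>lborel \<partial>lborel)"
  using Fm by (intro lborel_pair.nn_integral_snd[symmetric]) (simp add: lborel_prod)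
 also have "\<dots> \<le> (\<integral>\<^sup>+x. 16 * (b x * ?I x) \<partial>lborel)"
 proof (intro nn_integral_mono)
  fix x
  have "ennreal (F (t, x)) \<le> (16 * b x) * ennreal (sqW (t, x))" for t
  proof -
   have "F (t, x) \<le> 16 * (\<eta> x)\<^sup>2 * sqW (t, x)"
   proof (cases "x \<in> ball x0 (r / 2)")
    case True
    have "(1 / 4)\<^sup>2 \<le> (\<eta> x)\<^sup>2" using \<eta>(4)[OF True] by (intro power_mono) auto
    then have "1 * sqW (t, x) \<le> 16 * (\<eta> x)\<^sup>2 * sqW (t, x)" by (intro mult_right_mono sqW_nonneg) (simp add: power2_eq_square)
    then show ?thesis using True by (simp add: F_def)
   qed (simp add: F_def sqW_nonneg)
   then have "ennreal (F (t, x)) \<le> ennreal (16 * (\<eta> x)\<^sup>2 * sqW (t, x))" by (rule ennreal_leI)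
   also have "\<dots> = (16 * b x) * ennreal (sqW (t, x))"
    unfolding b_def by (subst ennreal_mult, simp, rule sqW_nonneg, subst ennreal_mult) auto
   finally show ?thesis .
  qed
  then have "(\<integral>\<^sup>+t. ennreal (F (t, x)) \<partial>lborel) \<le> (\<integral>\<^sup>+t. (16 * b x) * ennreal (sqW (t, x)) \<partial>lborel)" by (intro nn_integral_mono)
  also have "\<dots> = (16 * b x) * ?I x" by (rule nn_integral_cmult[OF sm])
  finally show "(\<integral>\<^sup>+t. ennreal (F (t, x)) \<partial>lborel) \<le> 16 * (b x * ?I x)" by (simp add: mult.assoc)
 qed
 also have "\<dots> = 16 * (\<integral>\<^sup>+x. b x * ?I x \<partial>lborel)"
 proof (rule nn_integral_cmult)
  have "(\<lambda>x. \<integral>\<^sup>+t. ennreal (sqW (t, x)) \<partial>lborel) \<in> borel_measurable lborel"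
  proof (rule lborel.borel_measurable_nn_integral)
   have "(\<lambda>(x, t). (t, x)) \<in> (lborel :: (real^'n) measure) \<Otimes>\<^sub>M (lborel :: real measure) \<rightarrow>\<^sub>M borel"
    unfolding borel_prod[symmetric] by measurable
   from measurable_compose[OF this sqW_measurable] have "(\<lambda>p. sqW ((\<lambda>(x, t). (t, x)) p)) \<in> borel_measurable (lborel \<Otimes>\<^sub>M lborel)" .
   then show "(\<lambda>(x, t). ennreal (sqW (t, x))) \<in> borel_measurable (lborel \<Otimes>\<^sub>M lborel)" by (simp add: split_def)
  qed
  then show "(\<lambda>x. b x * ?I x) \<in> borel_measurable lborel" using bm by simp
 qed
 also have "\<dots> \<le> 16 * (ennreal K * ennreal R)" by (intro mult_left_mono fin) auto
 also have "\<dots> < \<infinity>" by (simp add: ennreal_mult_less_top)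
 finally have "(\<integral>\<^sup>+p. ennreal (F p) \<partial>lborel) < \<infinity>" .
 moreover have "norm (F p) = F p" for p by (simp add: F_def sqW_nonneg)
 ultimately have "lintegrable F" using Fm by (intro integrableI_bounded) auto
 then show ?thesis using r by (auto simp: good_def F_def[abs_def] intro!: exI[of _ "r / 2"])
qed

text \<open>Separate continuity is used in both variables: continuity in \<open>x\<close> makes the
  sets \<open>E m\<close> closed, continuity in \<open>t\<close> on the compact interval makes them
  cover. On the exceptional part of some ball \<open>W\<close> is then bounded, and its centre,
  chosen exceptional, is good by \<open>good_point\<close>.\<close>

lemma good_UNIV: "good = UNIV"
proof (rule ccontr)
 assume "good \<noteq> UNIV"
 then have Z: "closed (- good)" "- good \<noteq> {}" using open_good by auto
 define E where "E m = {x. \<forall>t\<in>{lo..hi}. \<bar>W t x\<bar> \<le> real m}" for m :: nat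
 have t: "0 < t" "t < T" if "t \<in> {lo..hi}" for t using that lohi by auto
 have Ec: "closed (E m)" for m
 proof -
  have "E m = (\<Inter>t\<in>{lo..hi}. {x. \<bar>W t x\<bar> \<le> real m})" by (auto simp: E_def)
  moreover have "closed {x. \<bar>W t x\<bar> \<le> real m}" if "t \<in> {lo..hi}" for t
   by (intro closed_Collect_le continuous_intros W_x t that)
  ultimately show ?thesis by (auto intro!: closed_INT)
 qed
 have cover: "- good \<subseteq> (\<Union>m. E m)"
 proof
  fix x
  have "continuous_on {lo..hi} (\<lambda>t. W t x)" by (rule continuous_on_subset[OF W_t]) (use t in auto)
  from compact_image_bound[OF compact_Icc this] obtain B where B: "0 < B" "\<And>t. t \<in> {lo..hi} ==> norm (W t x) \<le> B" by blast
  obtain m where "B \<le> real m" using real_arch_simple by blast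
  then have "x \<in> E m" using B(2) by (force simp: E_def)
  then show "x \<in> (\<Union>m. E m)" by blast
 qed
 obtain m x r where r: "0 < r" "x \<in> - good" "- good \<inter> ball x r \<subseteq> E m"
  by (rule Baire_closed_cover[OF Z Ec cover]) blast
 have "x \<in> good"
 proof (rule good_point[of "r / 2" x "real m"])
  fix y t assume "y \<in> cball x (r / 2)" "y \<notin> good" "t \<in> {lo..hi}"
  then have "y \<in> E m" using r by (auto intro!: subsetD[OF r(3)])
  then show "\<bar>W t y\<bar> \<le> real m" using \<open>t \<in> {lo..hi}\<close> by (auto simp: E_def)
 qed (use r in simp)
 then show False using r by simp
qed

end

section \<open>The equation tested against functions of space\<close>

text \<open>The exponent 3 exceeds 2, so two continuous derivatives survive at the end
  points.\<close>

lemma C2_time_bump: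
 fixes lo hi :: real
 defines "f \<equiv> \<lambda>t. max 0 ((t - lo) * (hi - t))"
 defines "\<theta> \<equiv> \<lambda>t. f t powr 3" and "\<theta>' \<equiv> \<lambda>t. 3 * f t powr 2 * (lo + hi - 2 * t)"
  and "\<theta>'' \<equiv> \<lambda>t. 6 * f t powr 1 * (lo + hi - 2 * t)\<^sup>2 - 6 * f t powr 2"
 assumes lh: "lo < hi"
 shows "(\<theta> has_real_derivative \<theta>' t) (at t)" "(\<theta>' has_real_derivative \<theta>'' t) (at t)" "cts \<theta>''"
  "t \<notin> {lo..hi} ==> \<theta> t = 0" "t \<notin> {lo..hi} ==> \<theta>' t = 0" "t \<notin> {lo..hi} ==> \<theta>'' t = 0" "lo < t ==> t < hi ==> 0 < \<theta> t"
proof -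
 have dq: "((\<lambda>t. (t - lo) * (hi - t)) has_real_derivative (lo + hi - 2 * t)) (at t)" for t
  by (auto intro!: derivative_eq_intros simp: algebra_simps)
 have fp: "((\<lambda>t. f t powr c) has_real_derivative c * f t powr (c - 1) * (lo + hi - 2 * t)) (at t)" if "1 < c" for c t
  unfolding f_def using DERIV_chain2[OF DERIV_pos_part_powr[OF that] dq] .
 show "(\<theta> has_real_derivative \<theta>' t) (at t)" using fp[of 3 t] by (simp add: \<theta>_def \<theta>'_def)
 have "((\<lambda>t. 3 * (f t powr 2) * (lo + hi - 2 * t)) has_real_derivative
  3 * (2 * f t powr (2 - 1) * (lo + hi - 2 * t)) * (lo + hi - 2 * t) + 3 * (f t powr 2) * (- 2)) (at t)"
  by (rule derivative_eq_intros fp refl | simp)+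
 then show "(\<theta>' has_real_derivative \<theta>'' t) (at t)" by (simp add: \<theta>'_def \<theta>''_def power2_eq_square algebra_simps)
 have fc: "cts f" unfolding f_def by (intro continuous_intros)
 show "cts \<theta>''" unfolding \<theta>''_def
  by (intro continuous_intros continuous_on_powr' fc) (auto simp: f_def)
 have f0: "f t = 0" if "t \<notin> {lo..hi}" for t
 proof -
  have "(t - lo) * (hi - t) \<le> 0" using that lh by (auto simp: not_le mult_le_0_iff)
  then show ?thesis by (simp add: f_def)
 qed
 show "t \<notin> {lo..hi} ==> \<theta> t = 0" "t \<notin> {lo..hi} ==> \<theta>' t = 0" "t \<notin> {lo..hi} ==> \<theta>'' t = 0"
  by (simp_all add: \<theta>_def \<theta>'_def \<theta>''_def f0)
 show "lo < t ==> t < hi ==> 0 < \<theta> t" by (simp add: \<theta>_def f_def max_def)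
qed

context frac_data
begin

text \<open>A cut-off supported on a slightly larger interval has a positive minimum
  \<open>m\<close> on \<open>[s, t]\<close>, so \<open>|W| \<le> (1 + (\<theta> W)^2) / m\<close>
  there and square integrability of \<open>\<theta> W\<close> suffices.\<close>

lemma W_integrable:
 assumes st: "0 < s" "s \<le> t" "t < T" and K: "compact K"
 shows "lintegrable (\<lambda>p. indicator ({s..t} \<times> K) p * W (fst p) (snd p))"
proof -
 define lo where "lo = s / 2"
 define hi where "hi = (t + T) / 2"
 have lh: "lo < hi" "0 < lo" "hi < T" "lo < s" "t < hi" using st by (auto simp: lo_def hi_def)
 note bump = C2_time_bump[OF lh(1)]
 define \<theta> where "\<theta> t = max 0 ((t - lo) * (hi - t)) powr 3" for t
 interpret frac_cut a \<Lambda> \<delta>0 T \<alpha> U V W UX bb cc lo hi \<theta>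
  "\<lambda>t. 3 * max 0 ((t - lo) * (hi - t)) powr 2 * (lo + hi - 2 * t)"
  "\<lambda>t. 6 * max 0 ((t - lo) * (hi - t)) powr 1 * (lo + hi - 2 * t)\<^sup>2 - 6 * max 0 ((t - lo) * (hi - t)) powr 2"
  unfolding \<theta>_def[abs_def] by unfold_locales (use bump lh in auto)
 have "\<exists>x\<in>{s..t}. \<forall>y\<in>{s..t}. \<theta> x \<le> \<theta> y"
  using st(2) by (intro continuous_attains_inf cont\<theta>) auto
 then obtain t0 where t0: "t0 \<in> {s..t}" "\<And>y. y \<in> {s..t} ==> \<theta> t0 \<le> \<theta> y" by blast
 define m where "m = \<theta> t0"
 have m: "0 < m" unfolding m_def using t0(1) lh by (intro \<theta>_pos) auto
 show ?thesis
 proof (rule integrable_bound)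
  have "lintegrable (\<lambda>p. indicator K (snd p) * sqW p)"
   by (rule integrable_sqW_compact[OF K]) (simp add: good_UNIV)
  moreover have "lintegrable (\<lambda>p :: real \<times> (real^'n). (1::real) * indicator ({s..t} \<times> K) p)"
   by (rule integrable_indicator_compact[OF compact_Times[OF compact_Icc K]])
  ultimately show "lintegrable (\<lambda>p. (1 / m) * ((1::real) * indicator ({s..t} \<times> K) p + indicator K (snd p) * sqW p))"
   by (intro integrable_mult_right) (rule integrable_add)
  have ms: "{s..t} \<times> K \<in> sets borel" by (intro borel_compact compact_Times compact_Icc K)
  have "(\<lambda>p. indicator ({s..t} \<times> K) p * ((\<theta> (fst p) * W (fst p) (snd p)) / \<theta> (fst p))) \<in> borel_measurable borel"
  proof -
   have "(\<lambda>p :: real \<times> (real^'n). \<theta> (fst p)) \<in> borel_measurable borel"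
    by (intro borel_measurable_continuous_onI cont_fst cont\<theta>)
   then show ?thesis using W_measurable ms by measurable
  qed
  moreover have "(\<lambda>p. indicator ({s..t} \<times> K) p * ((\<theta> (fst p) * W (fst p) (snd p)) / \<theta> (fst p)))
   = (\<lambda>p. indicator ({s..t} \<times> K) p * W (fst p) (snd p))"
  proof
   fix p :: "real \<times> (real^'n)"
   show "indicator ({s..t} \<times> K) p * ((\<theta> (fst p) * W (fst p) (snd p)) / \<theta> (fst p)) = indicator ({s..t} \<times> K) p * W (fst p) (snd p)"
    using \<theta>_pos[of "fst p"] lh by (cases p) (auto simp: indicator_def)
  qed
  ultimately show "(\<lambda>p. indicator ({s..t} \<times> K) p * W (fst p) (snd p)) \<in> borel_measurable lborel" by simp
  show "AE p in lborel. norm (indicator ({s..t} \<times> K) p * W (fst p) (snd p))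
   \<le> norm ((1 / m) * ((1::real) * indicator ({s..t} \<times> K) p + indicator K (snd p) * sqW p))"
  proof (rule AE_I2)
   fix p :: "real \<times> (real^'n)"
   show "norm (indicator ({s..t} \<times> K) p * W (fst p) (snd p))
    \<le> norm ((1 / m) * ((1::real) * indicator ({s..t} \<times> K) p + indicator K (snd p) * sqW p))"
   proof (cases "p \<in> {s..t} \<times> K")
    case True
    define w where "w = \<bar>W (fst p) (snd p)\<bar>"
    define c where "c = \<theta> (fst p)"
    have c: "m \<le> c" unfolding m_def c_def using True by (intro t0(2)) auto
    have "m * w \<le> c * w" using c by (intro mult_right_mono) (auto simp: w_def)
    also have "\<dots> \<le> 1 + (c * w)\<^sup>2"
    proof -
     have "0 \<le> (c * w - 1)\<^sup>2" by simp
     then have "2 * (c * w) \<le> (c * w)\<^sup>2 + 1" by (simp add: power2_diff)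
     then show ?thesis using zero_le_power2[of "c * w"] by linarith
    qed
    also have "(c * w)\<^sup>2 = sqW p" by (simp add: sqW_def c_def w_def power_mult_distrib)
    finally have "w \<le> (1 / m) * (1 + sqW p)" using m by (simp add: field_simps)
    moreover have "0 \<le> (1 / m) * (1 + sqW p)" using m sqW_nonneg[of p] by simp
    ultimately have "norm (W (fst p) (snd p)) \<le> norm ((1 / m) * (1 + sqW p))" unfolding w_def real_norm_def by linarith
    then show ?thesis using True by (cases p) simp
   qed simp
  qed
 qed
qed

lemma UX0: "UX k t x = 0" if "t \<le> 0"
proof -
 have "pderiv_on (U t) k (\<lambda>_. 0)" using U0[OF that] by (simp add: pderiv_on_def has_vector_derivative_const)
 from pderiv_unique[OF pU this] show ?thesis by (simp add: fun_eq_iff)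
qed

lemma JJ0: "JJ t x = 0" if "t \<le> 0"
 unfolding JJ_def by (rule fconv_eq_0[OF \<alpha>]) (use V0 that in auto)

text \<open>The convolution of the solution itself: \<open>JJ\<close> is its first and
  \<open>W\<close> its second time derivative, so that both derivatives can be moved to a weight in
  time.\<close>

definition KK :: "real => real^'n => real" where "KK t x = fconv \<alpha> (\<lambda>t. U t x) t"

lemma contKK: "cts2 KK"
 unfolding KK_def by (rule continuous_fconv[OF \<alpha> contU U0])

lemma KK0: "KK t x = 0" if "t \<le> 0"
 unfolding KK_def by (rule fconv_eq_0[OF \<alpha>]) (use U0 that in auto)

lemma d_KK: "t < T ==> ((\<lambda>t. KK t x) has_vector_derivative JJ t x) (at t)"
 unfolding KK_def JJ_def
 by (rule has_vector_derivative_fconv[OF \<alpha> cont_slice_t[OF contU] U0 cont_slice_t[OF contV] V0, where T = T])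
  (use dU in \<open>auto simp: real_derivative_iff\<close>)

context
 fixes \<psi> :: "real^'n => real" and d\<psi>
 assumes \<psi>: "C1_test UNIV \<psi> d\<psi>"
begin

definition testU :: "real => real" where "testU t = (\<integral>x. KK t x * \<psi> x)"
definition testV :: "real => real" where "testV t = (\<integral>x. JJ t x * \<psi> x)"
definition testG :: "real => real^'n => real" where
 "testG t x = LL t x * \<psi> x - aform x (\<lambda>k. UX k t x) (\<lambda>k. d\<psi> k x)"
text \<open>Defined by the right-hand side of the equation instead of \<open>W\<close>, so that
  continuity in time is immediate; \<open>d_testV\<close> identifies it with the derivative of
  \<open>testV\<close>.\<close>

definition testW :: "real => real" where "testW t = (\<integral>x. testG t x)"

lemma \<psi>c: "cts \<psi>" "cts (d\<psi> k)"
 using C1_test_fun[OF \<psi>] by (auto simp: C1_fun_def)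

lemma cont_testG: "cts2 testG"
 unfolding testG_def aform_def by (intro continuous_intros contLL contUX cont_snd \<psi>c a_cont)

lemma \<psi>_support: obtains K where "compact K" "\<And>x. x \<notin> K ==> \<psi> x = 0" "\<And>t x. x \<notin> K ==> testG t x = 0"
proof -
 obtain K where K: "compact K" "K \<subseteq> UNIV" "\<And>x. x \<notin> K ==> \<psi> x = 0" "\<And>x k. x \<notin> K ==> d\<psi> k x = 0"
  by (rule C1_testE[OF \<psi>]) blast
 show thesis by (rule that[OF K(1,3)]) (simp_all add: K(3,4) testG_def aform_def)
qed

lemma cont_test: "cts testU" "cts testV" "cts testW"
proof -
 obtain K where K: "compact K" "\<And>x. x \<notin> K ==> \<psi> x = 0" "\<And>t x. x \<notin> K ==> testG t x = 0" by (rule \<psi>_support) blast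
 show "cts testU" unfolding testU_def
  by (rule continuous_param_integral_compact[OF _ K(1)]) (auto intro!: continuous_intros contKK cont_snd \<psi>c simp: K)
 show "cts testV" unfolding testV_def
  by (rule continuous_param_integral_compact[OF _ K(1)]) (auto intro!: continuous_intros contJJ cont_snd \<psi>c simp: K)
 show "cts testW" unfolding testW_def
  by (rule continuous_param_integral_compact[OF cont_testG K(1)]) (rule K(3))
qed

lemma test0: "testU 0 = 0" "testV 0 = 0"
 by (simp_all add: testU_def testV_def KK0 JJ0)

lemma d_testU:
 assumes t: "t < T" shows "(testU has_real_derivative testV t) (at t)"
proof -
 obtain K where K: "compact K" "\<And>x. x \<notin> K ==> \<psi> x = 0" "\<And>t x. x \<notin> K ==> testG t x = 0" by (rule \<psi>_support) blast
 have cJ: "cts (\<lambda>p. JJ (fst p) (snd p) * \<psi> (snd p))" by (intro continuous_intros contJJ cont_snd \<psi>c)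
 obtain B where B: "0 < B" "\<And>p. p \<in> {2 * t - T..T} \<times> K ==> norm (JJ (fst p) (snd p) * \<psi> (snd p)) \<le> B"
  using compact_image_bound[OF compact_Times[OF compact_Icc K(1)] continuous_on_subset[OF cJ subset_UNIV]] by blast
 show ?thesis
  unfolding real_derivative_iff testU_def[abs_def] testV_def
 proof (rule has_vector_derivative_integral(1)[where r = "T - t" and g = "\<lambda>x. B * indicator K x"])
 show "0 < T - t" using t by simp
 show "lintegrable (\<lambda>x. B * indicator K x)" by (rule integrable_indicator_compact[OF K(1)])
 fix s assume s: "\<bar>s - t\<bar> < T - t"
 show "lintegrable (\<lambda>x. KK s x * \<psi> x)"
  by (rule integrable_compact_support[OF _ K(1)]) (auto intro!: continuous_intros cont_slice_x[OF contKK] \<psi>c simp: K)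
 fix x
 show "((\<lambda>s. KK s x * \<psi> x) has_vector_derivative JJ s x * \<psi> x) (at s)"
  using s by (intro has_vector_derivative_mult_left d_KK) auto
 show "norm (JJ s x * \<psi> x) \<le> B * indicator K x"
  using B(2)[of "(s, x)"] K(2)[of x] s by (cases "x \<in> K") (auto simp: abs_less_iff)
 qed
qed

text \<open>The equation integrated over a time interval. Exchanging the integrals of
  \<open>W\<close> over \<open>[s, t]\<close> and over space is the purpose of
  \<open>W_integrable\<close>.\<close>

lemma testV_increment:
 assumes st: "0 < s" "s \<le> t" "t < T"
 shows "testV t - testV s = (\<integral>r. indicator {s..t} r *\<^sub>R testW r)"
proof -
 obtain K where K: "compact K" "\<And>x. x \<notin> K ==> \<psi> x = 0" "\<And>t x. x \<notin> K ==> testG t x = 0" by (rule \<psi>_support) blast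
 obtain C where C: "0 < C" "\<And>x. norm (\<psi> x) \<le> C" using bounded_compact_support[OF \<psi>c(1) K(1,2)] by metis
 define X where "X r x = indicator ({s..t} \<times> K) (r, x) * W r x * \<psi> x" for r x
 have "lintegrable (\<lambda>p. X (fst p) (snd p))"
 proof (rule integrable_bound)
  show "lintegrable (\<lambda>p. C * (indicator ({s..t} \<times> K) p * W (fst p) (snd p)))"
   by (intro integrable_mult_right W_integrable st K(1))
  have "(\<lambda>p :: real \<times> (real^'n). \<psi> (snd p)) \<in> borel_measurable borel" by (intro borel_measurable_continuous_onI cont_snd \<psi>c)
  moreover have "(\<lambda>p. indicator ({s..t} \<times> K) p * W (fst p) (snd p)) \<in> borel_measurable borel"
   using borel_measurable_integrable[OF W_integrable[OF st K(1)]] by simp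
  ultimately show "(\<lambda>p. X (fst p) (snd p)) \<in> borel_measurable lborel" unfolding X_def by simp
  show "AE p in lborel. norm (X (fst p) (snd p)) \<le> norm (C * (indicator ({s..t} \<times> K) p * W (fst p) (snd p)))"
  proof (rule AE_I2)
   fix p :: "real \<times> (real^'n)"
   have "norm (X (fst p) (snd p)) = norm (indicator ({s..t} \<times> K) p * W (fst p) (snd p)) * norm (\<psi> (snd p))"
    unfolding X_def by (simp only: prod.collapse norm_mult)
   also have "\<dots> \<le> norm (indicator ({s..t} \<times> K) p * W (fst p) (snd p)) * C" by (intro mult_left_mono C) auto
   also have "\<dots> = norm (C * (indicator ({s..t} \<times> K) p * W (fst p) (snd p)))" using C(1) by (simp only: norm_mult) simp
   finally show "norm (X (fst p) (snd p)) \<le> norm (C * (indicator ({s..t} \<times> K) p * W (fst p) (snd p)))" .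
  qed
 qed
 then have iX: "integrable (lborel \<Otimes>\<^sub>M lborel) (\<lambda>(r, x). X r x)" by (simp add: lborel_prod split_def)
 have it: "(\<integral>r. X r x) = JJ t x * \<psi> x - JJ s x * \<psi> x" for x
 proof -
  have "(\<integral>r. X r x) = (\<integral>r. (indicator {s..t} r *\<^sub>R W r x) * \<psi> x)"
   by (intro integral_cong refl) (use K(2) in \<open>auto simp: X_def indicator_def\<close>)
  also have "\<dots> = (\<integral>r. indicator {s..t} r *\<^sub>R W r x) * \<psi> x" by (rule integral_mult_left_zero)
  also have "(\<integral>r. indicator {s..t} r *\<^sub>R W r x) = JJ t x - JJ s x"
  proof (rule integral_FTC_Icc[OF st(2)])
   show "((\<lambda>r. JJ r x) has_vector_derivative W r x) (at r within {s..t})" if "s \<le> r" "r \<le> t" for r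
   proof -
    have r: "0 < r" "r < T" using that st by auto
    show ?thesis unfolding JJ_def
     by (rule has_vector_derivative_at_within[OF dJ[OF r, unfolded real_derivative_iff]])
   qed
   show "continuous_on {s..t} (\<lambda>r. W r x)" by (rule continuous_on_subset[OF W_t]) (use st in auto)
  qed
  finally show ?thesis by (simp add: left_diff_distrib)
 qed
 have ix: "(\<integral>x. X r x) = indicator {s..t} r *\<^sub>R testW r" for r
 proof (cases "r \<in> {s..t}")
  case True
  then have r: "0 < r" "r < T" using st by auto
  have i1: "lintegrable (\<lambda>x. W r x * \<psi> x)"
   by (rule integrable_compact_support[OF _ K(1)]) (auto intro!: continuous_intros W_x r \<psi>c simp: K)
  have i2: "lintegrable (testG r)"
   by (rule integrable_compact_support[OF cont_slice_x[OF cont_testG] K(1)]) (rule K(3))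
  have "(\<integral>x. W r x * \<psi> x - testG r x) = 0"
   using slice[OF r \<psi>] by (simp only: testG_def LL_def diff_diff_eq2)
  then have "(\<integral>x. W r x * \<psi> x) = testW r" using i1 i2 by (simp add: testW_def)
  moreover have "(\<integral>x. X r x) = (\<integral>x. W r x * \<psi> x)"
   by (intro integral_cong refl) (use K(2) True in \<open>auto simp: X_def indicator_def\<close>)
  ultimately show ?thesis using True by simp
 next
  case False
  then have "X r x = 0" for x by (auto simp: X_def)
  then show ?thesis using False by simp
 qed
 have i: "lintegrable (\<lambda>x. JJ r x * \<psi> x)" for r
  by (rule integrable_compact_support[OF _ K(1)]) (auto intro!: continuous_intros cont_slice_x[OF contJJ] \<psi>c simp: K)
 have "testV t - testV s = (\<integral>x. JJ t x * \<psi> x - JJ s x * \<psi> x)" unfolding testV_def using i by simp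
 also have "\<dots> = (\<integral>x. \<integral>r. X r x)" by (simp only: it)
 also have "\<dots> = (\<integral>r. \<integral>x. X r x)" by (rule lborel_pair.Fubini_integral[OF iX])
 finally show ?thesis by (simp only: ix)
qed

lemma d_testV:
 assumes t: "0 < t" "t < T" shows "(testV has_real_derivative testW t) (at t)"
proof -
 define s where "s = t / 2"
 define e where "e = (t + T) / 2"
 have se: "0 < s" "s < t" "t < e" "e < T" using t by (auto simp: s_def e_def)
 have eq: "testV r = testV s + integral {s..r} testW" if "r \<in> {s..e}" for r
 proof -
  have "set_integrable lborel {s..r} testW"
   by (rule borel_integrable_atLeastAtMost'[OF continuous_on_subset[OF cont_test(3) subset_UNIV]])
  from set_borel_integral_eq_integral(2)[OF this]
  show ?thesis using testV_increment[of s r] se that by (simp add: set_lebesgue_integral_def)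
 qed
 have "((\<lambda>r. integral {s..r} testW) has_real_derivative testW t) (at t within {s..e})"
  by (rule integral_has_real_derivative[OF continuous_on_subset[OF cont_test(3) subset_UNIV]]) (use se in auto)
 then have "((\<lambda>r. testV s + integral {s..r} testW) has_real_derivative testW t) (at t)"
  using se at_within_Icc_at[of s t e] by (auto intro!: derivative_eq_intros)
 then show ?thesis
 proof (rule has_field_derivative_transform_within_open[where S = "{s<..<e}"])
  show "testV s + integral {s..r} testW = testV r" if "r \<in> {s<..<e}" for r using eq[of r] that by simp
 qed (use se in auto)
qed

text \<open>Integration by parts twice. The terms at 0 vanish with \<open>testU\<close> and
  \<open>testV\<close>, those at \<open>T\<close> by the two conditions on \<open>\<theta>\<close>;
  derivatives are taken only in the open interval, where the equation is available.\<close>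

lemma test_time_integral:
 assumes d: "\<And>t. (\<theta> has_real_derivative \<theta>' t) (at t)" "\<And>t. (\<theta>' has_real_derivative \<theta>'' t) (at t)"
  and c: "cts \<theta>''" and e: "\<theta> T = 0" "\<theta>' T = 0"
 shows "(\<integral>t. indicator {0..T} t *\<^sub>R (\<theta> t * testW t)) = (\<integral>t. indicator {0..T} t *\<^sub>R (\<theta>'' t * testU t))"
proof -
 have c\<theta>: "continuous_on S \<theta>" "continuous_on S \<theta>'" for S
  by (rule DERIV_continuous_on[OF has_field_derivative_at_within[OF d(1)]])
   (rule DERIV_continuous_on[OF has_field_derivative_at_within[OF d(2)]])
 define g where "g t = \<theta> t * testW t - \<theta>'' t * testU t" for t
 have "(g has_integral (\<theta> T * testV T - \<theta>' T * testU T) - (\<theta> 0 * testV 0 - \<theta>' 0 * testU 0)) {0..T}"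
 proof (rule fundamental_theorem_of_calculus_interior)
  show "0 \<le> T" using T by simp
  show "continuous_on {0..T} (\<lambda>t. \<theta> t * testV t - \<theta>' t * testU t)"
   by (intro continuous_intros c\<theta> continuous_on_subset[OF cont_test(1)] continuous_on_subset[OF cont_test(2)]) auto
  fix t assume "t \<in> {0<..<T}"
  then have t: "0 < t" "t < T" by auto
  show "((\<lambda>t. \<theta> t * testV t - \<theta>' t * testU t) has_vector_derivative g t) (at t)"
   unfolding real_derivative_iff[symmetric]
   using DERIV_diff[OF DERIV_mult[OF d(1) d_testV[OF t]] DERIV_mult[OF d(2) d_testU[OF t(2)]]]
   by (simp add: g_def algebra_simps)
 qed
 then have z: "integral {0..T} g = 0" using e test0 by (simp add: integral_unique)
 have si: "set_integrable lborel {0..T} (\<lambda>t. \<theta> t * testW t)" "set_integrable lborel {0..T} (\<lambda>t. \<theta>'' t * testU t)"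
  by (intro borel_integrable_atLeastAtMost' continuous_intros c\<theta> continuous_on_subset[OF c] continuous_on_subset[OF cont_test(1)] continuous_on_subset[OF cont_test(3)]; simp)+
 have "(LBINT t:{0..T}. g t) = 0" using set_borel_integral_eq_integral(2)[of "{0..T}" g] z set_integral_diff(1)[OF si] by (simp add: g_def[abs_def])
 then show ?thesis using set_integral_diff(2)[OF si] by (simp add: g_def[abs_def] set_lebesgue_integral_def)
qed

end

end

section \<open>Laplace transform over a finite time interval\<close>

lemma continuous_Icc_integral:
 fixes G :: "real => 'x::heine_borel => real"
 assumes G: "cts2 G"
 shows "cts (\<lambda>x. \<integral>t. indicator {a..b} t *\<^sub>R G t x)"
proof (rule continuous_on_integral_dominated)
 have ct: "cts (\<lambda>t. G t x)" for x
 proof -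
  have "cts (\<lambda>t. (t, x))" by (intro continuous_intros)
  from continuous_on_compose2[OF G this] show ?thesis by simp
 qed
 show "(\<lambda>t. indicator {a..b} t *\<^sub>R G t x) \<in> borel_measurable lborel" for x
  using borel_measurable_continuous_onI[OF ct] by measurable
 have "cts (\<lambda>x. G t x)" for t
 proof -
  have "cts (\<lambda>x :: 'x. (t, x))" by (intro continuous_intros)
  from continuous_on_compose2[OF G this] show ?thesis by simp
 qed
 then show "cts (\<lambda>x. indicator {a..b} t *\<^sub>R G t x)" for t by (intro continuous_intros)
 fix s :: "nat => 'x" and x assume s: "s \<longlonglongrightarrow> x"
 have K: "compact (insert x (range s))" by (rule compact_sequence_with_limit[OF s])
 obtain B where B: "0 < B" "\<And>p. p \<in> {a..b} \<times> insert x (range s) ==> norm (G (fst p) (snd p)) \<le> B"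
  using compact_image_bound[OF compact_Times[OF compact_Icc K] continuous_on_subset[OF G subset_UNIV]] by blast
 show "\<exists>g. lintegrable g \<and> (\<forall>n. \<forall>t\<in>space lborel. norm (indicator {a..b} t *\<^sub>R G t (s n)) \<le> g t)"
 proof (intro exI conjI allI ballI)
  show "lintegrable (\<lambda>t. B * indicator {a..b} t)" by (rule integrable_indicator_compact[OF compact_Icc])
  fix n t show "norm (indicator {a..b} t *\<^sub>R G t (s n)) \<le> B * indicator {a..b} t"
   using B(2)[of "(t, s n)"] by (cases "t \<in> {a..b}") auto
 qed
qed

text \<open>The product \<open>X s t\<close> of the kernel and the truncated function integrates to
  the product of the transforms. Its part \<open>Y\<close> with \<open>t \<le> T\<close> gives the
  truncated transform of the convolution, and the part \<open>Z\<close> beyond \<open>T\<close> is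
  the error, where the exponential is small.\<close>

lemma fconv_laplace_Icc:
 fixes f :: "real => real"
 assumes \<alpha>: "1 < \<alpha>" "\<alpha> < 2" and f: "cts f" "\<And>t. t \<le> 0 ==> f t = 0" "\<And>t. t \<le> T ==> \<bar>f t\<bar> \<le> B"
  and T: "0 < T" and p: "1 \<le> p"
 shows "\<bar>(\<integral>t. indicator {0..T} t *\<^sub>R (exp (- p * t) * fconv \<alpha> f t))
   - p powr (\<alpha> - 2) * (\<integral>t. indicator {0..T} t *\<^sub>R (exp (- p * t) * f t))\<bar> \<le> B * T * exp T * exp (- p * T)"
proof -
 define k where "k s = frac_ker \<alpha> s * exp (- p * s)" for s
 define g where "g r = indicator {0..T} r *\<^sub>R (exp (- p * r) * f r)" for r
 have B: "0 \<le> B" using f(3)[of 0] T by (smt (verit) abs_ge_zero)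
 have k0: "0 \<le> k s" for s by (simp add: k_def frac_ker_nonneg[OF \<alpha>])
 have ki: "lintegrable k" "(\<integral>s. k s) = p powr (\<alpha> - 2)"
  using frac_ker_laplace_real[OF \<alpha>, of p] p unfolding k_def[abs_def] has_bochner_integral_iff by auto
 have fm [measurable]: "f \<in> borel_measurable borel" using f(1) by (rule borel_measurable_continuous_onI)
 have gm [measurable]: "g \<in> borel_measurable borel" unfolding g_def by measurable
 have km [measurable]: "k \<in> borel_measurable borel" unfolding k_def by measurable
 have gi: "lintegrable g" unfolding g_def
  by (rule borel_integrable_compact[OF compact_Icc]) (intro continuous_intros continuous_on_subset[OF f(1)], simp)
 have tr: "lintegrable (\<lambda>t. h (t - s))" "(\<integral>t. h (t - s)) = (\<integral>t. h t)"
  if "lintegrable h" for h :: "real => real" and s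
  using lborel_integrable_real_affine[OF that, of 1 "-s"] lborel_integral_real_affine[of 1 h "-s"]
  by (simp_all add: algebra_simps)
 define X where "X s t = k s * g (t - s)" for s t
 have iX: "integrable (lborel \<Otimes>\<^sub>M lborel) (\<lambda>(s, t). X s t)"
 proof (rule lborel_pair.Fubini_integrable)
  show "(\<lambda>(s, t). X s t) \<in> borel_measurable (lborel \<Otimes>\<^sub>M lborel)" unfolding X_def by measurable
  have "(\<integral>t. norm (X s t)) = k s * (\<integral>t. norm (g t))" for s
  proof -
   have "(\<integral>t. norm (X s t)) = (\<integral>t. k s * norm (g (t - s)))"
    unfolding X_def by (simp only: norm_mult) (simp add: k0)
   also have "\<dots> = k s * (\<integral>t. norm (g (t - s)))" by (rule integral_mult_right_zero)
   finally show ?thesis using tr(2)[of "\<lambda>t. norm (g t)" s] gi by simp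
  qed
  then show "lintegrable (\<lambda>s. \<integral>t. norm (case (s, t) of (s, t) => X s t))"
   unfolding prod.case by (simp only:) (intro integrable_mult_left ki(1))
  show "AE s in lborel. lintegrable (\<lambda>t. case (s, t) of (s, t) => X s t)"
   unfolding X_def prod.case by (intro AE_I2 integrable_mult_right tr(1) gi)
 qed
 define Y where "Y s t = (if t \<le> T then X s t else 0)" for s t
 define Z where "Z s t = (if t \<le> T then 0 else X s t)" for s t
 have Xm [measurable]: "(\<lambda>(s, t). X s t) \<in> borel_measurable (lborel \<Otimes>\<^sub>M lborel)" unfolding X_def by measurable
 have iY: "integrable (lborel \<Otimes>\<^sub>M lborel) (\<lambda>(s, t). Y s t)"
  by (rule integrable_bound[OF iX]) (unfold Y_def X_def, measurable, auto intro!: AE_I2)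
 have Ys: "(\<integral>s. Y s t) = indicator {0..T} t *\<^sub>R (exp (- p * t) * fconv \<alpha> f t)" for t
 proof (cases "t \<le> T")
  case True
  have "Y s t = exp (- p * t) * (frac_ker \<alpha> s *\<^sub>R f (t - s))" for s
  proof (cases "0 < s \<and> s < t")
   case True
   have "exp (- p * s) * exp (- p * (t - s)) = exp (- p * t)" by (simp flip: exp_add add: algebra_simps)
   then show ?thesis using True \<open>t \<le> T\<close> by (simp add: Y_def X_def k_def g_def)
  next
   case False
   then have "frac_ker \<alpha> s = 0 \<or> f (t - s) = 0" using f(2)[of "t - s"] by (auto simp: frac_ker_def)
   then show ?thesis by (auto simp: Y_def X_def k_def g_def)
  qed
  then have "(\<integral>s. Y s t) = exp (- p * t) * fconv \<alpha> f t" unfolding fconv_def by (simp only: integral_mult_right_zero)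
  moreover have "fconv \<alpha> f t = 0" if "t < 0" by (rule fconv_eq_0[OF \<alpha>]) (use f(2) that in auto)
  ultimately show ?thesis using True by (cases "0 \<le> t") auto
 qed (simp add: Y_def)
 have Xi: "lintegrable (\<lambda>t. X s t)" for s unfolding X_def by (intro integrable_mult_right tr(1) gi)
 have iYt: "lintegrable (\<lambda>t. Y s t)" and iZ: "lintegrable (\<lambda>t. Z s t)" for s
 proof -
  have "(\<lambda>t. Y s t) = (\<lambda>t. indicator {..T} t *\<^sub>R X s t)" "(\<lambda>t. Z s t) = (\<lambda>t. indicator {T<..} t *\<^sub>R X s t)"
   by (auto simp: Y_def Z_def indicator_def)
  then show "lintegrable (\<lambda>t. Y s t)" "lintegrable (\<lambda>t. Z s t)"
   using integrable_mult_indicator[OF _ Xi[of s]] by simp_all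
 qed
 have tail: "\<bar>\<integral>t. Z s t\<bar> \<le> B * T * exp T * exp (- p * T) * (frac_ker \<alpha> s * exp (- 1 * s))" for s
 proof (cases "0 < s")
  case True
  have le: "norm (Z s t) \<le> (k s * exp (- p * (max 0 (T - s)))) * (B * indicator {s..s + T} t)" for t
  proof (cases "t > T \<and> t - s \<in> {0..T}")
   case True
   have "exp (- p * (t - s)) \<le> exp (- p * (max 0 (T - s)))" using True p by simp
   then have "\<bar>exp (- p * (t - s)) * f (t - s)\<bar> \<le> exp (- p * (max 0 (T - s))) * B"
    unfolding abs_mult using f(3)[of "t - s"] True by (intro mult_mono) auto
   then have "k s * \<bar>exp (- p * (t - s)) * f (t - s)\<bar> \<le> k s * (exp (- p * (max 0 (T - s))) * B)"
    by (rule mult_left_mono[OF _ k0])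
   then show ?thesis using True k0[of s] by (simp add: Z_def X_def g_def abs_mult)
  next
   case False
   then have "Z s t = 0" by (auto simp: Z_def X_def g_def)
   then show ?thesis using k0[of s] B by simp
  qed
  have "norm (\<integral>t. Z s t) \<le> (\<integral>t. (k s * exp (- p * (max 0 (T - s)))) * (B * indicator {s..s + T} t))"
  proof (rule integral_norm_bound_integral[OF iZ _ le])
   show "lintegrable (\<lambda>t. (k s * exp (- p * (max 0 (T - s)))) * (B * indicator {s..s + T} t))"
    by (intro integrable_mult_right integrable_indicator_compact(1) compact_Icc)
  qed
  also have "\<dots> = k s * exp (- p * (max 0 (T - s))) * (B * T)" using T by simp
  also have "\<dots> = (frac_ker \<alpha> s * (B * T)) * (exp (- p * s) * exp (- p * (max 0 (T - s))))" by (simp add: k_def)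
  also have "\<dots> \<le> (frac_ker \<alpha> s * (B * T)) * (exp T * exp (- p * T) * exp (- 1 * s))"
  proof -
   \<comment> \<open>The left-hand side is \<open>- p * max s T\<close>. One factor
     \<open>exp (- s)\<close> is kept because the kernel must remain integrable in \<open>s\<close>;
     this uses \<open>p \<ge> 1\<close>.\<close>
   have "- p * s - p * max 0 (T - s) \<le> T - p * T - s"
   proof (cases "s \<le> T")
    case True then show ?thesis by (simp add: algebra_simps)
   next
    case False
    then have "0 \<le> (p - 1) * (s - T)" using p by simp
    then show ?thesis using False by (simp add: algebra_simps)
   qed
   then have "exp (- p * s) * exp (- p * (max 0 (T - s))) \<le> exp T * exp (- p * T) * exp (- 1 * s)" by (simp flip: exp_add)
   then show ?thesis using frac_ker_nonneg[OF \<alpha>, of s] B T by (intro mult_left_mono) auto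
  qed
  finally show ?thesis by (simp only: real_norm_def ac_simps)
 next
  case False
  then have "Z s t = 0" for t by (simp add: Z_def X_def k_def frac_ker_def)
  then show ?thesis using False by (simp add: frac_ker_def)
 qed
 have XYZ: "(\<integral>t. X s t) = (\<integral>t. Y s t) + (\<integral>t. Z s t)" for s
  unfolding integral_add[OF iYt iZ, symmetric]
  by (intro integral_cong refl) (simp add: Y_def Z_def)
 have iXs: "lintegrable (\<lambda>s. \<integral>t. X s t)" and iYs: "lintegrable (\<lambda>s. \<integral>t. Y s t)"
  using lborel_pair.integrable_fst[OF iX] lborel_pair.integrable_fst[OF iY] by simp_all
 have "(\<integral>s. \<integral>t. X s t) = p powr (\<alpha> - 2) * (\<integral>t. g t)"
  unfolding X_def using tr(2)[OF gi] ki(2) by simp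
 moreover have "(\<integral>s. \<integral>t. Y s t) = (\<integral>t. indicator {0..T} t *\<^sub>R (exp (- p * t) * fconv \<alpha> f t))"
  using lborel_pair.Fubini_integral[OF iY] by (simp only: Ys)
 moreover have "\<bar>(\<integral>s. \<integral>t. Y s t) - (\<integral>s. \<integral>t. X s t)\<bar> \<le> B * T * exp T * exp (- p * T)"
 proof -
  have "(\<integral>s. \<integral>t. X s t) - (\<integral>s. \<integral>t. Y s t) = (\<integral>s. (\<integral>t. X s t) - (\<integral>t. Y s t))"
   by (rule integral_diff[OF iXs iYs, symmetric])
  also have "\<dots> = (\<integral>s. (\<integral>t. Z s t))" by (simp add: XYZ)
  finally have eq: "(\<integral>s. \<integral>t. X s t) - (\<integral>s. \<integral>t. Y s t) = (\<integral>s. (\<integral>t. Z s t))" .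
  have l1: "lintegrable (\<lambda>s. frac_ker \<alpha> s * exp (- 1 * s))" "(\<integral>s. frac_ker \<alpha> s * exp (- 1 * s)) = 1"
   using frac_ker_laplace_real[OF \<alpha>, of 1] unfolding has_bochner_integral_iff by auto
  have "norm (\<integral>s. (\<integral>t. Z s t)) \<le> (\<integral>s. B * T * exp T * exp (- p * T) * (frac_ker \<alpha> s * exp (- 1 * s)))"
  proof (rule integral_norm_bound_integral)
   have "lintegrable (\<lambda>s. (\<integral>t. X s t) - (\<integral>t. Y s t))" by (intro integrable_diff iXs iYs)
   then show "lintegrable (\<lambda>s. \<integral>t. Z s t)" by (simp add: XYZ)
   show "lintegrable (\<lambda>s. B * T * exp T * exp (- p * T) * (frac_ker \<alpha> s * exp (- 1 * s)))"
    by (intro integrable_mult_right l1)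
   show "norm (\<integral>t. Z s t) \<le> B * T * exp T * exp (- p * T) * (frac_ker \<alpha> s * exp (- 1 * s))" for s
    using tail by (simp only: real_norm_def)
  qed
  also have "\<dots> = B * T * exp T * exp (- p * T)" by (simp only: integral_mult_right_zero l1(2))
  finally show ?thesis using eq by (simp add: abs_minus_commute)
 qed
 ultimately show ?thesis by (simp add: g_def)
qed

section \<open>The truncated transform of a solution and its weak equation\<close>

context frac_data
begin

context
 fixes p :: real
 assumes p: "1 \<le> p"
begin

text \<open>Subtracting the tangent of \<open>exp (- p t)\<close> at \<open>T\<close> makes the weight vanish there to second order,
 so that no boundary terms appear when it is tested against the equation.\<close>

definition lw :: "real => real" where "lw t = exp (- p * t) - exp (- p * T) * (1 + p * (T - t))"
text \<open>Clamping at \<open>T\<close>, where \<open>lw\<close> vanishes, and the vanishing of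
  \<open>U\<close> for negative times make the integrand continuous with support in
  \<open>[0, T]\<close>.\<close>

definition vp :: "real^'n => real" where "vp x = (\<integral>t. lw (min t T) * U t x)"
definition vpx :: "'n => real^'n => real" where "vpx k x = (\<integral>t. lw (min t T) * UX k t x)"
text \<open>The failure of the convolution theorem under truncation: on the whole half line
  \<open>p^2\<close> times the transform of \<open>KK\<close> would be
  \<open>p powr \<alpha>\<close> times that of \<open>U\<close>.\<close>

definition Rp :: "real^'n => real" where
 "Rp x = p\<^sup>2 * (\<integral>t. indicator {0..T} t *\<^sub>R (exp (- p * t) * KK t x)) - p powr \<alpha> * vp x"

lemma lw_T: "lw T = 0" by (simp add: lw_def)

lemma lw_bounds: "0 \<le> lw t" "0 \<le> t ==> t \<le> T ==> lw t \<le> 1"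
proof -
 have "1 + p * (T - t) \<le> exp (p * (T - t))" by (rule exp_ge_add_one_self)
 then have "exp (- p * T) * (1 + p * (T - t)) \<le> exp (- p * T) * exp (p * (T - t))" by (intro mult_left_mono) auto
 also have "\<dots> = exp (- p * t)" by (simp flip: exp_add add: algebra_simps)
 finally show "0 \<le> lw t" by (simp add: lw_def)
 assume t: "0 \<le> t" "t \<le> T"
 have "exp (- p * t) \<le> 1" "0 \<le> exp (- p * T) * (1 + p * (T - t))" using t p by auto
 then show "lw t \<le> 1" unfolding lw_def by linarith
qed

lemma cont_lw: "continuous_on S (\<lambda>t. lw (min t T))"
 unfolding lw_def by (intro continuous_intros)

lemma lw_out:
 assumes "t \<notin> {0..T}"
 shows "lw (min t T) * U t x = 0" "lw (min t T) * UX k t x = 0" "lw (min t T) * LL t x = 0"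
 using assms U0[of t x] UX0[of t k x] UX0[of t _ x] lw_T by (auto simp: not_le LL_def)

lemma integrable_lw:
 "lintegrable (\<lambda>t. lw (min t T) * U t x)" "lintegrable (\<lambda>t. lw (min t T) * UX k t x)"
 by (rule integrable_compact_support[OF _ compact_Icc[of 0 T]];
   use lw_out in \<open>auto intro!: continuous_intros cont_lw cont_slice_t[OF contU] cont_slice_t[OF contUX]\<close>)+

lemma C1_vp: "C1_fun vp vpx"
 unfolding C1_fun_def
proof (intro conjI allI)
 have c: "cts (\<lambda>q :: real \<times> (real^'n). lw (min (fst q) T) * U (fst q) (snd q))"
  "cts (\<lambda>q :: real \<times> (real^'n). lw (min (fst q) T) * UX k (fst q) (snd q))" for k
  by (intro continuous_intros contU contUX cont_fst[OF cont_lw])+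
 show "cts vp" unfolding vp_def
  by (rule continuous_param_integral[where lo = 0 and hi = T, OF c(1) lw_out(1)])
 show "cts (vpx k)" for k unfolding vpx_def
  by (rule continuous_param_integral[where lo = 0 and hi = T, OF c(2) lw_out(2)])
 show "pderiv_on vp k (vpx k)" for k unfolding vp_def vpx_def
 proof (rule pderiv_param_integral[where lo = 0 and hi = T, OF c(1) lw_out(1) c(2) lw_out(2)])
  show "pderiv_on (\<lambda>x. lw (min t T) * U t x) k (\<lambda>x. lw (min t T) * UX k t x)" for t
   by (rule pderiv_bounded_linear[OF bounded_linear_mult_right pU])
 qed auto
qed

lemma cont_Rp: "cts Rp"
proof -
 have "cts (\<lambda>q :: real \<times> (real^'n). exp (- p * fst q) * KK (fst q) (snd q))"
  by (intro continuous_intros contKK)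
 from continuous_Icc_integral[OF this, of 0 T] show ?thesis
  unfolding Rp_def using C1_vp by (intro continuous_intros) (auto simp: C1_fun_def)
qed

lemma vp_bound:
 assumes "\<And>t. 0 \<le> t ==> t \<le> T ==> \<bar>U t x\<bar> \<le> B"
 shows "\<bar>vp x\<bar> \<le> T * B"
proof -
 have "norm (vp x) \<le> (\<integral>t. B * indicator {0..T} t)"
  unfolding vp_def
 proof (rule integral_norm_bound_integral[OF integrable_lw(1) integrable_indicator_compact(1)[OF compact_Icc]])
   fix t
   show "norm (lw (min t T) * U t x) \<le> B * indicator {0..T} t"
   proof (cases "t \<in> {0..T}")
    case True
    then have "\<bar>lw t\<bar> * \<bar>U t x\<bar> \<le> 1 * B" using lw_bounds[of t] assms[of t] by (intro mult_mono) auto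
    then show ?thesis using True by (simp add: abs_mult min_def)
   next
    case False then show ?thesis using lw_out(1)[OF False] by simp
   qed
 qed
 also have "\<dots> = T * B" using T by simp
 finally show ?thesis by simp
qed

text \<open>There are two errors of size \<open>exp (- p T)\<close>, up to powers of
  \<open>p\<close>: the truncated convolution theorem, multiplied by \<open>p^2\<close>, and the
  tangent subtracted in \<open>lw\<close>, multiplied by \<open>p powr \<alpha>\<close>.\<close>

lemma Rp_bound:
 assumes B: "\<And>t. 0 \<le> t ==> t \<le> T ==> \<bar>U t x\<bar> \<le> B"
 shows "\<bar>Rp x\<bar> \<le> B * T * exp (- p * T) * (p\<^sup>2 * exp T + p powr \<alpha> * (1 + p * T))"
proof -
 have B0: "0 \<le> B" using B[of 0] T by simp
 have b: "\<bar>U t x\<bar> \<le> B" if "t \<le> T" for t using B[of t] U0[of t x] that B0 by (cases "0 \<le> t") auto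
 define I where "I = (\<integral>t. indicator {0..T} t *\<^sub>R (exp (- p * t) * U t x))"
 define L where "L = (\<integral>t. indicator {0..T} t *\<^sub>R (exp (- p * t) * KK t x))"
 define E where "E = (\<integral>t. indicator {0..T} t *\<^sub>R ((1 + p * (T - t)) * U t x))"
 have "\<bar>L - p powr (\<alpha> - 2) * I\<bar> \<le> B * T * exp T * exp (- p * T)"
  unfolding L_def I_def KK_def
  by (rule fconv_laplace_Icc[OF \<alpha> cont_slice_t[OF contU] U0 b T p])
 then have "p\<^sup>2 * \<bar>L - p powr (\<alpha> - 2) * I\<bar> \<le> p\<^sup>2 * (B * T * exp T * exp (- p * T))" by (intro mult_left_mono) auto
 then have 1: "\<bar>p\<^sup>2 * L - p powr \<alpha> * I\<bar> \<le> p\<^sup>2 * (B * T * exp T * exp (- p * T))"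
 proof -
  have "p\<^sup>2 * (p powr (\<alpha> - 2)) = p powr \<alpha>"
   using p powr_add[of p 2 "\<alpha> - 2"] by (simp add: powr_numeral)
  then have "p\<^sup>2 * L - p powr \<alpha> * I = p\<^sup>2 * (L - p powr (\<alpha> - 2) * I)" by (simp add: right_diff_distrib mult.assoc[symmetric])
  then show ?thesis using \<open>p\<^sup>2 * \<bar>L - p powr (\<alpha> - 2) * I\<bar> \<le> _\<close> by (simp add: abs_mult)
 qed
 have ii: "lintegrable (\<lambda>t. indicator {0..T} t *\<^sub>R (exp (- p * t) * U t x))"
  "lintegrable (\<lambda>t. indicator {0..T} t *\<^sub>R ((1 + p * (T - t)) * U t x))"
  by (rule borel_integrable_compact[OF compact_Icc]; intro continuous_intros continuous_on_subset[OF cont_slice_t[OF contU]]; simp)+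
 have "vp x = (\<integral>t. indicator {0..T} t *\<^sub>R (exp (- p * t) * U t x) - exp (- p * T) * (indicator {0..T} t *\<^sub>R ((1 + p * (T - t)) * U t x)))"
  unfolding vp_def
 proof (intro integral_cong refl)
  fix t
  show "lw (min t T) * U t x = indicator {0..T} t *\<^sub>R (exp (- p * t) * U t x) - exp (- p * T) * (indicator {0..T} t *\<^sub>R ((1 + p * (T - t)) * U t x))"
  proof (cases "t \<in> {0..T}")
   case True then show ?thesis by (simp add: lw_def min_def left_diff_distrib mult.assoc)
  next
   case False show ?thesis unfolding lw_out(1)[OF False] using False by simp
  qed
 qed
 also have "\<dots> = I - exp (- p * T) * E"
  unfolding I_def E_def using ii by (subst integral_diff) auto
 finally have v: "vp x = I - exp (- p * T) * E" .
 have 2: "\<bar>E\<bar> \<le> (1 + p * T) * B * T"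
 proof -
  have "norm E \<le> (\<integral>t. ((1 + p * T) * B) * indicator {0..T} t)"
   unfolding E_def
  proof (rule integral_norm_bound_integral[OF ii(2) integrable_indicator_compact(1)[OF compact_Icc]])
    fix t
    show "norm (indicator {0..T} t *\<^sub>R ((1 + p * (T - t)) * U t x)) \<le> ((1 + p * T) * B) * indicator {0..T} t"
    proof (cases "t \<in> {0..T}")
     case True
     then have "0 \<le> p * (T - t)" "p * (T - t) \<le> p * T" using p by auto
     then have "\<bar>1 + p * (T - t)\<bar> * \<bar>U t x\<bar> \<le> (1 + p * T) * B" using b[of t] True by (intro mult_mono) auto
     then show ?thesis using True by (simp add: abs_mult)
    qed simp
  qed
  also have "\<dots> = (1 + p * T) * B * T" using T by simp
  finally show ?thesis by simp
 qed
 have "Rp x = (p\<^sup>2 * L - p powr \<alpha> * I) + p powr \<alpha> * exp (- p * T) * E"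
  unfolding Rp_def L_def[symmetric] v by (simp add: algebra_simps)
 then have "\<bar>Rp x\<bar> \<le> \<bar>p\<^sup>2 * L - p powr \<alpha> * I\<bar> + \<bar>p powr \<alpha> * exp (- p * T) * E\<bar>" by (simp only: abs_triangle_ineq)
 also have "\<bar>p powr \<alpha> * exp (- p * T) * E\<bar> = p powr \<alpha> * exp (- p * T) * \<bar>E\<bar>" by (simp add: abs_mult)
 also have "\<dots> \<le> p powr \<alpha> * exp (- p * T) * ((1 + p * T) * B * T)" by (intro mult_left_mono 2) auto
 finally show ?thesis using 1 by (simp add: algebra_simps)
qed

text \<open>The weight \<open>lw\<close> and its derivative vanish at \<open>T\<close> and its
  second derivative is \<open>p^2 * exp (- p t)\<close>, so \<open>test_time_integral\<close> moves
  both time derivatives onto it; Fubini's theorem then identifies the functions of \<open>x\<close>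
  on the two sides.\<close>

lemma weak_vp:
 assumes \<psi>: "C1_test UNIV \<psi> d\<psi>"
 shows "(\<integral>x. (p powr \<alpha> * vp x + Rp x) * \<psi> x + af vpx d\<psi> x
  - ((\<Sum>k\<in>UNIV. bb k x * vpx k x) + cc x * vp x) * \<psi> x) = 0"
proof -
 let ?l = "\<lambda>x. (\<Sum>k\<in>UNIV. bb k x * vpx k x) + cc x * vp x"
 note c\<psi> = \<psi>c[OF \<psi>]
 obtain K where K: "compact K" "\<And>x. x \<notin> K ==> \<psi> x = 0" "\<And>t x. x \<notin> K ==> testG \<psi> d\<psi> t x = 0" by (rule \<psi>_support[OF \<psi>]) blast
 obtain K' where K': "compact K'" "K' \<subseteq> UNIV" "\<And>x. x \<notin> K' ==> \<psi> x = 0" "\<And>x k. x \<notin> K' ==> d\<psi> k x = 0"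
  by (rule C1_testE[OF \<psi>]) blast
 have cv: "cts vp" "cts (vpx k)" for k using C1_vp by (auto simp: C1_fun_def)
 define lw' where "lw' t = - p * exp (- p * t) + p * exp (- p * T)" for t
 have d: "(lw has_real_derivative lw' t) (at t)" "(lw' has_real_derivative p\<^sup>2 * exp (- p * t)) (at t)" for t
  unfolding lw_def[abs_def] lw'_def[abs_def]
  by (auto intro!: derivative_eq_intros simp: power2_eq_square algebra_simps)
 have eq: "(\<integral>t. indicator {0..T} t *\<^sub>R (lw t * testW \<psi> d\<psi> t)) = (\<integral>t. indicator {0..T} t *\<^sub>R ((p\<^sup>2 * exp (- p * t)) * testU \<psi> t))"
  by (rule test_time_integral[OF \<psi> d]) (auto intro!: continuous_intros simp: lw'_def lw_def)
 have G0: "testG \<psi> d\<psi> t x = 0" if "t \<le> 0" for t x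
  using UX0[OF that] U0[OF that] by (simp add: testG_def[OF \<psi>] LL_def aform_def)
 have "(\<integral>t. indicator {0..T} t *\<^sub>R (lw t * testW \<psi> d\<psi> t)) = (\<integral>t. \<integral>x. lw (min t T) * testG \<psi> d\<psi> t x)"
 proof (intro integral_cong refl)
  fix t
  have "indicator {0..T} t *\<^sub>R (lw t * testW \<psi> d\<psi> t) = lw (min t T) * testW \<psi> d\<psi> t"
  proof (cases "t \<in> {0..T}")
   case False
   then consider "T < t" | "t \<le> 0" by force
   then have "lw (min t T) * testW \<psi> d\<psi> t = 0"
    by cases (simp_all add: lw_T testW_def[OF \<psi>] G0)
   then show ?thesis using False by simp
  qed (simp add: min_def)
  then show "indicator {0..T} t *\<^sub>R (lw t * testW \<psi> d\<psi> t) = (\<integral>x. lw (min t T) * testG \<psi> d\<psi> t x)"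
   by (simp add: testW_def[OF \<psi>])
 qed
 also have "\<dots> = (\<integral>x. \<integral>t. lw (min t T) * testG \<psi> d\<psi> t x)"
 proof (rule lborel_pair.Fubini_integral[symmetric])
  have "lintegrable (\<lambda>q. lw (min (fst q) T) * testG \<psi> d\<psi> (fst q) (snd q))"
  proof (rule integrable_compact_support[OF _ compact_Times[OF compact_Icc[of 0 T] K(1)]])
   show "cts (\<lambda>q :: real \<times> (real^'n). lw (min (fst q) T) * testG \<psi> d\<psi> (fst q) (snd q))"
    by (intro continuous_intros cont_testG[OF \<psi>] cont_fst[OF cont_lw])
   show "lw (min (fst q) T) * testG \<psi> d\<psi> (fst q) (snd q) = 0" if "q \<notin> {0..T} \<times> K" for q
    using that K(3)[of "snd q"] G0[of "fst q" "snd q"] lw_T by (cases q) (auto simp: not_le)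
  qed
  then show "integrable (lborel \<Otimes>\<^sub>M lborel) (\<lambda>(t, x). lw (min t T) * testG \<psi> d\<psi> t x)" by (simp add: lborel_prod split_def)
 qed
 also have "(\<lambda>x. \<integral>t. lw (min t T) * testG \<psi> d\<psi> t x)
  = (\<lambda>x. ?l x * \<psi> x - af vpx d\<psi> x)"
 proof
  fix x
  have "lw (min t T) * testG \<psi> d\<psi> t x = ((\<Sum>k\<in>UNIV. bb k x * (lw (min t T) * UX k t x)) + cc x * (lw (min t T) * U t x)) * \<psi> x
   - (\<Sum>k\<in>UNIV. \<Sum>l\<in>UNIV. a k l x * ((lw (min t T) * UX k t x) * d\<psi> l x))" for t
   unfolding testG_def[OF \<psi>] LL_def aform_def right_diff_distrib distrib_left distrib_right sum_distrib_left sum_distrib_right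
   by (simp add: ac_simps)
  moreover have "(\<integral>t. ((\<Sum>k\<in>UNIV. bb k x * (lw (min t T) * UX k t x)) + cc x * (lw (min t T) * U t x)) * \<psi> x
   - (\<Sum>k\<in>UNIV. \<Sum>l\<in>UNIV. a k l x * ((lw (min t T) * UX k t x) * d\<psi> l x)))
   = ?l x * \<psi> x - (\<Sum>k\<in>UNIV. \<Sum>l\<in>UNIV. a k l x * (vpx k x * d\<psi> l x))"
  proof (rule has_bochner_integral_integral_eq)
   have hb: "has_bochner_integral lborel (\<lambda>t. lw (min t T) * UX k t x) (vpx k x)" for k
    unfolding vpx_def by (rule has_bochner_integral_integrable[OF integrable_lw(2)])
   have hU: "has_bochner_integral lborel (\<lambda>t. lw (min t T) * U t x) (vp x)"
    unfolding vp_def by (rule has_bochner_integral_integrable[OF integrable_lw(1)])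
   show "has_bochner_integral lborel (\<lambda>t. ((\<Sum>k\<in>UNIV. bb k x * (lw (min t T) * UX k t x)) + cc x * (lw (min t T) * U t x)) * \<psi> x
    - (\<Sum>k\<in>UNIV. \<Sum>l\<in>UNIV. a k l x * ((lw (min t T) * UX k t x) * d\<psi> l x)))
    (?l x * \<psi> x - (\<Sum>k\<in>UNIV. \<Sum>l\<in>UNIV. a k l x * (vpx k x * d\<psi> l x)))"
    by (intro has_bochner_integral_diff has_bochner_integral_add has_bochner_integral_sum has_bochner_integral_mult_left has_bochner_integral_mult_right hb hU)
  qed
  ultimately show "(\<integral>t. lw (min t T) * testG \<psi> d\<psi> t x)
   = ?l x * \<psi> x - af vpx d\<psi> x"
   by (simp add: aform_def)
 qed
 finally have L: "(\<integral>t. indicator {0..T} t *\<^sub>R (lw t * testW \<psi> d\<psi> t))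
  = (\<integral>x. ?l x * \<psi> x - af vpx d\<psi> x)" .
 have "(\<integral>t. indicator {0..T} t *\<^sub>R ((p\<^sup>2 * exp (- p * t)) * testU \<psi> t))
  = (\<integral>t. \<integral>x. indicator ({0..T} \<times> K) (t, x) *\<^sub>R (p\<^sup>2 * exp (- p * t) * KK t x * \<psi> x))"
 proof (intro integral_cong refl)
  fix t
  have "(\<integral>x. indicator ({0..T} \<times> K) (t, x) *\<^sub>R (p\<^sup>2 * exp (- p * t) * KK t x * \<psi> x))
   = (\<integral>x. (indicator {0..T} t * (p\<^sup>2 * exp (- p * t))) * (KK t x * \<psi> x))"
   by (intro integral_cong refl) (use K(2) in \<open>auto simp: indicator_def\<close>)
  also have "\<dots> = (indicator {0..T} t * (p\<^sup>2 * exp (- p * t))) * testU \<psi> t"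
   unfolding testU_def[OF \<psi>] by (rule integral_mult_right_zero)
  finally show "indicator {0..T} t *\<^sub>R ((p\<^sup>2 * exp (- p * t)) * testU \<psi> t)
   = (\<integral>x. indicator ({0..T} \<times> K) (t, x) *\<^sub>R (p\<^sup>2 * exp (- p * t) * KK t x * \<psi> x))" by simp
 qed
 also have "\<dots> = (\<integral>x. \<integral>t. indicator ({0..T} \<times> K) (t, x) *\<^sub>R (p\<^sup>2 * exp (- p * t) * KK t x * \<psi> x))"
 proof (rule lborel_pair.Fubini_integral[symmetric])
  have "lintegrable (\<lambda>q. indicator ({0..T} \<times> K) q *\<^sub>R (p\<^sup>2 * exp (- p * fst q) * KK (fst q) (snd q) * \<psi> (snd q)))"
   by (rule borel_integrable_compact[OF compact_Times[OF compact_Icc K(1)]])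
    (rule continuous_on_subset[OF _ subset_UNIV], intro continuous_intros contKK cont_snd c\<psi>)
  then show "integrable (lborel \<Otimes>\<^sub>M lborel) (\<lambda>(t, x). indicator ({0..T} \<times> K) (t, x) *\<^sub>R (p\<^sup>2 * exp (- p * t) * KK t x * \<psi> x))"
   by (simp add: lborel_prod split_def)
 qed
 also have "(\<lambda>x. \<integral>t. indicator ({0..T} \<times> K) (t, x) *\<^sub>R (p\<^sup>2 * exp (- p * t) * KK t x * \<psi> x)) = (\<lambda>x. (p powr \<alpha> * vp x + Rp x) * \<psi> x)"
 proof
  fix x
  have "(\<integral>t. indicator ({0..T} \<times> K) (t, x) *\<^sub>R (p\<^sup>2 * exp (- p * t) * KK t x * \<psi> x))
   = (\<integral>t. (p\<^sup>2 * \<psi> x) * (indicator {0..T} t *\<^sub>R (exp (- p * t) * KK t x)))"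
   by (intro integral_cong refl) (use K(2) in \<open>auto simp: indicator_def\<close>)
  also have "\<dots> = (p\<^sup>2 * \<psi> x) * (\<integral>t. indicator {0..T} t *\<^sub>R (exp (- p * t) * KK t x))" by (rule integral_mult_right_zero)
  finally show "(\<integral>t. indicator ({0..T} \<times> K) (t, x) *\<^sub>R (p\<^sup>2 * exp (- p * t) * KK t x * \<psi> x)) = (p powr \<alpha> * vp x + Rp x) * \<psi> x"
   by (simp add: Rp_def algebra_simps)
 qed
 finally have R: "(\<integral>t. indicator {0..T} t *\<^sub>R ((p\<^sup>2 * exp (- p * t)) * testU \<psi> t)) = (\<integral>x. (p powr \<alpha> * vp x + Rp x) * \<psi> x)" .
 have i: "lintegrable (\<lambda>x. (p powr \<alpha> * vp x + Rp x) * \<psi> x)"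
  "lintegrable (\<lambda>x. ?l x * \<psi> x - af vpx d\<psi> x)"
  unfolding aform_def
  by (rule integrable_compact_support[OF _ K'(1)];
    auto intro!: continuous_intros cont_Rp cv c\<psi> cont_bb cont_cc a_cont simp: K')+
 from integral_diff[OF i] L R eq
 have "(\<integral>x. (p powr \<alpha> * vp x + Rp x) * \<psi> x - (?l x * \<psi> x - af vpx d\<psi> x)) = 0"
  by simp
 then show ?thesis by (simp only: diff_diff_eq2)
qed

end

end

section \<open>A weighted energy estimate\<close>

context elliptic_form
begin

text \<open>The test function is \<open>v * z^2\<close>. Half of \<open>z^2 * A\<close> absorbs the
  cross term with the gradient of the weight, the other half the drift; of \<open>P * v^2\<close>
  one quarter goes to drift and zero-order term and one quarter to \<open>R\<close>, which leaves
  the half on the left.\<close>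

lemma weighted_energy_pointwise:
 fixes v R B P z dz :: real and dv dzk g :: "'n => real"
 assumes P: "0 < P" "B + real CARD('n) * B\<^sup>2 / (2 * \<delta>0) \<le> P / 4" and g: "\<And>k. \<bar>g k\<bar> \<le> B" and c: "\<bar>c\<bar> \<le> B"
 shows "(P / 2) * (z * v)\<^sup>2 - 2 * \<Lambda> * v\<^sup>2 * (\<Sum>k\<in>UNIV. \<bar>dzk k\<bar>)\<^sup>2 - (1 / P) * (z * R)\<^sup>2
  \<le> (P * v + R) * (v * (z * z)) + aform x dv (\<lambda>k. v * (z * dzk k + dzk k * z) + dv k * (z * z))
   - ((\<Sum>k\<in>UNIV. g k * dv k) + c * v) * (v * (z * z))"
proof -
 define A where "A = aform x dv dv"
 define D where "D = aform x dzk dzk"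
 define X where "X = aform x dv dzk"
 define S where "S = (\<Sum>k\<in>UNIV. (dv k)\<^sup>2)"
 define n where "n = real CARD('n)"
 have A: "0 \<le> A" "\<delta>0 * S \<le> A" unfolding A_def S_def using aform_nonneg[of x dv] aform_ge[of dv x] by auto
 have D: "0 \<le> D" "D \<le> \<Lambda> * (\<Sum>k\<in>UNIV. \<bar>dzk k\<bar>)\<^sup>2" unfolding D_def using aform_nonneg[of x dzk] aform_le[of x dzk] by auto
 have X: "\<bar>X\<bar> \<le> sqrt A * sqrt D" unfolding X_def A_def D_def by (rule aform_Cauchy)
 have exp: "aform x dv (\<lambda>k. v * (z * dzk k + dzk k * z) + dv k * (z * z)) = 2 * z * v * X + z\<^sup>2 * A"
 proof -
  have "(\<lambda>k. v * (z * dzk k + dzk k * z) + dv k * (z * z)) = (\<lambda>k. (2 * z * v) *\<^sub>R dzk k + (z\<^sup>2) *\<^sub>R dv k)"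
   by (simp add: fun_eq_iff power2_eq_square algebra_simps)
  then show ?thesis by (simp only: aform_add_right aform_scaleR_right X_def A_def)
 qed
 have 1: "- (2 * z * v * X) \<le> z\<^sup>2 * A / 2 + 2 * (v\<^sup>2 * D)"
 proof -
  have "- (2 * z * v * X) \<le> 2 * (\<bar>z\<bar> * \<bar>v\<bar> * \<bar>X\<bar>)"
   using abs_ge_minus_self[of "2 * z * v * X"] by (simp add: abs_mult)
  also have "\<dots> \<le> 2 * (\<bar>z\<bar> * \<bar>v\<bar> * (sqrt A * sqrt D))" using X by (intro mult_left_mono) auto
  also have "\<dots> \<le> (\<bar>z\<bar> * sqrt A)\<^sup>2 / 2 + 2 * (\<bar>v\<bar> * sqrt D)\<^sup>2"
  proof -
   have "2 * (r * s) \<le> r\<^sup>2 / 2 + 2 * s\<^sup>2" for r s :: real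
    using zero_le_power2[of "r - 2 * s"] by (simp add: power2_diff power_mult_distrib)
   from this[of "\<bar>z\<bar> * sqrt A" "\<bar>v\<bar> * sqrt D"] show ?thesis by (simp only: ac_simps)
  qed
  finally show ?thesis using A D by (simp add: power_mult_distrib)
 qed
 have 2: "(\<Sum>k\<in>UNIV. g k * dv k) * v \<le> \<delta>0 / 2 * S + n * B\<^sup>2 / (2 * \<delta>0) * v\<^sup>2"
 proof -
  have "g k * dv k * v \<le> \<delta>0 / 2 * (dv k)\<^sup>2 + B\<^sup>2 / (2 * \<delta>0) * v\<^sup>2" for k
  proof -
   have "g k * dv k * v \<le> \<bar>g k\<bar> * (\<bar>dv k\<bar> * \<bar>v\<bar>)"
    using abs_ge_self[of "g k * dv k * v"] by (simp add: abs_mult mult.assoc)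
   also have "\<dots> \<le> B * (\<bar>dv k\<bar> * \<bar>v\<bar>)" using g by (intro mult_right_mono) auto
   also have "\<dots> \<le> \<delta>0 / 2 * (dv k)\<^sup>2 + B\<^sup>2 / (2 * \<delta>0) * v\<^sup>2"
   proof -
    have "0 \<le> (\<delta>0 * \<bar>dv k\<bar> - B * \<bar>v\<bar>)\<^sup>2 / (2 * \<delta>0)" using \<delta>0 by simp
    also have "\<dots> = \<delta>0 / 2 * (dv k)\<^sup>2 + B\<^sup>2 / (2 * \<delta>0) * v\<^sup>2 - B * (\<bar>dv k\<bar> * \<bar>v\<bar>)"
     using \<delta>0 by (simp add: power2_diff power_mult_distrib add_divide_distrib diff_divide_distrib) (simp add: power2_eq_square field_simps)
    finally show ?thesis by simp
   qed
   finally show ?thesis .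
  qed
  then have "(\<Sum>k\<in>UNIV. g k * dv k * v) \<le> (\<Sum>k\<in>UNIV. \<delta>0 / 2 * (dv k)\<^sup>2 + B\<^sup>2 / (2 * \<delta>0) * v\<^sup>2)" by (intro sum_mono)
  then show ?thesis by (simp add: sum_distrib_right sum.distrib S_def n_def sum_distrib_left)
 qed
 have 3: "c * v * v \<le> B * v\<^sup>2"
  using c mult_right_mono[of c B "v\<^sup>2"] by (simp add: power2_eq_square mult.assoc)
 have 4: "- (R * v) \<le> (P / 4) * v\<^sup>2 + (1 / P) * R\<^sup>2"
 proof -
  have "0 \<le> (P / 2 * v + R)\<^sup>2 / P" using P by simp
  also have "\<dots> = (P / 4) * v\<^sup>2 + (1 / P) * R\<^sup>2 + R * v" using P by (simp add: power2_eq_square field_simps)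
  finally show ?thesis by simp
 qed
 have "(\<Sum>k\<in>UNIV. g k * dv k) * v + c * v * v - R * v \<le> \<delta>0 / 2 * S + (B + n * B\<^sup>2 / (2 * \<delta>0)) * v\<^sup>2 + (P / 4) * v\<^sup>2 + (1 / P) * R\<^sup>2"
  using 2 3 4 by (simp add: algebra_simps)
 also have "\<dots> \<le> A / 2 + (P / 4) * v\<^sup>2 + (P / 4) * v\<^sup>2 + (1 / P) * R\<^sup>2"
  using A(2) mult_right_mono[OF P(2)[folded n_def], of "v\<^sup>2"] by simp
 finally have "z\<^sup>2 * ((\<Sum>k\<in>UNIV. g k * dv k) * v + c * v * v - R * v) \<le> z\<^sup>2 * (A / 2 + (P / 2) * v\<^sup>2 + (1 / P) * R\<^sup>2)"
  by (intro mult_left_mono) auto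
 moreover have "v\<^sup>2 * D \<le> v\<^sup>2 * (\<Lambda> * (\<Sum>k\<in>UNIV. \<bar>dzk k\<bar>)\<^sup>2)" by (intro mult_left_mono D) auto
 ultimately show ?thesis using 1 unfolding exp
  by (simp add: power_mult_distrib power2_eq_square algebra_simps)
qed

lemma weighted_energy:
 fixes v R \<zeta> cc :: "real^'n => real" and bb :: "'n => real^'n => real"
 assumes v: "C1_fun v dv" and R: "cts R" and \<zeta>: "C1_test UNIV \<zeta> d\<zeta>"
  and bb: "\<And>k. cts (bb k)" "\<And>k x. \<bar>bb k x\<bar> \<le> B" and cc: "cts cc" "\<And>x. \<bar>cc x\<bar> \<le> B"
  and P: "0 < P" "B + real CARD('n) * B\<^sup>2 / (2 * \<delta>0) \<le> P / 4"
  and weak: "\<And>\<psi> d\<psi>. C1_test UNIV \<psi> d\<psi> ==> (\<integral>x. (P * v x + R x) * \<psi> x + af dv d\<psi> x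
   - ((\<Sum>k\<in>UNIV. bb k x * dv k x) + cc x * v x) * \<psi> x) = 0"
 shows "(P / 2) * (\<integral>x. (\<zeta> x * v x)\<^sup>2)
  \<le> 2 * \<Lambda> * (\<integral>x. (v x)\<^sup>2 * (\<Sum>k\<in>UNIV. \<bar>d\<zeta> k x\<bar>)\<^sup>2) + (1 / P) * (\<integral>x. (\<zeta> x * R x)\<^sup>2)"
proof -
 obtain K where K: "compact K" "K \<subseteq> UNIV" "\<And>x. x \<notin> K ==> \<zeta> x = 0" "\<And>x k. x \<notin> K ==> d\<zeta> k x = 0"
  by (rule C1_testE[OF \<zeta>]) blast
 have vc: "cts v" "cts (dv k)" for k using v by (auto simp: C1_fun_def)
 have \<zeta>c: "cts \<zeta>" "cts (d\<zeta> k)" for k using C1_test_fun[OF \<zeta>] by (auto simp: C1_fun_def)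
 have \<psi>: "C1_test UNIV (\<lambda>x. v x * (\<zeta> x * \<zeta> x)) (\<lambda>k x. v x * (\<zeta> x * d\<zeta> k x + d\<zeta> k x * \<zeta> x) + dv k x * (\<zeta> x * \<zeta> x))"
  using C1_test_scaleR[OF v C1_test_scaleR[OF C1_test_fun[OF \<zeta>] \<zeta>]] by simp
 define h where "h x = (P * v x + R x) * (v x * (\<zeta> x * \<zeta> x))
  + aform x (\<lambda>k. dv k x) (\<lambda>k. v x * (\<zeta> x * d\<zeta> k x + d\<zeta> k x * \<zeta> x) + dv k x * (\<zeta> x * \<zeta> x))
  - ((\<Sum>k\<in>UNIV. bb k x * dv k x) + cc x * v x) * (v x * (\<zeta> x * \<zeta> x))" for x
 define h1 where "h1 x = (\<zeta> x * v x)\<^sup>2" for x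
 define h2 where "h2 x = (v x)\<^sup>2 * (\<Sum>k\<in>UNIV. \<bar>d\<zeta> k x\<bar>)\<^sup>2" for x
 define h3 where "h3 x = (\<zeta> x * R x)\<^sup>2" for x
 have i: "lintegrable h" "lintegrable h1" "lintegrable h2" "lintegrable h3"
  unfolding h_def[abs_def] h1_def[abs_def] h2_def[abs_def] h3_def[abs_def] aform_def
  by (rule integrable_compact_support[OF _ K(1)];
    auto intro!: continuous_intros vc \<zeta>c R bb cc a_cont simp: K)+
 have "(\<integral>x. (P / 2) * h1 x - 2 * \<Lambda> * h2 x - (1 / P) * h3 x) \<le> (\<integral>x. h x)"
 proof (rule integral_mono)
  show "lintegrable (\<lambda>x. (P / 2) * h1 x - 2 * \<Lambda> * h2 x - (1 / P) * h3 x)"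
   by (intro integrable_diff integrable_mult_right i)
  show "(P / 2) * h1 x - 2 * \<Lambda> * h2 x - (1 / P) * h3 x \<le> h x" for x
   unfolding h_def h1_def h2_def h3_def
   using weighted_energy_pointwise[OF P, of "\<lambda>k. bb k x" "cc x" "\<zeta> x" "v x" "\<lambda>k. d\<zeta> k x" "R x" x "\<lambda>k. dv k x"] bb(2) cc(2)
   by (simp only: mult.assoc)
 qed (rule i)
 also have "(\<integral>x. h x) = 0" unfolding h_def by (rule weak[OF \<psi>])
 also have "(\<integral>x. (P / 2) * h1 x - 2 * \<Lambda> * h2 x - (1 / P) * h3 x)
  = (P / 2) * (\<integral>x. h1 x) - 2 * \<Lambda> * (\<integral>x. h2 x) - (1 / P) * (\<integral>x. h3 x)"
  by (subst integral_diff, intro integrable_diff integrable_mult_right i, intro integrable_mult_right i,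
    subst integral_diff) (auto intro!: integrable_mult_right i)
 finally show ?thesis unfolding h1_def h2_def h3_def by linarith
qed

end

text \<open>The weight \<open>exp (- \<kappa> * sqrt (1 + |x|^2))\<close> replaces
  \<open>exp (- \<kappa> |x|)\<close> to be differentiable at the origin. Its logarithmic derivative
  is at most \<open>\<kappa>\<close>; the spatial cut-off varies only for \<open>|x|\<close> between
  \<open>\<rho>\<close> and \<open>2 \<rho>\<close>, where the weight is already at most
  \<open>exp (- \<kappa> \<rho>)\<close>.\<close>

lemma exp_cutoff:
 fixes \<kappa> \<rho> :: real
 assumes \<kappa>: "0 \<le> \<kappa>" and \<rho>: "1 \<le> \<rho>"
 obtains \<zeta> :: "real^'n::finite => real" and d\<zeta> where
  "C1_test (cball 0 (2 * \<rho>)) \<zeta> d\<zeta>" "\<And>x. 0 \<le> \<zeta> x" "\<And>x. \<zeta> x \<le> 1" "\<And>x. norm x \<le> \<rho> ==> exp (- \<kappa> * (1 + norm x)) \<le> \<zeta> x"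
  "\<And>k x. \<bar>d\<zeta> k x\<bar> \<le> \<kappa> * \<zeta> x + 6 * exp (- \<kappa> * \<rho>) * indicator (cball 0 (2 * \<rho>)) x"
proof -
 \<comment> \<open>The profile \<open>s\<close>, in the variable \<open>|x|^2 / \<rho>^2\<close>,
   descends from 1 at 1 to 0 at 4; both powers are 2 to keep it continuously differentiable.\<close>
 define m where "m y = max 0 ((y - 1) / 3) powr 2" for y :: real
 define m' where "m' y = 2 * max 0 ((y - 1) / 3) powr 1 * (1 / 3)" for y :: real
 define s where "s y = max 0 (1 - m y) powr 2" for y
 define s' where "s' y = 2 * max 0 (1 - m y) powr 1 * (- m' y)" for y
 have dm: "(m has_real_derivative m' y) (at y)" for y
 proof -
  have "((\<lambda>y. (y - 1) / 3) has_real_derivative 1 / 3) (at y)" by (auto intro!: derivative_eq_intros)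
  from DERIV_chain2[OF DERIV_pos_part_powr[of 2] this] show ?thesis by (simp add: m_def[abs_def] m'_def)
 qed
 have ds: "(s has_real_derivative s' y) (at y)" for y
 proof -
  have "((\<lambda>y. 1 - m y) has_real_derivative - m' y) (at y)" using dm by (auto intro!: derivative_eq_intros)
  from DERIV_chain2[OF DERIV_pos_part_powr[of 2] this] show ?thesis by (simp add: s_def[abs_def] s'_def)
 qed
 have cm: "continuous_on S m" "continuous_on S m'" for S unfolding m_def[abs_def] m'_def[abs_def]
  by (intro continuous_intros continuous_on_powr'; auto)+
 have cs: "cts s'" unfolding s'_def
  by (intro continuous_intros continuous_on_powr' cm) auto
 have m0: "0 \<le> m y" for y by (simp add: m_def)
 have s0: "0 \<le> s y" for y by (simp add: s_def)
 have s1: "s y \<le> 1" for y unfolding s_def using powr_mono2[of 2 "max 0 (1 - m y)" 1] m0[of y] by simp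
 have low: "s y = 1" "s' y = 0" if "y \<le> 1" for y using that by (simp_all add: s_def s'_def m_def m'_def max_def)
 have high: "s y = 0" "s' y = 0" if "4 \<le> y" for y
 proof -
  have "1 powr 2 \<le> max 0 ((y - 1) / 3) powr 2" using that by (intro powr_mono2) auto
  then have "1 \<le> m y" by (simp add: m_def)
  then show "s y = 0" "s' y = 0" by (simp_all add: s_def s'_def)
 qed
 have s'b: "\<bar>s' y\<bar> \<le> 4 / 3" for y
 proof (cases "y \<le> 4")
  case True
  have "\<bar>m' y\<bar> \<le> 2 / 3" using True by (simp add: m'_def max_def)
  moreover have "\<bar>max 0 (1 - m y) powr 1\<bar> \<le> 1" using m0[of y] by (simp add: max_def)
  ultimately have "\<bar>max 0 (1 - m y) powr 1\<bar> * \<bar>m' y\<bar> \<le> 1 * (2 / 3)" by (intro mult_mono) auto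
  then show ?thesis by (simp add: s'_def abs_mult ac_simps)
 qed (use high(2) in simp)
 define g where "g x = sqrt (1 + x \<bullet> x)" for x :: "real^'n"
 have g: "norm x \<le> g x" "g x \<le> 1 + norm x" "0 < g x" for x
 proof -
  have x: "x \<bullet> x = (norm x)\<^sup>2" by (simp add: power2_norm_eq_inner)
  show "norm x \<le> g x" unfolding g_def x by (rule real_le_rsqrt) simp
  show "g x \<le> 1 + norm x" unfolding g_def x by (rule real_le_lsqrt) (auto simp: power2_sum)
  show "0 < g x" unfolding g_def x by (simp add: add_pos_nonneg)
 qed
 define \<zeta> where "\<zeta> x = exp (- \<kappa> * g x) * s (x \<bullet> x / \<rho>\<^sup>2)" for x
 define d\<zeta> where "d\<zeta> k x = (exp (- \<kappa> * g x) * (- \<kappa> / (2 * g x)) * s (x \<bullet> x / \<rho>\<^sup>2) + exp (- \<kappa> * g x) * (s' (x \<bullet> x / \<rho>\<^sup>2) / \<rho>\<^sup>2)) * (2 * x $ k)" for k x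
 have \<rho>0: "0 < \<rho>" using \<rho> by simp
 have pq: "pderiv_on (\<lambda>x :: real^'n. x \<bullet> x) k (\<lambda>x. 2 * x $ k)" for k
 proof -
  have d: "pderiv_on (\<lambda>x :: real^'n. x) k (\<lambda>_. axis k 1)"
   unfolding pderiv_on_def by (auto intro!: derivative_eq_intros simp: has_vector_derivative_def)
  from pderiv_inner[OF d d] show ?thesis by (simp add: inner_axis inner_axis')
 qed
 have p\<zeta>: "pderiv_on \<zeta> k (d\<zeta> k)" for k
  unfolding \<zeta>_def[abs_def] d\<zeta>_def[abs_def] g_def
 proof (rule pderiv_chain[OF pq, of "\<lambda>y. exp (- \<kappa> * sqrt (1 + y)) * s (y / \<rho>\<^sup>2)"
   "\<lambda>y. exp (- \<kappa> * sqrt (1 + y)) * (- \<kappa> / (2 * sqrt (1 + y))) * s (y / \<rho>\<^sup>2) + exp (- \<kappa> * sqrt (1 + y)) * (s' (y / \<rho>\<^sup>2) / \<rho>\<^sup>2)"])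
  fix x :: "real^'n"
  define y where "y = x \<bullet> x"
  have y: "0 < 1 + y" by (simp add: y_def add_pos_nonneg)
  have 1: "((\<lambda>y. s (y / \<rho>\<^sup>2)) has_real_derivative s' (y / \<rho>\<^sup>2) / \<rho>\<^sup>2) (at y)"
   using DERIV_chain2[OF ds DERIV_cdivide[OF DERIV_ident], of "\<rho>\<^sup>2" y UNIV] by simp
  have 2: "((\<lambda>y. exp (- \<kappa> * sqrt (1 + y))) has_real_derivative exp (- \<kappa> * sqrt (1 + y)) * (- \<kappa> / (2 * sqrt (1 + y)))) (at y)"
   using y by (auto intro!: derivative_eq_intros simp: field_simps)
  show "((\<lambda>y. exp (- \<kappa> * sqrt (1 + y)) * s (y / \<rho>\<^sup>2)) has_real_derivative exp (- \<kappa> * sqrt (1 + x \<bullet> x)) * (- \<kappa> / (2 * sqrt (1 + x \<bullet> x))) * s (x \<bullet> x / \<rho>\<^sup>2) + exp (- \<kappa> * sqrt (1 + x \<bullet> x)) * (s' (x \<bullet> x / \<rho>\<^sup>2) / \<rho>\<^sup>2)) (at (x \<bullet> x))"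
   using DERIV_mult[OF 2 1] by (simp add: y_def algebra_simps)
 qed
 have gc: "cts g" unfolding g_def[abs_def] by (intro continuous_intros)
 have sc: "cts s" by (rule DERIV_continuous_on[OF has_field_derivative_at_within[OF ds]])
 have qc: "cts (\<lambda>x :: real^'n. x \<bullet> x / \<rho>\<^sup>2)" using \<rho>0 by (intro continuous_intros) auto
 have c: "cts \<zeta>" "cts (d\<zeta> k)" for k
 proof -
  have "g x \<noteq> 0" for x using g(3)[of x] by simp
  moreover have "cts (\<lambda>x :: real^'n. s (x \<bullet> x / \<rho>\<^sup>2))" "cts (\<lambda>x :: real^'n. s' (x \<bullet> x / \<rho>\<^sup>2))"
   by (rule continuous_on_compose2[OF sc qc subset_UNIV], rule continuous_on_compose2[OF cs qc subset_UNIV])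
  ultimately show "cts \<zeta>" "cts (d\<zeta> k)"
   unfolding \<zeta>_def[abs_def] d\<zeta>_def[abs_def] using \<rho>0
   by (auto intro!: continuous_intros gc)
 qed
 have out: "4 \<le> x \<bullet> x / \<rho>\<^sup>2" if "x \<notin> cball 0 (2 * \<rho>)" for x :: "real^'n"
 proof -
  have "(2 * \<rho>)\<^sup>2 \<le> (norm x)\<^sup>2" using that \<rho>0 by (intro power_mono) auto
  then show ?thesis using \<rho>0 by (simp add: power2_norm_eq_inner power_mult_distrib le_divide_eq)
 qed
 show thesis
 proof (rule that)
  show "C1_test (cball 0 (2 * \<rho>)) \<zeta> d\<zeta>"
  proof (rule C1_testI[OF _ compact_cball order_refl])
   show "C1_fun \<zeta> d\<zeta>" using p\<zeta> c by (auto simp: C1_fun_def)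
   show "\<zeta> x = 0" if "x \<notin> cball 0 (2 * \<rho>)" for x using high(1)[OF out[OF that]] by (simp add: \<zeta>_def)
  qed
  show "0 \<le> \<zeta> x" for x by (simp add: \<zeta>_def s0)
  show "\<zeta> x \<le> 1" for x
  proof -
   have "exp (- \<kappa> * g x) * s (x \<bullet> x / \<rho>\<^sup>2) \<le> 1 * 1"
    using \<kappa> g(3)[of x] s0 s1 by (intro mult_mono) auto
   then show ?thesis by (simp add: \<zeta>_def)
  qed
  show "exp (- \<kappa> * (1 + norm x)) \<le> \<zeta> x" if "norm x \<le> \<rho>" for x
  proof -
   have "(norm x)\<^sup>2 \<le> \<rho>\<^sup>2" using that by (intro power_mono) auto
   then have "x \<bullet> x / \<rho>\<^sup>2 \<le> 1" using \<rho>0 by (simp add: power2_norm_eq_inner)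
   moreover have "exp (- \<kappa> * (1 + norm x)) \<le> exp (- \<kappa> * g x)" using \<kappa> g(2)[of x] by (simp add: mult_left_mono)
   ultimately show ?thesis by (simp add: \<zeta>_def low)
  qed
  fix k and x :: "real^'n"
  have xk: "\<bar>x $ k\<bar> \<le> norm x" by (rule component_le_norm_cart)
  have 1: "\<bar>exp (- \<kappa> * g x) * (- \<kappa> / (2 * g x)) * s (x \<bullet> x / \<rho>\<^sup>2) * (2 * x $ k)\<bar> \<le> \<kappa> * \<zeta> x"
  proof -
   have "\<bar>exp (- \<kappa> * g x) * (- \<kappa> / (2 * g x)) * s (x \<bullet> x / \<rho>\<^sup>2) * (2 * x $ k)\<bar> = (\<bar>x $ k\<bar> / g x) * (\<kappa> * \<zeta> x)"
    using \<kappa> g(3)[of x] s0 by (simp add: abs_mult \<zeta>_def)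
   also have "\<dots> \<le> 1 * (\<kappa> * \<zeta> x)"
   proof (rule mult_right_mono)
    show "\<bar>x $ k\<bar> / g x \<le> 1" using xk g(1,3)[of x] by simp
    show "0 \<le> \<kappa> * \<zeta> x" using \<kappa> s0 by (simp add: \<zeta>_def)
   qed
   finally show ?thesis by simp
  qed
  have 2: "\<bar>exp (- \<kappa> * g x) * (s' (x \<bullet> x / \<rho>\<^sup>2) / \<rho>\<^sup>2) * (2 * x $ k)\<bar> \<le> 6 * exp (- \<kappa> * \<rho>) * indicator (cball 0 (2 * \<rho>)) x"
  proof (cases "x \<in> cball 0 (2 * \<rho>) \<and> \<rho> \<le> norm x")
   case True
   have e: "exp (- \<kappa> * g x) \<le> exp (- \<kappa> * \<rho>)" using True \<kappa> g(1)[of x] by (simp add: mult_left_mono)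
   have n: "\<bar>2 * x $ k\<bar> \<le> 4 * \<rho>" unfolding abs_mult using True xk by simp
   \<comment> \<open>With \<open>|s'| \<le> 4 / 3\<close>, \<open>|2 x_k| \<le> 4 \<rho>\<close> and
     \<open>\<rho> \<ge> 1\<close> the factor is at most \<open>16 / 3\<close>, rounded up to
     6.\<close>
   have "\<bar>s' (x \<bullet> x / \<rho>\<^sup>2)\<bar> * \<bar>2 * x $ k\<bar> \<le> (4 / 3) * (4 * \<rho>)" using s'b n by (intro mult_mono) auto
   also have "\<dots> \<le> 6 * \<rho>\<^sup>2" using \<rho> by (simp add: power2_eq_square)
   finally have "\<bar>s' (x \<bullet> x / \<rho>\<^sup>2)\<bar> * \<bar>2 * x $ k\<bar> / \<rho>\<^sup>2 \<le> 6" using \<rho>0 by (simp add: divide_le_eq)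
   then have "exp (- \<kappa> * g x) * (\<bar>s' (x \<bullet> x / \<rho>\<^sup>2)\<bar> * \<bar>2 * x $ k\<bar> / \<rho>\<^sup>2) \<le> exp (- \<kappa> * \<rho>) * 6"
    using e by (intro mult_mono) auto
   then show ?thesis using True by (simp add: abs_mult)
  next
   case False
   have "s' (x \<bullet> x / \<rho>\<^sup>2) = 0"
   proof (cases "x \<in> cball 0 (2 * \<rho>)")
    case True
    then have "(norm x)\<^sup>2 \<le> \<rho>\<^sup>2" using False by (intro power_mono) auto
    then show ?thesis using \<rho>0 by (intro low) (simp add: power2_norm_eq_inner)
   qed (use high(2) out in blast)
   then show ?thesis by simp
  qed
  show "\<bar>d\<zeta> k x\<bar> \<le> \<kappa> * \<zeta> x + 6 * exp (- \<kappa> * \<rho>) * indicator (cball 0 (2 * \<rho>)) x"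
   unfolding d\<zeta>_def distrib_right using 1 2 by (intro order_trans[OF abs_triangle_ineq] add_mono)
 qed
qed

section \<open>Exponentially small Laplace transforms\<close>

lemma exp_series_tail:
 fixes y :: real
 shows "(\<lambda>n. y ^ Suc n / fact (Suc n)) sums (exp y - 1)"
 using exp_converges[of y] sums_Suc_iff[of "\<lambda>n. y ^ n /\<^sub>R fact n" "exp y - 1"]
 by (simp add: divide_inverse mult.commute)

text \<open>Summing the transforms at \<open>p n\<close> with the coefficients of \<open>exp (- exp (p (s - t))) - 1\<close>,
 which tends to \<open>- 1\<close> for \<open>t < s\<close> and to \<open>0\<close> for \<open>t > s\<close> as \<open>p\<close> grows.\<close>

lemma laplace_decay_integral:
 fixes f :: "real => real"
 assumes f: "cts f" and s: "0 < s" "s < t0" "t0 \<le> T"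
  and d: "\<And>p. p0 \<le> p ==> \<bar>\<integral>t. indicator {0..T} t *\<^sub>R (exp (- p * t) * f t)\<bar> \<le> C * exp (- p * t0)"
 shows "(\<integral>t. indicator {0..s} t *\<^sub>R f t) = 0"
proof -
 have C: "0 \<le> C"
  using order_trans[OF abs_ge_zero d[OF order_refl]] by (simp add: zero_le_mult_iff)
 define y where "y m t = exp (m * (s - t))" for m t :: real
 have yc: "continuous_on S (y m)" for S m unfolding y_def by (intro continuous_intros)
 have ii: "lintegrable (\<lambda>t. indicator {0..T} t *\<^sub>R (f t * g t))" if "cts g" for g
  by (rule borel_integrable_compact[OF compact_Icc])
   (intro continuous_intros continuous_on_subset[OF f subset_UNIV] continuous_on_subset[OF that subset_UNIV])
 have cexp: "cts (\<lambda>t. exp (- y m t) - 1)" for m by (intro continuous_intros yc)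
 \<comment> \<open>The partial sums \<open>e N\<close> are combinations of exponentials with rates
   \<open>m (n + 1) \<ge> p0\<close>, so the hypothesis applies to each term; its bound contributes
   \<open>C q^(n+1) / (n+1)!\<close>, and the sum over \<open>n\<close> stays below
   \<open>C (exp q - 1)\<close>.\<close>
 have bound: "\<bar>\<integral>t. indicator {0..T} t *\<^sub>R (f t * (exp (- y m t) - 1))\<bar> \<le> C * (exp (exp (m * (s - t0))) - 1)"
  if m: "p0 \<le> m" "0 \<le> m" for m
 proof -
  define q where "q = exp (m * (s - t0))"
  define e where "e N t = (\<Sum>n<N. (- y m t) ^ Suc n / fact (Suc n))" for N t
  have ec: "cts (e N)" for N unfolding e_def[abs_def] by (intro continuous_intros yc) auto
  have eb: "\<bar>\<integral>t. indicator {0..T} t *\<^sub>R (f t * e N t)\<bar> \<le> C * (exp q - 1)" for N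
  proof -
   define E where "E n t = indicator {0..T} t *\<^sub>R (exp (- (m * real (Suc n)) * t) * f t)" for n t
   define c where "c n = (- 1) ^ Suc n * exp (m * real (Suc n) * s) / fact (Suc n)" for n :: nat
   have yp: "(- y m t) ^ Suc n / fact (Suc n) = c n * exp (- (m * real (Suc n)) * t)" for n t
   proof -
    have "y m t ^ Suc n = exp (real (Suc n) * (m * (s - t)))" unfolding y_def by (rule exp_of_nat_mult[symmetric])
    also have "real (Suc n) * (m * (s - t)) = m * real (Suc n) * s + - (m * real (Suc n)) * t" by (simp add: algebra_simps)
    finally have "y m t ^ Suc n = exp (m * real (Suc n) * s) * exp (- (m * real (Suc n)) * t)" by (simp only: exp_add)
    then show ?thesis unfolding power_minus[of "y m t"] by (simp add: c_def)
   qed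
   have Ei: "lintegrable (E n)" for n
    using ii[of "\<lambda>t. exp (- (m * real (Suc n)) * t)"] unfolding E_def[abs_def]
    by (simp add: mult.commute continuous_intros)
   have "(\<integral>t. indicator {0..T} t *\<^sub>R (f t * e N t)) = (\<integral>t. (\<Sum>n<N. c n * E n t))"
    unfolding e_def yp E_def by (intro integral_cong refl) (simp add: sum_distrib_left ac_simps)
   also have "\<dots> = (\<Sum>n<N. c n * (\<integral>t. E n t))" using Ei by simp
   finally have "\<bar>\<integral>t. indicator {0..T} t *\<^sub>R (f t * e N t)\<bar> \<le> (\<Sum>n<N. \<bar>c n * (\<integral>t. E n t)\<bar>)" by simp
   also have "\<dots> \<le> (\<Sum>n<N. C * (q ^ Suc n / fact (Suc n)))"
   proof (rule sum_mono)
    fix n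
    have "m * 1 \<le> m * real (Suc n)" using m by (intro mult_left_mono) auto
    then have "\<bar>\<integral>t. E n t\<bar> \<le> C * exp (- (m * real (Suc n)) * t0)" unfolding E_def using m by (intro d) simp
    then have "\<bar>c n\<bar> * \<bar>\<integral>t. E n t\<bar> \<le> \<bar>c n\<bar> * (C * exp (- (m * real (Suc n)) * t0))" by (rule mult_left_mono) simp
    also have "\<dots> = C * ((exp (m * real (Suc n) * s) * exp (- (m * real (Suc n)) * t0)) / fact (Suc n))"
     by (simp add: c_def abs_mult power_abs)
    also have "exp (m * real (Suc n) * s) * exp (- (m * real (Suc n)) * t0) = q ^ Suc n"
     unfolding q_def exp_of_nat_mult[symmetric] exp_add[symmetric] by (simp add: algebra_simps)
    finally show "\<bar>c n * (\<integral>t. E n t)\<bar> \<le> C * (q ^ Suc n / fact (Suc n))" by (simp only: abs_mult)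
   qed
   also have "\<dots> = C * (\<Sum>n<N. q ^ Suc n / fact (Suc n))" by (rule sum_distrib_left[symmetric])
   also have "(\<Sum>n<N. q ^ Suc n / fact (Suc n)) \<le> exp q - 1"
    using sum_le_suminf[OF sums_summable[OF exp_series_tail[of q]], of "{..<N}"] sums_unique[OF exp_series_tail[of q]]
    by (simp add: q_def)
   finally show ?thesis using C by (simp add: mult_left_mono)
  qed
  have "(\<lambda>N. \<integral>t. indicator {0..T} t *\<^sub>R (f t * e N t)) \<longlonglongrightarrow> (\<integral>t. indicator {0..T} t *\<^sub>R (f t * (exp (- y m t) - 1)))"
  proof (rule integral_dominated_convergence)
   show "(\<lambda>t. indicator {0..T} t *\<^sub>R (f t * (exp (- y m t) - 1))) \<in> borel_measurable lborel"
    by (rule borel_measurable_integrable[OF ii[OF cexp]])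
   show "(\<lambda>t. indicator {0..T} t *\<^sub>R (f t * e N t)) \<in> borel_measurable lborel" for N
    using ii[OF ec] by (rule borel_measurable_integrable)
   show "lintegrable (\<lambda>t. indicator {0..T} t *\<^sub>R (\<bar>f t\<bar> * exp (y m t)))"
    by (rule borel_integrable_compact[OF compact_Icc]) (intro continuous_intros yc continuous_on_subset[OF f subset_UNIV])
   show "AE t in lborel. (\<lambda>N. indicator {0..T} t *\<^sub>R (f t * e N t)) \<longlonglongrightarrow> indicator {0..T} t *\<^sub>R (f t * (exp (- y m t) - 1))"
   proof (intro AE_I2 tendsto_intros)
    show "(\<lambda>N. e N t) \<longlonglongrightarrow> exp (- y m t) - 1" for t
     using exp_series_tail[of "- y m t"] unfolding e_def sums_def .
   qed
   show "AE t in lborel. norm (indicator {0..T} t *\<^sub>R (f t * e N t)) \<le> indicator {0..T} t *\<^sub>R (\<bar>f t\<bar> * exp (y m t))" for N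
   proof (rule AE_I2)
    fix t
    have y0: "0 \<le> y m t" by (simp add: y_def)
    have "\<bar>e N t\<bar> \<le> (\<Sum>n<N. \<bar>(- y m t) ^ Suc n / fact (Suc n)\<bar>)" unfolding e_def by (rule sum_abs)
    also have "\<dots> = (\<Sum>n<N. y m t ^ Suc n / fact (Suc n))" using y0 by (simp add: abs_mult power_abs)
    also have "\<dots> \<le> exp (y m t) - 1"
     using sum_le_suminf[OF sums_summable[OF exp_series_tail[of "y m t"]], of "{..<N}"] sums_unique[OF exp_series_tail[of "y m t"]] y0
     by simp
    finally have "\<bar>f t\<bar> * \<bar>e N t\<bar> \<le> \<bar>f t\<bar> * exp (y m t)" by (intro mult_left_mono) auto
    then show "norm (indicator {0..T} t *\<^sub>R (f t * e N t)) \<le> indicator {0..T} t *\<^sub>R (\<bar>f t\<bar> * exp (y m t))"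
     by (simp add: abs_mult indicator_def)
   qed
  qed
  from tendsto_rabs[OF this] show ?thesis
   by (rule LIMSEQ_le_const2) (use eb in \<open>auto simp: q_def\<close>)
 qed
 have lim0: "(\<lambda>m. C * (exp (exp (real m * (s - t0))) - 1)) \<longlonglongrightarrow> 0"
 proof -
  have "((\<lambda>x. C * (exp (exp (x * (s - t0))) - 1)) \<longlongrightarrow> 0) at_top" using s by real_asymp
  from filterlim_compose[OF this filterlim_real_sequentially] show ?thesis .
 qed
 have "(\<lambda>m. \<integral>t. indicator {0..T} t *\<^sub>R (f t * (exp (- y (real m) t) - 1))) \<longlonglongrightarrow> (\<integral>t. - (indicator {0..s} t *\<^sub>R f t))"
 proof (rule integral_dominated_convergence)
  show "(\<lambda>t. - (indicator {0..s} t *\<^sub>R f t)) \<in> borel_measurable lborel"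
   using borel_measurable_continuous_onI[OF f] by measurable
  show "(\<lambda>t. indicator {0..T} t *\<^sub>R (f t * (exp (- y (real m) t) - 1))) \<in> borel_measurable lborel" for m
   by (rule borel_measurable_integrable[OF ii[OF cexp]])
  show "lintegrable (\<lambda>t. indicator {0..T} t *\<^sub>R \<bar>f t\<bar>)"
   by (rule borel_integrable_compact[OF compact_Icc]) (intro continuous_intros continuous_on_subset[OF f subset_UNIV])
  show "AE t in lborel. norm (indicator {0..T} t *\<^sub>R (f t * (exp (- y (real m) t) - 1))) \<le> indicator {0..T} t *\<^sub>R \<bar>f t\<bar>" for m
  proof (rule AE_I2)
   fix t
   have "\<bar>f t\<bar> * \<bar>exp (- y (real m) t) - 1\<bar> \<le> \<bar>f t\<bar> * 1" by (intro mult_left_mono) (auto simp: y_def abs_le_iff)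
   then show "norm (indicator {0..T} t *\<^sub>R (f t * (exp (- y (real m) t) - 1))) \<le> indicator {0..T} t *\<^sub>R \<bar>f t\<bar>"
    by (simp add: abs_mult indicator_def)
  qed
  have ptw: "(\<lambda>m. exp (- y (real m) t) - 1) \<longlonglongrightarrow> (if t < s then - 1 else 0)" if "t \<noteq> s" for t
  proof (cases "t < s")
   case True
   then have "((\<lambda>x. exp (- exp (x * (s - t))) - 1) \<longlongrightarrow> - 1) at_top" by real_asymp
   from filterlim_compose[OF this filterlim_real_sequentially] show ?thesis using True by (simp add: y_def)
  next
   case False
   then have "s - t < 0" using that by simp
   then have "((\<lambda>x. exp (- exp (x * (s - t))) - 1) \<longlongrightarrow> 0) at_top" by real_asymp
   from filterlim_compose[OF this filterlim_real_sequentially] show ?thesis using False by (simp add: y_def)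
  qed
  show "AE t in lborel. (\<lambda>m. indicator {0..T} t *\<^sub>R (f t * (exp (- y (real m) t) - 1))) \<longlonglongrightarrow> - (indicator {0..s} t *\<^sub>R f t)"
   using AE_lborel_singleton[of s]
  proof (rule AE_mp, intro AE_I2 impI)
   fix t assume t: "t \<noteq> s"
   have "(\<lambda>m. indicator {0..T} t *\<^sub>R (f t * (exp (- y (real m) t) - 1))) \<longlonglongrightarrow> indicator {0..T} t *\<^sub>R (f t * (if t < s then - 1 else 0))"
    by (intro tendsto_intros ptw t)
   moreover have "indicator {0..T} t *\<^sub>R (f t * (if t < s then - 1 else 0)) = - (indicator {0..s} t *\<^sub>R f t)"
    using s t by (auto simp: indicator_def)
   ultimately show "(\<lambda>m. indicator {0..T} t *\<^sub>R (f t * (exp (- y (real m) t) - 1))) \<longlonglongrightarrow> - (indicator {0..s} t *\<^sub>R f t)" by simp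
  qed
 qed
 moreover have "(\<lambda>m. \<integral>t. indicator {0..T} t *\<^sub>R (f t * (exp (- y (real m) t) - 1))) \<longlonglongrightarrow> 0"
 proof (rule Lim_null_comparison[OF _ lim0])
  obtain M :: nat where "p0 \<le> real M" using real_arch_simple by blast
  then have "norm (\<integral>t. indicator {0..T} t *\<^sub>R (f t * (exp (- y (real m) t) - 1))) \<le> C * (exp (exp (real m * (s - t0))) - 1)"
   if "M \<le> m" for m using bound[of "real m"] that by simp
  then show "\<forall>\<^sub>F m in sequentially. norm (\<integral>t. indicator {0..T} t *\<^sub>R (f t * (exp (- y (real m) t) - 1))) \<le> C * (exp (exp (real m * (s - t0))) - 1)"
   unfolding eventually_sequentially by blast
 qed
 ultimately have "(\<integral>t. - (indicator {0..s} t *\<^sub>R f t)) = 0" by (rule LIMSEQ_unique)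
 then show ?thesis by (simp only: integral_minus neg_equal_0_iff_equal)
qed

text \<open>The decay makes the integrals of \<open>f\<close> over all \<open>[0, s]\<close> with
  \<open>s < t0\<close> vanish, hence \<open>f\<close> itself on the open interval; continuity adds
  the end points.\<close>

lemma laplace_decay_imp_zero:
 fixes f :: "real => real"
 assumes f: "cts f" and t0: "0 < t0" "t0 \<le> T"
  and d: "\<And>p. p0 \<le> p ==> \<bar>\<integral>t. indicator {0..T} t *\<^sub>R (exp (- p * t) * f t)\<bar> \<le> C * exp (- p * t0)"
  and t: "0 \<le> t" "t \<le> t0"
 shows "f t = 0"
proof -
 have z: "integral {0..s} f = 0" if "0 < s" "s < t0" for s
 proof -
  have "set_integrable lborel {0..s} f"
   by (rule borel_integrable_atLeastAtMost'[OF continuous_on_subset[OF f subset_UNIV]])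
  from set_borel_integral_eq_integral(2)[OF this] laplace_decay_integral[OF f that t0(2) d]
  show ?thesis by (simp add: set_lebesgue_integral_def)
 qed
 have "f s = 0" if s: "s \<in> {0<..<t0}" for s
 proof -
  have "((\<lambda>r. integral {0..r} f) has_real_derivative f s) (at s within {0..t0})"
   by (rule integral_has_real_derivative[OF continuous_on_subset[OF f subset_UNIV]]) (use s in auto)
  then have "((\<lambda>r. integral {0..r} f) has_real_derivative f s) (at s)"
   using s at_within_Icc_at[of 0 s t0] by simp
  then have "((\<lambda>r. 0) has_real_derivative f s) (at s)"
   by (rule has_field_derivative_transform_within_open[where S = "{0<..<t0}"]) (use z s in auto)
  then show ?thesis using DERIV_const DERIV_unique by blast
 qed
 moreover have "closure {0<..<t0} = {0..t0}" using t0 by simp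
 ultimately show ?thesis
  using continuous_constant_on_closure[of "{0<..<t0}" f 0 t] continuous_on_subset[OF f subset_UNIV, of "closure {0<..<t0}"] t
  by auto
qed

text \<open>The set where \<open>f\<close> is nonzero is open and null, hence empty.\<close>

lemma integral_eq_0_imp_zero:
 fixes f :: "'a::euclidean_space => real"
 assumes f: "cts f" "lintegrable f" "\<And>x. 0 \<le> f x" "(\<integral>x. f x) = 0"
 shows "f x = 0"
proof (rule ccontr)
 assume x: "f x \<noteq> 0"
 have "AE x in lborel. f x = 0" using integral_nonneg_eq_0_iff_AE[OF f(2)] f(3,4) by simp
 then have "{x. f x \<noteq> 0} \<in> null_sets lborel"
  using AE_iff_null[of lborel "\<lambda>x. f x = 0"] open_Collect_neq[OF f(1) continuous_on_const[of UNIV 0]] by simp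
 then have "negligible {x. f x \<noteq> 0}" by (simp add: negligible_iff_null_sets null_sets_completionI)
 moreover have "open {x. f x \<noteq> 0}" by (intro open_Collect_neq f(1) continuous_on_const)
 ultimately show False using open_not_negligible[of "{x. f x \<noteq> 0}"] x by blast
qed

section \<open>Decay of the Laplace transform\<close>

text \<open>The logarithm of the left-hand side divided by \<open>p\<close> tends to 0, because
  \<open>a < 1\<close>.\<close>

lemma power_exp_powr_le:
 fixes a b \<epsilon> :: real and m :: nat
 assumes a: "0 < a" "a < 1" and e: "0 < \<epsilon>"
 obtains p1 where "1 \<le> p1" "\<And>p. p1 \<le> p ==> p ^ m * exp (b * p powr a) \<le> exp (\<epsilon> * p)"
proof -
 have l1: "((\<lambda>p::real. ln p / p) \<longlongrightarrow> 0) at_top" by real_asymp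
 have l2: "((\<lambda>p::real. p powr (a - 1)) \<longlongrightarrow> 0) at_top" by (rule tendsto_neg_powr) (use a in \<open>auto intro: filterlim_ident\<close>)
 have "((\<lambda>p. real m * (ln p / p) + b * p powr (a - 1)) \<longlongrightarrow> real m * 0 + b * 0) at_top" by (intro tendsto_intros l1 l2)
 then have "\<forall>\<^sub>F p in at_top. real m * (ln p / p) + b * p powr (a - 1) < \<epsilon>" using e by (intro order_tendstoD(2)) auto
 then obtain q where q: "\<And>p. q \<le> p ==> real m * (ln p / p) + b * p powr (a - 1) < \<epsilon>" unfolding eventually_at_top_linorder by blast
 show thesis
 proof (rule that[of "max 1 q"])
  fix p assume p: "max 1 q \<le> p"
  then have p0: "0 < p" by simp
  have "p * (real m * (ln p / p) + b * p powr (a - 1)) \<le> p * \<epsilon>" using q[of p] p p0 by (intro mult_left_mono) auto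
  moreover have "p * p powr (a - 1) = p powr a" using p0 powr_add[of p 1 "a - 1"] by simp
  ultimately have "real m * ln p + b * p powr a \<le> \<epsilon> * p" using p0 by (simp add: distrib_left mult.left_commute mult.commute)
  then have "exp (real m * ln p + b * p powr a) \<le> exp (\<epsilon> * p)" by simp
  moreover have "exp (real m * ln p) = p ^ m" using p0 by (simp add: exp_of_nat_mult)
  ultimately show "p ^ m * exp (b * p powr a) \<le> exp (\<epsilon> * p)" by (simp add: exp_add)
 qed simp
qed

context frac_data
begin

text \<open>The condition on \<open>\<kappa>\<close> lets the left-hand side of the energy estimate
  absorb that part of the gradient of the weight which is proportional to the weight; what is left
  comes from the outer ball and from \<open>Rp\<close>. The factor 144 is twice 72, and 72 is
  \<open>2 * 6^2\<close> with the 6 of the cut-off.\<close>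

lemma vp_energy:
 assumes p: "1 \<le> p" and \<rho>: "1 \<le> \<rho>" "r \<le> \<rho>" and \<kappa>: "0 \<le> \<kappa>" "4 * \<Lambda> * (real CARD('n))\<^sup>2 * \<kappa>\<^sup>2 \<le> p powr \<alpha> / 4"
  and bb: "\<And>k x. \<bar>bb k x\<bar> \<le> B" and cc: "\<And>x. \<bar>cc x\<bar> \<le> B"
  and P: "B + real CARD('n) * B\<^sup>2 / (2 * \<delta>0) \<le> p powr \<alpha> / 4"
  and Mv: "\<And>x. x \<in> cball 0 (2 * \<rho>) ==> \<bar>vp p x\<bar> \<le> Mv" and MR: "\<And>x. x \<in> cball 0 (2 * \<rho>) ==> \<bar>Rp p x\<bar> \<le> MR"
 shows "(p powr \<alpha> / 4) * (exp (- 2 * \<kappa> * (1 + r)) * (\<integral>x. indicator (cball 0 r) x *\<^sub>R (vp p x)\<^sup>2))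
  \<le> measure lborel (cball (0 :: real^'n) (2 * \<rho>)) * (144 * \<Lambda> * (real CARD('n))\<^sup>2 * exp (- 2 * \<kappa> * \<rho>) * Mv\<^sup>2 + MR\<^sup>2 / p powr \<alpha>)"
proof -
 define P where "P = p powr \<alpha>"
 have P0: "0 < P" using p by (simp add: P_def)
 define n where "n = real CARD('n)"
 define D where "D = cball (0 :: real^'n) (2 * \<rho>)"
 define v where "v = vp p"
 have cD: "compact D" by (simp add: D_def)
 obtain \<zeta> :: "real^'n => real" and d\<zeta> where \<zeta>: "C1_test (cball 0 (2 * \<rho>)) \<zeta> d\<zeta>" "\<And>x. 0 \<le> \<zeta> x" "\<And>x. \<zeta> x \<le> 1"
  "\<And>x. norm x \<le> \<rho> ==> exp (- \<kappa> * (1 + norm x)) \<le> \<zeta> x"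
  "\<And>k x. \<bar>d\<zeta> k x\<bar> \<le> \<kappa> * \<zeta> x + 6 * exp (- \<kappa> * \<rho>) * indicator (cball 0 (2 * \<rho>)) x"
  by (rule exp_cutoff[OF \<kappa>(1) \<rho>(1)]) blast
 have \<zeta>U: "C1_test UNIV \<zeta> d\<zeta>" using \<zeta>(1) by (auto simp: C1_test_def)
 have \<zeta>c: "cts \<zeta>" "cts (d\<zeta> k)" for k using C1_test_fun[OF \<zeta>U] by (auto simp: C1_fun_def)
 have z: "\<zeta> x = 0" "d\<zeta> k x = 0" if "x \<notin> D" for x k
 proof -
  obtain K where K: "compact K" "K \<subseteq> cball 0 (2 * \<rho>)" "\<And>x. x \<notin> K ==> \<zeta> x = 0" "\<And>x k. x \<notin> K ==> d\<zeta> k x = 0"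
   by (rule C1_testE[OF \<zeta>(1)]) blast
  have "x \<notin> K" using K(2) that by (auto simp: D_def)
  then show "\<zeta> x = 0" "d\<zeta> k x = 0" by (auto intro: K(3,4))
 qed
 have vc: "cts v" using C1_vp[OF p] by (simp add: C1_fun_def v_def)
 have Rc: "cts (Rp p)" by (rule cont_Rp[OF p])
 define h1 where "h1 x = (\<zeta> x * v x)\<^sup>2" for x
 define h2 where "h2 x = (v x)\<^sup>2 * (\<Sum>k\<in>UNIV. \<bar>d\<zeta> k x\<bar>)\<^sup>2" for x
 define h3 where "h3 x = (\<zeta> x * Rp p x)\<^sup>2" for x
 have i: "lintegrable h1" "lintegrable h2" "lintegrable h3"
  unfolding h1_def[abs_def] h2_def[abs_def] h3_def[abs_def]
  by (rule integrable_compact_support[OF _ cD]; auto intro!: continuous_intros vc Rc \<zeta>c simp: z)+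
 have main: "(P / 2) * (\<integral>x. h1 x) \<le> 2 * \<Lambda> * (\<integral>x. h2 x) + (1 / P) * (\<integral>x. h3 x)"
  unfolding h1_def h2_def h3_def v_def
  by (rule weighted_energy[OF C1_vp[OF p] Rc \<zeta>U cont_bb bb cont_cc cc P0 P[folded P_def] weak_vp[OF p, folded P_def]])
 define E where "E = exp (- \<kappa> * \<rho>)"
 have e2: "(\<integral>x. h2 x) \<le> (\<integral>x. 2 * n\<^sup>2 * \<kappa>\<^sup>2 * h1 x + (72 * n\<^sup>2 * E\<^sup>2 * Mv\<^sup>2) * indicator D x)"
 proof (rule integral_mono[OF i(2)])
  show "lintegrable (\<lambda>x. 2 * n\<^sup>2 * \<kappa>\<^sup>2 * h1 x + (72 * n\<^sup>2 * E\<^sup>2 * Mv\<^sup>2) * indicator D x)"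
   by (intro integrable_add integrable_mult_right i integrable_indicator_compact(1) cD)
  fix x
  show "h2 x \<le> 2 * n\<^sup>2 * \<kappa>\<^sup>2 * h1 x + (72 * n\<^sup>2 * E\<^sup>2 * Mv\<^sup>2) * indicator D x"
  proof (cases "x \<in> D")
   case True
   have "(\<Sum>k\<in>UNIV. \<bar>d\<zeta> k x\<bar>) \<le> (\<Sum>k\<in>(UNIV::'n set). \<kappa> * \<zeta> x + 6 * E)"
    by (intro sum_mono) (use \<zeta>(5)[of _ x] True in \<open>simp add: E_def D_def\<close>)
   also have "\<dots> = n * (\<kappa> * \<zeta> x + 6 * E)" by (simp add: n_def)
   finally have "(\<Sum>k\<in>UNIV. \<bar>d\<zeta> k x\<bar>)\<^sup>2 \<le> (n * (\<kappa> * \<zeta> x + 6 * E))\<^sup>2" by (intro power_mono) (auto intro: sum_nonneg)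
   also have "\<dots> = n\<^sup>2 * (\<kappa> * \<zeta> x + 6 * E)\<^sup>2" by (rule power_mult_distrib)
   also have "\<dots> \<le> n\<^sup>2 * (2 * (\<kappa> * \<zeta> x)\<^sup>2 + 72 * E\<^sup>2)"
   proof (rule mult_left_mono)
    have "0 \<le> (\<kappa> * \<zeta> x - 6 * E)\<^sup>2" by simp
    then show "(\<kappa> * \<zeta> x + 6 * E)\<^sup>2 \<le> 2 * (\<kappa> * \<zeta> x)\<^sup>2 + 72 * E\<^sup>2" by (simp add: power2_eq_square algebra_simps)
   qed simp
   finally have "h2 x \<le> (v x)\<^sup>2 * (n\<^sup>2 * (2 * (\<kappa> * \<zeta> x)\<^sup>2 + 72 * E\<^sup>2))" unfolding h2_def by (intro mult_left_mono) auto
   also have "\<dots> = 2 * n\<^sup>2 * \<kappa>\<^sup>2 * h1 x + (72 * n\<^sup>2 * E\<^sup>2) * (v x)\<^sup>2" by (simp add: h1_def power_mult_distrib algebra_simps)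
   also have "(72 * n\<^sup>2 * E\<^sup>2) * (v x)\<^sup>2 \<le> (72 * n\<^sup>2 * E\<^sup>2) * Mv\<^sup>2"
    using Mv[of x] True by (intro mult_left_mono) (auto simp: v_def D_def intro!: abs_le_square_iff[THEN iffD1])
   finally show ?thesis using True by simp
  next
   case False then show ?thesis by (simp add: h1_def h2_def z)
  qed
 qed
 have e2': "(\<integral>x. 2 * n\<^sup>2 * \<kappa>\<^sup>2 * h1 x + (72 * n\<^sup>2 * E\<^sup>2 * Mv\<^sup>2) * indicator D x) = 2 * n\<^sup>2 * \<kappa>\<^sup>2 * (\<integral>x. h1 x) + 72 * n\<^sup>2 * E\<^sup>2 * Mv\<^sup>2 * measure lborel D"
  using integrable_indicator_compact[OF cD] i by (subst integral_add) auto
 have e3: "(\<integral>x. h3 x) \<le> MR\<^sup>2 * measure lborel D"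
 proof -
  have "(\<integral>x. h3 x) \<le> (\<integral>x. MR\<^sup>2 * indicator D x)"
  proof (rule integral_mono[OF i(3) integrable_indicator_compact(1)[OF cD]])
   fix x
   show "h3 x \<le> MR\<^sup>2 * indicator D x"
   proof (cases "x \<in> D")
    case True
    have "\<bar>\<zeta> x * Rp p x\<bar> \<le> 1 * MR" unfolding abs_mult using \<zeta>(2,3)[of x] MR[of x] True by (intro mult_mono) (auto simp: D_def)
    then have "\<bar>\<zeta> x * Rp p x\<bar>\<^sup>2 \<le> MR\<^sup>2" by (intro power_mono) auto
    then show ?thesis using True by (simp add: h3_def)
   qed (simp add: h3_def z)
  qed
  then show ?thesis using integrable_indicator_compact(2)[OF cD] by simp
 qed
 have e1: "exp (- 2 * \<kappa> * (1 + r)) * (\<integral>x. indicator (cball 0 r) x *\<^sub>R (vp p x)\<^sup>2) \<le> (\<integral>x. h1 x)"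
 proof -
  have ib: "lintegrable (\<lambda>x. indicator (cball 0 r) x *\<^sub>R (v x)\<^sup>2)"
   by (rule borel_integrable_compact[OF compact_cball]) (rule continuous_on_subset[OF _ subset_UNIV], intro continuous_intros vc)
  have "(\<integral>x. exp (- 2 * \<kappa> * (1 + r)) * (indicator (cball 0 r) x *\<^sub>R (v x)\<^sup>2)) \<le> (\<integral>x. h1 x)"
  proof (rule integral_mono[OF integrable_mult_right[OF ib] i(1)])
   fix x
   show "exp (- 2 * \<kappa> * (1 + r)) * (indicator (cball 0 r) x *\<^sub>R (v x)\<^sup>2) \<le> h1 x"
   proof (cases "x \<in> cball 0 r")
    case True
    then have x: "norm x \<le> r" by simp
    have "exp (- \<kappa> * (1 + r)) \<le> exp (- \<kappa> * (1 + norm x))" using x \<kappa>(1) by (simp add: mult_left_mono)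
    also have "\<dots> \<le> \<zeta> x" by (rule \<zeta>(4)) (use x \<rho> in simp)
    finally have "(exp (- \<kappa> * (1 + r)))\<^sup>2 \<le> (\<zeta> x)\<^sup>2" by (intro power_mono) auto
    also have "(exp (- \<kappa> * (1 + r)))\<^sup>2 = exp (- 2 * \<kappa> * (1 + r))" by (simp flip: exp_double add: algebra_simps)
    finally have "exp (- 2 * \<kappa> * (1 + r)) * (v x)\<^sup>2 \<le> (\<zeta> x)\<^sup>2 * (v x)\<^sup>2" by (rule mult_right_mono) simp
    then show ?thesis using True by (simp add: h1_def power_mult_distrib)
   qed (simp add: h1_def)
  qed
  then show ?thesis using ib by (simp add: v_def)
 qed
 define X where "X = (\<integral>x. h1 x)"
 have X0: "0 \<le> X" unfolding X_def h1_def by (rule integral_nonneg) simp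
 have "2 * \<Lambda> * (\<integral>x. h2 x) \<le> 2 * \<Lambda> * (2 * n\<^sup>2 * \<kappa>\<^sup>2 * X + 72 * n\<^sup>2 * E\<^sup>2 * Mv\<^sup>2 * measure lborel D)"
  using e2 \<Lambda> unfolding e2' X_def by (intro mult_left_mono) auto
 moreover have "(1 / P) * (\<integral>x. h3 x) \<le> (1 / P) * (MR\<^sup>2 * measure lborel D)" using e3 P0 by (intro mult_left_mono) auto
 moreover have "4 * \<Lambda> * n\<^sup>2 * \<kappa>\<^sup>2 * X \<le> P / 4 * X" using \<kappa>(2) X0 unfolding n_def P_def by (rule mult_right_mono)
 ultimately have "(P / 4) * X \<le> 144 * \<Lambda> * n\<^sup>2 * E\<^sup>2 * Mv\<^sup>2 * measure lborel D + (1 / P) * (MR\<^sup>2 * measure lborel D)"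
 proof -
  assume 1: "2 * \<Lambda> * (\<integral>x. h2 x) \<le> 2 * \<Lambda> * (2 * n\<^sup>2 * \<kappa>\<^sup>2 * X + 72 * n\<^sup>2 * E\<^sup>2 * Mv\<^sup>2 * measure lborel D)"
   and 2: "(1 / P) * (\<integral>x. h3 x) \<le> (1 / P) * (MR\<^sup>2 * measure lborel D)" and 3: "4 * \<Lambda> * n\<^sup>2 * \<kappa>\<^sup>2 * X \<le> P / 4 * X"
  have "2 * \<Lambda> * (2 * n\<^sup>2 * \<kappa>\<^sup>2 * X + 72 * n\<^sup>2 * E\<^sup>2 * Mv\<^sup>2 * measure lborel D)
   = 4 * \<Lambda> * n\<^sup>2 * \<kappa>\<^sup>2 * X + 144 * \<Lambda> * n\<^sup>2 * E\<^sup>2 * Mv\<^sup>2 * measure lborel D" by (simp add: algebra_simps)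
  moreover have "(P / 2) * X = (P / 4) * X + (P / 4) * X" by simp
  ultimately show ?thesis using main 1 2 3 unfolding X_def by linarith
 qed
 also have "\<dots> = measure lborel D * (144 * \<Lambda> * n\<^sup>2 * E\<^sup>2 * Mv\<^sup>2 + MR\<^sup>2 / P)" by (simp add: algebra_simps)
 also have "E\<^sup>2 = exp (- 2 * \<kappa> * \<rho>)" by (simp add: E_def flip: exp_double)
 finally have "(P / 4) * X \<le> measure lborel D * (144 * \<Lambda> * n\<^sup>2 * exp (- 2 * \<kappa> * \<rho>) * Mv\<^sup>2 + MR\<^sup>2 / P)" .
 moreover have "(P / 4) * (exp (- 2 * \<kappa> * (1 + r)) * (\<integral>x. indicator (cball 0 r) x *\<^sub>R (vp p x)\<^sup>2)) \<le> (P / 4) * X"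
  using e1 P0 unfolding X_def by (intro mult_left_mono) auto
 ultimately show ?thesis unfolding P_def n_def D_def by linarith
qed

text \<open>The gains \<open>exp (- 2 \<kappa> \<rho>)\<close> and \<open>exp (- 2 p T)\<close> must
  beat the squared growth \<open>exp (2 A p / K)\<close> on the ball of radius
  \<open>2 \<rho>\<close> with room \<open>exp (- 4 p / K)\<close>. Half of the room pays for powers
  of \<open>p\<close> and for removing the weight on a fixed ball; the other half is the claimed
  decay with \<open>t0 = 1 / K\<close>.\<close>

lemma vp_decay:
 assumes bb: "\<And>k x. \<bar>bb k x\<bar> \<le> B" and cc: "\<And>x. \<bar>cc x\<bar> \<le> B" and \<sigma>: "0 \<le> \<sigma>"
  and gr: "\<And>t x. 0 \<le> t ==> t \<le> T ==> \<bar>U t x\<bar> \<le> C * exp (\<sigma> * norm x powr (2 / (2 - \<alpha>)))"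
 obtains t0 where "0 < t0" "2 * t0 \<le> T"
  "\<And>r. 0 \<le> r ==> \<exists>D p1. 1 \<le> p1 \<and> (\<forall>p\<ge>p1. (\<integral>x. indicator (cball 0 r) x *\<^sub>R (vp p x)\<^sup>2) \<le> D * exp (- 2 * t0 * p))"
proof -
 define \<beta> where "\<beta> = 2 / (2 - \<alpha>)"
 have \<beta>: "0 < \<beta>" "inverse \<beta> = 1 - \<alpha> / 2" using \<alpha> by (simp_all add: \<beta>_def field_simps)
 define n where "n = real CARD('n)"
 have n: "1 \<le> n" unfolding n_def using zero_less_card_finite[where 'a = 'n] by linarith
 \<comment> \<open>Small enough that \<open>\<kappa> = c1 * p powr (\<alpha> / 2)\<close> satisfies
   the absorption condition of \<open>vp_energy\<close>; writing \<open>\<Lambda> + 1\<close> keeps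
   the denominator positive.\<close>
 define c1 where "c1 = 1 / (4 * n * sqrt (\<Lambda> + 1))"
 have c1: "0 < c1" using \<Lambda> n by (simp add: c1_def)
 have c1': "4 * \<Lambda> * n\<^sup>2 * c1\<^sup>2 \<le> 1 / 4" 
 proof -
  have L: "0 < \<Lambda> + 1" using \<Lambda> by simp
  have "c1\<^sup>2 = 1 / (16 * n\<^sup>2 * (\<Lambda> + 1))" using L by (simp add: c1_def power_mult_distrib power_divide)
  then have "4 * \<Lambda> * n\<^sup>2 * c1\<^sup>2 = 4 * \<Lambda> / (16 * (\<Lambda> + 1))" using n by simp
  also have "\<dots> \<le> 1 / 4" using L by (simp add: divide_le_eq)
  finally show ?thesis .
 qed
 \<comment> \<open>The growth exponent on the ball of radius \<open>2 \<rho>\<close> is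
   \<open>\<sigma> * (2 \<rho>) powr \<beta> = A * (p / K)\<close>.\<close>
 define A where "A = \<sigma> * 2 powr \<beta>"
 have A: "0 \<le> A" using \<sigma> by (simp add: A_def)
 \<comment> \<open>The two lower bounds amount to
   \<open>A + 2 \<le> c1 * K powr (\<alpha> / 2)\<close>, for the weight, and
   \<open>A + 2 \<le> K * T\<close>, for the truncation in time.\<close>
 define K where "K = max 1 (max (((A + 2) / c1) powr (2 / \<alpha>)) ((A + 2) / T))"
 have K1: "1 \<le> K" by (simp add: K_def)
 have KT: "A + 2 \<le> K * T" 
 proof -
  have "(A + 2) / T \<le> K" by (simp add: K_def)
  then show ?thesis using T by (simp add: divide_le_eq)
 qed
 have Kc: "A + 2 \<le> c1 * K powr (\<alpha> / 2)"
 proof -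
  have "(A + 2) / c1 = (((A + 2) / c1) powr (2 / \<alpha>)) powr (\<alpha> / 2)" using A c1 \<alpha> by (simp add: powr_powr)
  also have "\<dots> \<le> K powr (\<alpha> / 2)" using \<alpha> by (intro powr_mono2) (auto simp: K_def)
  finally show ?thesis using c1 by (simp add: divide_le_eq mult.commute)
 qed
 have C0: "0 \<le> C"
 proof -
  have "0 \<le> C * exp (\<sigma> * norm (0 :: real^'n) powr (2 / (2 - \<alpha>)))" using gr[of 0 0] T by (meson abs_ge_zero le_less order_trans)
  then show ?thesis by (simp add: zero_le_mult_iff)
 qed
 show thesis
 proof (rule that[of "1 / K"])
  show "0 < 1 / K" using K1 by simp
  show "2 * (1 / K) \<le> T" using KT A K1 by (simp add: divide_le_eq mult.commute)
  fix r :: real assume r: "0 \<le> r"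
  define b where "b = 2 * c1 * (1 + r)"
  \<comment> \<open>The exponent counts \<open>CARD('n)\<close> for the volume of the ball, whose
    radius is at most \<open>2 p\<close>, and 6 for the square of the cubic bound on
    \<open>Q\<close>; \<open>b\<close> is the cost of removing the weight on the ball of radius
    \<open>r\<close>.\<close>
  obtain p2 where p2: "1 \<le> p2" "\<And>p. p2 \<le> p ==> p ^ (CARD('n) + 6) * exp (b * p powr (\<alpha> / 2)) \<le> exp ((2 / K) * p)"
   by (rule power_exp_powr_le[of "\<alpha> / 2" "2 / K" "CARD('n) + 6" b]) (use \<alpha> K1 in auto)
  define B' where "B' = B + n * B\<^sup>2 / (2 * \<delta>0)"
  define p1 where "p1 = max (max p2 K) (max (K * r powr \<beta>) (4 * B'))"
  define N where "N = unit_ball_vol n * 2 ^ CARD('n)"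
  define D where "D = 4 * N * (144 * \<Lambda> * n\<^sup>2 * (T * C)\<^sup>2 + (C * T * (exp T + 1 + T))\<^sup>2)"
  show "\<exists>D p1. 1 \<le> p1 \<and> (\<forall>p\<ge>p1. (\<integral>x. indicator (cball 0 r) x *\<^sub>R (vp p x)\<^sup>2) \<le> D * exp (- 2 * (1 / K) * p))"
  proof (intro exI conjI allI impI)
   show "1 \<le> p1" using p2(1) by (simp add: p1_def)
   fix p assume "p1 \<le> p"
   then have p: "1 \<le> p" "p2 \<le> p" "K \<le> p" "K * r powr \<beta> \<le> p" "4 * B' \<le> p" using p2(1) by (auto simp: p1_def)
   \<comment> \<open>The exponent is the reciprocal of \<open>\<beta>\<close>, so that
     \<open>\<rho> powr \<beta> = p / K\<close> and the growth on the ball is exponential of a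
     linear function of \<open>p\<close>.\<close>
   define \<rho> where "\<rho> = (p / K) powr (1 - \<alpha> / 2)"
   have pK: "1 \<le> p / K" using p K1 by simp
   have \<rho>: "1 \<le> \<rho>" unfolding \<rho>_def using pK \<alpha> by (intro ge_one_powr_ge_zero) auto
   have \<rho>p: "\<rho> \<le> p"
   proof -
    have "\<rho> \<le> (p / K) powr 1" unfolding \<rho>_def using pK \<alpha> by (intro powr_mono) auto
    also have "\<dots> \<le> p" using p K1 by (simp add: divide_le_eq)
    finally show ?thesis .
   qed
   have \<rho>\<beta>: "\<rho> powr \<beta> = p / K"
    unfolding \<rho>_def powr_powr \<beta>(2)[symmetric] using \<beta>(1) pK p(1) K1 by simp
   have r\<rho>: "r \<le> \<rho>"
   proof (rule ccontr)
    assume "\<not> r \<le> \<rho>"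
    then have "\<rho> powr \<beta> < r powr \<beta>" using \<rho> \<beta>(1) by (intro powr_less_mono2) auto
    then show False using p(4) K1 unfolding \<rho>\<beta> by (simp add: divide_less_eq mult.commute)
   qed
   define \<kappa> where "\<kappa> = c1 * p powr (\<alpha> / 2)"
   have \<kappa>0: "0 \<le> \<kappa>" using c1 by (simp add: \<kappa>_def)
   define P where "P = p powr \<alpha>"
   have Pp: "p \<le> P" using powr_mono[of 1 \<alpha> p] p \<alpha> by (simp add: P_def)
   have P1: "1 \<le> P" using Pp p by simp
   have \<kappa>2: "\<kappa>\<^sup>2 = c1\<^sup>2 * P" using p by (simp add: \<kappa>_def P_def power_mult_distrib powr_power)
   have \<kappa>P: "4 * \<Lambda> * (real CARD('n))\<^sup>2 * \<kappa>\<^sup>2 \<le> p powr \<alpha> / 4"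
    using mult_right_mono[OF c1', of P] P1 unfolding \<kappa>2 n_def[symmetric] P_def[symmetric] by (simp add: mult.assoc)
   have \<kappa>\<rho>: "(A + 2) * (p / K) \<le> \<kappa> * \<rho>"
   proof -
    have "p powr (\<alpha> / 2) * (p / K) powr (1 - \<alpha> / 2) = K powr (\<alpha> / 2) * (p / K)"
    proof -
     have "p powr (\<alpha> / 2) = (K * (p / K)) powr (\<alpha> / 2)" using K1 by simp
     also have "\<dots> = K powr (\<alpha> / 2) * (p / K) powr (\<alpha> / 2)" using K1 pK by (intro powr_mult)
     finally have "p powr (\<alpha> / 2) * (p / K) powr (1 - \<alpha> / 2) = K powr (\<alpha> / 2) * ((p / K) powr (\<alpha> / 2) * (p / K) powr (1 - \<alpha> / 2))"
      by simp
     also have "(p / K) powr (\<alpha> / 2) * (p / K) powr (1 - \<alpha> / 2) = p / K" using pK p(1) K1 by (simp flip: powr_add)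
     finally show ?thesis .
    qed
    then have "\<kappa> * \<rho> = (c1 * K powr (\<alpha> / 2)) * (p / K)" unfolding \<kappa>_def \<rho>_def by (simp only: mult.assoc)
    then show ?thesis using mult_right_mono[OF Kc, of "p / K"] pK by simp
   qed
   have pT: "(A + 2) * (p / K) \<le> p * T"
    using mult_right_mono[OF KT, of "p / K"] pK K1 by (simp add: mult.commute)
   define Bp where "Bp = C * exp (A * (p / K))"
   have Bp: "0 \<le> Bp" using C0 by (simp add: Bp_def)
   have Ub: "\<bar>U t x\<bar> \<le> Bp" if "x \<in> cball 0 (2 * \<rho>)" "0 \<le> t" "t \<le> T" for t x
   proof -
    have "norm x powr \<beta> \<le> (2 * \<rho>) powr \<beta>" using that(1) \<beta>(1) by (intro powr_mono2) auto
    also have "\<dots> = 2 powr \<beta> * (p / K)" using \<rho> by (simp add: powr_mult \<rho>\<beta>)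
    finally have "\<sigma> * norm x powr \<beta> \<le> \<sigma> * (2 powr \<beta> * (p / K))" using \<sigma> by (rule mult_left_mono)
    then have "\<sigma> * norm x powr \<beta> \<le> A * (p / K)" by (simp add: A_def)
    then have "C * exp (\<sigma> * norm x powr \<beta>) \<le> Bp" unfolding Bp_def using C0 by (intro mult_left_mono) auto
    then show ?thesis using gr[OF that(2,3), of x] by (simp add: \<beta>_def)
   qed
   define Q where "Q = p\<^sup>2 * exp T + P * (1 + p * T)"
   have Q: "0 \<le> Q" "Q \<le> p ^ 3 * (exp T + 1 + T)"
   proof -
    show "0 \<le> Q" unfolding Q_def using p T P1 by (intro add_nonneg_nonneg mult_nonneg_nonneg) auto
    have "P \<le> p\<^sup>2" using powr_mono[of \<alpha> 2 p] p \<alpha> by (simp add: P_def powr_numeral)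
    moreover have "1 + p * T \<le> p * (1 + T)" using p T by (simp add: distrib_left)
    ultimately have "P * (1 + p * T) \<le> p\<^sup>2 * (p * (1 + T))" using p T by (intro mult_mono) auto
    moreover have "p\<^sup>2 * exp T \<le> p ^ 3 * exp T" using p by (intro mult_right_mono power_increasing) auto
    ultimately show "Q \<le> p ^ 3 * (exp T + 1 + T)" unfolding Q_def by (simp add: power2_eq_square power3_eq_cube algebra_simps)
   qed
   define Mv where "Mv = T * Bp"
   define MR where "MR = Bp * T * exp (- p * T) * Q"
   define I where "I = (\<integral>x. indicator (cball 0 r) x *\<^sub>R (vp p x)\<^sup>2)"
   define V where "V = measure lborel (cball (0 :: real^'n) (2 * \<rho>))"
   have main: "(P / 4) * (exp (- 2 * \<kappa> * (1 + r)) * I) \<le> V * (144 * \<Lambda> * n\<^sup>2 * exp (- 2 * \<kappa> * \<rho>) * Mv\<^sup>2 + MR\<^sup>2 / P)"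
    unfolding I_def V_def P_def n_def
   proof (rule vp_energy[OF p(1) \<rho> r\<rho> \<kappa>0 \<kappa>P bb cc])
    show "B + real CARD('n) * B\<^sup>2 / (2 * \<delta>0) \<le> p powr \<alpha> / 4" using p(5) Pp by (simp add: B'_def n_def P_def)
    fix x :: "real^'n" assume x: "x \<in> cball 0 (2 * \<rho>)"
    show "\<bar>vp p x\<bar> \<le> Mv" unfolding Mv_def by (rule vp_bound[OF p(1)]) (use Ub[OF x] in auto)
    show "\<bar>Rp p x\<bar> \<le> MR" unfolding MR_def Q_def P_def by (rule Rp_bound[OF p(1)]) (use Ub[OF x] in auto)
   qed
   have dec: "exp (- 2 * \<kappa> * \<rho>) * (exp (A * (p / K)))\<^sup>2 \<le> exp (- 4 * (p / K))"
    "(exp (- p * T))\<^sup>2 * (exp (A * (p / K)))\<^sup>2 \<le> exp (- 4 * (p / K))"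
   proof -
    have ex: "exp c * (exp d)\<^sup>2 \<le> exp e" if "c + 2 * d \<le> e" for c d e :: real
     using that by (simp flip: exp_double exp_add)
    have dist: "(A + 2) * (p / K) = A * (p / K) + 2 * (p / K)" by (rule distrib_right)
    show "exp (- 2 * \<kappa> * \<rho>) * (exp (A * (p / K)))\<^sup>2 \<le> exp (- 4 * (p / K))"
    proof (rule ex)
     have "- 2 * \<kappa> * \<rho> = - 2 * (\<kappa> * \<rho>)" by simp
     then show "- 2 * \<kappa> * \<rho> + 2 * (A * (p / K)) \<le> - 4 * (p / K)" using \<kappa>\<rho> dist by linarith
    qed
    have "exp (2 * (- p * T)) * (exp (A * (p / K)))\<^sup>2 \<le> exp (- 4 * (p / K))"
    proof (rule ex)
     have "2 * (- p * T) = - 2 * (p * T)" by simp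
     then show "2 * (- p * T) + 2 * (A * (p / K)) \<le> - 4 * (p / K)" using pT dist by linarith
    qed
    then show "(exp (- p * T))\<^sup>2 * (exp (A * (p / K)))\<^sup>2 \<le> exp (- 4 * (p / K))" by (simp only: exp_double)
   qed
   have b1: "exp (- 2 * \<kappa> * \<rho>) * Mv\<^sup>2 \<le> (T * C)\<^sup>2 * exp (- 4 * (p / K))"
   proof -
    have "exp (- 2 * \<kappa> * \<rho>) * Mv\<^sup>2 = (T * C)\<^sup>2 * (exp (- 2 * \<kappa> * \<rho>) * (exp (A * (p / K)))\<^sup>2)"
     by (simp only: Mv_def Bp_def power_mult_distrib ac_simps)
    also have "\<dots> \<le> (T * C)\<^sup>2 * exp (- 4 * (p / K))" by (intro mult_left_mono dec) auto
    finally show ?thesis .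
   qed
   have b2: "MR\<^sup>2 / P \<le> (C * T * (exp T + 1 + T))\<^sup>2 * p ^ 6 * exp (- 4 * (p / K))"
   proof -
    have "MR\<^sup>2 / P \<le> MR\<^sup>2 / 1" using P1 by (intro divide_left_mono) auto
    also have "\<dots> = ((C * T)\<^sup>2 * Q\<^sup>2) * ((exp (- p * T))\<^sup>2 * (exp (A * (p / K)))\<^sup>2)"
     by (simp only: MR_def Bp_def power_mult_distrib ac_simps div_by_1)
    also have "\<dots> \<le> ((C * T)\<^sup>2 * (p ^ 3 * (exp T + 1 + T))\<^sup>2) * exp (- 4 * (p / K))"
     by (intro mult_mono mult_left_mono power_mono dec Q) auto
    also have "\<dots> = (C * T * (exp T + 1 + T))\<^sup>2 * p ^ 6 * exp (- 4 * (p / K))"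
     by (simp only: power_mult_distrib power_mult[symmetric] mult_numeral_1 ac_simps) simp
    finally show ?thesis .
   qed
   define H where "H = 144 * \<Lambda> * n\<^sup>2 * (T * C)\<^sup>2 + (C * T * (exp T + 1 + T))\<^sup>2"
   have H: "0 \<le> H" using \<Lambda> by (simp add: H_def)
   have b3: "144 * \<Lambda> * n\<^sup>2 * exp (- 2 * \<kappa> * \<rho>) * Mv\<^sup>2 + MR\<^sup>2 / P \<le> H * p ^ 6 * exp (- 4 * (p / K))"
   proof -
    have "(144 * \<Lambda> * n\<^sup>2) * (exp (- 2 * \<kappa> * \<rho>) * Mv\<^sup>2) \<le> (144 * \<Lambda> * n\<^sup>2) * ((T * C)\<^sup>2 * exp (- 4 * (p / K)))"
     using \<Lambda> by (intro mult_left_mono b1) auto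
    also have "\<dots> \<le> (144 * \<Lambda> * n\<^sup>2) * ((T * C)\<^sup>2 * exp (- 4 * (p / K))) * p ^ 6"
     using p(1) \<Lambda> mult_left_mono[of 1 "p ^ 6" "(144 * \<Lambda> * n\<^sup>2) * ((T * C)\<^sup>2 * exp (- 4 * (p / K)))"] by (simp add: one_le_power)
    finally show ?thesis using b2 by (simp add: H_def algebra_simps)
   qed
   have VN: "V \<le> N * p ^ CARD('n)"
   proof -
    have "V = unit_ball_vol n * (2 * \<rho>) ^ CARD('n)"
     unfolding V_def n_def using content_cball[of "2 * \<rho>" "0 :: real^'n"] \<rho> by simp
    also have "\<dots> \<le> unit_ball_vol n * (2 * p) ^ CARD('n)"
     using \<rho> \<rho>p unit_ball_vol_nonneg[of n] n by (intro mult_left_mono power_mono) auto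
    also have "\<dots> = N * p ^ CARD('n)" by (simp add: N_def power_mult_distrib)
    finally show ?thesis .
   qed
   have I0: "0 \<le> I" unfolding I_def by (rule integral_nonneg) simp
   have V0: "0 \<le> V" by (simp add: V_def)
   have N0: "0 \<le> N" using unit_ball_vol_nonneg[of n] n by (simp add: N_def)
   have "(1 / 4) * (exp (- 2 * \<kappa> * (1 + r)) * I) \<le> (P / 4) * (exp (- 2 * \<kappa> * (1 + r)) * I)"
    using P1 I0 by (intro mult_right_mono) auto
   also note main
   also have "V * (144 * \<Lambda> * n\<^sup>2 * exp (- 2 * \<kappa> * \<rho>) * Mv\<^sup>2 + MR\<^sup>2 / P) \<le> (N * p ^ CARD('n)) * (H * p ^ 6 * exp (- 4 * (p / K)))"
    by (rule order_trans[OF mult_left_mono[OF b3 V0] mult_right_mono[OF VN]]) (use H p(1) in auto)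
   finally have "exp (- 2 * \<kappa> * (1 + r)) * I \<le> 4 * N * H * (p ^ (CARD('n) + 6) * exp (- 4 * (p / K)))"
    by (simp add: power_add algebra_simps)
   then have "exp (2 * \<kappa> * (1 + r)) * (exp (- 2 * \<kappa> * (1 + r)) * I) \<le> exp (2 * \<kappa> * (1 + r)) * (4 * N * H * (p ^ (CARD('n) + 6) * exp (- 4 * (p / K))))"
    by (rule mult_left_mono) simp
   moreover have "exp (2 * \<kappa> * (1 + r)) * (exp (- 2 * \<kappa> * (1 + r)) * I) = I"
   proof -
    have "exp (2 * \<kappa> * (1 + r)) * exp (- 2 * \<kappa> * (1 + r)) = 1" by (simp flip: exp_add)
    then show ?thesis by (simp only: mult.assoc[symmetric] mult_1_left)
   qed
   ultimately have "I \<le> 4 * N * H * (p ^ (CARD('n) + 6) * exp (2 * \<kappa> * (1 + r)) * exp (- 4 * (p / K)))"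
    by (simp only: ac_simps)
   also have "2 * \<kappa> * (1 + r) = b * p powr (\<alpha> / 2)" by (simp add: b_def \<kappa>_def)
   also have "4 * N * H * (p ^ (CARD('n) + 6) * exp (b * p powr (\<alpha> / 2)) * exp (- 4 * (p / K))) \<le> 4 * N * H * (exp ((2 / K) * p) * exp (- 4 * (p / K)))"
    using p2(2)[OF p(2)] N0 H by (intro mult_left_mono mult_right_mono) auto
   also have "exp ((2 / K) * p) * exp (- 4 * (p / K)) = exp (- 2 * (1 / K) * p)" by (simp flip: exp_add)
   finally show "(\<integral>x. indicator (cball 0 r) x *\<^sub>R (vp p x)\<^sup>2) \<le> D * exp (- 2 * (1 / K) * p)"
    by (simp add: I_def D_def H_def)
  qed
 qed
qed

end

section \<open>Uniqueness\<close>

context frac_data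
begin

text \<open>Decay of \<open>vp\<close> in mean square gives decay of the transform of the scalar
  function \<open>f t\<close>, the integral of \<open>U t\<close> against a fixed
  \<open>\<psi>\<close>. With \<open>\<psi> = \<eta> * U t1\<close> the conclusion
  \<open>f t1 = 0\<close> says that the integral of \<open>\<eta> * (U t1)^2\<close>
  vanishes.\<close>

lemma vanish_initially:
 assumes bb: "\<And>k x. \<bar>bb k x\<bar> \<le> B" and cc: "\<And>x. \<bar>cc x\<bar> \<le> B" and \<sigma>: "0 \<le> \<sigma>"
  and gr: "\<And>t x. 0 \<le> t ==> t \<le> T ==> \<bar>U t x\<bar> \<le> C * exp (\<sigma> * norm x powr (2 / (2 - \<alpha>)))"
 obtains t0 where "0 < t0" "t0 \<le> T" "\<And>t x. t \<le> t0 ==> U t x = 0"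
proof -
 obtain t0 where t0: "0 < t0" "2 * t0 \<le> T"
  and dec: "\<And>r. 0 \<le> r ==> \<exists>D p1. 1 \<le> p1 \<and> (\<forall>p\<ge>p1. (\<integral>x. indicator (cball 0 r) x *\<^sub>R (vp p x)\<^sup>2) \<le> D * exp (- 2 * t0 * p))"
  by (rule vp_decay[OF bb cc \<sigma> gr]) blast+
 have "U t1 x1 = 0" if t1: "0 \<le> t1" "t1 \<le> t0" for t1 x1
 proof -
  obtain \<eta> d\<eta> where \<eta>: "C1_test (cball x1 1) \<eta> d\<eta>" "\<And>x. 0 \<le> \<eta> x" "\<And>x. \<eta> x \<le> (1::real)"
   "\<And>x. x \<in> ball x1 (1 / 2) ==> 1 / 4 \<le> \<eta> x" by (rule C1_bump[of 1 x1]) (simp, blast)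
  have \<eta>c: "cts \<eta>" using C1_test_fun[OF \<eta>(1)] by (simp add: C1_fun_def)
  have \<eta>0: "\<eta> x = 0" if "x \<notin> cball x1 1" for x
  proof -
   obtain K where K: "compact K" "K \<subseteq> cball x1 1" "\<And>x. x \<notin> K ==> \<eta> x = 0" "\<And>x k. x \<notin> K ==> d\<eta> k x = 0"
    by (rule C1_testE[OF \<eta>(1)]) blast
   have "x \<notin> K" using K(2) that by blast
   then show "\<eta> x = 0" by (rule K(3))
  qed
  define r where "r = norm x1 + 1"
  define Q where "Q = cball (0 :: real^'n) r"
  have cQ: "compact Q" by (simp add: Q_def)
  define \<psi> where "\<psi> x = \<eta> x * U t1 x" for x
  have \<psi>c: "cts \<psi>" unfolding \<psi>_def[abs_def] by (intro continuous_intros \<eta>c cont_slice_x[OF contU])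
  have \<psi>0: "\<psi> x = 0" if "x \<notin> Q" for x
  proof -
   have "x \<notin> cball x1 1" using that norm_triangle_sub[of x x1] by (auto simp: Q_def r_def dist_norm norm_minus_commute)
   then show ?thesis by (simp add: \<psi>_def \<eta>0)
  qed
  define f where "f t = (\<integral>x. U t x * \<psi> x)" for t
  have fc: "cts f" unfolding f_def
   by (rule continuous_param_integral_compact[OF _ cQ]) (auto intro!: continuous_intros contU cont_snd \<psi>c simp: \<psi>0)
  have f0: "f t = 0" if "t \<le> 0" for t by (simp add: f_def U0[OF that])
  obtain Mf where Mf: "0 < Mf" "\<And>t. t \<in> {0..T} ==> norm (f t) \<le> Mf"
   using compact_image_bound[OF compact_Icc continuous_on_subset[OF fc subset_UNIV]] by blast
  obtain D p1 where D: "1 \<le> p1" "\<And>p. p1 \<le> p ==> (\<integral>x. indicator Q x *\<^sub>R (vp p x)\<^sup>2) \<le> D * exp (- 2 * t0 * p)"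
   using dec[of r] unfolding Q_def r_def by auto
  define \<Psi> where "\<Psi> = (\<integral>x. (\<psi> x)\<^sup>2)"
  have i\<psi>: "lintegrable (\<lambda>x. (\<psi> x)\<^sup>2)"
   by (rule integrable_compact_support[OF _ cQ]) (auto intro!: continuous_intros \<psi>c simp: \<psi>0)
  have bound: "\<bar>\<integral>t. indicator {0..T} t *\<^sub>R (exp (- p * t) * f t)\<bar> \<le> ((\<Psi> + D) / 2 + 2 * Mf * T) * exp (- p * t0)"
   if p1: "p1 \<le> p" for p
  proof -
   have p: "1 \<le> p" using p1 D(1) by simp
   define g where "g t = lw p (min t T) * f t" for t
   define h where "h t = indicator {0..T} t *\<^sub>R ((1 + p * (T - t)) * f t)" for t
   have gi: "lintegrable g" unfolding g_def[abs_def]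
   proof (rule integrable_compact_support[OF _ compact_Icc[of 0 T]])
    show "cts (\<lambda>t. lw p (min t T) * f t)" by (intro continuous_intros fc cont_lw[OF p])
    show "lw p (min t T) * f t = 0" if "t \<notin> {0..T}" for t using that f0[of t] lw_T[OF p] by (auto simp: not_le)
   qed
   have hi: "lintegrable h" unfolding h_def[abs_def]
    by (rule borel_integrable_compact[OF compact_Icc]) (intro continuous_intros continuous_on_subset[OF fc subset_UNIV])
   have "indicator {0..T} t *\<^sub>R (exp (- p * t) * f t) = g t + exp (- p * T) * h t" for t
   proof (cases "t \<in> {0..T}")
    case True then show ?thesis by (simp add: g_def h_def lw_def[OF p] min_def algebra_simps)
   next
    case False then show ?thesis using f0[of t] lw_T[OF p] by (auto simp: g_def h_def not_le)
   qed
   then have e1: "(\<integral>t. indicator {0..T} t *\<^sub>R (exp (- p * t) * f t)) = (\<integral>t. g t) + exp (- p * T) * (\<integral>t. h t)"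
    using gi hi by simp
   have "\<bar>\<integral>t. h t\<bar> \<le> (1 + p * T) * Mf * T"
   proof -
    have "norm (\<integral>t. h t) \<le> (\<integral>t. ((1 + p * T) * Mf) * indicator {0..T} t)"
    proof (rule integral_norm_bound_integral[OF hi integrable_indicator_compact(1)[OF compact_Icc]])
     fix t
     show "norm (h t) \<le> ((1 + p * T) * Mf) * indicator {0..T} t"
     proof (cases "t \<in> {0..T}")
      case True
      then have "0 \<le> p * (T - t)" "p * (T - t) \<le> p * T" using p by auto
      then have "\<bar>1 + p * (T - t)\<bar> * \<bar>f t\<bar> \<le> (1 + p * T) * Mf" using Mf(2)[OF True] by (intro mult_mono) auto
      then show ?thesis using True by (simp add: h_def abs_mult)
     qed (simp add: h_def)
    qed
    then show ?thesis using T by simp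
   qed
   then have "exp (- p * T) * \<bar>\<integral>t. h t\<bar> \<le> exp (- p * T) * ((1 + p * T) * Mf * T)" by (intro mult_left_mono) auto
   also have "\<dots> = (exp (- p * T) * (1 + p * T)) * (Mf * T)" by simp
   also have "\<dots> \<le> (2 * exp (- p * t0)) * (Mf * T)"
   proof (rule mult_right_mono)
    \<comment> \<open>The condition \<open>2 * t0 \<le> T\<close> pays for the factor
      \<open>1 + p * T\<close> of the tangent term, since
      \<open>1 + p * T \<le> 2 * exp (p * T / 2)\<close>.\<close>
    have "1 + p * T / 2 \<le> exp (p * T / 2)" by (rule exp_ge_add_one_self)
    then have "1 + p * T \<le> 2 * exp (p * T / 2)" by linarith
    then have "exp (- p * T) * (1 + p * T) \<le> exp (- p * T) * (2 * exp (p * T / 2))" by (intro mult_left_mono) auto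
    also have "\<dots> = 2 * exp (- (p * T / 2))" by (simp flip: exp_add)
    also have "\<dots> \<le> 2 * exp (- p * t0)" using mult_left_mono[OF t0(2), of p] p by simp
    finally show "exp (- p * T) * (1 + p * T) \<le> 2 * exp (- p * t0)" .
   qed (use Mf T in simp)
   finally have e2: "\<bar>exp (- p * T) * (\<integral>t. h t)\<bar> \<le> 2 * Mf * T * exp (- p * t0)" by (simp add: abs_mult ac_simps)
   have "(\<integral>t. g t) = (\<integral>t. \<integral>x. lw p (min t T) * U t x * \<psi> x)"
    unfolding g_def f_def by (simp only: integral_mult_right_zero[symmetric] mult.assoc)
   also have "\<dots> = (\<integral>x. \<integral>t. lw p (min t T) * U t x * \<psi> x)"
   proof (rule lborel_pair.Fubini_integral[symmetric])
    have "lintegrable (\<lambda>q. lw p (min (fst q) T) * U (fst q) (snd q) * \<psi> (snd q))"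
    proof (rule integrable_compact_support[OF _ compact_Times[OF compact_Icc[of 0 T] cQ]])
     show "cts (\<lambda>q :: real \<times> (real^'n). lw p (min (fst q) T) * U (fst q) (snd q) * \<psi> (snd q))"
      by (intro continuous_intros contU cont_fst[OF cont_lw[OF p]] cont_snd \<psi>c)
     show "lw p (min (fst q) T) * U (fst q) (snd q) * \<psi> (snd q) = 0" if "q \<notin> {0..T} \<times> Q" for q
      using that \<psi>0[of "snd q"] lw_out(1)[OF p, of "fst q" "snd q"] by (cases q) auto
    qed
    then show "integrable (lborel \<Otimes>\<^sub>M lborel) (\<lambda>(t, x). lw p (min t T) * U t x * \<psi> x)" by (simp add: lborel_prod split_def)
   qed
   also have "\<dots> = (\<integral>x. vp p x * \<psi> x)" unfolding vp_def[OF p] by (simp only: integral_mult_left_zero)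
   finally have e3: "(\<integral>t. g t) = (\<integral>x. vp p x * \<psi> x)" .
   have vc: "cts (vp p)" using C1_vp[OF p] by (simp add: C1_fun_def)
   have iv: "lintegrable (\<lambda>x. indicator Q x *\<^sub>R (vp p x)\<^sup>2)"
    by (rule borel_integrable_compact[OF cQ]) (rule continuous_on_subset[OF _ subset_UNIV], intro continuous_intros vc)
   \<comment> \<open>Young's inequality with weight \<open>q\<close> balances the constant
     \<open>\<Psi>\<close> against a square that decays like \<open>exp (- 2 p t0)\<close>; both
     contributions become \<open>exp (- p t0)\<close>.\<close>
   define q where "q = exp (p * t0)"
   have q0: "0 < q" by (simp add: q_def)
   have "norm (\<integral>x. vp p x * \<psi> x) \<le> (\<integral>x. (1 / (2 * q)) * (\<psi> x)\<^sup>2 + (q / 2) * (indicator Q x *\<^sub>R (vp p x)\<^sup>2))"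
   proof (rule integral_norm_bound_integral)
    show "lintegrable (\<lambda>x. vp p x * \<psi> x)"
     by (rule integrable_compact_support[OF _ cQ]) (auto intro!: continuous_intros vc \<psi>c simp: \<psi>0)
    show "lintegrable (\<lambda>x. (1 / (2 * q)) * (\<psi> x)\<^sup>2 + (q / 2) * (indicator Q x *\<^sub>R (vp p x)\<^sup>2))"
     by (intro integrable_add integrable_mult_right i\<psi> iv)
    fix x
    show "norm (vp p x * \<psi> x) \<le> (1 / (2 * q)) * (\<psi> x)\<^sup>2 + (q / 2) * (indicator Q x *\<^sub>R (vp p x)\<^sup>2)"
    proof (cases "x \<in> Q")
     case True
     have "0 \<le> (\<bar>\<psi> x\<bar> - q * \<bar>vp p x\<bar>)\<^sup>2 / (2 * q)" using q0 by simp
     also have "\<dots> = (1 / (2 * q)) * (\<psi> x)\<^sup>2 + (q / 2) * (vp p x)\<^sup>2 - \<bar>vp p x\<bar> * \<bar>\<psi> x\<bar>"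
      using q0 by (simp add: power2_diff power_mult_distrib add_divide_distrib diff_divide_distrib) (simp add: power2_eq_square)
     finally show ?thesis using True by (simp add: abs_mult)
    qed (use q0 in \<open>simp add: \<psi>0\<close>)
   qed
   also have "\<dots> = (1 / (2 * q)) * \<Psi> + (q / 2) * (\<integral>x. indicator Q x *\<^sub>R (vp p x)\<^sup>2)"
    using i\<psi> iv unfolding \<Psi>_def by (subst integral_add) auto
   also have "\<dots> \<le> (1 / (2 * q)) * \<Psi> + (q / 2) * (D * exp (- 2 * t0 * p))"
    using D(2)[OF p1] q0 by (intro add_left_mono mult_left_mono) auto
   also have "\<dots> = (\<Psi> + D) / 2 * exp (- p * t0)"
   proof -
    have "1 / q = exp (- p * t0)" by (simp add: q_def exp_minus divide_inverse)
    moreover have "q * exp (- 2 * t0 * p) = exp (- p * t0)" by (simp add: q_def flip: exp_add)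
    moreover have "(1 / (2 * q)) * \<Psi> = (1 / q) * \<Psi> / 2" "(q / 2) * (D * exp (- 2 * t0 * p)) = (q * exp (- 2 * t0 * p)) * D / 2" by simp_all
    ultimately show ?thesis by (simp only:) (simp add: algebra_simps)
   qed
   finally have "\<bar>\<integral>t. g t\<bar> \<le> (\<Psi> + D) / 2 * exp (- p * t0)" unfolding e3 by simp
   then show ?thesis unfolding e1 using e2 abs_triangle_ineq[of "\<integral>t. g t" "exp (- p * T) * (\<integral>t. h t)"]
    unfolding distrib_right by linarith
  qed
  have "f t1 = 0" by (rule laplace_decay_imp_zero[OF fc t0(1) _ bound t1]) (use t0 in simp)
  moreover have "f t1 = (\<integral>x. \<eta> x * (U t1 x)\<^sup>2)"
   unfolding f_def \<psi>_def by (intro integral_cong refl) (simp add: power2_eq_square)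
  ultimately have z: "(\<integral>x. \<eta> x * (U t1 x)\<^sup>2) = 0" by simp
  have "\<eta> x1 * (U t1 x1)\<^sup>2 = 0"
  proof (rule integral_eq_0_imp_zero[OF _ _ _ z])
   show c: "cts (\<lambda>x. \<eta> x * (U t1 x)\<^sup>2)" by (intro continuous_intros \<eta>c cont_slice_x[OF contU])
   show "lintegrable (\<lambda>x. \<eta> x * (U t1 x)\<^sup>2)" by (rule integrable_compact_support[OF c compact_cball[of x1 1]]) (simp add: \<eta>0)
  qed (use \<eta>(2) in simp)
  then show ?thesis using \<eta>(4)[of x1] by auto
 qed
 then have "U t x = 0" if "t \<le> t0" for t x using that U0[of t x] by (cases "0 \<le> t") auto
 then show thesis using that[OF t0(1)] t0 by simp
qed

text \<open>Convolution over the whole past commutes with translation, and the past before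
  \<open>s\<close> is zero, so the translated functions satisfy the same hypotheses on a shorter
  interval. The vanishing of \<open>V\<close> up to and including \<open>s\<close> follows from that
  of \<open>U\<close> by differentiation and continuity.\<close>

lemma shift_frac_data:
 assumes s: "0 \<le> s" "s < T" and z: "\<And>t x. t \<le> s ==> U t x = 0"
 shows "frac_data a \<Lambda> \<delta>0 (T - s) \<alpha> (\<lambda>t. U (t + s)) (\<lambda>t. V (t + s)) (\<lambda>t. W (t + s)) (\<lambda>k t. UX k (t + s)) bb cc"
proof -
 have cs: "cts (\<lambda>q :: real \<times> (real^'n). F (fst q + s) (snd q))"
  if "cts2 F" for F :: "real => real^'n => real"
 proof -
  have "cts (\<lambda>q :: real \<times> (real^'n). (fst q + s, snd q))" by (intro continuous_intros)
  from continuous_on_compose2[OF that this] show ?thesis by simp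
 qed
 have Vs: "V t x = 0" if "t < s" for t x
 proof -
  have "((\<lambda>t. 0) has_real_derivative V t x) (at t)"
   by (rule has_field_derivative_transform_within_open[OF dU[of t x], where S = "{..<s}"]) (use that s z in auto)
  then show ?thesis using DERIV_const DERIV_unique by blast
 qed
 have Vz: "V t x = 0" if "t \<le> s" for t x
 proof -
  have "closure {..<s} = {..s}" by simp
  then show ?thesis
   using continuous_constant_on_closure[of "{..<s}" "\<lambda>t. V t x" 0 t] continuous_on_subset[OF cont_slice_t[OF contV] subset_UNIV, of "closure {..<s}"] Vs that
   by auto
 qed
 show ?thesis
 proof (unfold_locales)
  fix t x k \<phi> d\<phi>
  show "t \<le> 0 ==> V (t + s) x = 0" using Vz by simp
  show "t \<le> 0 ==> U (t + s) x = 0" using z by simp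
  show "((\<lambda>t. U (t + s) x) has_real_derivative V (t + s) x) (at t)" if "t < T - s"
   using dU[of "t + s" x] that by (simp add: DERIV_shift)
  show "(fconv \<alpha> (\<lambda>t. V (t + s) x) has_real_derivative W (t + s) x) (at t)" if "0 < t" "t < T - s"
  proof -
   have "fconv \<alpha> (\<lambda>t. V (t + s) x) = (\<lambda>t. fconv \<alpha> (\<lambda>t. V t x) (t + s))"
    unfolding fconv_def by (simp add: algebra_simps)
   then show ?thesis using dJ[of "t + s" x] that s by (simp add: DERIV_shift)
  qed
  have "continuous_on {0<..<T - s} (\<lambda>t. t + s)" by (intro continuous_intros)
  moreover have "(\<lambda>t. t + s) ` {0<..<T - s} \<subseteq> {0<..<T}" using s by auto
  ultimately show "continuous_on {0<..<T - s} (\<lambda>t. W (t + s) x)" by (rule continuous_on_compose2[OF W_t[of x]])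
  show "0 < t ==> t < T - s ==> cts (W (t + s))" using W_x[of "t + s"] s by simp
  show "(\<integral>x. W (t + s) x * \<phi> x + aform x (\<lambda>k. UX k (t + s) x) (\<lambda>k. d\<phi> k x)
   - ((\<Sum>k\<in>UNIV. bb k x * UX k (t + s) x) + cc x * U (t + s) x) * \<phi> x) = 0"
   if "0 < t" "t < T - s" "C1_test UNIV \<phi> d\<phi>" using slice[of "t + s" \<phi> d\<phi>] that s by simp
 qed (use s \<alpha> cs[OF contU] cs[OF contV] cs[OF contUX] pU cont_bb cont_cc in simp_all)
qed

text \<open>The length gained by \<open>vanish_initially\<close> depends on the remaining time, so
  instead of counting steps the largest interval of vanishing is taken: it is closed by continuity
  and could be extended if it ended before \<open>T\<close>.\<close>

lemma unique:
 assumes bb: "\<And>k x. \<bar>bb k x\<bar> \<le> B" and cc: "\<And>x. \<bar>cc x\<bar> \<le> B" and \<sigma>: "0 \<le> \<sigma>"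
  and gr: "\<And>t x. 0 \<le> t ==> t \<le> T ==> \<bar>U t x\<bar> \<le> C * exp (\<sigma> * norm x powr (2 / (2 - \<alpha>)))"
  and t: "t \<le> T"
 shows "U t x = 0"
proof -
 define S where "S = {s. 0 \<le> s \<and> s \<le> T \<and> (\<forall>t x. t \<le> s \<longrightarrow> U t x = 0)}"
 have S0: "0 \<in> S" using T U0 by (auto simp: S_def)
 have Sb: "bdd_above S" by (rule bdd_aboveI[of _ T]) (simp add: S_def)
 define s where "s = Sup S"
 have s: "0 \<le> s" "s \<le> T"
 proof -
  show "0 \<le> s" unfolding s_def by (rule cSup_upper[OF S0 Sb])
  show "s \<le> T" unfolding s_def by (rule cSup_least) (use S0 in \<open>auto simp: S_def\<close>)
 qed
 have lt: "U t x = 0" if "t < s" for t x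
 proof -
  have "\<exists>r\<in>S. t < r" using less_cSupD[of S t] S0 that unfolding s_def by auto
  then obtain r where "r \<in> S" "t < r" by blast
  from \<open>r \<in> S\<close> have "\<forall>t x. t \<le> r \<longrightarrow> U t x = 0" by (simp add: S_def)
  then show ?thesis using \<open>t < r\<close> by simp
 qed
 have le: "U t x = 0" if "t \<le> s" for t x
 proof -
  have "closure {..<s} = {..s}" by simp
  then show ?thesis
   using continuous_constant_on_closure[of "{..<s}" "\<lambda>t. U t x" 0 t] continuous_on_subset[OF cont_slice_t[OF contU] subset_UNIV, of "closure {..<s}"] lt that
   by auto
 qed
 have "s = T"
 proof (rule ccontr)
  assume "s \<noteq> T"
  then have sT: "s < T" using s by simp
  interpret sh: frac_data a \<Lambda> \<delta>0 "T - s" \<alpha> "\<lambda>t. U (t + s)" "\<lambda>t. V (t + s)" "\<lambda>t. W (t + s)" "\<lambda>k t. UX k (t + s)" bb cc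
   by (rule shift_frac_data[OF s(1) sT le])
  have gr': "\<bar>U (t + s) x\<bar> \<le> C * exp (\<sigma> * norm x powr (2 / (2 - \<alpha>)))" if "0 \<le> t" "t \<le> T - s" for t x
   by (rule gr) (use that s in auto)
  obtain t0 where t0: "0 < t0" "t0 \<le> T - s" and z: "\<And>t x. t \<le> t0 ==> U (t + s) x = 0"
   by (rule sh.vanish_initially[OF bb cc \<sigma> gr']) blast+
  have "U t x = 0" if "t \<le> s + t0" for t x using z[of "t - s" x] that by simp
  then have "s + t0 \<in> S" using t0 s by (simp add: S_def)
  then have "s + t0 \<le> s" unfolding s_def by (rule cSup_upper[OF _ Sb])
  then show False using t0 by simp
 qed
 then show ?thesis using le t by simp
qed

end

section \<open>From a classical solution to the abstract data\<close>

lemma unif_holder_continuous: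
 fixes f :: "real^'n::finite => real"
 assumes "unif_holder \<gamma> f" "0 < \<gamma>"
 shows "cts f"
proof -
 obtain C where C: "\<And>x y. \<bar>f x - f y\<bar> \<le> C * dist x y powr \<gamma>" using assms(1) by (auto simp: unif_holder_def)
 show ?thesis
 proof (rule continuous_at_imp_continuous_on, rule ballI)
  fix x :: "real^'n"
  have "((\<lambda>y. dist y x) \<longlongrightarrow> dist x x) (at x)" by (intro tendsto_intros)
  then have d: "((\<lambda>y. dist y x) \<longlongrightarrow> 0) (at x)" by simp
  have "((\<lambda>y. dist y x powr \<gamma>) \<longlongrightarrow> 0 powr \<gamma>) (at x)"
   by (rule tendsto_powr'[OF d tendsto_const]) (use assms(2) in auto)
  then have "((\<lambda>y. C * dist y x powr \<gamma>) \<longlongrightarrow> C * 0 powr \<gamma>) (at x)" by (rule tendsto_mult_left)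
  then have "((\<lambda>y. C * dist y x powr \<gamma>) \<longlongrightarrow> 0) (at x)" by simp
  then have "((\<lambda>y. f y - f x) \<longlongrightarrow> 0) (at x)" by (rule Lim_null_comparison[rotated]) (use C in auto)
  then show "isCont f x" by (simp add: isCont_def LIM_zero_iff)
 qed
qed

lemma bdd_fun_uniform:
 fixes f :: "'i::finite => real^'n::finite => real"
 assumes "\<And>i. bdd_fun (f i)"
 obtains M where "0 \<le> M" "\<And>i x. \<bar>f i x\<bar> \<le> M"
proof -
 obtain m where m: "\<And>i x. \<bar>f i x\<bar> \<le> m i" using assms unfolding bdd_fun_def by metis
 show thesis
 proof (rule that[of "\<Sum>i\<in>UNIV. \<bar>m i\<bar>"])
  show "\<bar>f i x\<bar> \<le> (\<Sum>i\<in>UNIV. \<bar>m i\<bar>)" for i x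
   using m[where i = i and x = x] member_le_sum[of i UNIV "\<lambda>i. \<bar>m i\<bar>"] by simp
 qed (simp add: sum_nonneg)
qed

text \<open>Outside a large ball the limit condition with bound 1 suffices; inside, \<open>u\<close>
  is bounded on a compact set and the exponential is at least 1.\<close>

lemma exponential_growth_bound:
 fixes u :: "real => real^'n::finite => real"
 assumes c: "continuous_on ({0..T} \<times> UNIV) (\<lambda>p. u (fst p) (snd p))" and \<sigma>: "0 \<le> \<sigma>"
  and lim: "\<forall>\<epsilon>>0. \<exists>R. \<forall>t\<in>{0..T}. \<forall>x. norm x > R \<longrightarrow> \<bar>u t x * exp (- \<sigma> * norm x powr \<beta>)\<bar> < \<epsilon>"
 obtains C where "\<And>t x. t \<in> {0..T} ==> \<bar>u t x\<bar> \<le> C * exp (\<sigma> * norm x powr \<beta>)"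
proof -
 from lim[rule_format, OF zero_less_one]
 obtain R where R: "\<forall>t\<in>{0..T}. \<forall>x. norm x > R \<longrightarrow> \<bar>u t x * exp (- \<sigma> * norm x powr \<beta>)\<bar> < 1" by blast
 obtain B where B: "0 < B" "\<And>p. p \<in> {0..T} \<times> cball 0 R ==> norm (u (fst p) (snd p)) \<le> B"
  by (rule compact_image_bound[OF compact_Times[OF compact_Icc compact_cball[of "0 :: real^'n" R]] continuous_on_subset[OF c]]) auto
 show thesis
 proof (rule that)
  fix t and x :: "real^'n" assume t: "t \<in> {0..T}"
  define e where "e = exp (\<sigma> * norm x powr \<beta>)"
  have e: "1 \<le> e" using \<sigma> by (simp add: e_def)
  show "\<bar>u t x\<bar> \<le> (B + 1) * exp (\<sigma> * norm x powr \<beta>)"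
  proof (cases "norm x \<le> R")
   case True
   then have "\<bar>u t x\<bar> \<le> B * 1" using B(2)[of "(t, x)"] t by simp
   also have "\<dots> \<le> (B + 1) * e" using B(1) e by (intro mult_mono) auto
   finally show ?thesis by (simp add: e_def)
  next
   case False
   have "exp (- \<sigma> * norm x powr \<beta>) = 1 / e" by (simp add: e_def exp_minus divide_inverse)
   then have "\<bar>u t x\<bar> / e < 1" using R[rule_format, OF t, of x] False e by (simp add: abs_mult)
   then have "\<bar>u t x\<bar> \<le> 1 * e" using e by (simp add: divide_less_eq)
   also have "\<dots> \<le> (B + 1) * e" using B(1) e by (intro mult_right_mono) auto
   finally show ?thesis by (simp add: e_def)
  qed
 qed
qed

text \<open>Links the Lebesgue convolution to the Henstock-Kurzweil integral in the definition of a
  classical solution.\<close>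

lemma fconv_eq_integral:
 fixes f :: "real => real"
 assumes \<alpha>: "1 < \<alpha>" "\<alpha> < 2" and f: "cts f" "\<And>t. t \<le> 0 ==> f t = 0"
 shows "fconv \<alpha> f s = integral {0..s} (\<lambda>r. (s - r) powr (1 - \<alpha>) * f r) / Gamma (2 - \<alpha>)"
proof -
 define G where "G = Gamma (2 - \<alpha>)"
 have G: "G \<noteq> 0" unfolding G_def using Gamma_pos[OF \<alpha>] by simp
 have eq: "frac_ker \<alpha> (s - r) *\<^sub>R f r = (1 / G) * (indicator {0..s} r *\<^sub>R ((s - r) powr (1 - \<alpha>) * f r))" for r
  using f(2)[of r] by (auto simp: frac_ker_def G_def indicator_def)
 have "lintegrable (\<lambda>r. frac_ker \<alpha> (s - r) *\<^sub>R f r)"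
  using lborel_integrable_real_affine[OF fconv_integrable[OF \<alpha> f, of s], of "-1" s] by simp
 from integrable_mult_right[OF this, of G]
 have "set_integrable lborel {0..s} (\<lambda>r. (s - r) powr (1 - \<alpha>) * f r)"
  unfolding eq set_integrable_def using G by simp
 from set_borel_integral_eq_integral(2)[OF this]
 show ?thesis unfolding fconv_reflect[OF \<alpha>] eq by (simp add: set_lebesgue_integral_def G_def)
qed

theorem theorem4:
 fixes \<alpha> T \<gamma> \<sigma> :: real
  and a :: "'n::finite \<Rightarrow> 'n \<Rightarrow> real^'n \<Rightarrow> real"
  and b :: "'n \<Rightarrow> real^'n \<Rightarrow> real"
  and c :: "real^'n \<Rightarrow> real"
  and u :: "real \<Rightarrow> real^'n \<Rightarrow> real"
 assumes "1 < \<alpha>" and "\<alpha> < 2" and "T > 0"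
  and "standing_assms \<alpha> \<gamma> a b c"
  and "condition_D a b"
  and "classical_solution \<alpha> T a b c u"
  and "\<sigma> > 0"
  and "\<forall>\<epsilon>>0. \<exists>R. \<forall>t\<in>{0..T}. \<forall>x. norm x > R \<longrightarrow>
      \<bar>u t x * exp (- \<sigma> * norm x powr (2 / (2 - \<alpha>)))\<bar> < \<epsilon>"
 shows "\<forall>t\<in>{0..T}. \<forall>x. u t x = 0"
proof -
 note \<alpha> = assms(1,2) and T = assms(3)
 \<comment> \<open>As \<open>\<alpha> > 1\<close>, the number \<open>2 - 2 / \<alpha>\<close> is
   positive; hence so is the Hoelder exponent, and the coefficients are continuous.\<close>
 have "2 / \<alpha> < 2" using \<alpha> by (simp add: divide_less_eq)
 then have \<gamma>: "0 < \<gamma>" using assms(4) by (simp add: standing_assms_def)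
 have sym: "a i j x = a j i x" for i j x using assms(4) by (simp add: standing_assms_def)
 have abdd: "bdd_fun (a i j)" and ah: "unif_holder \<gamma> (a i j)" for i j using assms(4) by (simp_all add: standing_assms_def)
 have bbdd: "bdd_fun (b j)" and bh: "unif_holder \<gamma> (b j)" for j using assms(4) by (simp_all add: standing_assms_def)
 have cbdd: "bdd_fun c" and ch: "unif_holder \<gamma> c" using assms(4) by (simp_all add: standing_assms_def)
 have ac: "cts (a i j)" and bc: "cts (b j)" and cc: "cts c" for i j
  by (rule unif_holder_continuous[OF ah \<gamma>], rule unif_holder_continuous[OF bh \<gamma>], rule unif_holder_continuous[OF ch \<gamma>])
 obtain \<delta>0 where \<delta>0: "0 < \<delta>0" "\<And>x \<zeta>. (\<Sum>i\<in>UNIV. \<Sum>j\<in>UNIV. a i j x * \<zeta>$i * \<zeta>$j) \<ge> \<delta>0 * (norm \<zeta>)\<^sup>2"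
  using assms(4) by (auto simp: standing_assms_def)
 obtain da where da: "\<And>i j k. has_partial (a i j) k (da i j k)" "\<And>i j k. bdd_holder (da i j k)"
  using assms(5) unfolding condition_D_def by blast
 have dac: "cts (da i j k)" and dab: "bdd_fun (da i j k)" for i j k
  using da(2)[of i j k] unif_holder_continuous by (auto simp: bdd_holder_def)
 obtain \<Lambda> where \<Lambda>: "\<And>i j x. \<bar>a i j x\<bar> \<le> \<Lambda>"
 proof (rule bdd_fun_uniform[of "\<lambda>(i, j). a i j"])
  show "bdd_fun (case q of (i, j) => a i j)" for q by (cases q) (simp add: abdd)
  fix M assume M: "\<And>q x. \<bar>(case q of (i, j) => a i j) x\<bar> \<le> M"
  assume th: "\<And>\<Lambda>. (\<And>i j x. \<bar>a i j x\<bar> \<le> \<Lambda>) ==> thesis"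
  show thesis
  proof (rule th)
   show "\<bar>a i j x\<bar> \<le> M" for i j x using M[of "(i, j)" x] by simp
  qed
 qed
 \<comment> \<open>In divergence form the principal part is the sum of
   \<open>D_l (a_kl D_k u)\<close>; the product rule leaves the sum over \<open>l\<close> of
   \<open>- D_l a_kl\<close> in the drift.\<close>
 define bb where "bb k x = b k x - (\<Sum>l\<in>UNIV. da k l l x)" for k x
 have bbc: "cts (bb k)" for k unfolding bb_def by (intro continuous_intros bc dac)
 obtain B where B: "\<And>k x. \<bar>bb k x\<bar> \<le> B" "\<And>x. \<bar>c x\<bar> \<le> B"
 proof -
  obtain M1 where M1: "0 \<le> M1" "\<And>k x. \<bar>b k x\<bar> \<le> M1" by (rule bdd_fun_uniform[of b, OF bbdd]) blast
  obtain M2 where M2: "0 \<le> M2" "\<And>q x. \<bar>(\<lambda>(k, l). da k l l) q x\<bar> \<le> M2"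
   by (rule bdd_fun_uniform[of "\<lambda>(k, l). da k l l"]) (auto simp: dab)
  obtain M3 where M3: "\<And>x. \<bar>c x\<bar> \<le> M3" using cbdd by (auto simp: bdd_fun_def)
  have M30: "0 \<le> M3" using M3[of 0] by linarith
  show thesis
  proof (rule that[of "M1 + real CARD('n) * M2 + M3"])
   fix k x
   have "\<bar>\<Sum>l\<in>UNIV. da k l l x\<bar> \<le> (\<Sum>l\<in>UNIV. \<bar>da k l l x\<bar>)" by (rule sum_abs)
   also have "\<dots> \<le> (\<Sum>l\<in>(UNIV :: 'n set). M2)" by (intro sum_mono) (use M2(2)[of "(k, _)" x] in simp)
   finally have "\<bar>\<Sum>l\<in>UNIV. da k l l x\<bar> \<le> real CARD('n) * M2" by simp
   then show "\<bar>bb k x\<bar> \<le> M1 + real CARD('n) * M2 + M3" using M1(2)[of k x] M30 unfolding bb_def by linarith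
   show "\<bar>c x\<bar> \<le> M1 + real CARD('n) * M2 + M3" using M3[of x] M1(1) M2(1) by (simp add: add_increasing)
  qed
 qed
 obtain ut ux uxx It where
  ud: "\<forall>t\<in>{0..T}. \<forall>x. ((\<lambda>p. u (fst p) (snd p)) has_derivative
   (\<lambda>h. fst h * ut t x + (\<Sum>k\<in>UNIV. snd h $ k * ux k t x))) (at (t, x) within {0..T} \<times> UNIV)"
  and utc: "continuous_on ({0..T} \<times> UNIV) (\<lambda>p. ut (fst p) (snd p))"
  and uxc: "\<forall>k. continuous_on ({0..T} \<times> UNIV) (\<lambda>p. ux k (fst p) (snd p))"
  and uxx: "\<forall>t\<in>{0<..T}. \<forall>k l. has_partial (ux k t) l (uxx k l t) \<and> cts (uxx k l t)"
  and It: "\<forall>x. \<forall>t\<in>{0<..T}. ((\<lambda>s. integral {0..s} (\<lambda>\<tau>. (s - \<tau>) powr (1 - \<alpha>) * ut \<tau> x) / Gamma (2 - \<alpha>))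
      has_real_derivative It t x) (at t within {0..T})"
  and Itc: "\<forall>x. continuous_on {0<..T} (\<lambda>t. It t x)"
  and pde: "\<forall>t\<in>{0<..T}. \<forall>x. (It t x - t powr (1 - \<alpha>) * ut 0 x / Gamma (2 - \<alpha>))
      - opB a b c (u t x) (\<lambda>k. ux k t x) (\<lambda>k l. uxx k l t x) x = 0"
  and u0: "\<forall>x. u 0 x = 0" and ut0: "\<forall>x. ut 0 x = 0"
  using assms(6) unfolding classical_solution_def by (elim exE conjE) (rule that; assumption)
 note ud = ud[rule_format] and uxc = uxc[rule_format] and It = It[rule_format] and Itc = Itc[rule_format]
  and pde = pde[rule_format] and u0 = u0[rule_format] and ut0 = ut0[rule_format]
  and uxx = uxx[rule_format, THEN conjunct1] uxx[rule_format, THEN conjunct2]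
 \<comment> \<open>Freezing time outside \<open>[0, T]\<close> gives functions on the whole line. By
   the initial conditions the values for negative times are 0, as the convolution requires.\<close>
 define \<tau> where "\<tau> t = max 0 (min T t)" for t
 have \<tau>: "\<tau> t \<in> {0..T}" for t using T by (auto simp: \<tau>_def)
 have \<tau>0: "\<tau> t = 0" if "t \<le> 0" for t using that T by (simp add: \<tau>_def)
 have \<tau>id: "\<tau> t = t" if "0 \<le> t" "t \<le> T" for t using that by (simp add: \<tau>_def)
 have clamp: "cts (\<lambda>p :: real \<times> (real^'n). F (\<tau> (fst p)) (snd p))"
  if "continuous_on ({0..T} \<times> UNIV) (\<lambda>p. F (fst p) (snd p))" for F :: "real => real^'n => real"
 proof -
  have "cts (\<lambda>p :: real \<times> (real^'n). (\<tau> (fst p), snd p))" unfolding \<tau>_def by (intro continuous_intros)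
  moreover have "range (\<lambda>p :: real \<times> (real^'n). (\<tau> (fst p), snd p)) \<subseteq> {0..T} \<times> UNIV"
   using \<tau> by (auto simp del: atLeastAtMost_iff)
  ultimately have "cts (\<lambda>p :: real \<times> (real^'n). F (fst (\<tau> (fst p), snd p)) (snd (\<tau> (fst p), snd p)))"
   by (rule continuous_on_compose2[OF that])
  then show ?thesis by simp
 qed
 have uc: "continuous_on ({0..T} \<times> UNIV) (\<lambda>p. u (fst p) (snd p))"
  unfolding continuous_on_eq_continuous_within
 proof
  fix p :: "real \<times> (real^'n)" assume "p \<in> {0..T} \<times> UNIV"
  then obtain t x where p: "p = (t, x)" "t \<in> {0..T}" by blast
  show "continuous (at p within {0..T} \<times> UNIV) (\<lambda>p. u (fst p) (snd p))"
   unfolding p(1) by (rule has_derivative_continuous[OF ud[OF p(2)]])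
 qed
 have u_t: "((\<lambda>s. u s x) has_real_derivative ut t x) (at t within {0..T})" if t: "t \<in> {0..T}" for t x
 proof -
  have g: "((\<lambda>s. (s, x)) has_derivative (\<lambda>h. (h, 0))) (at t within {0..T})"
   by (intro derivative_eq_intros has_derivative_Pair has_derivative_ident has_derivative_const)
  have "((\<lambda>s. u (fst (s, x)) (snd (s, x))) has_derivative (\<lambda>h. fst (h, 0 :: real^'n) * ut t x + (\<Sum>k\<in>UNIV. snd (h, 0 :: real^'n) $ k * ux k t x))) (at t within {0..T})"
   by (rule has_derivative_in_compose[OF g has_derivative_subset[OF ud[OF t]]]) auto
  then show ?thesis by (simp add: has_field_derivative_def mult.commute[of _ "ut t x"])
 qed
 have u_x: "pderiv_on (u t) k (ux k t)" if t: "t \<in> {0..T}" for t k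
  unfolding pderiv_on_def
 proof
  fix x :: "real^'n"
  have g: "((\<lambda>s. (t, x + s *\<^sub>R axis k 1)) has_derivative (\<lambda>h. (0, h *\<^sub>R axis k 1))) (at 0)"
   by (auto intro!: derivative_eq_intros)
  have u': "((\<lambda>p. u (fst p) (snd p)) has_derivative (\<lambda>h. fst h * ut t x + (\<Sum>j\<in>UNIV. snd h $ j * ux j t x)))
   (at (t, x + 0 *\<^sub>R axis k 1) within range (\<lambda>s. (t, x + s *\<^sub>R axis k 1)))"
  proof -
   have "range (\<lambda>s. (t, x + s *\<^sub>R axis k 1)) \<subseteq> {0..T} \<times> UNIV" using t by auto
   from has_derivative_subset[OF ud[OF t, of x] this] show ?thesis by simp
  qed
  have "((\<lambda>s. u t (x + s *\<^sub>R axis k 1)) has_derivative (\<lambda>h. \<Sum>j\<in>UNIV. (h *\<^sub>R axis k 1 :: real^'n) $ j * ux j t x)) (at 0)"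
   using has_derivative_in_compose[OF g u'] by simp
  moreover have "(\<Sum>j\<in>UNIV. (h *\<^sub>R axis k 1 :: real^'n) $ j * ux j t x) = h *\<^sub>R ux k t x" for h
  proof -
   have "(\<Sum>j\<in>UNIV. (h *\<^sub>R axis k 1 :: real^'n) $ j * ux j t x) = (\<Sum>j\<in>UNIV. if j = k then h * ux k t x else 0)"
    by (intro sum.cong refl) (auto simp: axis_def)
   then show ?thesis by simp
  qed
  ultimately show "((\<lambda>s. u t (x + s *\<^sub>R axis k 1)) has_vector_derivative ux k t x) (at 0)"
   by (simp add: has_vector_derivative_def)
 qed
 have cx: "cts (F t)" if "continuous_on ({0..T} \<times> UNIV) (\<lambda>p. F (fst p) (snd p))" "t \<in> {0..T}"
  for F :: "real => real^'n => real" and t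
 proof -
  have "cts (\<lambda>x :: real^'n. (t, x))" by (intro continuous_intros)
  moreover have "range (\<lambda>x :: real^'n. (t, x)) \<subseteq> {0..T} \<times> UNIV" using that(2) by auto
  ultimately have "cts (\<lambda>x. F (fst (t, x)) (snd (t, x)))" by (rule continuous_on_compose2[OF that(1)])
  then show ?thesis by simp
 qed
 have It_eq: "It t x = (\<Sum>k\<in>UNIV. \<Sum>l\<in>UNIV. a k l x * uxx k l t x) + (\<Sum>k\<in>UNIV. b k x * ux k t x) + c x * u t x"
  if "t \<in> {0<..T}" for t x using pde[OF that, of x] by (simp add: ut0 opB_def)
 define U where "U t x = u (\<tau> t) x" for t x
 define V where "V t x = ut (\<tau> t) x" for t x
 define UX where "UX k t x = ux k (\<tau> t) x" for k t x
 have contV: "cts2 V" unfolding V_def by (rule clamp[OF utc])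
 have V0: "V t x = 0" if "t \<le> 0" for t x using that by (simp add: V_def \<tau>0 ut0)
 have U0: "U t x = 0" if "t \<le> 0" for t x using that by (simp add: U_def \<tau>0 u0)
 interpret elliptic_form a \<Lambda> \<delta>0 by unfold_locales (use sym ac \<Lambda> \<delta>0 in auto)
 interpret frac_data a \<Lambda> \<delta>0 T \<alpha> U V It UX bb c
 proof
  fix t x k \<phi> d\<phi>
  show "cts2 U" unfolding U_def by (rule clamp[OF uc])
  show "cts2 (UX k)" unfolding UX_def by (rule clamp[OF uxc])
  show "pderiv_on (U t) k (UX k t)" unfolding U_def[abs_def] UX_def[abs_def] by (rule u_x[OF \<tau>])
  show "((\<lambda>t. U t x) has_real_derivative V t x) (at t)" if t: "t < T"
  proof -
   \<comment> \<open>At \<open>t = 0\<close> the one-sided derivatives agree because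
     \<open>ut\<close> vanishes initially, so the extension is differentiable there.\<close>
   have l: "((\<lambda>t. U t x) has_real_derivative 0) (at t within {..0})" if "t \<le> 0"
    by (rule has_field_derivative_transform_within[OF DERIV_const[of 0], where d = 1]) (use that U0 in auto)
   have r: "((\<lambda>t. U t x) has_real_derivative V t x) (at t within {0..T})" if "0 \<le> t"
    unfolding V_def \<tau>id[OF that less_imp_le[OF t]]
    by (rule has_field_derivative_transform_within[OF u_t[of t x], where d = 1]) (use that t \<tau>id in \<open>auto simp: U_def\<close>)
   consider "t < 0" | "t = 0" | "0 < t" by linarith
   then show ?thesis
   proof cases
    case 1
    then have "at t within {..0} = at t" by (intro at_within_interior) simp
    then show ?thesis using l 1 V0[of t x] by simp
   next
    case 2
    have "at (0::real) within {0..T} = at 0 within {0..}" using T by (simp add: at_within_Icc_at_right at_within_Ici_at_right)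
    then show ?thesis using DERIV_glue[of "\<lambda>t. U t x" 0 0] l r 2 V0[of 0 x] by simp
   next
    case 3 then show ?thesis using r t at_within_Icc_at[of 0 t T] by simp
   qed
  qed
  show "(fconv \<alpha> (\<lambda>t. V t x) has_real_derivative It t x) (at t)" if t: "0 < t" "t < T"
  proof -
   have cV: "cts (\<lambda>t. V t x)"
   proof -
    have "cts (\<lambda>t. (t, x))" by (intro continuous_intros)
    from continuous_on_compose2[OF contV this] show ?thesis by simp
   qed
   have "((\<lambda>s. integral {0..s} (\<lambda>\<tau>. (s - \<tau>) powr (1 - \<alpha>) * ut \<tau> x) / Gamma (2 - \<alpha>)) has_real_derivative It t x) (at t)"
    using It[of t x] t at_within_Icc_at[of 0 t T] by simp
   then show ?thesis
   proof (rule has_field_derivative_transform_within_open[where S = "{0<..<T}"])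
    fix s assume s: "s \<in> {0<..<T}"
    have "integral {0..s} (\<lambda>\<tau>. (s - \<tau>) powr (1 - \<alpha>) * ut \<tau> x) = integral {0..s} (\<lambda>r. (s - r) powr (1 - \<alpha>) * V r x)"
     by (rule Henstock_Kurzweil_Integration.integral_cong) (use s \<tau>id in \<open>auto simp: V_def\<close>)
    then show "integral {0..s} (\<lambda>\<tau>. (s - \<tau>) powr (1 - \<alpha>) * ut \<tau> x) / Gamma (2 - \<alpha>) = fconv \<alpha> (\<lambda>t. V t x) s"
     using fconv_eq_integral[of \<alpha> "\<lambda>t. V t x" s, OF \<alpha> cV V0] by simp
   qed (use t in auto)
  qed
  show "continuous_on {0<..<T} (\<lambda>t. It t x)" by (rule continuous_on_subset[OF Itc]) auto
  show "cts (It t)" if t: "0 < t" "t < T"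
  proof -
   have t': "t \<in> {0<..T}" "t \<in> {0..T}" using t by auto
   have "It t = (\<lambda>x. (\<Sum>k\<in>UNIV. \<Sum>l\<in>UNIV. a k l x * uxx k l t x) + (\<Sum>k\<in>UNIV. b k x * ux k t x) + c x * u t x)"
    using It_eq[OF t'(1)] by (rule ext)
   then show ?thesis
    by (simp only:) (intro continuous_intros ac bc cc uxx(2)[OF t'(1)] cx[OF uxc t'(2)] cx[OF uc t'(2)])
  qed
  show "(\<integral>x. It t x * \<phi> x + aform x (\<lambda>k. UX k t x) (\<lambda>k. d\<phi> k x)
     - ((\<Sum>k\<in>UNIV. bb k x * UX k t x) + c x * U t x) * \<phi> x) = 0"
   if t: "0 < t" "t < T" and \<phi>: "C1_test UNIV \<phi> d\<phi>"
  proof -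
   have t': "t \<in> {0<..T}" "t \<in> {0..T}" "\<tau> t = t" using t \<tau>id by auto
   obtain K where K: "compact K" "K \<subseteq> UNIV" "\<And>x. x \<notin> K ==> \<phi> x = 0" "\<And>x k. x \<notin> K ==> d\<phi> k x = 0"
    by (rule C1_testE[OF \<phi>]) blast
   have \<phi>c: "cts \<phi>" "cts (d\<phi> k)" "pderiv_on \<phi> k (d\<phi> k)" for k
    using C1_test_fun[OF \<phi>] by (auto simp: C1_fun_def)
   \<comment> \<open>\<open>g k l\<close> is the \<open>l\<close>-th partial derivative of
     \<open>a k l * ux k t * \<phi>\<close>; its integral vanishes, and the sum over
     \<open>k\<close> and \<open>l\<close> is exactly the weak integrand after the equation is
     inserted.\<close>
   define g where "g k l x = (a k l x * ux k t x) * d\<phi> l x + (a k l x * uxx k l t x + da k l l x * ux k t x) * \<phi> x" for k l x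
   have gc: "cts (g k l)" for k l unfolding g_def[abs_def]
    by (intro continuous_intros ac dac uxx(2)[OF t'(1)] cx[OF uxc t'(2)] \<phi>c)
   have g0: "(\<integral>x. g k l x) = 0" for k l
   proof (rule integral_pderiv_eq_0[where f = "\<lambda>x. (a k l x * ux k t x) * \<phi> x", OF _ _ gc K(1)])
    show "pderiv_on (\<lambda>x. (a k l x * ux k t x) * \<phi> x) l (g k l)"
     unfolding g_def[abs_def]
     by (intro pderiv_mult \<phi>c(3)) (use da(1) uxx(1)[OF t'(1)] in \<open>auto simp: has_partial_iff\<close>)
    show "cts (\<lambda>x. (a k l x * ux k t x) * \<phi> x)"
     by (intro continuous_intros ac cx[OF uxc t'(2)] \<phi>c)
   qed (simp_all add: g_def K)
   have gi: "lintegrable (g k l)" for k l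
    by (rule integrable_compact_support[OF gc K(1)]) (simp add: g_def K)
   have "It t x * \<phi> x + aform x (\<lambda>k. UX k t x) (\<lambda>k. d\<phi> k x)
     - ((\<Sum>k\<in>UNIV. bb k x * UX k t x) + c x * U t x) * \<phi> x = (\<Sum>k\<in>UNIV. \<Sum>l\<in>UNIV. g k l x)" for x
   proof -
    have "(\<Sum>k\<in>UNIV. \<Sum>l\<in>UNIV. g k l x) = (\<Sum>k\<in>UNIV. \<Sum>l\<in>UNIV. a k l x * uxx k l t x) * \<phi> x
     + (\<Sum>k\<in>UNIV. \<Sum>l\<in>UNIV. a k l x * (ux k t x * d\<phi> l x)) + (\<Sum>k\<in>UNIV. (\<Sum>l\<in>UNIV. da k l l x) * ux k t x) * \<phi> x"
     by (simp add: g_def distrib_right sum.distrib sum_distrib_right mult.assoc)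
    moreover have "(\<Sum>k\<in>UNIV. b k x * ux k t x) = (\<Sum>k\<in>UNIV. bb k x * ux k t x) + (\<Sum>k\<in>UNIV. (\<Sum>l\<in>UNIV. da k l l x) * ux k t x)"
     by (simp add: bb_def left_diff_distrib sum_subtractf)
    ultimately show ?thesis
     unfolding It_eq[OF t'(1)] UX_def U_def t'(3) aform_def inner_real_def by (simp only: distrib_right)
   qed
   then show ?thesis using g0 gi by (simp add: integral_sum)
  qed
 qed (use \<alpha> T contV U0 V0 bbc cc in auto)
 obtain C where C: "\<And>t x. t \<in> {0..T} ==> \<bar>u t x\<bar> \<le> C * exp (\<sigma> * norm x powr (2 / (2 - \<alpha>)))"
  by (rule exponential_growth_bound[OF uc _ assms(8)]) (use assms(7) in auto)
 show ?thesis
 proof (intro ballI allI)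
  fix t x assume t: "t \<in> {0..T}"
  have "U t x = 0"
  proof (rule unique[OF B less_imp_le[OF assms(7)]])
   show "\<bar>U s y\<bar> \<le> C * exp (\<sigma> * norm y powr (2 / (2 - \<alpha>)))" for s y unfolding U_def by (rule C[OF \<tau>])
  qed (use t in simp)
  then show "u t x = 0" using t \<tau>id[of t] by (simp add: U_def)
 qed
qed

end
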